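(* Let $G=(V,E)$ be a graph, let $R,S\subseteq V$, and suppose $G$ is $(R,S)$-connected. Then the following are equivalent: (1) $L(R,S)-P(G;R,S)\neq\emptyset$; (2) there exists a cyclic ordering $t_1,\ldots,t_n$ of the vertices in $R\cup S$ such that $R$ and $S$ cross and $(G,t_1,\ldots,t_n)$ is nearly planar; (3) there exists a cyclic ordering $t_1,\ldots,t_n$ of the vertices in $R\cup S$ such that $R$ and $S$ cross and, for all $z\in L(R,S)$, $\operatorname{link}(z;t_1,\ldots,t_n)=0$ if and only if $z\in P(G;R,S)$.
   Context: Graphs are finite and undirected. Modules. For a finite set $X$, $\mathbb{Z}\langle X\rangle$ is the free $\mathbb{Z}$-module generated by $X$. For finite sets $R,S$, $L(R,S)$ is the submodule of $\mathbb{Z}\langle R\rangle\otimes\mathbb{Z}\langle S\rangle$ of all $\sum_{r\in R,s\in S}c(r\otimes s)\,r\otimes s$ with $c(r\otimes r)=0$ for all $r\in R\cap S$, $\sum_{r\in R}c(r\otimes s)=0$ for all $s\in S$, and $\sum_{s\in S}c(r\otimes s)=0$ for all $r\in R$. It is regarded as a submodule of $\mathbb{Z}\langle R\cup S\rangle\otimes\mathbb{Z}\langle R\cup S\rangle$. Link. Let $t_1,\ldots,t_n$ be an ordering of a finite set $T$. For distinct $u,v\in T$, $\operatorname{link}(u\otimes v;t_1,\ldots,t_n)=1$ if $v$ comes after $u$ in the sequence $t_1,\ldots,t_n$, and $-1$ if $v$ comes before $u$. This is extended linearly to all $\sum_{r,s\in T} c(r\otimes s)\,r\otimes s$ with $c(r\otimes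 r)=0$ for all $r$. On elements whose coefficients satisfy $\sum_s c(r\otimes s)=0=\sum_s c(s\otimes r)$ for all $r\in T$ (in particular on $L(R,S)$ with $T=R\cup S$), the value does not depend on where the cyclic ordering $t_1,\ldots,t_n$ is started. Linkages. If $P$ is an oriented path from $u_2$ to $u_1$, then $\partial(P)=u_1-u_2\in\mathbb{Z}\langle V\rangle$. An $(R;S)$-linkage in $G$ is a pair $(P_1,P_2)$ of disjoint paths in $G$ such that $P_1$ connects vertices in $R$ and $P_2$ connects vertices in $S$. A $(u_1u_2;v_1v_2)$-linkage is a pair of disjoint paths $(P_1,P_2)$ such that $P_1$ connects $u_1$ and $u_2$, and $P_2$ connects $v_1$ and $v_2$. $P(G;R,S)$ is the $\mathbb{Z}$-span of all $\partial(P_1)\otimes\partial(P_2)\in\mathbb{Z}\langle R\rangle\otimes\mathbb{Z}\langle S\rangle$ with $(P_1,P_2)$ an $(R;S)$-linkage in $G$ (paths oriented arbitrarily). Connectivity. A separation of $G$ is a pair $(G_1,G_2)$ of subgraphs with $G_1\cup G_2=G$ and $E(G_1)\cap E(G_2)=\emptyset$; it is a $2$-separation if $|V(G_1\cap G_2)|=2$. A $2$-separation $(G_1,G_2)$ is a sided $(R,S)$-separation if $|V(G_2)-V(G_1)|>0$, $(V(G_1)-V(G_2))\cap S=\emptyset$, and $G_1-V(G_2)$ contains at least two vertices $u_1,u_2$ from $R$ and there are $(u_1w_1;u_2w_2)$- and $(u_1w_2;u_2w_1)$-linkages in $G_1$, where $\{w_1,w_2\}=V(G_1\cap G_2)$.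 $G$ is $(R,S)$-connected if $G$ is $2$-connected and has no sided $(R,S)$-separation and no sided $(S,R)$-separation. Near planarity. $N(X)$ is the set of vertices in $V-X$ adjacent to a vertex of $X$. A family $\mathcal{A}=\{A_1,\ldots,A_k\}$ of pairwise disjoint subsets of $V$ is separated if $N(A_i)\cap A_j=\emptyset$ for $i\neq j$. For such a family, $p(G,\mathcal{A})$ is the graph obtained from $G$ by deleting each $A_i$ and adding new edges joining every pair of distinct vertices in $N(A_i)$. A pair $(G,\mathcal{A})$ is nearly planar if $\mathcal{A}$ is separated, $|N(A_i)|\le 3$ for each $i$, and $p(G,\mathcal{A})$ can be drawn in a closed disc $D$ with no pair of edges crossing such that for each $A_i$ with $|N(A_i)|=3$, $N(A_i)$ induces a facial triangle in $p(G,\mathcal{A})$. If in addition $r_1,\ldots,r_n$ are vertices of $G$ not in any $A_j\in\mathcal{A}$ and $r_1,\ldots,r_n$ occur on the boundary of $D$ in the specified order, then $(G,\mathcal{A},r_1,\ldots,r_n)$ is nearly planar. $(G,r_1,\ldots,r_n)$ is nearly planar if $(G,\mathcal{A},r_1,\ldots,r_n)$ is nearly planar for some $\mathcal{A}$. Crossing. Given a cyclic ordering $t_1,\ldots,t_n$ and $R,S$ with $R\cup S=\{t_1,\ldots,t_n\}$, $R$ and $S$ cross if $R=S$ and $|R|=3$, or there exist $u_1,u_2\in R$ and $v_1,v_2\in S$ such that $u_1,v_1,u_2,v_2$ are distinct and occur in this order in the cyclic ordering $t_1,\ldots,t_n$. *)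

theory Defs
  imports "HOL-Analysis.Analysis" "HOL-Library.Poly_Mapping" "HOL-Library.Sublist"
begin

section \<open>Graphs, paths and linkages\<close>

record 'v ugraph =
  verts :: "'v set"
  edges :: "'v set set"

definition fin_graph :: "'v ugraph \<Rightarrow> bool" where
  "fin_graph G \<longleftrightarrow> finite (verts G) \<and> (\<forall>e\<in>edges G. e \<subseteq> verts G \<and> card e = 2)"

definition subgraph_of :: "'v ugraph \<Rightarrow> 'v ugraph \<Rightarrow> bool" where
  "subgraph_of H G \<longleftrightarrow> fin_graph H \<and> verts H \<subseteq> verts G \<and> edges H \<subseteq> edges G"

definition delete_verts :: "'v ugraph \<Rightarrow> 'v set \<Rightarrow> 'v ugraph" where
  "delete_verts G X = \<lparr>verts = verts G - X, edges = {e \<in> edges G. e \<inter> X = {}}\<rparr>"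

text \<open>A path is given by the list of its vertices, oriented from \<open>hd P\<close> to \<open>last P\<close>;
  the reversed list is the same path with the opposite orientation.\<close>

definition is_path :: "'v ugraph \<Rightarrow> 'v list \<Rightarrow> bool" where
  "is_path G P \<longleftrightarrow> P \<noteq> [] \<and> distinct P \<and> set P \<subseteq> verts G \<and>
     successively (\<lambda>x y. {x, y} \<in> edges G) P"

definition connects :: "'v ugraph \<Rightarrow> 'v list \<Rightarrow> 'v \<Rightarrow> 'v \<Rightarrow> bool" where
  "connects G P u v \<longleftrightarrow> is_path G P \<and> {hd P, last P} = {u, v}"

definition vertex_linkage ::
  "'v ugraph \<Rightarrow> 'v \<Rightarrow> 'v \<Rightarrow> 'v \<Rightarrow> 'v \<Rightarrow> 'v list \<Rightarrow> 'v list \<Rightarrow> bool" where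
  "vertex_linkage G u1 u2 v1 v2 P1 P2 \<longleftrightarrow>
     connects G P1 u1 u2 \<and> connects G P2 v1 v2 \<and> set P1 \<inter> set P2 = {}"

definition set_linkage ::
  "'v ugraph \<Rightarrow> 'v set \<Rightarrow> 'v set \<Rightarrow> 'v list \<Rightarrow> 'v list \<Rightarrow> bool" where
  "set_linkage G R S P1 P2 \<longleftrightarrow>
     is_path G P1 \<and> hd P1 \<in> R \<and> last P1 \<in> R \<and>
     is_path G P2 \<and> hd P2 \<in> S \<and> last P2 \<in> S \<and> set P1 \<inter> set P2 = {}"

section \<open>The modules \<open>L(R,S)\<close> and \<open>P(G;R,S)\<close>\<close>

text \<open>The free module over a set \<open>X\<close> consists of the \<open>a :: 'v \<Rightarrow>\<^sub>0 int\<close> with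
  \<open>Poly_Mapping.keys a \<subseteq> X\<close>; its tensor product with the free module over \<open>Y\<close> is the free
  module over \<open>X \<times> Y\<close>, the pair \<open>(x, y)\<close> standing for \<open>x \<otimes> y\<close>.\<close>

interpretation frag: module frag_cmul
  by unfold_locales (simp_all add: frag_cmul_distrib frag_cmul_distrib2)

definition tensor ::
  "('a \<Rightarrow>\<^sub>0 int) \<Rightarrow> ('b \<Rightarrow>\<^sub>0 int) \<Rightarrow> ('a \<times> 'b \<Rightarrow>\<^sub>0 int)" where
  "tensor a b = (\<Sum>r\<in>Poly_Mapping.keys a. \<Sum>s\<in>Poly_Mapping.keys b.
     frag_cmul (Poly_Mapping.lookup a r * Poly_Mapping.lookup b s) (frag_of (r, s)))"

definition boundary :: "'v list \<Rightarrow> ('v \<Rightarrow>\<^sub>0 int)" where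
  "boundary P = frag_of (last P) - frag_of (hd P)"

definition L_module :: "'v set \<Rightarrow> 'v set \<Rightarrow> ('v \<times> 'v \<Rightarrow>\<^sub>0 int) set" where
  "L_module R S = {c. Poly_Mapping.keys c \<subseteq> R \<times> S \<and>
     (\<forall>r\<in>R \<inter> S. Poly_Mapping.lookup c (r, r) = 0) \<and>
     (\<forall>s\<in>S. (\<Sum>r\<in>R. Poly_Mapping.lookup c (r, s)) = 0) \<and>
     (\<forall>r\<in>R. (\<Sum>s\<in>S. Poly_Mapping.lookup c (r, s)) = 0)}"

definition P_module ::
  "'v ugraph \<Rightarrow> 'v set \<Rightarrow> 'v set \<Rightarrow> ('v \<times> 'v \<Rightarrow>\<^sub>0 int) set" where
  "P_module G R S =
     frag.span {tensor (boundary P1) (boundary P2) | P1 P2. set_linkage G R S P1 P2}"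

section \<open>Cyclic orderings, link and crossing\<close>

text \<open>A cyclic ordering of a finite set is represented by any list that enumerates it without
  repetition; lists that are rotations of each other represent the same cyclic ordering.\<close>

definition is_ordering :: "'v set \<Rightarrow> 'v list \<Rightarrow> bool" where
  "is_ordering T ts \<longleftrightarrow> distinct ts \<and> set ts = T"

definition comes_before :: "'v list \<Rightarrow> 'v \<Rightarrow> 'v \<Rightarrow> bool" where
  "comes_before ts u v \<longleftrightarrow> (\<exists>i j. i < j \<and> j < length ts \<and> ts ! i = u \<and> ts ! j = v)"

text \<open>The final case below is a dummy value: it is reached only on the diagonal or outside
  \<open>set ts\<close>, where the coefficients of the elements \<^term>\<open>z\<close> of interest vanish.\<close>

definition link_sign :: "'v list \<Rightarrow> 'v \<Rightarrow> 'v \<Rightarrow> int" where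
  "link_sign ts u v = (if comes_before ts u v then 1 else if comes_before ts v u then -1 else 0)"

definition link :: "('v \<times> 'v \<Rightarrow>\<^sub>0 int) \<Rightarrow> 'v list \<Rightarrow> int" where
  "link z ts = (\<Sum>(u, v)\<in>Poly_Mapping.keys z. Poly_Mapping.lookup z (u, v) * link_sign ts u v)"

definition in_cyclic_order :: "'v list \<Rightarrow> 'v list \<Rightarrow> bool" where
  "in_cyclic_order ts xs \<longleftrightarrow> (\<exists>k. subseq xs (rotate k ts))"

definition crossing :: "'v list \<Rightarrow> 'v set \<Rightarrow> 'v set \<Rightarrow> bool" where
  "crossing ts R S \<longleftrightarrow> (R = S \<and> card R = 3) \<or>
     (\<exists>u1\<in>R. \<exists>u2\<in>R. \<exists>v1\<in>S. \<exists>v2\<in>S.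
        distinct [u1, v1, u2, v2] \<and> in_cyclic_order ts [u1, v1, u2, v2])"

section \<open>Connectivity\<close>

definition connected_graph :: "'v ugraph \<Rightarrow> bool" where
  "connected_graph G \<longleftrightarrow> (\<forall>u\<in>verts G. \<forall>v\<in>verts G. \<exists>P. connects G P u v)"

definition two_connected :: "'v ugraph \<Rightarrow> bool" where
  "two_connected G \<longleftrightarrow> card (verts G) > 2 \<and>
     (\<forall>X\<subseteq>verts G. card X < 2 \<longrightarrow> connected_graph (delete_verts G X))"

definition separation :: "'v ugraph \<Rightarrow> 'v ugraph \<Rightarrow> 'v ugraph \<Rightarrow> bool" where
  "separation G G1 G2 \<longleftrightarrow> subgraph_of G1 G \<and> subgraph_of G2 G \<and>
     verts G1 \<union> verts G2 = verts G \<and> edges G1 \<union> edges G2 = edges G \<and>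
     edges G1 \<inter> edges G2 = {}"

definition two_separation :: "'v ugraph \<Rightarrow> 'v ugraph \<Rightarrow> 'v ugraph \<Rightarrow> bool" where
  "two_separation G G1 G2 \<longleftrightarrow> separation G G1 G2 \<and> card (verts G1 \<inter> verts G2) = 2"

definition sided_separation ::
  "'v ugraph \<Rightarrow> 'v set \<Rightarrow> 'v set \<Rightarrow> 'v ugraph \<Rightarrow> 'v ugraph \<Rightarrow> bool" where
  "sided_separation G R S G1 G2 \<longleftrightarrow> two_separation G G1 G2 \<and>
     card (verts G2 - verts G1) > 0 \<and>
     (verts G1 - verts G2) \<inter> S = {} \<and>
     (\<exists>u1 u2 w1 w2. u1 \<noteq> u2 \<and> {u1, u2} \<subseteq> (verts G1 - verts G2) \<inter> R \<and>
        verts G1 \<inter> verts G2 = {w1, w2} \<and>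
        (\<exists>P1 P2. vertex_linkage G1 u1 w1 u2 w2 P1 P2) \<and>
        (\<exists>P1 P2. vertex_linkage G1 u1 w2 u2 w1 P1 P2))"

definition RS_connected :: "'v ugraph \<Rightarrow> 'v set \<Rightarrow> 'v set \<Rightarrow> bool" where
  "RS_connected G R S \<longleftrightarrow> two_connected G \<and>
     (\<nexists>G1 G2. sided_separation G R S G1 G2) \<and>
     (\<nexists>G1 G2. sided_separation G S R G1 G2)"

section \<open>Near planarity\<close>

definition nbrs :: "'v ugraph \<Rightarrow> 'v set \<Rightarrow> 'v set" where
  "nbrs G X = {v \<in> verts G - X. \<exists>x\<in>X. {x, v} \<in> edges G}"

definition separated :: "'v ugraph \<Rightarrow> 'v set set \<Rightarrow> bool" where
  "separated G \<A> \<longleftrightarrow> \<A> \<subseteq> Pow (verts G) \<and> pairwise disjnt \<A> \<and>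
     (\<forall>A\<in>\<A>. \<forall>B\<in>\<A>. A \<noteq> B \<longrightarrow> nbrs G A \<inter> B = {})"

definition p_graph :: "'v ugraph \<Rightarrow> 'v set set \<Rightarrow> 'v ugraph" where
  "p_graph G \<A> = \<lparr>verts = verts G - \<Union>\<A>,
     edges = edges (delete_verts G (\<Union>\<A>)) \<union>
       {{x, y} | x y A. A \<in> \<A> \<and> x \<in> nbrs G A \<and> y \<in> nbrs G A \<and> x \<noteq> y}\<rparr>"

text \<open>A drawing without crossings in the closed unit disc: \<open>pos\<close> places the vertices and
  \<open>arcs e\<close> parametrises the arc representing the edge \<open>e\<close>, in either direction.\<close>

definition disc_drawing ::
  "'v ugraph \<Rightarrow> ('v \<Rightarrow> complex) \<Rightarrow> ('v set \<Rightarrow> real \<Rightarrow> complex) \<Rightarrow> bool" where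
  "disc_drawing H pos arcs \<longleftrightarrow>
     inj_on pos (verts H) \<and> pos ` verts H \<subseteq> cball 0 1 \<and>
     (\<forall>e\<in>edges H. arc (arcs e) \<and> path_image (arcs e) \<subseteq> cball 0 1 \<and>
        {pathstart (arcs e), pathfinish (arcs e)} = pos ` e \<and>
        path_image (arcs e) \<inter> pos ` verts H = pos ` e) \<and>
     (\<forall>e\<in>edges H. \<forall>f\<in>edges H. e \<noteq> f \<longrightarrow>
        path_image (arcs e) \<inter> path_image (arcs f) \<subseteq> pos ` (e \<inter> f))"

definition drawing_image ::
  "'v ugraph \<Rightarrow> ('v \<Rightarrow> complex) \<Rightarrow> ('v set \<Rightarrow> real \<Rightarrow> complex) \<Rightarrow> complex set" where
  "drawing_image H pos arcs = pos ` verts H \<union> (\<Union>e\<in>edges H. path_image (arcs e))"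

text \<open>Faces are the components of the complement of the drawing in the plane; \<open>X\<close> induces a
  facial triangle if some face has the triangle on \<open>X\<close> as its entire boundary.\<close>

definition facial_triangle ::
  "'v ugraph \<Rightarrow> ('v \<Rightarrow> complex) \<Rightarrow> ('v set \<Rightarrow> real \<Rightarrow> complex) \<Rightarrow> 'v set \<Rightarrow> bool" where
  "facial_triangle H pos arcs X \<longleftrightarrow> X \<subseteq> verts H \<and> card X = 3 \<and>
     (\<forall>x\<in>X. \<forall>y\<in>X. x \<noteq> y \<longrightarrow> {x, y} \<in> edges H) \<and>
     (\<exists>F\<in>components (- drawing_image H pos arcs).
        frontier F = (\<Union>e\<in>{e \<in> edges H. e \<subseteq> X}. path_image (arcs e)))"

text \<open>The angles \<open>\<theta>\<close> express that \<open>ts\<close> occurs counterclockwise along the unit circle.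
  The clockwise direction is not listed separately, as it arises by reflecting the disc.\<close>

definition on_boundary_in_order :: "('v \<Rightarrow> complex) \<Rightarrow> 'v list \<Rightarrow> bool" where
  "on_boundary_in_order pos ts \<longleftrightarrow> (\<exists>\<theta> :: 'v \<Rightarrow> real.
     (\<forall>t\<in>set ts. pos t = cis (\<theta> t)) \<and>
     sorted_wrt (\<lambda>u v. \<theta> u < \<theta> v \<and> \<theta> v < \<theta> u + 2 * pi) ts)"

definition nearly_planar_wrt :: "'v ugraph \<Rightarrow> 'v set set \<Rightarrow> 'v list \<Rightarrow> bool" where
  "nearly_planar_wrt G \<A> ts \<longleftrightarrow> separated G \<A> \<and> (\<forall>A\<in>\<A>. card (nbrs G A) \<le> 3) \<and>
     set ts \<subseteq> verts G - \<Union>\<A> \<and>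
     (\<exists>pos arcs. disc_drawing (p_graph G \<A>) pos arcs \<and>
        (\<forall>A\<in>\<A>. card (nbrs G A) = 3 \<longrightarrow>
           facial_triangle (p_graph G \<A>) pos arcs (nbrs G A)) \<and>
        on_boundary_in_order pos ts)"

definition nearly_planar :: "'v ugraph \<Rightarrow> 'v list \<Rightarrow> bool" where
  "nearly_planar G ts \<longleftrightarrow> (\<exists>\<A>. nearly_planar_wrt G \<A> ts)"

end

(* Write qd a b c d for (a - b) (x) (c - d).  The elements qd a b c d generate L(R,S), and those
   for which {a,b} and {c,d} lie in disjoint connected sets generate P(G;R,S).

   (1) implies (2).  Suppose that qd r r' c s and qd r r' c e are not in P and that disjoint paths
   join s, e to r, r' in both ways.  Rerouting the paths around a maximal connected set containing c
   exhibits a part of G attached at two vertices through which s and e can be linked in both ways; as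
   there is no sided separation it contains a further vertex of R, and this vertex contradicts
   maximality.  So at most one of the two ways exists, which lets one add vertices to R and to S
   without losing L - P until both sets equal T.  Now "qd a b c d is not in P" satisfies the axioms
   of separation of point pairs on a circle, hence comes from a cyclic order of T, and no two pairs
   that cross in this order are linked.  After replacing every set with at most three neighbours by
   a triangle, such a graph is a web: it is built by gluing along an edge and by covering a boundary
   edge by a triangle.  Webs are drawn above the real axis by induction.

   (2) implies (3).  By the Fashoda theorem the drawing has no linked crossing pairs, so link
   vanishes on P.  By 2-connectedness noncrossing pairs are linked; the corresponding qd a b c d
   together with a single crossing one generate L(R,S), so P is the whole kernel of link.

   (3) implies (1), because link is nonzero on a crossing quadruple, and for R = S with three
   elements on the hexagon.  *)
theory Submission imports Defs begin

section \<open>Connected vertex sets\<close>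

text \<open>Linkages enter only through the four-place relation \<open>lk\<close>. Two disjoint
  connected sets can be enlarged until they cover a connected graph, so a fifth vertex falls on one
  of the two sides, and many arguments become case distinctions on quadruples. The obstacle in
  adding \<open>s\<close> to R is that the larger span may use the row of \<open>s\<close>; that row
  has to be rewritten through two rows \<open>r\<close>, \<open>r'\<close> of R. The columns split
  into two types accordingly, and \<open>sigma\<close> makes the two rewritings agree. Peeling a
  boundary edge \<open>{a, b}\<close> must expose a vertex that leaves the longer boundary
  crossfree. It is the second vertex of the path from \<open>a\<close> to \<open>b\<close> left over
  by a largest set attached to the rest of the boundary; since every set off the boundary has four
  neighbours, nothing else is left over. A web is drawn with parabolas and their images under
  explicit homeomorphisms of the plane. Factor 1 is the roof over a drawing; factor 1/2 is the
  height at which a lifted bottom edge meets the roof of a drawing that has been halved.\<close>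

definition conn :: "'v set set \<Rightarrow> 'v set \<Rightarrow> bool" where
 "conn E X \<longleftrightarrow> (\<forall>Y\<subseteq>X. Y \<noteq> {} \<longrightarrow> Y \<noteq> X \<longrightarrow> (\<exists>y\<in>Y. \<exists>x\<in>X - Y. {x, y} \<in> E))"

text \<open>For \<open>v\<close> outside \<open>X\<close> this is empty. Later sets of the form
  \<open>comp E (C - {w}) r\<close> rely on that value when \<open>w = r\<close>.\<close>

definition comp :: "'v set set \<Rightarrow> 'v set \<Rightarrow> 'v \<Rightarrow> 'v set" where
 "comp E X v = \<Union>{Y. Y \<subseteq> X \<and> v \<in> Y \<and> conn E Y}"

definition nb :: "'v set set \<Rightarrow> 'v set \<Rightarrow> 'v set \<Rightarrow> 'v set" where
 "nb E V X = {v \<in> V - X. \<exists>x\<in>X. {x, v} \<in> E}"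

definition pth :: "'v set set \<Rightarrow> 'v list \<Rightarrow> bool" where
 "pth E P \<longleftrightarrow> P \<noteq> [] \<and> distinct P \<and> successively (\<lambda>x y. {x, y} \<in> E) P"

lemma conn_empty [simp]: "conn E {}"
 by (auto simp: conn_def)

lemma conn_singleton [simp]: "conn E {x}"
 by (auto simp: conn_def)

lemma conn_edge: "conn E X ==> Y \<subseteq> X ==> Y \<noteq> {} ==> Y \<noteq> X ==> \<exists>y\<in>Y. \<exists>x\<in>X - Y. {x, y} \<in> E"
 by (auto simp: conn_def)

text \<open>This replaces induction along paths: later proofs take for \<open>Y\<close> the vertices
  that can be reached in the desired way and check that no edge inside \<open>X\<close> leaves
  \<open>Y\<close>.\<close>

lemma conn_cut: "conn E X ==> Y \<subseteq> X ==> y \<in> Y ==> (\<And>y x. y \<in> Y ==> x \<in> X - Y ==> {x, y} \<notin> E) ==> Y = X"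
 using conn_edge[of E X Y] by blast

lemma connI:
 assumes "\<And>Y. Y \<subseteq> X ==> Y \<noteq> {} ==> (\<And>y x. y \<in> Y ==> x \<in> X - Y ==> {x, y} \<notin> E) ==> Y = X"
 shows "conn E X"
 unfolding conn_def using assms by blast

lemma conn_mono: "conn E X ==> E \<subseteq> F ==> conn F X"
 unfolding conn_def by blast

lemma conn_Union:
 assumes "\<And>Y. Y \<in> F ==> conn E Y" "\<And>Y. Y \<in> F ==> v \<in> Y"
 shows "conn E (\<Union>F)"
proof (rule connI)
 fix Y assume Y: "Y \<subseteq> \<Union>F" "Y \<noteq> {}" "\<And>y x. y \<in> Y ==> x \<in> \<Union>F - Y ==> {x, y} \<notin> E"
 have one: "Z \<subseteq> Y" if "Z \<in> F" "Z \<inter> Y \<noteq> {}" for Z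
 proof -
  from that(2) obtain y where "y \<in> Z \<inter> Y" by blast
  thus ?thesis using conn_cut[OF assms(1)[OF that(1)], of "Z \<inter> Y" y] Y(3) that by blast
 qed
 obtain Z where Z: "Z \<in> F" "Z \<inter> Y \<noteq> {}" using Y by blast
 thus "Y = \<Union>F" using one assms(2) Y(1) by blast
qed

lemma conn_Un: "conn E X ==> conn E Y ==> v \<in> X ==> v \<in> Y ==> conn E (X \<union> Y)"
 using conn_Union[of "{X, Y}" E v] by auto

lemma conn_pair: "{x, y} \<in> E ==> conn E {x, y}"
proof (rule connI)
 fix Y assume e: "{x, y} \<in> E" and Y: "Y \<subseteq> {x, y}" "Y \<noteq> {}" "\<And>v u. v \<in> Y ==> u \<in> {x, y} - Y ==> {u, v} \<notin> E"
 show "Y = {x, y}" using e Y(1,2) Y(3)[of x y] Y(3)[of y x] by (auto simp: insert_commute)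
qed

lemma conn_insert: "conn E X ==> x \<in> X ==> {x, y} \<in> E ==> conn E (insert y X)"
 using conn_Un[of E X "{x, y}" x] conn_pair[of x y E] by (simp add: insert_absorb)

lemma conn_Un_edge: "conn E X ==> conn E Y ==> x \<in> X ==> y \<in> Y ==> {x, y} \<in> E ==> conn E (X \<union> Y)"
 using conn_Un[of E "insert y X" Y y] conn_insert[of E X x y] by (simp add: insert_absorb)

lemma comp_subset: "comp E X v \<subseteq> X"
 by (auto simp: comp_def)

lemma conn_comp [simp]: "conn E (comp E X v)"
 unfolding comp_def by (rule conn_Union[of _ _ v]) auto

lemma comp_self: "v \<in> X ==> v \<in> comp E X v"
 unfolding comp_def using conn_singleton[of E v] by blast

lemma comp_outside: "v \<notin> X ==> comp E X v = {}"
 unfolding comp_def by blast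

lemma comp_superset: "conn E Y ==> Y \<subseteq> X ==> v \<in> Y ==> Y \<subseteq> comp E X v"
 unfolding comp_def by blast

lemma comp_absorb: "conn E Y ==> Y \<subseteq> X ==> y \<in> Y ==> y \<in> comp E X v ==> Y \<subseteq> comp E X v"
proof -
 assume a: "conn E Y" "Y \<subseteq> X" "y \<in> Y" "y \<in> comp E X v"
 thus ?thesis
  using comp_outside[of v X E] comp_self[of v X E] comp_superset[of E "comp E X v \<union> Y" X v] conn_Un[of E "comp E X v" Y y] a comp_subset[of E X v] by auto
qed

lemma comp_step: "y \<in> comp E X v ==> x \<in> X ==> {x, y} \<in> E ==> x \<in> comp E X v"
 using comp_absorb[of E "{x, y}" X y v] conn_pair[of x y E] comp_subset[of E X v] by blast

lemma comp_sym: "u \<in> comp E X v ==> v \<in> comp E X u"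
proof -
 assume u: "u \<in> comp E X v"
 thus ?thesis using comp_outside[of v X E] comp_superset[OF conn_comp comp_subset u] comp_self[of v X E] by blast
qed

lemma comp_eq: "u \<in> comp E X v ==> comp E X u = comp E X v"
proof -
 assume u: "u \<in> comp E X v"
 have "comp E X v \<subseteq> comp E X u" using comp_superset[OF conn_comp comp_subset u] .
 moreover have "comp E X u \<subseteq> comp E X v" using comp_superset[OF conn_comp comp_subset comp_sym[OF u]] .
 ultimately show ?thesis by blast
qed

lemma comp_mono: "X \<subseteq> Y ==> comp E X v \<subseteq> comp E Y v"
 unfolding comp_def by blast

text \<open>The connected set \<open>X\<close> has an edge that leaves the component, and its outer
  end cannot lie in \<open>X'\<close>, since the component would have absorbed it.\<close>

lemma comp_edge_out:
 assumes "conn E X" "X' \<subseteq> X" "u \<in> X'" "w \<in> X - comp E X' u"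
 shows "\<exists>y\<in>comp E X' u. \<exists>x\<in>X - X'. {x, y} \<in> E"
proof -
 have "comp E X' u \<noteq> {}" "comp E X' u \<noteq> X" "comp E X' u \<subseteq> X" using assms comp_self[of u X' E] comp_subset[of E X' u] by auto
 from conn_edge[OF assms(1) this(3,1,2)] obtain y x where
  "y \<in> comp E X' u" "x \<in> X - comp E X' u" "{x, y} \<in> E" by blast
 thus ?thesis using comp_step[of y E X' u x] by blast
qed

text \<open>Every other component of \<open>X - W\<close> is joined directly to \<open>W\<close>, so
  discarding one component does not disconnect the rest. This is what allows two disjoint connected
  sets to be enlarged to a partition.\<close>

lemma conn_minus_comp:
 assumes "conn E X" "conn E W" "W \<subseteq> X"
 shows "conn E (X - comp E (X - W) u)"
proof (rule connI)
 let ?D = "comp E (X - W) u"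
 have D: "?D \<subseteq> X - W" by (rule comp_subset)
 fix Y assume Y: "Y \<subseteq> X - ?D" "Y \<noteq> {}" "\<And>y x. y \<in> Y ==> x \<in> X - ?D - Y ==> {x, y} \<notin> E"
 \<comment> \<open>A set that avoids \<open>W\<close> and is closed inside \<open>X - ?D\<close> has
   no edge to \<open>?D\<close> either, because \<open>?D\<close> is a component of
   \<open>X - W\<close>. So it is closed in \<open>X\<close>.\<close>
 have key: "Z = {}" if Z: "Z \<subseteq> X - ?D" "Z \<inter> W = {}" "\<And>y x. y \<in> Z ==> x \<in> X - ?D - Z ==> {x, y} \<notin> E" "Z \<noteq> X" for Z
 proof (rule ccontr)
  assume "Z \<noteq> {}"
  then obtain y x where yx: "y \<in> Z" "x \<in> X - Z" "{x, y} \<in> E" using conn_edge[OF assms(1), of Z] Z by blast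
  hence "x \<in> ?D" using Z(3) by blast
  hence "y \<in> ?D" using comp_step[of x E "X - W" u y] yx Z by (auto simp: insert_commute)
  thus False using yx Z by blast
 qed
 show "Y = X - ?D"
 proof (cases "W \<inter> Y = {}")
  case True
  thus ?thesis using key[of Y] Y by blast
 next
  case False
  then obtain w where "w \<in> W \<inter> Y" by blast
  hence "W \<inter> Y = W" using conn_cut[OF assms(2), of "W \<inter> Y" w] Y(3) assms(3) D by blast
  hence wY: "w \<in> Y" "w \<in> X" using \<open>w \<in> W \<inter> Y\<close> assms(3) by auto
  have "X - ?D - Y = {}"
  proof (rule key)
   show "(X - ?D - Y) \<inter> W = {}" using \<open>W \<inter> Y = W\<close> by blast
   show "{x, y} \<notin> E" if "y \<in> X - ?D - Y" "x \<in> X - ?D - (X - ?D - Y)" for y x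
    using Y(3)[of x y] that by (auto simp: insert_commute)
  qed (use wY in auto)
  thus ?thesis using Y by blast
 qed
qed

section \<open>Paths inside connected sets\<close>

lemma pth_append:
 "pth E (P @ Q) ==> P \<noteq> [] ==> pth E P" "pth E (P @ Q) ==> Q \<noteq> [] ==> pth E Q"
 by (auto simp: pth_def successively_append_iff)

lemma pth_singleton [simp]: "pth E [x]"
 by (simp add: pth_def)

lemma pth_join:
 "pth E P ==> pth E Q ==> set P \<inter> set Q = {} ==> {last P, hd Q} \<in> E ==> pth E (P @ Q)"
 by (auto simp: pth_def successively_append_iff)

lemma conn_pth: "pth E P ==> conn E (set P)"
proof (induction P)
 case Nil thus ?case by simp
next
 case (Cons x P)
 show ?case
 proof (cases P)
  case Nil thus ?thesis by simp
 next
  case (Cons y Q)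
  hence "pth E P" "{x, y} \<in> E" using Cons.prems by (auto simp: pth_def)
  thus ?thesis using Cons.IH conn_insert[of E "set P" y x] Cons by (auto simp: insert_commute)
 qed
qed

lemma conn_obtain_pth:
 assumes "conn E X" "a \<in> X" "b \<in> X"
 obtains P where "pth E P" "hd P = a" "last P = b" "set P \<subseteq> X"
proof -
 let ?Y = "{y. \<exists>P. pth E P \<and> hd P = a \<and> last P = y \<and> set P \<subseteq> X}"
 have "?Y \<subseteq> X" unfolding pth_def by auto
 moreover have "a \<in> ?Y" using assms by (auto intro!: exI[of _ "[a]"])
 moreover have "{x, y} \<notin> E" if yx: "y \<in> ?Y" "x \<in> X - ?Y" for x y
 proof
  assume e: "{x, y} \<in> E"
  from yx obtain P where P: "pth E P" "hd P = a" "last P = y" "set P \<subseteq> X" by blast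
  have "x \<in> ?Y"
  proof (cases "x \<in> set P")
   case True
   then obtain Q R where "P = Q @ x # R" by (meson split_list)
   hence "pth E (Q @ [x])" "hd (Q @ [x]) = a" "set (Q @ [x]) \<subseteq> X"
    using P pth_append(1)[of E "Q @ [x]" R] by (auto simp: hd_append)
   thus ?thesis by (intro CollectI exI[of _ "Q @ [x]"]) auto
  next
   case False
   hence "pth E (P @ [x])" using pth_join[of E P "[x]"] P e by (auto simp: insert_commute)
   thus ?thesis using P yx by (intro CollectI exI[of _ "P @ [x]"]) (auto simp: pth_def)
  qed
  thus False using yx by blast
 qed
 ultimately show ?thesis using conn_cut[OF assms(1), of ?Y a] that assms by blast
qed

text \<open>Take the last vertex in \<open>U\<close> of some path, then the first vertex in
  \<open>W\<close> from there on. The result may be a single vertex.\<close>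

lemma conn_obtain_trimmed:
 assumes "conn E X" "X \<inter> U \<noteq> {}" "X \<inter> W \<noteq> {}"
 obtains P where "pth E P" "set P \<subseteq> X" "set P \<inter> U = {hd P}" "set P \<inter> W = {last P}"
proof -
 obtain a b where ab: "a \<in> X \<inter> U" "b \<in> X \<inter> W" using assms by blast
 obtain P where P: "pth E P" "hd P = a" "last P = b" "set P \<subseteq> X" using conn_obtain_pth[OF assms(1)] ab by blast
 have Pne: "P \<noteq> []" using P by (simp add: pth_def)
 obtain Q u R where Q: "P = Q @ u # R" "u \<in> U" "\<forall>z\<in>set R. z \<notin> U"
  using P ab Pne hd_in_set split_list_last_prop[of P "\<lambda>x. x \<in> U"] by blast
 obtain A w B where A: "u # R = A @ w # B" "w \<in> W" "\<forall>z\<in>set A. z \<notin> W"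
  using P Q ab last_in_set[of "u # R"] split_list_first_prop[of "u # R" "\<lambda>x. x \<in> W"] by auto
 have p: "pth E (A @ [w])" using P(1) Q(1) A(1) pth_append(2)[of E Q "u # R"] pth_append(1)[of E "A @ [w]" B] by auto
 have sub: "set (A @ [w]) \<subseteq> set (u # R)" using A(1) by auto
 have h: "hd (A @ [w]) = u" using A(1) by (cases A) auto
 show ?thesis
 proof (rule that[of "A @ [w]"])
  show "set (A @ [w]) \<inter> U = {hd (A @ [w])}" using sub h hd_in_set[of "A @ [w]"] unfolding h using Q(2,3) by auto
 qed (use p P(4) Q(1) A sub in auto)
qed

section \<open>Two disjoint paths\<close>

text \<open>The vertices of a path are distinct, so it uses \<open>e\<close> at most once and both
  remaining pieces avoid it.\<close>

lemma pth_remove_edge: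
 assumes "pth F p" "\<not> pth (F - {e}) p"
 obtains A B where "p = A @ B" "pth (F - {e}) A" "pth (F - {e}) B" "e = {last A, hd B}" "last A \<noteq> hd B"
  "last A \<notin> set B" "hd B \<notin> set A"
proof -
 have "\<exists>A B. p = A @ B \<and> A \<noteq> [] \<and> B \<noteq> [] \<and> e = {last A, hd B}" using assms
 proof (induction p)
  case Nil thus ?case by (simp add: pth_def)
 next
  case (Cons x p)
  show ?case
  proof (cases p)
   case Nil thus ?thesis using Cons.prems by simp
  next
   case (Cons y q)
   show ?thesis
   proof (cases "{x, y} = e")
    case True
    thus ?thesis using Cons by (intro exI[of _ "[x]"] exI[of _ p]) auto
   next
    case False
    obtain A B where "p = A @ B \<and> A \<noteq> [] \<and> B \<noteq> [] \<and> e = {last A, hd B}"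
     using Cons.prems False Cons Cons.IH by (auto simp: pth_def)
    thus ?thesis by (intro exI[of _ "x # A"] exI[of _ B]) auto
   qed
  qed
 qed
 then obtain A B where AB: "p = A @ B" "A \<noteq> []" "B \<noteq> []" "e = {last A, hd B}" by blast
 have d: "set A \<inter> set B = {}" using assms(1) AB by (auto simp: pth_def)
 have nA: "hd B \<notin> set A" "last A \<notin> set B" using d AB(2,3) hd_in_set last_in_set by blast+
 have mono: "pth (F - {e}) Q" if "pth F Q" "\<not> e \<subseteq> set Q" for Q
 proof -
  have "successively (\<lambda>x y. {x, y} \<in> F - {e}) Q"
   by (rule successively_mono[of "\<lambda>x y. {x, y} \<in> F"]) (use that in \<open>auto simp: pth_def\<close>)
  thus ?thesis using that by (simp add: pth_def)
 qed
 show ?thesis by (rule that[OF AB(1) mono mono AB(4)])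
   (use AB nA pth_append[of F A B] assms(1) d last_in_set[OF AB(2)] in auto)
qed

text \<open>Without \<open>e\<close>, the vertex \<open>z\<close> separates \<open>U\<close> from
  \<open>W\<close>, and \<open>y\<close> is out of reach of \<open>U\<close>. So a path from
  \<open>U\<close> to \<open>W\<close> must meet \<open>z\<close> or \<open>x\<close>, and the piece
  up to the first such vertex cannot have used \<open>e\<close>, as it would have come to
  \<open>y\<close> before.\<close>

lemma first_hit_avoiding_edge:
 assumes e: "e = {x, y}" "x \<noteq> y"
  and sep: "\<And>X. conn (F - {e}) X ==> X \<subseteq> V - {z} ==> X \<inter> U \<noteq> {} ==> X \<inter> W = {}"
  and side: "\<And>X. conn (F - {e}) X ==> X \<subseteq> V - {z} ==> X \<inter> U \<noteq> {} ==> y \<notin> X"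
  and X: "conn F X" "X \<subseteq> V" "X \<inter> U \<noteq> {}" "X \<inter> W \<noteq> {}"
 shows "\<exists>X'. conn (F - {e}) X' \<and> X' \<subseteq> X \<and> X' \<inter> U \<noteq> {} \<and> X' \<inter> {z, x} \<noteq> {}"
proof -
 obtain p where p: "pth F p" "set p \<subseteq> X" "set p \<inter> U = {hd p}" "set p \<inter> W = {last p}"
  using conn_obtain_trimmed[OF X(1,3,4)] by blast
 have ex: "\<exists>v\<in>set p. v \<in> {z, x}"
 proof (rule ccontr)
  assume n: "\<not> ?thesis"
  have "pth (F - {e}) p"
   using pth_remove_edge[OF p(1)] n e by (metis append_is_Nil_conv doubleton_eq_iff insert_iff last_in_set hd_in_set pth_def set_append Un_iff)
  thus False using sep[OF conn_pth, of p] n p X(2) by blast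
 qed
 obtain A v B where A: "p = A @ v # B" "v \<in> {z, x}" "\<forall>u\<in>set A. u \<notin> {z, x}" using split_list_first_prop[OF ex] by blast
 have pA: "pth F (A @ [v])" using p(1) A(1) pth_append(1)[of F "A @ [v]" B] by simp
 have h: "hd p = hd (A @ [v])" using A(1) by (cases A) auto
 have hU: "hd (A @ [v]) \<in> U" using p(3) h[symmetric] by auto
 have "pth (F - {e}) (A @ [v])"
 proof (rule ccontr)
  assume "\<not> ?thesis"
  then obtain C D where CD: "A @ [v] = C @ D" "pth (F - {e}) C" "pth (F - {e}) D"
   "e = {last C, hd D}" "last C \<notin> set D" using pth_remove_edge[OF pA] by metis
  have ne: "C \<noteq> []" "D \<noteq> []" using CD by (auto simp: pth_def)
  have "last C \<in> set A"
   using CD(1) ne by (metis butlast_append butlast_snoc last_in_set in_set_conv_decomp Un_iff set_append)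
  hence "last C = y" using CD(4) e A(3) by (auto simp: doubleton_eq_iff)
  moreover have "set C \<subseteq> set A" using CD(1) ne by (metis butlast_append butlast_snoc set_append Un_upper1)
  moreover have "hd C \<in> U" using hU CD(1) ne by (metis hd_append2)
  moreover have "set A \<subseteq> V" using p(2) X(2) A(1) by auto
  ultimately show False using side[OF conn_pth[OF CD(2)]] A(3) ne hd_in_set[OF ne(1)] last_in_set[OF ne(1)] by blast
 qed
 hence "conn (F - {e}) (set (A @ [v]))" by (rule conn_pth)
 moreover have "set (A @ [v]) \<subseteq> X" using p(2) A(1) by auto
 moreover have "hd (A @ [v]) \<in> set (A @ [v])" by (rule hd_in_set) simp
 ultimately show ?thesis using hU A(2) by (intro exI[of _ "set (A @ [v])"]) auto
qed

text \<open>Menger's theorem for two paths, by induction on the number of edges. If the removed edge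
  was essential, a single vertex \<open>z\<close> separates in the smaller graph. The induction
  hypothesis is then used from \<open>U\<close> and from \<open>W\<close>, each time towards
  \<open>z\<close> and the near end of the edge, and the results are joined at \<open>z\<close> and
  across the edge.\<close>

lemma menger2:
 assumes "finite F"
  and "\<And>z. \<exists>X. conn F X \<and> X \<subseteq> V - {z} \<and> X \<inter> U \<noteq> {} \<and> X \<inter> W \<noteq> {}"
 obtains p q where "pth F p" "pth F q" "set p \<subseteq> V" "set q \<subseteq> V" "set p \<inter> set q = {}"
  "set p \<inter> U = {hd p}" "set p \<inter> W = {last p}" "set q \<inter> U = {hd q}" "set q \<inter> W = {last q}"
proof -
 have "\<exists>X Y. conn F X \<and> conn F Y \<and> X \<subseteq> V \<and> Y \<subseteq> V \<and> X \<inter> Y = {} \<and> X \<inter> U \<noteq> {} \<and> X \<inter> W \<noteq> {} \<and> Y \<inter> U \<noteq> {} \<and> Y \<inter> W \<noteq> {}"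
  using assms
 proof (induction "card F" arbitrary: F U W)
  case 0
  hence "F = {}" by simp
  have single: "\<exists>v. v \<in> X \<and> X = {v}" if X: "conn F X" "X \<inter> U \<noteq> {}" for X
  proof -
   obtain v where "v \<in> X" using X by blast
   thus ?thesis using conn_cut[OF X(1), of "{v}" v] \<open>F = {}\<close> by blast
  qed
  obtain X where X: "conn F X" "X \<subseteq> V" "X \<inter> U \<noteq> {}" "X \<inter> W \<noteq> {}" using 0(3)[of undefined] by blast
  then obtain v where v: "X = {v}" using single by blast
  obtain Y where Y: "conn F Y" "Y \<subseteq> V - {v}" "Y \<inter> U \<noteq> {}" "Y \<inter> W \<noteq> {}" using 0(3)[of v] by blast
  thus ?case using X v by (intro exI[of _ X] exI[of _ Y]) auto
 next
  case (Suc n)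
  then obtain e where e: "e \<in> F" by fastforce
  let ?F = "F - {e}"
  have n: "n = card ?F" "finite ?F" using Suc e by auto
  have FF: "?F \<subseteq> F" by blast
  show ?case
  proof (cases "\<exists>z. \<forall>X. conn ?F X \<longrightarrow> X \<subseteq> V - {z} \<longrightarrow> X \<inter> U \<noteq> {} \<longrightarrow> X \<inter> W = {}")
   case False
   thus ?thesis using Suc(1)[OF n, of U W] conn_mono[OF _ FF] by (metis (no_types, lifting))
  next
   case True
   then obtain z where z: "\<And>X. conn ?F X ==> X \<subseteq> V - {z} ==> X \<inter> U \<noteq> {} ==> X \<inter> W = {}" by meson
   obtain X0 where X0: "conn F X0" "X0 \<subseteq> V - {z}" "X0 \<inter> U \<noteq> {}" "X0 \<inter> W \<noteq> {}" using Suc(4)[of z] by blast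
   obtain p where p: "pth F p" "set p \<subseteq> X0" "set p \<inter> U = {hd p}" "set p \<inter> W = {last p}"
    using conn_obtain_trimmed[OF X0(1,3,4)] by blast
   have "\<not> pth ?F p" using z[OF conn_pth, of p] p X0(2) by blast
   then obtain A B where AB: "p = A @ B" "pth ?F A" "pth ?F B" "e = {last A, hd B}" "last A \<noteq> hd B"
    using pth_remove_edge[OF p(1)] by metis
   have ne: "A \<noteq> []" "B \<noteq> []" using AB by (auto simp: pth_def)
   define x y where "x = last A" and "y = hd B"
   have xy: "x \<in> set A" "y \<in> set B" "x \<noteq> y" "e = {x, y}" using ne AB by (auto simp: x_def y_def)
   have AU: "set A \<inter> U \<noteq> {}" and BW: "set B \<inter> W \<noteq> {}"
   proof -
    have "hd A = hd p" "last B = last p" using AB(1) ne by simp_all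
    thus "set A \<inter> U \<noteq> {}" "set B \<inter> W \<noteq> {}" using p(3,4) hd_in_set[OF ne(1)] last_in_set[OF ne(2)] by auto
   qed
   have ABV: "set A \<subseteq> V - {z}" "set B \<subseteq> V - {z}" using p X0(2) AB(1) by auto
   have sideU: "y \<notin> X" if "conn ?F X" "X \<subseteq> V - {z}" "X \<inter> U \<noteq> {}" for X
    using conn_Un[OF that(1) conn_pth[OF AB(3)]] xy z[of "X \<union> set B"] ABV BW that by blast
   have sideW: "x \<notin> X" if "conn ?F X" "X \<subseteq> V - {z}" "X \<inter> W \<noteq> {}" for X
    using conn_Un[OF that(1) conn_pth[OF AB(2)]] xy z[of "X \<union> set A"] ABV AU that by blast
   have zs: "X \<inter> U = {}" if "conn ?F X" "X \<subseteq> V - {z}" "X \<inter> W \<noteq> {}" for X using z that by blast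
   \<comment> \<open>Every connection of \<open>U\<close> with \<open>W\<close> begins with one to
     \<open>z\<close> or \<open>x\<close> that avoids the removed edge, so no single vertex
     separates \<open>U\<close> from \<open>{z, x}\<close> in the smaller graph.\<close>
   have h1: "\<exists>X. conn ?F X \<and> X \<subseteq> V - {v} \<and> X \<inter> U \<noteq> {} \<and> X \<inter> {z, x} \<noteq> {}" for v
   proof -
    obtain X where X: "conn F X" "X \<subseteq> V - {v}" "X \<inter> U \<noteq> {}" "X \<inter> W \<noteq> {}" using Suc(4)[of v] by blast
    have "X \<subseteq> V" using X by blast
    hence "\<exists>X'. conn ?F X' \<and> X' \<subseteq> X \<and> X' \<inter> U \<noteq> {} \<and> X' \<inter> {z, x} \<noteq> {}"
     by (intro first_hit_avoiding_edge[OF xy(4,3) _ _ X(1) _ X(3,4)] z sideU)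
    thus ?thesis using X(2) by (meson subset_trans)
   qed
   have h2: "\<exists>X. conn ?F X \<and> X \<subseteq> V - {v} \<and> X \<inter> W \<noteq> {} \<and> X \<inter> {z, y} \<noteq> {}" for v
   proof -
    obtain X where X: "conn F X" "X \<subseteq> V - {v}" "X \<inter> W \<noteq> {}" "X \<inter> U \<noteq> {}" using Suc(4)[of v] by blast
    have "X \<subseteq> V" "e = {y, x}" using X xy by blast+
    hence "\<exists>X'. conn ?F X' \<and> X' \<subseteq> X \<and> X' \<inter> W \<noteq> {} \<and> X' \<inter> {z, y} \<noteq> {}"
     by (intro first_hit_avoiding_edge[OF _ xy(3)[symmetric] _ _ X(1) _ X(3,4)] zs sideW)
    thus ?thesis using X(2) by (meson subset_trans)
   qed
   obtain P1 P2 where P: "conn ?F P1" "conn ?F P2" "P1 \<subseteq> V" "P2 \<subseteq> V" "P1 \<inter> P2 = {}"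
    "P1 \<inter> U \<noteq> {}" "P2 \<inter> U \<noteq> {}" "z \<in> P1" "x \<in> P2"
    using Suc(1)[OF n h1] by blast
   obtain Q1 Q2 where Q: "conn ?F Q1" "conn ?F Q2" "Q1 \<subseteq> V" "Q2 \<subseteq> V" "Q1 \<inter> Q2 = {}"
    "Q1 \<inter> W \<noteq> {}" "Q2 \<inter> W \<noteq> {}" "z \<in> Q1" "y \<in> Q2"
    using Suc(1)[OF n h2] by blast
   \<comment> \<open>\<open>P1\<close> is replaced by a path that ends in \<open>z\<close>: deleting
     \<open>z\<close> from an arbitrary connected set could cut off vertices from \<open>U\<close>,
     deleting the last vertex of a path does not.\<close>
   obtain p1 where p1: "pth ?F p1" "set p1 \<subseteq> P1" "set p1 \<inter> U = {hd p1}" "set p1 \<inter> {z} = {last p1}"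
   proof (rule conn_obtain_trimmed[OF P(1,6)])
    show "P1 \<inter> {z} \<noteq> {}" using P(8) by simp
   qed
   obtain q1 where q1: "pth ?F q1" "set q1 \<subseteq> Q1" "set q1 \<inter> W = {hd q1}" "set q1 \<inter> {z} = {last q1}"
   proof (rule conn_obtain_trimmed[OF Q(1,6)])
    show "Q1 \<inter> {z} \<noteq> {}" using Q(8) by simp
   qed
   have half: "\<exists>X. conn ?F X \<and> v \<in> X \<and> X \<subseteq> set r - {z} \<and> X \<inter> U' \<noteq> {}"
    if r: "pth ?F r" "set r \<inter> U' = {hd r}" "set r \<inter> {z} = {last r}" and v: "v \<in> set r" "v \<noteq> z" for r U' v
   proof -
    have rne: "r \<noteq> []" using r by (simp add: pth_def)
    have lz: "last r = z" using r by blast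
    have rb: "r = butlast r @ [z]" using rne lz by (metis append_butlast_last_id)
    hence "v \<in> set (butlast r)" using v by (metis Un_iff set_append empty_iff empty_set insert_iff list.set(2))
    hence bne: "butlast r \<noteq> []" by auto
    have "pth ?F (butlast r)" using r(1) rb bne pth_append(1) by metis
    moreover have "z \<notin> set (butlast r)"
     using r(1) rb unfolding pth_def by (metis disjoint_iff distinct_append list.set_intros(1))
    moreover have "hd r = hd (butlast r)" using rb bne by (metis hd_append2)
    hence "hd r \<in> set (butlast r)" using bne by simp
    moreover have "hd r \<in> U'" using r(2) by blast
    moreover have "set (butlast r) \<subseteq> set r" using in_set_butlastD by fast
    ultimately show ?thesis using conn_pth \<open>v \<in> set (butlast r)\<close> by (intro exI[of _ "set (butlast r)"]) auto
   qed
   \<comment> \<open>A common vertex other than \<open>z\<close> would connect \<open>U\<close> with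
     \<open>W\<close> in the smaller graph while avoiding \<open>z\<close>.\<close>
   have d1: "v \<notin> set q1 \<union> Q2" if v0: "v \<in> set p1 \<union> P2" "v \<noteq> z" for v
   proof
    assume v: "v \<in> set q1 \<union> Q2"
    have "\<exists>X. conn ?F X \<and> v \<in> X \<and> X \<subseteq> V - {z} \<and> X \<inter> U \<noteq> {}"
    proof (cases "v \<in> set p1")
     case True
     then obtain X where "conn ?F X" "v \<in> X" "X \<subseteq> set p1 - {z}" "X \<inter> U \<noteq> {}" using half[OF p1(1,3,4) _ v0(2)] by meson
     thus ?thesis using P(3) p1(2) by blast
    next
     case False
     thus ?thesis using v0 P(4,5,8) P(2,7) by auto
    qed
    moreover have "\<exists>X. conn ?F X \<and> v \<in> X \<and> X \<subseteq> V - {z} \<and> X \<inter> W \<noteq> {}"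
    proof (cases "v \<in> set q1")
     case True
     then obtain X where "conn ?F X" "v \<in> X" "X \<subseteq> set q1 - {z}" "X \<inter> W \<noteq> {}" using half[OF q1(1,3,4) _ v0(2)] by meson
     thus ?thesis using Q(3) q1(2) by blast
    next
     case False
     thus ?thesis using v v0 Q(4,5,8) Q(2,7) by auto
    qed
    ultimately obtain X Y where XY: "conn ?F X" "v \<in> X" "X \<subseteq> V - {z}" "X \<inter> U \<noteq> {}"
     "conn ?F Y" "v \<in> Y" "Y \<subseteq> V - {z}" "Y \<inter> W \<noteq> {}" by metis
    have "(X \<union> Y) \<inter> W = {}" by (rule z[OF conn_Un[OF XY(1,5,2,6)]]) (use XY(3,4,7) in auto)
    thus False using XY(8) by auto
   qed
   have zz: "z \<in> set p1" "z \<in> set q1" using p1(4) q1(4) by auto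
   have c1: "conn ?F (set p1 \<union> set q1)" by (rule conn_Un[OF conn_pth[OF p1(1)] conn_pth[OF q1(1)] zz])
   have c2: "conn F (P2 \<union> Q2)"
    by (rule conn_Un_edge[OF conn_mono[OF P(2) FF] conn_mono[OF Q(2) FF] P(9) Q(9)]) (use xy e in simp)
   show ?thesis
   proof (rule exI[of _ "set p1 \<union> set q1"], rule exI[of _ "P2 \<union> Q2"], intro conjI)
    have "v \<notin> P2 \<union> Q2" if v: "v \<in> set p1 \<union> set q1" for v using P(5,8) Q(5,8) v d1[of v] p1(2) q1(2) P(5) Q(5) that by blast
    thus "(set p1 \<union> set q1) \<inter> (P2 \<union> Q2) = {}" by auto
    show "(set p1 \<union> set q1) \<inter> U \<noteq> {}" "(set p1 \<union> set q1) \<inter> W \<noteq> {}" using p1(3) q1(3) by auto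
    show "set p1 \<union> set q1 \<subseteq> V" "P2 \<union> Q2 \<subseteq> V" using p1(2) q1(2) P(3,4) Q(3,4) by auto
    show "(P2 \<union> Q2) \<inter> U \<noteq> {}" "(P2 \<union> Q2) \<inter> W \<noteq> {}" using P(7) Q(7) by auto
    show "conn F (set p1 \<union> set q1)" by (rule conn_mono[OF c1 FF])
   qed (rule c2)
  qed
 qed
 then obtain X Y where XY: "conn F X" "conn F Y" "X \<subseteq> V" "Y \<subseteq> V" "X \<inter> Y = {}" "X \<inter> U \<noteq> {}" "X \<inter> W \<noteq> {}" "Y \<inter> U \<noteq> {}" "Y \<inter> W \<noteq> {}" by blast
 obtain p where p: "pth F p" "set p \<subseteq> X" "set p \<inter> U = {hd p}" "set p \<inter> W = {last p}"
  using conn_obtain_trimmed[OF XY(1,6,7)] .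
 obtain q where q: "pth F q" "set q \<subseteq> Y" "set q \<inter> U = {hd q}" "set q \<inter> W = {last q}"
  using conn_obtain_trimmed[OF XY(2,8,9)] .
 show ?thesis by (rule that[OF p(1) q(1) _ _ _ p(3,4) q(3,4)]) (use p(2) q(2) XY(3-5) in auto)
qed

section \<open>Linkages of quadruples\<close>

text \<open>Connected sets stand in for the paths of a linkage.\<close>

definition lk :: "'v set set \<Rightarrow> 'v set \<Rightarrow> 'v \<Rightarrow> 'v \<Rightarrow> 'v \<Rightarrow> 'v \<Rightarrow> bool" where
 "lk E V a b c d \<longleftrightarrow> (\<exists>X Y. X \<subseteq> V \<and> Y \<subseteq> V \<and> X \<inter> Y = {} \<and> conn E X \<and> conn E Y \<and>
   a \<in> X \<and> b \<in> X \<and> c \<in> Y \<and> d \<in> Y)"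

lemma lkI: "conn E X ==> conn E Y ==> X \<subseteq> V ==> Y \<subseteq> V ==> X \<inter> Y = {} ==>
  a \<in> X ==> b \<in> X ==> c \<in> Y ==> d \<in> Y ==> lk E V a b c d"
 unfolding lk_def by blast

lemma lk_swap1: "lk E V a b c d ==> lk E V b a c d"
 unfolding lk_def by blast

lemma lk_swap2: "lk E V a b c d ==> lk E V a b d c"
 unfolding lk_def by blast

lemma lk_flip: "lk E V a b c d ==> lk E V c d a b"
 unfolding lk_def by (metis Int_commute)

lemma lk_distinct: "lk E V a b c d ==> a \<noteq> c \<and> a \<noteq> d \<and> b \<noteq> c \<and> b \<noteq> d"
 unfolding lk_def by blast

text \<open>\<open>Y\<close> grows to the component of \<open>c\<close> in the complement of
  \<open>X\<close>, and \<open>conn_minus_comp\<close> keeps the remainder connected.\<close>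

lemma lk_partition:
 assumes "conn E V" "lk E V a b c d"
 obtains X Y where "X \<union> Y = V" "X \<inter> Y = {}" "conn E X" "conn E Y" "a \<in> X" "b \<in> X" "c \<in> Y" "d \<in> Y"
proof -
 obtain X Y where XY: "X \<subseteq> V" "Y \<subseteq> V" "X \<inter> Y = {}" "conn E X" "conn E Y" "a \<in> X" "b \<in> X" "c \<in> Y" "d \<in> Y"
  using assms(2) unfolding lk_def by blast
 let ?Y = "comp E (V - X) c"
 have "conn E (V - ?Y)" by (rule conn_minus_comp[OF assms(1) XY(4,1)])
 moreover have "Y \<subseteq> ?Y" using comp_superset[OF XY(5), of "V - X" c] XY by blast
 moreover have "?Y \<subseteq> V - X" by (rule comp_subset)
 ultimately show ?thesis using that[of "V - ?Y" ?Y] XY by auto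
qed

text \<open>Once the linkage covers \<open>V\<close>, the vertex \<open>e\<close> lies on one of its
  two sides.\<close>

lemma lk_fifth:
 assumes "conn E V" "lk E V a b c d" "e \<in> V"
 shows "(lk E V a e c d \<and> lk E V b e c d) \<or> (lk E V a b c e \<and> lk E V a b d e)"
proof -
 obtain X Y where "X \<union> Y = V" "X \<inter> Y = {}" "conn E X" "conn E Y" "a \<in> X" "b \<in> X" "c \<in> Y" "d \<in> Y"
  using lk_partition[OF assms(1,2)] .
 thus ?thesis using assms(3) unfolding lk_def by blast
qed

locale twoc =
 fixes V :: "'v set" and E :: "'v set set"
 assumes finV: "finite V" and edge: "e \<in> E ==> e \<subseteq> V \<and> card e = 2"
  and cV: "conn E V" and cV1: "conn E (V - {x})"
begin

lemma finE: "finite E"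
 using finV edge by (meson PowI finite_Pow_iff finite_subset subsetI)

lemma two_paths:
 assumes "U \<subseteq> V" "W \<subseteq> V" "u \<in> U" "u' \<in> U" "u \<noteq> u'" "w \<in> W" "w' \<in> W" "w \<noteq> w'"
 obtains p q where "pth E p" "pth E q" "set p \<subseteq> V" "set q \<subseteq> V" "set p \<inter> set q = {}"
  "set p \<inter> U = {hd p}" "set p \<inter> W = {last p}" "set q \<inter> U = {hd q}" "set q \<inter> W = {last q}"
proof (rule menger2[OF finE, of V U W])
 show "\<exists>X. conn E X \<and> X \<subseteq> V - {z} \<and> X \<inter> U \<noteq> {} \<and> X \<inter> W \<noteq> {}" for z using cV1[of z] assms by (intro exI[of _ "V - {z}"]) blast
qed (rule that)

text \<open>Two disjoint paths between the pairs exist by Menger's theorem and match the ends in one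
  of two ways. The pairs may share vertices.\<close>

lemma A0:
 assumes "a \<in> V" "b \<in> V" "c \<in> V" "d \<in> V" "a \<noteq> b" "c \<noteq> d"
 shows "lk E V a c b d \<or> lk E V a d b c"
proof -
 have h: "{a, b} \<subseteq> V" "{c, d} \<subseteq> V" "a \<in> {a, b}" "b \<in> {a, b}" "a \<noteq> b" "c \<in> {c, d}" "d \<in> {c, d}" "c \<noteq> d" using assms by auto
 obtain p q where pq: "pth E p" "pth E q" "set p \<subseteq> V" "set q \<subseteq> V" "set p \<inter> set q = {}"
  "set p \<inter> {a, b} = {hd p}" "set p \<inter> {c, d} = {last p}" "set q \<inter> {a, b} = {hd q}" "set q \<inter> {c, d} = {last q}"
  using two_paths[OF h] .
 have c: "conn E (set p)" "conn E (set q)" by (rule conn_pth, rule pq)+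
 have i: "hd p \<in> set p \<inter> {a, b}" "hd q \<in> set q \<inter> {a, b}" "last p \<in> set p \<inter> {c, d}" "last q \<in> set q \<inter> {c, d}"
  unfolding pq(6-9) by simp_all
 hence "hd p \<in> {a, b}" "hd q \<in> {a, b}" "last p \<in> {c, d}" "last q \<in> {c, d}" by simp_all
 moreover have "hd p \<noteq> hd q" "last p \<noteq> last q" using i pq(5) by (metis IntD1 disjoint_iff)+
 moreover have "hd p \<in> set p" "hd q \<in> set q" "last p \<in> set p" "last q \<in> set q" using i by simp_all
 ultimately consider "a \<in> set p" "c \<in> set p" "b \<in> set q" "d \<in> set q" | "a \<in> set p" "d \<in> set p" "b \<in> set q" "c \<in> set q"
  | "a \<in> set q" "c \<in> set q" "b \<in> set p" "d \<in> set p" | "a \<in> set q" "d \<in> set q" "b \<in> set p" "c \<in> set p"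
  by auto
 thus ?thesis using lkI[OF c pq(3,4,5)] lkI[OF c(2,1) pq(4,3)] pq(5) by cases (simp_all add: Int_commute)
qed

text \<open>When \<open>e\<close> lies on the side of \<open>a\<close> and \<open>b\<close>, it
  competes with \<open>b\<close> for the connection to \<open>a\<close>: one of the two stays with
  \<open>a\<close>, the other moves to the side of \<open>c\<close> and \<open>d\<close>. Which one
  it is depends on two disjoint paths that lead from \<open>b\<close> and \<open>e\<close> to
  \<open>a\<close> or to the side of \<open>c\<close> and \<open>d\<close>.\<close>

lemma lk_tripod:
 assumes "lk E V a b c d" "e \<in> V" "a \<noteq> b" "a \<noteq> e" "b \<noteq> e" "c \<noteq> e" "d \<noteq> e"
 shows "(lk E V a b c e \<and> lk E V a b d e) \<or> (lk E V a e c b \<and> lk E V a e d b)"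
proof -
 obtain X Y where XY: "X \<union> Y = V" "X \<inter> Y = {}" "conn E X" "conn E Y" "a \<in> X" "b \<in> X" "c \<in> Y" "d \<in> Y"
  using lk_partition[OF cV assms(1)] .
 have first: ?thesis if "conn E X'" "conn E Y'" "X' \<subseteq> V" "Y' \<subseteq> V" "X' \<inter> Y' = {}" "a \<in> X'" "b \<in> X'"
  "c \<in> Y'" "d \<in> Y'" "e \<in> Y'" for X' Y'
  using that unfolding lk_def by blast
 have second: ?thesis if "conn E X'" "conn E Y'" "X' \<subseteq> V" "Y' \<subseteq> V" "X' \<inter> Y' = {}" "a \<in> X'" "e \<in> X'"
  "c \<in> Y'" "d \<in> Y'" "b \<in> Y'" for X' Y'
  using that unfolding lk_def by blast
 show ?thesis
 proof (cases "e \<in> Y")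
  case True
  thus ?thesis using first[of X Y] XY by blast
 next
  case False
  hence eX: "e \<in> X" using assms(2) XY(1) by blast
  have "\<exists>p q. pth E p \<and> pth E q \<and> set p \<subseteq> V \<and> set q \<subseteq> V \<and> set p \<inter> set q = {} \<and> hd p = b \<and> hd q = e
   \<and> set p \<inter> insert a Y = {last p} \<and> set q \<inter> insert a Y = {last q}"
  proof -
   have h: "{b, e} \<subseteq> V" "insert a Y \<subseteq> V" "b \<in> {b, e}" "e \<in> {b, e}" "b \<noteq> e" "a \<in> insert a Y" "c \<in> insert a Y" "a \<noteq> c"
    using assms XY eX by auto
   obtain p q where pq: "pth E p" "pth E q" "set p \<subseteq> V" "set q \<subseteq> V" "set p \<inter> set q = {}"
    "set p \<inter> {b, e} = {hd p}" "set p \<inter> insert a Y = {last p}" "set q \<inter> {b, e} = {hd q}" "set q \<inter> insert a Y = {last q}"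
    using two_paths[OF h] .
   have "hd p \<in> set p \<inter> {b, e}" "hd q \<in> set q \<inter> {b, e}" unfolding pq(6,8) by simp_all
   hence "hd p \<in> {b, e}" "hd q \<in> {b, e}" "hd p \<in> set p" "hd q \<in> set q" by simp_all
   moreover from this(3,4) have "hd p \<noteq> hd q" using pq(5) by (metis disjoint_iff)
   ultimately consider "hd p = b" "hd q = e" | "hd p = e" "hd q = b" by auto
   thus ?thesis
   proof cases
    case 1 thus ?thesis using pq by (intro exI[of _ p] exI[of _ q]) simp
   next
    case 2 thus ?thesis using pq by (intro exI[of _ q] exI[of _ p]) (simp add: Int_commute)
   qed
  qed
  then obtain p q where pq: "pth E p" "pth E q" "set p \<subseteq> V" "set q \<subseteq> V" "set p \<inter> set q = {}" "hd p = b" "hd q = e"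
   "set p \<inter> insert a Y = {last p}" "set q \<inter> insert a Y = {last q}" by blast
  have ne: "p \<noteq> []" "q \<noteq> []" using pq by (auto simp: pth_def)
  have bp: "b \<in> set p" "e \<in> set q" using pq(6,7) ne hd_in_set by blast+
  have cp: "conn E (set p)" "conn E (set q)" by (rule conn_pth, rule pq)+
  have lp: "last p \<in> set p" "last q \<in> set q" using ne by auto
  have body: "conn E (set (butlast r)) \<and> set (butlast r) \<subseteq> X \<and> hd r \<in> set (butlast r)"
   if r: "pth E r" "set r \<subseteq> V" "set r \<inter> insert a Y = {last r}" "hd r \<in> X" "last r \<in> Y" for r
  proof -
   have rne: "r \<noteq> []" using r by (simp add: pth_def)
   have "hd r \<noteq> last r" using r XY(2) by auto
   hence bne: "butlast r \<noteq> []" using rne by (metis append_butlast_last_id append_Nil list.sel(1))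
   have rb: "r = butlast r @ [last r]" using rne by simp
   have "pth E (butlast r)" using r(1) rb bne pth_append(1) by metis
   moreover have "last r \<notin> set (butlast r)"
    using r(1) rb unfolding pth_def by (metis disjoint_iff distinct_append list.set_intros(1))
   moreover have h: "hd r = hd (butlast r)" using rb bne by (metis hd_append2)
   moreover have "x \<in> X" if "x \<in> set (butlast r)" for x
   proof -
    have "x \<in> set r" "x \<noteq> last r" using in_set_butlastD[OF that] that \<open>last r \<notin> set (butlast r)\<close> by auto
    thus ?thesis using r(3) \<open>x \<in> set r\<close> r(2) XY(1) by blast
   qed
   ultimately show ?thesis using conn_pth bne by auto
  qed
  consider (1) "last p \<in> Y" "last q = a" | (2) "last p = a" "last q \<in> Y" | (3) "last p \<in> Y" "last q \<in> Y"
  proof -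
   have "last p \<in> insert a Y" "last q \<in> insert a Y" using pq(8,9) by blast+
   moreover have "last p \<noteq> last q" using pq(5) lp by (metis disjoint_iff)
   ultimately show ?thesis using that by (metis insertE)
  qed
  thus ?thesis
  proof cases
   case 1
   have d: "set q \<inter> (Y \<union> set p) = {}" using pq(9)[unfolded 1(2)] XY(2,5) pq(5) by fast
   have "conn E (Y \<union> set p)" by (rule conn_Un[OF XY(4) cp(1) 1(1) lp(1)])
   moreover have "Y \<union> set p \<subseteq> V" using XY(1) pq(3) by auto
   moreover have "a \<in> set q" using 1(2) lp(2) by simp
   ultimately show ?thesis using second[OF cp(2) _ pq(4) _ d _ bp(2)] XY(7,8) bp(1) by simp
  next
   case 2
   have d: "set p \<inter> (Y \<union> set q) = {}" using pq(8)[unfolded 2(1)] XY(2,5) pq(5) by fast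
   have "conn E (Y \<union> set q)" by (rule conn_Un[OF XY(4) cp(2) 2(2) lp(2)])
   moreover have "Y \<union> set q \<subseteq> V" using XY(1) pq(4) by auto
   moreover have "a \<in> set p" using 2(1) lp(1) by simp
   ultimately show ?thesis using first[OF cp(1) _ pq(3) _ d _ bp(1)] XY(7,8) bp(2) by simp
  next
   case 3
   have cY: "conn E (Y \<union> set p)" "conn E (Y \<union> set q)"
    by (rule conn_Un[OF XY(4) cp(1) 3(1) lp(1)], rule conn_Un[OF XY(4) cp(2) 3(2) lp(2)])
   have sY: "Y \<union> set p \<subseteq> V" "Y \<union> set q \<subseteq> V" using XY(1) pq(3,4) by auto
   \<comment> \<open>Neither path ends in \<open>a\<close>, so \<open>a\<close> is joined inside
     \<open>X\<close> to the path that is met first, and the other path is left to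
     \<open>Y\<close>.\<close>
   have "X \<inter> {a} \<noteq> {}" "X \<inter> (set p \<union> set q) \<noteq> {}" using XY(5,6) bp(1) by auto
   then obtain r where r: "pth E r" "set r \<subseteq> X" "set r \<inter> {a} = {hd r}" "set r \<inter> (set p \<union> set q) = {last r}"
    using conn_obtain_trimmed[OF XY(3)] by metis
   have cr: "conn E (set r)" "last r \<in> set r" "a \<in> set r" using conn_pth[OF r(1)] r(3,4) by auto
   have hp: "hd p \<in> X" "hd q \<in> X" using pq(6,7) XY(6) eX by auto
   note bodyp = body[OF pq(1,3,8) hp(1) 3(1)] and bodyq = body[OF pq(2,4,9) hp(2) 3(2)]
   have last_body: "last r \<in> set (butlast s)" if "last r \<in> set s" "last s \<in> Y" "s \<noteq> []" for s
   proof -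
    have "last r \<noteq> last s" using that(2) r(2) cr(2) XY(2) by auto
    moreover have "set s = insert (last s) (set (butlast s))"
     using that(3) by (metis append_butlast_last_id list.simps(15) rotate1.simps(2) set_rotate1)
    ultimately show ?thesis using that(1) by auto
   qed
   show ?thesis
   proof (cases "last r \<in> set p")
    case True
    have lb: "last r \<in> set (butlast p)" by (rule last_body[OF True 3(1) ne(1)])
    have "conn E (set r \<union> set (butlast p))" by (rule conn_Un[OF cr(1) _ cr(2) lb]) (use bodyp in simp)
    moreover have "(set r \<union> set (butlast p)) \<inter> (Y \<union> set q) = {}"
     using r(4) True pq(5) r(2) XY(2) bodyp in_set_butlastD[of _ p] by blast
    moreover have "set r \<union> set (butlast p) \<subseteq> V" using r(2) bodyp XY(1) by auto
    ultimately show ?thesis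
     using first[OF _ cY(2) _ sY(2), of "set r \<union> set (butlast p)"] cr(3) bodyp pq(6) XY(7,8) bp(2) by simp
   next
    case False
    hence T: "last r \<in> set q" using r(4) by auto
    have lb: "last r \<in> set (butlast q)" by (rule last_body[OF T 3(2) ne(2)])
    have "conn E (set r \<union> set (butlast q))" by (rule conn_Un[OF cr(1) _ cr(2) lb]) (use bodyq in simp)
    moreover have "set r \<inter> set p \<subseteq> {last r}" using r(4) by auto
    hence "set r \<inter> set p = {}" using False by auto
    hence "(set r \<union> set (butlast q)) \<inter> (Y \<union> set p) = {}" using r(2) pq(5) XY(2) bodyq in_set_butlastD[of _ q] by fast
    moreover have "set r \<union> set (butlast q) \<subseteq> V" using r(2) bodyq XY(1) by auto
    ultimately show ?thesis
     using second[OF _ cY(1) _ sY(1), of "set r \<union> set (butlast q)"] cr(3) bodyq pq(7) XY(7,8) bp(1) by simp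
   qed
  qed
 qed
qed

end

section \<open>Rerouting around a connected set\<close>

text \<open>Let \<open>z\<close> be the last vertex of \<open>A\<close> in \<open>Z\<close>. A path
  \<open>Q\<close> outside \<open>Z\<close> starts on the part of \<open>A\<close> after
  \<open>z\<close>. If \<open>Q\<close> ends on \<open>B\<close>, then \<open>B\<close>,
  \<open>Q\<close> and that part join \<open>r\<close> to \<open>r'\<close>, while \<open>D\<close>
  and the part of \<open>A\<close> up to \<open>z\<close> join \<open>c\<close> to \<open>s\<close>,
  which is excluded. So \<open>Q\<close> returns to \<open>A\<close> before \<open>z\<close> and
  gives a detour around \<open>z\<close>.\<close>

lemma reroute_step:
 assumes Z: "Z \<subseteq> V" and C: "conn E (V - Z)"
  and A: "pth E A" "hd A = s" "last A = r'" "set A \<subseteq> V"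
  and B: "pth E B" "hd B = e" "last B = r" "set B \<subseteq> V" and AB: "set A \<inter> set B = {}"
  and rZ: "r \<notin> Z" "r' \<notin> Z"
  and D: "pth E D" "hd D = c" "set D \<subseteq> Z" "last D \<in> set A" "set D \<inter> set B = {}"
  and no: "\<not> lk E V r r' c s"
 shows "\<exists>A'. pth E A' \<and> hd A' = s \<and> last A' = r' \<and> set A' \<subseteq> V \<and> set A' \<inter> set B = {} \<and>
  card ((set A' \<union> set B) \<inter> Z) < card ((set A \<union> set B) \<inter> Z)"
proof -
 have ne: "A \<noteq> []" "B \<noteq> []" "D \<noteq> []" using A(1) B(1) D(1) by (auto simp: pth_def)
 have "last D \<in> Z" using D(3) ne(3) by auto
 then obtain P1 z Q1 where sp: "A = P1 @ z # Q1" "z \<in> Z" "\<forall>x\<in>set Q1. x \<notin> Z"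
  using split_list_last_prop[of A "\<lambda>x. x \<in> Z"] D(4) by blast
 have Qne: "Q1 \<noteq> []" using sp A(3) rZ(2) by auto
 have dA: "distinct A" using A(1) by (simp add: pth_def)
 have pP: "pth E (P1 @ [z])" using A(1) sp(1) pth_append(1)[of E "P1 @ [z]" Q1] by simp
 have pQ: "pth E Q1" using A(1) sp(1) pth_append(2)[of E "P1 @ [z]" Q1] Qne by simp
 have hP: "hd (P1 @ [z]) = s" using sp(1) A(2) by (cases P1) auto
 have sP: "s \<in> set (P1 @ [z])" using hP hd_in_set[of "P1 @ [z]"] by auto
 have rB: "r \<in> set B" using B(3) ne(2) by auto
 have rQ: "r' \<in> set Q1" using sp(1) A(3) Qne by auto
 have V: "set Q1 \<subseteq> V - Z" "set P1 \<subseteq> V" using A(4) sp by auto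
 have "(V - Z) \<inter> set Q1 \<noteq> {}" "(V - Z) \<inter> (set P1 \<union> set B) \<noteq> {}" using rQ V rB B(4) rZ by auto
 then obtain Q where Q: "pth E Q" "set Q \<subseteq> V - Z" "set Q \<inter> set Q1 = {hd Q}" "set Q \<inter> (set P1 \<union> set B) = {last Q}"
  using conn_obtain_trimmed[OF C] by metis
 have hl: "hd Q \<in> set Q" "hd Q \<in> set Q1" "last Q \<in> set Q" "last Q \<in> set P1 \<union> set B" using Q(3,4) by auto
 have cQQ: "conn E (set Q \<union> set Q1)" by (rule conn_Un[OF conn_pth[OF Q(1)] conn_pth[OF pQ] hl(1,2)])
 show ?thesis
 proof (cases "last Q \<in> set B")
  case True
  hence notP: "last Q \<notin> set P1" using AB sp(1) by auto
  have QP: "set Q \<inter> set P1 = {}"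
  proof -
   have "set Q \<inter> set P1 \<subseteq> {last Q}" using Q(4) by auto
   thus ?thesis using notP by auto
  qed
  have "conn E (set B \<union> (set Q \<union> set Q1))" by (rule conn_Un[OF conn_pth[OF B(1)] cQQ True]) (use hl in simp)
  moreover have "last D \<in> set (P1 @ [z])" using D(4) sp(1,3) \<open>last D \<in> Z\<close> by auto
  hence "conn E (set (P1 @ [z]) \<union> set D)" by (rule conn_Un[OF conn_pth[OF pP] conn_pth[OF D(1)]]) (use ne in simp)
  moreover have "(set B \<union> (set Q \<union> set Q1)) \<inter> (set (P1 @ [z]) \<union> set D) = {}"
   using AB sp(1) QP Q(2) sp(2) dA V(1) D(3) D(5) by auto
  moreover have "c \<in> set D" using D(2) ne(3) by auto
  moreover have "set B \<union> (set Q \<union> set Q1) \<subseteq> V" "set (P1 @ [z]) \<union> set D \<subseteq> V" using B(4) Q(2) V D(3) Z sp(2) by auto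
  ultimately have "lk E V r r' c s"
   by (intro lkI[of E "set B \<union> (set Q \<union> set Q1)" "set (P1 @ [z]) \<union> set D"]) (use rB rQ sP in auto)
  thus ?thesis using no by blast
 next
  case False
  hence v: "last Q \<in> set P1" using hl by blast
  then obtain P2 P3 where P2: "P1 = P2 @ last Q # P3" by (meson split_list)
  have p2: "pth E (P2 @ [last Q])" using pP P2 pth_append(1)[of E "P2 @ [last Q]" "P3 @ [z]"] by simp
  let ?X = "set (P2 @ [last Q]) \<union> (set Q \<union> set Q1)"
  have "conn E ?X" by (rule conn_Un[OF conn_pth[OF p2] cQQ, of "last Q"]) (use hl in auto)
  moreover have "s \<in> ?X" using hP P2 hd_in_set[of "P2 @ [last Q]"] by (cases P2) auto
  moreover have "r' \<in> ?X" using rQ by simp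
  ultimately obtain A' where A': "pth E A'" "hd A' = s" "last A' = r'" "set A' \<subseteq> ?X" using conn_obtain_pth by metis
  have QB: "set Q \<inter> set B = {}"
  proof -
   have "set Q \<inter> set B \<subseteq> {last Q}" using Q(4) by auto
   thus ?thesis using False by auto
  qed
  have XB: "?X \<inter> set B = {}" using QB AB sp(1) P2 by auto
  have zB: "z \<notin> set B" using AB sp(1) by auto
  have XZ: "?X \<inter> Z \<subseteq> set A" using sp(1) P2 Q(2) by auto
  have "card ((set A' \<union> set B) \<inter> Z) < card ((set A \<union> set B) \<inter> Z)"
   using A'(4) XZ dA sp P2 Q(2) zB by (intro psubset_card_mono) auto
  moreover have "set A' \<subseteq> V" using A'(4) P2 V Q(2) by auto
  moreover have "set A' \<inter> set B = {}" using A'(4) XB by fast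
  ultimately show ?thesis using A' by (intro exI[of _ A']) simp
 qed
qed

text \<open>Of all such linkages take one with the fewest vertices in \<open>Z\<close>. If it met
  \<open>Z\<close>, a path from \<open>c\<close> inside \<open>Z\<close> would come first to one of
  its two paths, and \<open>reroute_step\<close> would improve it.\<close>

lemma reroute:
 assumes Z: "Z \<subseteq> V" "conn E Z" "c \<in> Z" and C: "conn E (V - Z)"
  and rZ: "r \<notin> Z" "r' \<notin> Z"
  and l: "lk E V s r' e r" and no: "\<not> lk E V r r' c s" "\<not> lk E V r r' c e"
 shows "lk E (V - Z) s r' e r"
proof -
 define ok where "ok A B \<longleftrightarrow> pth E A \<and> hd A = s \<and> last A = r' \<and> set A \<subseteq> V \<and>
   pth E B \<and> hd B = e \<and> last B = r \<and> set B \<subseteq> V \<and> set A \<inter> set B = {}" for A B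
 obtain X Y where XY: "X \<subseteq> V" "Y \<subseteq> V" "X \<inter> Y = {}" "conn E X" "conn E Y" "s \<in> X" "r' \<in> X" "e \<in> Y" "r \<in> Y"
  using l unfolding lk_def by blast
 obtain A where A: "pth E A" "hd A = s" "last A = r'" "set A \<subseteq> X" using conn_obtain_pth[OF XY(4,6,7)] .
 obtain B where B: "pth E B" "hd B = e" "last B = r" "set B \<subseteq> Y" using conn_obtain_pth[OF XY(5,8,9)] .
 have "ok A B" unfolding ok_def using A B XY(1,2,3) by auto
 hence "\<exists>p. ok (fst p) (snd p)" by (metis fst_conv snd_conv)
 then obtain p where p: "ok (fst p) (snd p)"
  "\<forall>q. ok (fst q) (snd q) \<longrightarrow> card ((set (fst p) \<union> set (snd p)) \<inter> Z) \<le> card ((set (fst q) \<union> set (snd q)) \<inter> Z)"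
  using ex_has_least_nat[of "\<lambda>p. ok (fst p) (snd p)" _ "\<lambda>p. card ((set (fst p) \<union> set (snd p)) \<inter> Z)"] by blast
 define A B where "A = fst p" and "B = snd p"
 have ok: "ok A B" and least: "\<And>A' B'. ok A' B' ==> card ((set A \<union> set B) \<inter> Z) \<le> card ((set A' \<union> set B') \<inter> Z)"
  using p unfolding A_def B_def by (auto dest: spec[of _ "(_, _)"])
 have A: "pth E A" "hd A = s" "last A = r'" "set A \<subseteq> V" and B: "pth E B" "hd B = e" "last B = r" "set B \<subseteq> V"
  and AB: "set A \<inter> set B = {}"
  using ok unfolding ok_def by auto
 have ne: "A \<noteq> []" "B \<noteq> []" using A(1) B(1) by (auto simp: pth_def)
 have "(set A \<union> set B) \<inter> Z = {}"
 proof (rule ccontr)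
  assume n: "(set A \<union> set B) \<inter> Z \<noteq> {}"
  have n1: "Z \<inter> {c} \<noteq> {}" and n2: "Z \<inter> (set A \<union> set B) \<noteq> {}" using n Z(3) by auto
  obtain D where D: "pth E D" "set D \<subseteq> Z" "set D \<inter> {c} = {hd D}" "set D \<inter> (set A \<union> set B) = {last D}"
   using conn_obtain_trimmed[OF Z(2) n1 n2] .
  have hD: "hd D = c" using D(3) by auto
  show False
  proof (cases "last D \<in> set A")
   case True
   have "set D \<inter> set B = {}" using D(4) True AB by auto
   from reroute_step[OF Z(1) C A B AB rZ D(1) hD D(2) True this no(1)]
   show False using least B unfolding ok_def by fastforce
  next
   case False
   hence T: "last D \<in> set B" using D(4) by auto
   have "set D \<inter> set A \<subseteq> {last D}" using D(4) by auto
   hence dd: "set D \<inter> set A = {}" using False by auto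
   have BA: "set B \<inter> set A = {}" using AB by auto
   have "\<not> lk E V r' r c e" using no(2) lk_swap1[of E V r' r c e] by blast
   from reroute_step[OF Z(1) C B A BA rZ(2,1) D(1) hD D(2) T dd this]
   obtain B' where B': "pth E B'" "hd B' = e" "last B' = r" "set B' \<subseteq> V" "set B' \<inter> set A = {}"
    "card ((set B' \<union> set A) \<inter> Z) < card ((set B \<union> set A) \<inter> Z)" by blast
   have "set A \<inter> set B' = {}" using B'(5) by auto
   thus False using least[of A B'] A B' unfolding ok_def by (simp add: Un_commute)
  qed
 qed
 hence sub: "set A \<subseteq> V - Z" "set B \<subseteq> V - Z" using A(4) B(4) by auto
 show ?thesis by (rule lkI[OF conn_pth[OF A(1)] conn_pth[OF B(1)] sub AB]) (use A(2,3) B(2,3) ne in auto)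
qed

section \<open>Blocks between two vertices\<close>

text \<open>Every attachment \<open>v\<close> in \<open>N\<close> cuts \<open>r\<close> from
  \<open>r'\<close>, so the attachments follow one another between the two. The vertex
  \<open>w\<close> is the last of them before \<open>s\<close> as seen from \<open>r\<close>, with
  \<open>r\<close> itself as the initial candidate; it is found by making the component of
  \<open>r'\<close> in \<open>C - {w}\<close> as small as possible.\<close>

lemma block_side:
 assumes fin: "finite C" and C: "conn E C" and r: "r \<in> C" "r' \<in> C" "r \<noteq> r'"
  and sep: "\<And>v. v \<in> N ==> v \<noteq> r ==> v \<noteq> r' ==> v \<in> C \<and> r' \<notin> comp E (C - {v}) r"
  and s: "s \<in> comp E (C - {r}) r'"
 obtains w where "w \<in> N \<union> {r}" "w \<noteq> r'" "w \<in> C" "s \<in> comp E (C - {w}) r'"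
  "\<And>v. v \<in> N ==> v \<noteq> r ==> v \<noteq> r' ==> s \<in> comp E (C - {v}) r' ==> v \<in> insert w (comp E (C - {w}) r)"
proof -
 define W where "W = {w. w \<in> N \<union> {r} \<and> w \<noteq> r' \<and> s \<in> comp E (C - {w}) r'}"
 have "r \<in> W" using s r unfolding W_def by auto
 then obtain w where w: "w \<in> W" "\<forall>v. v \<in> W \<longrightarrow> card (comp E (C - {w}) r') \<le> card (comp E (C - {v}) r')"
  using ex_has_least_nat[of "\<lambda>w. w \<in> W" r "\<lambda>w. card (comp E (C - {w}) r')"] by blast
 have wC: "w \<in> C" using w(1) sep[of w] r(1) unfolding W_def by auto
 show ?thesis
 proof (rule that[of w])
  show "w \<in> N \<union> {r}" "w \<noteq> r'" "s \<in> comp E (C - {w}) r'" using w(1) unfolding W_def by auto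
  show "w \<in> C" by (rule wC)
  fix v assume v: "v \<in> N" "v \<noteq> r" "v \<noteq> r'" "s \<in> comp E (C - {v}) r'"
  note vs = sep[OF v(1-3)]
  show "v \<in> insert w (comp E (C - {w}) r)"
  proof (rule ccontr)
   assume n: "v \<notin> insert w (comp E (C - {w}) r)"
   let ?K = "comp E (C - {v}) r'"
   have rK: "r' \<in> ?K" by (rule comp_self) (use r v in auto)
   have "r \<in> C - ?K" using vs r comp_sym[of r E "C - {v}" r'] by auto
   hence "\<exists>y\<in>?K. \<exists>x\<in>C - (C - {v}). {x, y} \<in> E" by (intro comp_edge_out[OF C _ _]) (use r v in auto)
   then obtain y where y: "y \<in> ?K" "{v, y} \<in> E" by auto
   \<comment> \<open>If \<open>w\<close> lay beyond \<open>v\<close>, the side of \<open>r\<close>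
     at \<open>w\<close> together with \<open>w\<close> would join \<open>r\<close> to
     \<open>r'\<close> without using \<open>v\<close>.\<close>
   have wK: "w \<notin> ?K"
   proof
    assume wK: "w \<in> ?K"
    have wr: "w \<noteq> r" using wK \<open>r \<in> C - ?K\<close> by auto
    let ?L = "insert w (comp E (C - {w}) r)"
    have "r' \<in> C - comp E (C - {w}) r" using sep[of w] w(1) wr r(2) unfolding W_def by auto
    hence "\<exists>y\<in>comp E (C - {w}) r. \<exists>x\<in>C - (C - {w}). {x, y} \<in> E" by (intro comp_edge_out[OF C _ _]) (use r wr in auto)
    then obtain z where z: "z \<in> comp E (C - {w}) r" "{w, z} \<in> E" by auto
    have cL: "conn E ?L" using conn_insert[OF conn_comp z(1)] z(2) by (simp add: insert_commute)
    have "conn E (?K \<union> ?L)" by (rule conn_Un[OF conn_comp cL wK]) simp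
    moreover have "?K \<union> ?L \<subseteq> C - {v}" using n comp_subset[of E "C - {v}" r'] comp_subset[of E "C - {w}" r] wC by auto
    moreover have "r \<in> ?K \<union> ?L" using comp_self[of r "C - {w}" E] r wr by auto
    ultimately have "?K \<union> ?L \<subseteq> comp E (C - {v}) r" by (rule comp_superset)
    thus False using vs rK by auto
   qed
   have sub: "insert v ?K \<subseteq> comp E (C - {w}) r'"
   proof (rule comp_superset)
    show "conn E (insert v ?K)" using conn_insert[OF conn_comp y(1)] y(2) by (simp add: insert_commute)
    show "insert v ?K \<subseteq> C - {w}" using wK n vs comp_subset[of E "C - {v}" r'] by auto
   qed (use rK in auto)
   have "?K \<subset> comp E (C - {w}) r'" using comp_subset[of E "C - {v}" r'] sub by auto
   moreover have "finite (comp E (C - {w}) r')" by (rule finite_subset[OF comp_subset]) (use fin in auto)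
   ultimately have "card ?K < card (comp E (C - {w}) r')" by (intro psubset_card_mono)
   moreover have "v \<in> W" using v unfolding W_def by auto
   ultimately show False using w(2) by auto
  qed
 qed
qed

text \<open>A connected set with vertices inside and outside \<open>I\<close> has to leave
  \<open>I\<close> through \<open>w\<close> or \<open>w'\<close>, and disjointness gives each of the
  two sets its own exit. Both sets can then be cut off at their exits.\<close>

lemma exit_linkage:
 assumes X: "conn E X" "s \<in> X" "r \<in> X" "X \<subseteq> C" and Y: "conn E Y" "e \<in> Y" "r' \<in> Y" "Y \<subseteq> C" "X \<inter> Y = {}"
  and I: "s \<in> I" "e \<in> I" "r \<notin> I" "r' \<notin> I"
  and out: "\<And>x y. x \<in> I ==> y \<in> C - I ==> {x, y} \<in> E ==> y = w \<or> y = w'"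
  and w: "w \<in> X" "w' \<in> Y" "w \<notin> I" "w' \<notin> I"
 shows "lk E (I \<union> {w, w'}) s w e w'"
proof -
 have one: "conn E (insert u (comp E (A \<inter> I) t))"
  if A: "conn E A" "t \<in> A" "t \<in> I" "q \<in> A" "q \<notin> I" "A \<subseteq> C"
   and u: "\<And>x y. x \<in> I ==> y \<in> A - I ==> {x, y} \<in> E ==> y = u" for A t q u
 proof -
  have "\<exists>y\<in>comp E (A \<inter> I) t. \<exists>x\<in>A - (A \<inter> I). {x, y} \<in> E"
   by (rule comp_edge_out[OF A(1), where w = q]) (use A comp_subset[of E "A \<inter> I" t] in auto)
  then obtain y x where yx: "y \<in> comp E (A \<inter> I) t" "x \<in> A - I" "{x, y} \<in> E" by auto
  show ?thesis
   using u[of y x] yx comp_subset[of E "A \<inter> I" t] conn_insert[OF conn_comp yx(1), of u] yx(3) by (auto simp: insert_commute)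
 qed
 have c1: "conn E (insert w (comp E (X \<inter> I) s))" by (rule one[OF X(1,2) I(1) X(3) I(3) X(4)]) (use out X(4) w Y(5) in blast)
 have c2: "conn E (insert w' (comp E (Y \<inter> I) e))" by (rule one[OF Y(1,2) I(2) Y(3) I(4) Y(4)]) (use out Y(4) w Y(5) in blast)
 have sub: "comp E (X \<inter> I) s \<subseteq> X \<inter> I" "comp E (Y \<inter> I) e \<subseteq> Y \<inter> I" by (rule comp_subset)+
 have self: "s \<in> comp E (X \<inter> I) s" "e \<in> comp E (Y \<inter> I) e" by (rule comp_self, use X Y I in simp)+
 show ?thesis by (rule lkI[OF c1 c2]) (use sub self w Y(5) in auto)
qed

text \<open>One end of the block. Every connection of \<open>s\<close> with \<open>r\<close> runs
  through \<open>w\<close>. So in the first linkage the connection of \<open>e\<close> with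
  \<open>r'\<close> avoids \<open>w\<close>, which puts \<open>e\<close> beyond \<open>w\<close> as
  well; hence in the second linkage the connection of \<open>e\<close> with \<open>r\<close> runs
  through \<open>w\<close>.\<close>

lemma block_half:
 assumes fin: "finite C" and C: "conn E C" and r: "r \<in> C" "r' \<in> C" "r \<noteq> r'"
  and sep: "\<And>v. v \<in> N ==> v \<noteq> r ==> v \<noteq> r' ==> v \<in> C \<and> r' \<notin> comp E (C - {v}) r"
  and 1: "Y1 \<subseteq> C" "conn E Y1" "e \<in> Y1" "r' \<in> Y1" "conn E X1" "X1 \<subseteq> C" "s \<in> X1" "r \<in> X1" "X1 \<inter> Y1 = {}"
  and 2: "X2 \<subseteq> C" "Y2 \<subseteq> C" "X2 \<inter> Y2 = {}" "conn E X2" "conn E Y2" "s \<in> X2" "r' \<in> X2" "e \<in> Y2" "r \<in> Y2"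
 obtains w where "w \<in> N \<union> {r}" "w \<noteq> r'" "w \<in> C" "s \<in> comp E (C - {w}) r'"
  "\<And>v. v \<in> N ==> v \<noteq> r ==> v \<noteq> r' ==> s \<in> comp E (C - {v}) r' ==> v \<in> insert w (comp E (C - {w}) r)"
  "r' \<notin> comp E (C - {w}) r" "s \<notin> comp E (C - {w}) r" "e \<notin> comp E (C - {w}) r"
  "\<And>X. conn E X ==> X \<subseteq> C ==> s \<in> X ==> r \<in> X ==> w \<in> X" "w \<in> Y2"
  "conn E (insert w (comp E (C - {w}) r))" "r \<in> insert w (comp E (C - {w}) r)"
proof -
 have s: "s \<in> comp E (C - {r}) r'" using comp_superset[OF 2(4), of "C - {r}" r'] 2 by auto
 obtain w where w: "w \<in> N \<union> {r}" "w \<noteq> r'" "w \<in> C" "s \<in> comp E (C - {w}) r'"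
  "\<And>v. v \<in> N ==> v \<noteq> r ==> v \<noteq> r' ==> s \<in> comp E (C - {v}) r' ==> v \<in> insert w (comp E (C - {w}) r)"
  using block_side[OF fin C r sep s] by blast
 let ?K = "comp E (C - {w}) r"
 have n: "r' \<notin> ?K" using sep[of w] w(1,2) comp_outside[of r "C - {w}" E] by auto
 have sK: "s \<notin> ?K" using n w(4) comp_eq comp_sym by metis
 have thru: "w \<in> X" if "conn E X" "X \<subseteq> C" "s \<in> X" "r \<in> X" for X
  using comp_superset[OF that(1), of "C - {w}" r] that sK by blast
 have "Y1 \<subseteq> C - {w}" using thru[OF 1(5-8)] 1(1,9) by blast
 hence "e \<in> comp E (C - {w}) r'" using comp_superset[OF 1(2) _ 1(4)] 1(3) by blast
 hence e: "e \<notin> ?K" using n comp_eq comp_sym by metis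
 have "w \<in> Y2" using comp_superset[OF 2(5), of "C - {w}" r] 2 e by blast
 moreover have "conn E (insert w ?K)"
 proof (cases "w = r")
  case False
  hence "\<exists>y\<in>?K. \<exists>x\<in>C - (C - {w}). {x, y} \<in> E" by (intro comp_edge_out[OF C _ _, of _ _ r']) (use r n in auto)
  then obtain z where z: "z \<in> ?K" "{w, z} \<in> E" by auto
  thus ?thesis using conn_insert[OF conn_comp z(1)] by (simp add: insert_commute)
 qed (simp add: comp_outside)
 moreover have "r \<in> insert w ?K" using comp_self[of r "C - {w}" E] r by auto
 ultimately show ?thesis using that[OF w n sK e thru] by blast
qed

text \<open>Otherwise the side of \<open>r'\<close> cut off at \<open>w'\<close> would be contained
  in the side of \<open>r\<close> cut off at \<open>w\<close>, and \<open>r'\<close> with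
  it.\<close>

lemma block_cross:
 assumes "w \<in> comp E (C - {w'}) r" "r \<notin> comp E (C - {w'}) r'" "conn E (insert w' (comp E (C - {w'}) r'))"
  and "r' \<notin> comp E (C - {w}) r" "r' \<in> C" "w' \<in> C" "w \<noteq> w'"
 shows "w' \<notin> comp E (C - {w}) r"
proof
 let ?K = "comp E (C - {w'}) r'"
 assume a: "w' \<in> comp E (C - {w}) r"
 have "w \<notin> ?K" using assms(1,2) comp_eq comp_sym by metis
 hence "insert w' ?K \<subseteq> C - {w}" using comp_subset[of E "C - {w'}" r'] assms(6,7) by blast
 hence "insert w' ?K \<subseteq> comp E (C - {w}) r" using comp_absorb[OF assms(3) _ _ a] by blast
 thus False using a assms(4,5) comp_self[of r' "C - {w'}" E] by blast
qed

context twoc begin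

text \<open>The two linkages differ by an exchange of \<open>r\<close> and \<open>r'\<close>.
  Cutting off the side of \<open>r\<close> at \<open>w\<close> and the side of \<open>r'\<close> at
  \<open>w'\<close> leaves the block \<open>I\<close>, to which both linkages can be restricted. The
  sets \<open>L\<close> and \<open>L'\<close> are the parts cut off; they serve to prolong linkages
  of the block.\<close>

lemma flip_block:
 assumes Z: "Z \<subseteq> V" "c \<in> Z" and C: "conn E (V - Z)"
  and r: "r \<in> V - Z" "r' \<in> V - Z" "r \<noteq> r'"
  and sep: "\<And>v. v \<in> nb E V Z ==> v \<noteq> r ==> v \<noteq> r' ==> r' \<notin> comp E (V - Z - {v}) r"
  and f1: "lk E (V - Z) s r e r'" and f2: "lk E (V - Z) s r' e r"
 obtains w w' I L L' where "w \<noteq> w'" "w \<in> nb E V Z" "w' \<in> nb E V Z" "I \<subseteq> V - Z" "s \<in> I" "e \<in> I"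
  "w \<notin> I" "w' \<notin> I" "r \<notin> I" "r' \<notin> I" "nb E V I \<subseteq> {w, w'}"
  "lk E (I \<union> {w, w'}) s w e w'" "lk E (I \<union> {w, w'}) s w' e w"
  "conn E L" "r \<in> L" "w \<in> L" "L \<subseteq> V - Z - I" "conn E L'" "r' \<in> L'" "w' \<in> L'" "L' \<subseteq> V - Z - I" "L \<inter> L' = {}"
proof -
 let ?C = "V - Z" and ?N = "nb E V Z"
 have NC: "?N \<subseteq> ?C" by (auto simp: nb_def)
 have finC: "finite ?C" using finV by simp
 obtain X1 Y1 where 1: "X1 \<subseteq> ?C" "Y1 \<subseteq> ?C" "X1 \<inter> Y1 = {}" "conn E X1" "conn E Y1" "s \<in> X1" "r \<in> X1" "e \<in> Y1" "r' \<in> Y1"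
  using f1 unfolding lk_def by blast
 obtain X2 Y2 where 2: "X2 \<subseteq> ?C" "Y2 \<subseteq> ?C" "X2 \<inter> Y2 = {}" "conn E X2" "conn E Y2" "s \<in> X2" "r' \<in> X2" "e \<in> Y2" "r \<in> Y2"
  using f2 unfolding lk_def by blast
 have sep': "v \<in> ?C \<and> r \<notin> comp E (?C - {v}) r'" if "v \<in> ?N" "v \<noteq> r'" "v \<noteq> r" for v
  using sep[OF that(1,3,2)] comp_sym[of r E "?C - {v}" r'] NC that(1) by auto
 obtain w where w: "w \<in> ?N \<union> {r}" "w \<noteq> r'" "w \<in> ?C" "s \<in> comp E (?C - {w}) r'"
  "\<And>v. v \<in> ?N ==> v \<noteq> r ==> v \<noteq> r' ==> s \<in> comp E (?C - {v}) r' ==> v \<in> insert w (comp E (?C - {w}) r)"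
  and K: "r' \<notin> comp E (?C - {w}) r" "s \<notin> comp E (?C - {w}) r" "e \<notin> comp E (?C - {w}) r"
  and thru: "\<And>X. conn E X ==> X \<subseteq> ?C ==> s \<in> X ==> r \<in> X ==> w \<in> X" and wY2: "w \<in> Y2"
  and cL: "conn E (insert w (comp E (?C - {w}) r))" and rL: "r \<in> insert w (comp E (?C - {w}) r)"
  by (rule block_half[OF finC C r _ 1(2,5,8,9,4,1,6,7,3) 2, of ?N]) (use sep NC in blast)+
 obtain w' where w': "w' \<in> ?N \<union> {r'}" "w' \<noteq> r" "w' \<in> ?C" "s \<in> comp E (?C - {w'}) r"
  "\<And>v. v \<in> ?N ==> v \<noteq> r' ==> v \<noteq> r ==> s \<in> comp E (?C - {v}) r ==> v \<in> insert w' (comp E (?C - {w'}) r')"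
  and K': "r \<notin> comp E (?C - {w'}) r'" "s \<notin> comp E (?C - {w'}) r'" "e \<notin> comp E (?C - {w'}) r'"
  and thru': "\<And>X. conn E X ==> X \<subseteq> ?C ==> s \<in> X ==> r' \<in> X ==> w' \<in> X" and w'Y1: "w' \<in> Y1"
  and cL': "conn E (insert w' (comp E (?C - {w'}) r'))" and rL': "r' \<in> insert w' (comp E (?C - {w'}) r')"
  by (rule block_half[OF finC C r(2,1) r(3)[symmetric] sep' 2(2,5,8,9,4,1,6,7,3) 1]) blast+
 let ?K = "comp E (?C - {w}) r" and ?K' = "comp E (?C - {w'}) r'"
 have ww: "w \<noteq> w'" using w'(4) K(2) by auto
 have wX1: "w \<in> X1" and wX2: "w' \<in> X2" using thru[OF 1(4,1,6,7)] thru'[OF 2(4,1,6,7)] .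
 define I where "I = ?C - {w, w'} - ?K - ?K'"
 have ne: "s \<noteq> w" "s \<noteq> w'" "e \<noteq> w" "e \<noteq> w'"
  using wX1 1(3) wX2 2(3) w(4) w'(4) comp_subset[of E "?C - {w}" r'] comp_subset[of E "?C - {w'}" r] 1(8) 2(8) by auto
 have sI: "s \<in> I" "e \<in> I" "r \<notin> I" "r' \<notin> I" unfolding I_def using K K' ne 1 rL rL' by auto
 have out: "y = w \<or> y = w'" if "x \<in> I" "y \<in> ?C - I" "{x, y} \<in> E" for x y
  using comp_step[of y E "?C - {w}" r x] comp_step[of y E "?C - {w'}" r' x] that unfolding I_def by blast
 \<comment> \<open>An attachment \<open>v\<close> inside \<open>I\<close> would lie on both
   connections of \<open>s\<close>. The two connections of \<open>e\<close> then avoid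
   \<open>v\<close> and together join \<open>r\<close> to \<open>r'\<close>, although
   \<open>v\<close> separates these.\<close>
 have IN: "I \<inter> ?N = {}"
 proof (rule ccontr)
  assume "I \<inter> ?N \<noteq> {}"
  then obtain v where v: "v \<in> I" "v \<in> ?N" by blast
  have vr: "v \<noteq> r" "v \<noteq> r'" using v sI(3,4) by auto
  have no: "s \<notin> comp E (?C - {v}) r'" "s \<notin> comp E (?C - {v}) r"
   using w(5)[OF v(2) vr] w'(5)[OF v(2) vr(2,1)] v(1) unfolding I_def by auto
  have "v \<in> X1" using no(2) comp_superset[OF 1(4), of "?C - {v}" r] 1 by auto
  moreover have "v \<in> X2" using no(1) comp_superset[OF 2(4), of "?C - {v}" r'] 2 by auto
  ultimately have "Y1 \<union> Y2 \<subseteq> comp E (?C - {v}) r"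
   using 1(3) 2(3) by (intro comp_superset conn_Un[OF 1(5) 2(5) 1(8) 2(8)]) (use 1 2 in auto)
  thus False using sep[OF v(2) vr] 1(9) by auto
 qed
 have IV: "I \<subseteq> ?C" unfolding I_def by auto
 have nbI: "nb E V I \<subseteq> {w, w'}"
 proof
  fix y assume y: "y \<in> nb E V I"
  then obtain x where x: "x \<in> I" "{x, y} \<in> E" "y \<in> V" "y \<notin> I" by (auto simp: nb_def)
  have "y \<notin> Z" using x IV IN by (auto simp: nb_def insert_commute)
  thus "y \<in> {w, w'}" using out x by auto
 qed
 have wI: "w \<notin> I" "w' \<notin> I" by (auto simp: I_def)
 have in': "comp E (?C - {w'}) r \<subseteq> ?C" "comp E (?C - {w}) r' \<subseteq> ?C"
  using comp_subset[of E "?C - {w'}" r] comp_subset[of E "?C - {w}" r'] by blast+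
 have sr: "r \<in> comp E (?C - {w'}) r" "r' \<in> comp E (?C - {w}) r'" by (rule comp_self; use r w(2) w'(2) in auto)+
 have w'K: "w' \<notin> ?K" by (rule block_cross[OF thru[OF conn_comp in'(1) w'(4) sr(1)] K'(1) cL' K(1) r(2) w'(3) ww])
 have wK': "w \<notin> ?K'" by (rule block_cross[OF thru'[OF conn_comp in'(2) w(4) sr(2)] K(1) cL K'(1) r(1) w(3) ww[symmetric]])
 have KK: "?K \<inter> ?K' = {}"
 proof (rule equals0I)
  fix x assume x: "x \<in> ?K \<inter> ?K'"
  have "?K \<subseteq> ?K'"
   using w'K comp_subset[of E "?C - {w}" r] comp_absorb[OF conn_comp, of E "?C - {w}" r "?C - {w'}" x r'] x by blast
  thus False
   using K'(1) comp_sym[of x E "?C - {w}" r] comp_self[of r "?C - {w}" E] comp_outside[of r "?C - {w}" E] x by blast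
 qed
 \<comment> \<open>Otherwise all edges that leave \<open>I\<close> together with \<open>u\<close>
   would end in the single vertex \<open>u'\<close>, against 2-connectedness.\<close>
 have inN: "u \<in> ?N" if u: "u \<in> ?C" "u' \<in> ?C" "u \<noteq> u'" "I = ?C - {u, u'} - comp E (?C - {u'}) t" "u \<notin> comp E (?C - {u'}) t" for u u' t
 proof (rule ccontr)
  assume n: "u \<notin> ?N"
  let ?Y = "insert u I"
  have "?Y = V - {u'}"
  proof (rule conn_cut[OF cV1])
   show "{x, y} \<notin> E" if y: "y \<in> ?Y" "x \<in> V - {u'} - ?Y" for y x
   proof
    assume e: "{x, y} \<in> E"
    have "x \<in> comp E (?C - {u'}) t" using e y n IN IV u(1) u(4) by (auto simp: nb_def)
    hence "y \<in> comp E (?C - {u'}) t" using comp_step[of x E "?C - {u'}" t y] e u(1,3,4) y by (auto simp: insert_commute)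
    thus False using y u(4,5) by auto
   qed
  qed (use u in auto)
  thus False using Z IV u(1,2) by auto
 qed
 have Nr: "w \<in> ?N"
 proof (cases "w = r")
  case True
  thus ?thesis by (intro inN[OF w(3) w'(3) ww _ wK']) (simp add: I_def comp_outside)
 qed (use w(1) in auto)
 have Nr': "w' \<in> ?N"
 proof (cases "w' = r'")
  case True
  thus ?thesis by (intro inN[OF w'(3) w(3) ww[symmetric] _ w'K]) (simp add: I_def comp_outside insert_commute)
 qed (use w'(1) in auto)
 have l1: "lk E (I \<union> {w, w'}) s w e w'" by (rule exit_linkage[OF 1(4,6,7,1) 1(5,8,9,2,3) sI out wX1 w'Y1 wI])
 have l2: "lk E (I \<union> {w', w}) s w' e w"
  by (rule exit_linkage[OF 2(4,6,7,1) 2(5,8,9,2,3) sI(1,2,4,3) _ wX2 wY2 wI(2,1)]) (use out in blast)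
 have LI: "insert w ?K \<subseteq> ?C - I" "insert w' ?K' \<subseteq> ?C - I"
  using w(3) w'(3) comp_subset[of E "?C - {w}" r] comp_subset[of E "?C - {w'}" r'] unfolding I_def by auto
 show ?thesis
 proof (rule that[OF ww Nr Nr' IV sI(1,2) wI sI(3,4) nbI l1 _ cL rL _ LI(1) cL' rL' _ LI(2)])
  show "lk E (I \<union> {w, w'}) s w' e w" using l2 by (simp add: insert_commute)
  show "insert w ?K \<inter> insert w' ?K' = {}" using KK w'K wK' ww by auto
 qed auto
qed

end

section \<open>The module of linkages\<close>

text \<open>The tensor \<open>(a - b) \<otimes> (c - d)\<close>.\<close>

definition qd :: "'v \<Rightarrow> 'v \<Rightarrow> 'v \<Rightarrow> 'v \<Rightarrow> ('v \<times> 'v \<Rightarrow>\<^sub>0 int)" where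
 "qd a b c d = frag_of (a, c) - frag_of (a, d) - frag_of (b, c) + frag_of (b, d)"

text \<open>\<open>P_module\<close> with the paths of a linkage replaced by connected sets; the two
  agree by \<open>P_module_eq\<close>.\<close>

definition PM :: "'v set set \<Rightarrow> 'v set \<Rightarrow> 'v set \<Rightarrow> 'v set \<Rightarrow> ('v \<times> 'v \<Rightarrow>\<^sub>0 int) set" where
 "PM E V R S = frag.span {qd a b c d | a b c d. a \<in> R \<and> b \<in> R \<and> c \<in> S \<and> d \<in> S \<and> lk E V a b c d}"

lemma qd_eq0 [simp]: "qd a a c d = 0" "qd a b c c = 0"
 by (auto simp: qd_def)

lemma qd_swap: "qd b a c d = - qd a b c d" "qd a b d c = - qd a b c d"
 by (auto simp: qd_def)

lemma qd_add: "qd a b c d = qd a x c d + qd x b c d" "qd a b c d = qd a b c x + qd a b x d"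
 by (auto simp: qd_def)

lemma PM_base: "a \<in> R ==> b \<in> R ==> c \<in> S ==> d \<in> S ==> lk E V a b c d ==> qd a b c d \<in> PM E V R S"
 unfolding PM_def by (rule frag.span_base) blast

lemma PM_subspace: "frag.subspace (PM E V R S)"
 unfolding PM_def by (rule frag.subspace_span)

lemma PM_add: "x \<in> PM E V R S ==> y \<in> PM E V R S ==> x + y \<in> PM E V R S"
 using PM_subspace by (rule frag.subspace_add)

lemma PM_diff: "x \<in> PM E V R S ==> y \<in> PM E V R S ==> x - y \<in> PM E V R S"
 using PM_subspace by (rule frag.subspace_diff)

lemma PM_0 [simp]: "0 \<in> PM E V R S"
 using PM_subspace by (rule frag.subspace_0)

lemma PM_minus: "- x \<in> PM E V R S \<longleftrightarrow> x \<in> PM E V R S"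
 using frag.subspace_neg[OF PM_subspace, of x] frag.subspace_neg[OF PM_subspace, of "- x"] by auto

lemma PM_swap: "qd b a c d \<in> PM E V R S \<longleftrightarrow> qd a b c d \<in> PM E V R S" "qd a b d c \<in> PM E V R S \<longleftrightarrow> qd a b c d \<in> PM E V R S"
 by (simp_all only: qd_swap[of b a] qd_swap(2)[of a b d c] PM_minus)

lemma PM_third1: "qd a x c d \<in> PM E V R S ==> qd x b c d \<in> PM E V R S ==> qd a b c d \<in> PM E V R S"
 using PM_add[of "qd a x c d" _ _ _ _ "qd x b c d"] qd_add(1)[of a b c d x] by simp

lemma PM_third2: "qd a b c x \<in> PM E V R S ==> qd a b x d \<in> PM E V R S ==> qd a b c d \<in> PM E V R S"
 using PM_add[of "qd a b c x" _ _ _ _ "qd a b x d"] qd_add(2)[of a b c d x] by simp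

text \<open>There is no sided \<open>(S, R)\<close>-separation \<open>(G1, G2)\<close>: \<open>I\<close> is the vertex set of \<open>G1\<close> without the
 attachment vertices \<open>w\<close> and \<open>w'\<close>.\<close>

definition nosd :: "'v set set \<Rightarrow> 'v set \<Rightarrow> 'v set \<Rightarrow> 'v set \<Rightarrow> bool" where
 "nosd E V R S \<longleftrightarrow> (\<forall>I w w' s e. w \<noteq> w' \<longrightarrow> w \<in> V - I \<longrightarrow> w' \<in> V - I \<longrightarrow> I \<subseteq> V \<longrightarrow> nb E V I \<subseteq> {w, w'} \<longrightarrow>
   V - I - {w, w'} \<noteq> {} \<longrightarrow> I \<inter> R = {} \<longrightarrow> s \<in> S \<inter> I \<longrightarrow> e \<in> S \<inter> I \<longrightarrow> s \<noteq> e \<longrightarrow>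
   lk E (I \<union> {w, w'}) s w e w' \<longrightarrow> \<not> lk E (I \<union> {w, w'}) s w' e w)"

lemma lk_absorb:
 assumes E: "conn E V" and I: "I \<subseteq> V" "q \<in> I" "nb E V I \<subseteq> {w, w'}" "w \<in> V - I" "w' \<in> V - I"
  and l: "lk E (I \<union> {w, w'}) s w e w'"
 obtains X Y where "conn E X" "conn E Y" "s \<in> X" "w \<in> X" "e \<in> Y" "w' \<in> Y" "X \<subseteq> I \<union> {w, w'}" "Y \<subseteq> I \<union> {w, w'}"
  "X \<inter> Y = {}" "q \<in> X \<or> q \<in> Y"
proof -
 obtain X Y where h: "X \<subseteq> I \<union> {w, w'}" "Y \<subseteq> I \<union> {w, w'}" "X \<inter> Y = {}" "conn E X" "conn E Y" "s \<in> X" "w \<in> X" "e \<in> Y" "w' \<in> Y"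
  using l unfolding lk_def by meson
 show ?thesis
 proof (cases "q \<in> X \<union> Y")
  case True
  thus ?thesis using that h by blast
 next
  case False
  let ?K = "comp E (I - X - Y) q"
  have K: "?K \<subseteq> I - X - Y" "q \<in> ?K" by (rule comp_subset, rule comp_self) (use I(2) False in auto)
  have "\<exists>y\<in>?K. \<exists>x\<in>V - (I - X - Y). {x, y} \<in> E" by (rule comp_edge_out[OF E, where w = w]) (use I False K in auto)
  then obtain y x where yx: "y \<in> ?K" "x \<in> V - (I - X - Y)" "{x, y} \<in> E" by blast
  have "x \<in> X \<union> Y" using I(3) h(7,9) yx K unfolding nb_def by (auto simp: insert_commute)
  then consider "x \<in> X" | "x \<in> Y" by blast
  thus ?thesis
  proof cases
   case 1
   have "conn E (X \<union> ?K)" by (rule conn_Un_edge[OF h(4) conn_comp 1 yx(1,3)])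
   thus ?thesis by (rule that[OF _ h(5)]) (use h K in blast)+
  next
   case 2
   have "conn E (Y \<union> ?K)" by (rule conn_Un_edge[OF h(5) conn_comp 2 yx(1,3)])
   thus ?thesis by (rule that[OF h(4)]) (use h K in blast)+
  qed
 qed
qed

context twoc begin

text \<open>Among all pairs \<open>r\<close>, \<open>r'\<close> choose one for which the connected set \<open>Z\<close> around \<open>c\<close> is largest. A vertex
 \<open>q\<close> of \<open>R\<close> inside the block either settles the claim or may replace \<open>r\<close> or \<open>r'\<close> with a larger \<open>Z\<close>.\<close>

lemma sigma:
 assumes ns: "nosd E V R S" and RS: "R \<subseteq> V" "S \<subseteq> V"
  and el: "r \<in> R" "r' \<in> R" "c \<in> S" "s \<in> S" "e \<in> S" and di: "distinct [r, r', c, s, e]"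
  and nP: "qd r r' c s \<notin> PM E V R S" "qd r r' c e \<notin> PM E V R S"
  and f1: "lk E V s r e r'"
 shows "\<not> lk E V s r' e r"
proof
 assume f2: "lk E V s r' e r"
 let ?P = "PM E V R S"
 define ok where "ok = (\<lambda>(r, r', Z). r \<in> R \<and> r' \<in> R \<and> distinct [r, r', c, s, e] \<and> qd r r' c s \<notin> ?P \<and> qd r r' c e \<notin> ?P \<and>
  lk E V s r e r' \<and> lk E V s r' e r \<and> Z \<subseteq> V \<and> conn E Z \<and> c \<in> Z \<and> r \<notin> Z \<and> r' \<notin> Z \<and> r' \<in> comp E (V - Z) r)"
 have "ok (r, r', {c})"
  using comp_superset[OF cV1[of c], of "V - {c}" r] el di RS unfolding ok_def using el di nP f1 f2 RS by auto
 moreover have "\<forall>t. ok t \<longrightarrow> card (snd (snd t)) < Suc (card V)"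
  unfolding ok_def using finV by (auto simp: less_Suc_eq_le intro: card_mono)
 ultimately obtain t where t: "ok t" "\<forall>t'. ok t' \<longrightarrow> card (snd (snd t')) \<le> card (snd (snd t))"
  using ex_has_greatest_nat[of ok _ "\<lambda>t. card (snd (snd t))"] by blast
 obtain a b Z where tt: "t = (a, b, Z)" by (metis prod_cases3)
 have ok: "a \<in> R" "b \<in> R" "distinct [a, b, c, s, e]" "qd a b c s \<notin> ?P" "qd a b c e \<notin> ?P"
  "lk E V s a e b" "lk E V s b e a" "Z \<subseteq> V" "conn E Z" "c \<in> Z" "a \<notin> Z" "b \<notin> Z" "b \<in> comp E (V - Z) a"
  using t(1) unfolding tt ok_def by auto
 have greatest: "card Z' \<le> card Z" if "ok (a', b', Z')" for a' b' Z' using t(2)[rule_format, OF that] tt by simp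
 have maxZ: "Z' = Z" if "ok (a', b', Z')" "Z \<subseteq> Z'" for a' b' Z'
  using card_seteq[OF _ that(2)] greatest[OF that(1)] that(1) finV finite_subset unfolding ok_def by blast
 have no: "\<not> lk E V a b c s" "\<not> lk E V a b c e" using ok PM_base[of a R b c S s E V] PM_base[of a R b c S e E V] el by blast+
 have abV: "a \<in> V" "b \<in> V" using ok RS by auto
 \<comment> \<open>Everything outside the component of \<open>a\<close> in \<open>V - Z\<close> may
   be added to \<open>Z\<close>, so by maximality that component is all of
   \<open>V - Z\<close>.\<close>
 have C: "conn E (V - Z)"
 proof -
  let ?C0 = "comp E (V - Z) a"
  let ?Z = "V - ?C0"
  have cZ: "conn E ?Z" by (rule conn_minus_comp[OF cV ok(9,8)])
  have C0: "?C0 \<subseteq> V - Z" by (rule comp_subset)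
  have a0: "a \<in> ?C0" by (rule comp_self) (use abV ok in auto)
  have "?C0 \<subseteq> comp E (V - ?Z) a" by (rule comp_superset[OF conn_comp _ a0]) (use C0 in auto)
  hence "ok (a, b, ?Z)" unfolding ok_def using ok C0 a0 cZ by auto
  hence "?Z = Z" by (rule maxZ) (use C0 ok in auto)
  hence "V - Z = ?C0" using C0 by auto
  thus ?thesis by (metis conn_comp)
 qed
 \<comment> \<open>An attachment that does not separate \<open>a\<close> from \<open>b\<close> could
   be added to \<open>Z\<close>.\<close>
 have sep: "b \<notin> comp E (V - Z - {v}) a" if v: "v \<in> nb E V Z" "v \<noteq> a" "v \<noteq> b" for v
 proof
  assume b: "b \<in> comp E (V - Z - {v}) a"
  obtain z where z: "z \<in> Z" "{z, v} \<in> E" "v \<in> V - Z" using v(1) by (auto simp: nb_def)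
  have "conn E (insert v Z)" using conn_insert[OF ok(9) z(1,2)] .
  moreover have "V - insert v Z = V - Z - {v}" by auto
  ultimately have "ok (a, b, insert v Z)" unfolding ok_def prod.case using ok v z b by simp
  hence "insert v Z = Z" by (rule maxZ) auto
  thus False using z by auto
 qed
 have f2': "lk E (V - Z) s b e a" by (rule reroute[OF ok(8,9,10) C ok(11,12) ok(7) no])
 have f1': "lk E (V - Z) s a e b" by (rule reroute[OF ok(8,9,10) C ok(12,11) ok(6)]) (use no lk_swap1[of E V b a] in blast)+
 have hab: "a \<in> V - Z" "b \<in> V - Z" "a \<noteq> b" using ok abV by auto
 obtain w w' I L L' where B: "w \<noteq> w'" "w \<in> nb E V Z" "w' \<in> nb E V Z" "I \<subseteq> V - Z" "s \<in> I" "e \<in> I"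
  "w \<notin> I" "w' \<notin> I" "a \<notin> I" "b \<notin> I" "nb E V I \<subseteq> {w, w'}"
  "lk E (I \<union> {w, w'}) s w e w'" "lk E (I \<union> {w, w'}) s w' e w"
  "conn E L" "a \<in> L" "w \<in> L" "L \<subseteq> V - Z - I" "conn E L'" "b \<in> L'" "w' \<in> L'" "L' \<subseteq> V - Z - I" "L \<inter> L' = {}"
  using flip_block[OF ok(8,10) C hab sep f1' f2'] .
 have wV: "w \<in> V - Z" "w' \<in> V - Z" using B(2,3) by (auto simp: nb_def)
 \<comment> \<open>Otherwise the block would form a sided separation; the vertex \<open>c\<close>
   lies on its other side.\<close>
 have "I \<inter> R \<noteq> {}" using ok(8,10) B(4) wV ns[unfolded nosd_def, rule_format, of w w' I s e] B el ok(3) by auto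
 then obtain q where q: "q \<in> I" "q \<in> R" by blast
 define H where "H = I \<union> {w, w'}"
 have IV: "I \<subseteq> V" "w \<in> V - I" "w' \<in> V - I" using B(4,7,8) wV by auto
 obtain X1 Y1 where 1: "conn E X1" "conn E Y1" "s \<in> X1" "w \<in> X1" "e \<in> Y1" "w' \<in> Y1" "X1 \<subseteq> H" "Y1 \<subseteq> H" "X1 \<inter> Y1 = {}"
  "q \<in> X1 \<or> q \<in> Y1"
  using lk_absorb[OF cV IV(1) q(1) B(11) IV(2,3) B(12)] unfolding H_def .
 obtain X2 Y2 where 2: "conn E X2" "conn E Y2" "s \<in> X2" "w' \<in> X2" "e \<in> Y2" "w \<in> Y2" "X2 \<subseteq> H" "Y2 \<subseteq> H" "X2 \<inter> Y2 = {}"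
  "q \<in> X2 \<or> q \<in> Y2"
  using lk_absorb[OF cV IV(1) q(1) _ IV(3,2), of s e] B(11,13) unfolding H_def insert_commute[of w' w] by blast
 have HV: "H \<subseteq> V" using B(4) wV by (auto simp: H_def)
 have LV: "L \<subseteq> V" "L' \<subseteq> V" "L \<inter> Z = {}" "L' \<inter> Z = {}" "L \<inter> I = {}" "L' \<inter> I = {}" using B(17,21) by auto
 have wL: "w' \<notin> L" "w \<notin> L'" using B(16,20,22) by auto
 have cZ: "conn E (X \<union> Z)" if "conn E X" "w \<in> X \<or> w' \<in> X" for X
 proof -
  obtain z z' where "z \<in> Z" "{z, w} \<in> E" "z' \<in> Z" "{z', w'} \<in> E" using B(2,3) by (auto simp: nb_def)
  thus ?thesis
   using that conn_Un_edge[OF that(1) ok(9), of w z] conn_Un_edge[OF that(1) ok(9), of w' z'] by (auto simp: insert_commute)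
 qed
 have HL: "H \<inter> Z = {}" "L \<inter> H = {w}" "L' \<inter> H = {w'}" using B(4,16,20) wV wL LV by (auto simp: H_def)
 \<comment> \<open>One piece of a linkage of the block is prolonged along \<open>L\<close> or
   \<open>L'\<close> to \<open>a\<close> or \<open>b\<close>, the other one through its exit into
   \<open>Z\<close>, where \<open>c\<close> lies.\<close>
 have via: "lk E V p t u v"
  if h: "conn E A" "conn E B" "A \<subseteq> H" "B \<subseteq> H" "A \<inter> B = {}" "m \<in> A" "m' \<in> B" "p \<in> A" "u \<in> B" "v \<in> B \<or> v = c"
   and M: "conn E M" "M \<inter> H = {m}" "M \<subseteq> V" "M \<inter> Z = {}" "t \<in> M" "m' = w \<or> m' = w'" for A B M m m' p t u v
 proof (rule lkI)
  show "conn E (A \<union> M)" by (rule conn_Un[OF h(1) M(1) h(6)]) (use M(2) in blast)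
  show "conn E (B \<union> Z)" by (rule cZ[OF h(2)]) (use h(7) M(6) in blast)
  have "M \<inter> B \<subseteq> M \<inter> H" "m \<notin> B" "A \<inter> Z \<subseteq> H \<inter> Z" using h(3-6) by auto
  hence "M \<inter> B = {}" "A \<inter> Z = {}" unfolding M(2) HL(1) by auto
  thus "(A \<union> M) \<inter> (B \<union> Z) = {}" by (simp add: h(5) M(4) Int_Un_distrib Int_Un_distrib2)
  show "A \<union> M \<subseteq> V" "B \<union> Z \<subseteq> V" using h(3,4) HV M(3) ok(8) by blast+
 qed (use h M ok(10) in auto)
 note toL = via[OF _ _ _ _ _ _ _ _ _ disjI2[OF refl] B(14) HL(2) LV(1,3) B(15) disjI2[OF refl]]
  and toL' = via[OF _ _ _ _ _ _ _ _ _ disjI2[OF refl] B(18) HL(3) LV(2,4) B(19) disjI1[OF refl]]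
  and inL = via[OF _ _ _ _ _ _ _ _ _ disjI1 B(14) HL(2) LV(1,3) B(15) disjI2[OF refl]]
  and inL' = via[OF _ _ _ _ _ _ _ _ _ disjI1 B(18) HL(3) LV(2,4) B(19) disjI1[OF refl]]
 have inP: "qd p p' c u \<in> ?P" if "lk E V p p' u c" "p \<in> R" "p' \<in> R" "u \<in> S" for p p' u
  using PM_base[OF that(2,3) el(3) that(4) lk_swap2[OF that(1)]] .
 have d1: "Y1 \<inter> X1 = {}" and d2: "Y2 \<inter> X2 = {}" using 1 2 by auto
 have qV: "q \<in> V - Z" "q \<notin> L" "q \<notin> L'" using q B(4) LV by auto
 \<comment> \<open>By 2-connectedness the component of \<open>q\<close> in the block has an edge to
   \<open>u'\<close>, so \<open>q\<close> stays connected with \<open>u\<close> after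
   \<open>M\<close> has been added to \<open>Z\<close>.\<close>
 have qcomp: "q \<in> comp E (V - Z - M) u" if "M \<inter> (I \<union> {u'}) = {}" "conn E N" "u' \<in> N" "u \<in> N" "N \<subseteq> V - Z - M"
  "nb E V I \<subseteq> {u', u''}" "u' \<notin> I" "u'' \<notin> I" "u' \<in> V" "u' \<noteq> u''" for M N u u' u''
 proof -
  have "\<exists>y\<in>comp E I q. \<exists>x\<in>V - {u''} - I. {x, y} \<in> E" by (rule comp_edge_out[OF cV1[of u''], where w = u'])
    (use q B(4) that comp_subset[of E I q] in auto)
  then obtain y x where yx: "y \<in> comp E I q" "x \<in> V - {u''} - I" "{x, y} \<in> E" by blast
  have sub: "comp E I q \<subseteq> I" by (rule comp_subset)
  have "conn E (N \<union> comp E I q)"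
   using yx sub that(6) yx(2) conn_Un_edge[OF that(2) conn_comp _ yx(1), of u'] yx(3) that(3) by (auto simp: nb_def insert_commute)
  moreover have "N \<union> comp E I q \<subseteq> V - Z - M" using that(1,5) sub B(4) by auto
  moreover have "q \<in> comp E I q" by (rule comp_self[OF q(1)])
  ultimately show ?thesis using comp_superset[of E "N \<union> comp E I q" "V - Z - M" u] that(4) by auto
 qed
 \<comment> \<open>If \<open>q\<close> accompanies \<open>s\<close> in both linkages, or
   \<open>e\<close> in both, the elements for \<open>a\<close>, \<open>q\<close> and for
   \<open>q\<close>, \<open>b\<close> lie in the span and add up to an excluded one. Otherwise
   \<open>q\<close> replaces \<open>b\<close> or \<open>a\<close>, and \<open>L'\<close> or
   \<open>L\<close> can be added to \<open>Z\<close>.\<close>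
 consider (XX) "q \<in> X2" "q \<in> X1" | (YY) "q \<in> Y2" "q \<in> Y1" | (XY) "q \<in> X2" "q \<in> Y1" | (YX) "q \<in> Y2" "q \<in> X1"
  using 1(10) 2(10) by blast
 thus False
 proof cases
  case XX
  have "qd q b c e \<in> ?P" by (rule inP[OF toL'[OF 2(1,2,7,8,9,4,6) XX(1) 2(5)] q(2) ok(2) el(5)])
  moreover have "qd a q c e \<in> ?P" by (rule inP[OF lk_swap1[OF toL[OF 1(1,2,7,8,9,4,6) XX(2) 1(5)]] ok(1) q(2) el(5)])
  ultimately show False using PM_third1[of a q c e E V R S b] ok(5) by blast
 next
  case YY
  have "qd q b c s \<in> ?P" by (rule inP[OF toL'[OF 1(2,1,8,7) d1 1(6,4) YY(2) 1(3)] q(2) ok(2) el(4)])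
  moreover have "qd a q c s \<in> ?P" by (rule inP[OF lk_swap1[OF toL[OF 2(2,1,8,7) d2 2(6,4) YY(1) 2(3)]] ok(1) q(2) el(4)])
  ultimately show False using PM_third1[of a q c s E V R S b] ok(4) by blast
 next
  case XY
  have "qd q b c e \<in> ?P" by (rule inP[OF toL'[OF 2(1,2,7,8,9,4,6) XY(1) 2(5)] q(2) ok(2) el(5)])
  moreover have "qd q b c s \<in> ?P" by (rule inP[OF toL'[OF 1(2,1,8,7) d1 1(6,4) XY(2) 1(3)] q(2) ok(2) el(4)])
  ultimately have n: "qd a q c s \<notin> ?P" "qd a q c e \<notin> ?P"
   using PM_third1[of a q c e E V R S b] PM_third1[of a q c s E V R S b] ok(4,5) by blast+
  have g1: "lk E V s q e a" by (rule lk_flip[OF inL[OF 2(2,1,8,7) d2 2(6,4,5,3) XY(1)], THEN lk_swap2, THEN lk_swap2])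
  have g2: "lk E V s a e q" by (rule inL[OF 1(1,2,7,8,9,4,6,3,5) XY(2)])
  have "ok (a, q, Z \<union> L')" unfolding ok_def
  proof (simp, intro conjI)
   show "conn E (Z \<union> L')" using cZ[OF B(18)] B(20) by (simp add: Un_commute)
   have "q \<in> comp E (V - Z - L') a" by (rule qcomp[of L' w L a w']) (use B LV wL wV in auto)
   thus "q \<in> comp E (V - (Z \<union> L')) a" by (simp add: Diff_eq Int_assoc)
   show "a \<notin> L'" using B(15,22) by auto
  qed (use XY 1(3,9) 2(5,9) B(9) ok n g1 g2 q LV qV in auto)
  hence "Z \<union> L' = Z" by (rule maxZ) auto
  thus False using B(19) LV by auto
 next
  case YX
  have "qd a q c s \<in> ?P" by (rule inP[OF lk_swap1[OF toL[OF 2(2,1,8,7) d2 2(6,4) YX(1) 2(3)]] ok(1) q(2) el(4)])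
  moreover have "qd a q c e \<in> ?P" by (rule inP[OF lk_swap1[OF toL[OF 1(1,2,7,8,9,4,6) YX(2) 1(5)]] ok(1) q(2) el(5)])
  ultimately have n: "qd q b c s \<notin> ?P" "qd q b c e \<notin> ?P"
   using PM_third1[of a q c e E V R S b] PM_third1[of a q c s E V R S b] ok(4,5) by blast+
  have g1: "lk E V s q e b" by (rule lk_flip[OF inL'[OF 1(2,1,8,7) d1 1(6,4,5,3) YX(2)], THEN lk_swap2, THEN lk_swap2])
  have g2: "lk E V s b e q" by (rule inL'[OF 2(1,2,7,8,9,4,6,3,5) YX(1)])
  have "ok (q, b, Z \<union> L)" unfolding ok_def
  proof (simp, intro conjI)
   show "conn E (Z \<union> L)" using cZ[OF B(14)] B(16) by (simp add: Un_commute)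
   have "q \<in> comp E (V - Z - L) b" by (rule qcomp[of L w' L' b w]) (use B LV wL wV in auto)
   hence "b \<in> comp E (V - Z - L) q" by (rule comp_sym)
   thus "b \<in> comp E (V - (Z \<union> L)) q" by (simp add: Diff_eq Int_assoc)
   show "b \<notin> L" using B(19,22) by auto
  qed (use YX 1(5,9) 2(3,9) B(10) ok n g1 g2 q LV qV in auto)
  hence "Z \<union> L = Z" by (rule maxZ) auto
  thus False using B(15) LV by auto
 qed
qed

end

lemma lk_ac: "lk E V b a c d \<longleftrightarrow> lk E V a b c d" "lk E V a b d c \<longleftrightarrow> lk E V a b c d" "lk E V c d a b \<longleftrightarrow> lk E V a b c d"
 using lk_swap1 lk_swap2 lk_flip by metis+

section \<open>Adding a row\<close>

locale rs = twoc V E for V :: "'v set" and E +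
 fixes R S :: "'v set"
 assumes RV: "R \<subseteq> V" and SV: "S \<subseteq> V" and ns: "nosd E V R S"
begin

abbreviation l where "l a b c d \<equiv> lk E V a b c d"
abbreviation P where "P \<equiv> PM E V R S"

lemma notP: "a \<in> R ==> b \<in> R ==> c \<in> S ==> d \<in> S ==> qd a b c d \<notin> P ==> \<not> l a b c d"
 using PM_base[of a R b c S d E V] by blast

lemma fifth1: "l a b c d ==> e \<in> V ==> \<not> l b e c d ==> l a b c e \<and> l a b d e"
proof -
 assume h: "l a b c d" "e \<in> V" "\<not> l b e c d"
 show ?thesis using lk_fifth[OF cV h(1,2)] h(3) by simp
qed

lemma others:
 assumes "\<not> l a b c d" "a \<in> V" "b \<in> V" "c \<in> V" "d \<in> V" "distinct [a, b, c, d]"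
 shows "l a c b d" "l a d b c"
 using A0[of a d b c] A0[of a c b d] assms lk_swap2 lk_flip by (auto dest: lk_swap2)

text \<open>The vertex \<open>s\<close> serves as a column here. For the rows \<open>r\<close> and
  \<open>x\<close>, \<open>sigma\<close> first excludes \<open>l s r e x\<close>. If
  \<open>e\<close> is not \<open>c\<close>, the tripod lemma then moves the difficulty from the
  column \<open>e\<close> to \<open>c\<close>, where \<open>sigma\<close> applies a second
  time.\<close>

lemma base_pair_aux:
 assumes el: "r \<in> R" "x \<in> R" "c \<in> S" "d \<in> S" "e \<in> S" "s \<in> S" "s \<notin> R" "c \<noteq> r" "c \<noteq> s"
  and d: "d = c \<or> l s r c d" and e: "e = c \<or> l s r c e" and lx: "l s x d e"
  and n: "qd r x d e \<notin> P" and n1: "qd r x d s \<notin> P"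
 shows False
proof -
 have V: "r \<in> V" "x \<in> V" "c \<in> V" "d \<in> V" "e \<in> V" "s \<in> V" using el RV SV by auto
 have ne: "r \<noteq> x" "d \<noteq> e" "s \<noteq> d" "s \<noteq> e" "x \<noteq> d" "x \<noteq> e" "s \<noteq> r" "s \<noteq> x" "r \<noteq> d" "r \<noteq> e"
  using n lk_distinct[OF lx] el d e lk_distinct[of E V s r c d] lk_distinct[of E V s r c e] by auto
 have nl: "\<not> l r x d e" "\<not> l r x d s" using notP el n n1 by blast+
 have a2: "\<not> l s r e x"
  using lk_fifth[OF cV lx V(1)] nl(1) lk_swap1[of E V x r d e] sigma[OF ns RV SV el(1,2,4,6,5) _ n1 n] ne by auto
 show False
 proof (cases "e = c")
  case True
  hence "l s r c d" using d ne by auto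
  moreover have "\<not> l r x c d" using nl(1) True by (simp add: lk_ac)
  ultimately have "l s r c x" using fifth1 V by blast
  thus False using a2 True by blast
 next
  case False
  hence lce: "l s r c e" using e by blast
  have xc: "x \<noteq> c" using a2 lce by (auto simp: lk_ac)
  have "(l s r c x \<and> l s r e x) \<or> (l s x c r \<and> l s x e r)" by (rule lk_tripod[OF lce V(2)]) (use ne xc el in auto)
  hence b1: "l s x c r" using a2 by blast
  have n2: "qd r x d c \<notin> P" using fifth1[OF lce V(2)] a2 PM_base[OF el(1,2,3,5)] n PM_third2[of r x d c E V R S e] by blast
  hence dc: "d \<noteq> c" by auto
  hence "l s r c d" using d by blast
  hence "l s r c x" using n2 PM_base[of r R x c S d E V] PM_swap(2)[of r x c d E V R S] el fifth1 V by blast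
  thus False using sigma[OF ns RV SV el(1,2,4,6,3) _ n1 n2] b1 ne xc el dc by auto
 qed
qed

text \<open>In a linkage of \<open>s\<close>, \<open>x\<close> with two columns of the type of
  \<open>r\<close>, the row \<open>s\<close> may be exchanged for \<open>r\<close>; this is the case
  of equal types in \<open>extend_row\<close>. The element splits at the column \<open>s\<close>,
  and the two halves are symmetric.\<close>

lemma base_pair:
 assumes el: "r \<in> R" "x \<in> R" "c \<in> S" "d \<in> S" "e \<in> S" "s \<in> S" "s \<notin> R" "c \<noteq> r" "c \<noteq> s"
  and d: "d = c \<or> l s r c d" and e: "e = c \<or> l s r c e" and lx: "l s x d e"
 shows "qd r x d e \<in> P"
proof (rule ccontr)
 assume n: "qd r x d e \<notin> P"
 have n': "qd r x e d \<notin> P" using n PM_swap(2)[of r x e d] by blast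
 consider "qd r x d s \<notin> P" | "qd r x e s \<notin> P"
  using n PM_third2[of r x d s E V R S e] PM_swap(2)[of r x e s] by blast
 thus False
 proof cases
  case 1
  show False by (rule base_pair_aux[OF el d e lx n 1])
 next
  case 2
  show False by (rule base_pair_aux[OF el(1-3,5,4,6-9) e d lk_swap2[OF lx] n' 2])
 qed
qed

context
 fixes r r' c s
 assumes el: "r \<in> R" "r' \<in> R" "c \<in> S" "s \<in> S" "s \<notin> R" and di: "distinct [r, r', c, s]"
  and nP: "qd r r' c s \<notin> P"
begin

lemma inV: "r \<in> V" "r' \<in> V" "c \<in> V" "s \<in> V"
 using el RV SV by auto

lemma nsep: "\<not> l r r' c s" "\<not> l s c r r'" "\<not> l s c r' r" "\<not> l r r' s c" "\<not> l r' r c s"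
proof -
 show a: "\<not> l r r' c s" using notP[OF el(1-4) nP] .
 show "\<not> l s c r r'" "\<not> l s c r' r" "\<not> l r r' s c" "\<not> l r' r c s" using a lk_swap1 lk_swap2 lk_flip by metis+
qed

text \<open>Guiding picture: \<open>s\<close>, \<open>r\<close>, \<open>c\<close>, \<open>r'\<close>
  lie in this order on a circle. The linkage with \<open>r\<close> can fail only for
  \<open>d\<close> between \<open>s\<close> and \<open>r\<close>, the one with \<open>r'\<close>
  only for \<open>d\<close> between \<open>r'\<close> and \<open>s\<close>.\<close>

lemma typed:
 assumes d: "d \<in> S" "d \<noteq> s" "d \<noteq> c"
 shows "l s r c d \<or> l s r' c d"
proof (rule ccontr)
 assume n: "\<not> ?thesis"
 have dV: "d \<in> V" using d SV by auto
 show False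
 proof (cases "d = r \<or> d = r'")
  case True
  have "l r c r' s" "l r s r' c" using others[OF nsep(1) inV(1,2,3,4)] di by auto
  thus False using True n lk_swap1 lk_swap2 lk_flip by metis
 next
  case False
  have "l s c r d" using others(1)[of s r c d] n d di inV dV False by auto
  hence "(l s c r r' \<and> l s c d r') \<or> (l s r' r c \<and> l s r' d c)" by (rule lk_tripod) (use inV di d False in auto)
  thus False using nsep n lk_swap2 by metis
 qed
qed

text \<open>If the element were outside the span, the fifth vertex would give linkages of
  \<open>s\<close> and \<open>d\<close> to \<open>r\<close> and \<open>r'\<close> in both ways,
  against \<open>sigma\<close>.\<close>

lemma both_types:
 assumes d: "d \<in> S" and t: "l s r c d" "l s r' c d"
 shows "qd r r' c d \<in> P"
proof (rule ccontr)
 assume n: "qd r r' c d \<notin> P"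
 have nl: "\<not> l r r' c d" "\<not> l r' r c d" using notP[OF el(1-3) d n] by (auto simp: lk_ac)
 have ne: "d \<noteq> r" "d \<noteq> r'" "d \<noteq> c" "d \<noteq> s" using lk_distinct[OF t(1)] lk_distinct[OF t(2)] n by auto
 have "l s r d r'" using fifth1[OF t(1) inV(2) nl(1)] by blast
 moreover have "l s r' d r" using fifth1[OF t(2) inV(1) nl(2)] by blast
 ultimately show False using sigma[OF ns RV SV el(1,2,3,4) d _ nP n] di ne by auto
qed

text \<open>In the circular picture \<open>e\<close> lies between \<open>r'\<close> and
  \<open>s\<close>. The element for the columns \<open>c\<close> and \<open>e\<close> must be
  outside the span too: otherwise the one for \<open>s\<close> and \<open>e\<close> would be, and
  \<open>sigma\<close> with \<open>s\<close> in the role of \<open>c\<close> gives a contradiction.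
  Then \<open>sigma\<close> for \<open>s\<close> and \<open>e\<close> excludes the second
  linkage.\<close>

lemma strict_side:
 assumes e: "e \<in> S" "e \<noteq> c" "e \<noteq> s" "e \<noteq> r'" and t: "l s r c e" "\<not> l s r' c e"
 shows "l s r e r'" "\<not> l s r' e r"
proof -
 have eV: "e \<in> V" using e SV by auto
 have er: "e \<noteq> r" using lk_distinct[OF t(1)] by auto
 have nl: "\<not> l r r' c e"
 proof
  assume "l r r' c e"
  from lk_fifth[OF cV this inV(4)] show False using t(2) nsep(1) by (auto simp: lk_ac)
 qed
 have nPe: "qd r r' c e \<notin> P"
 proof
  assume i: "qd r r' c e \<in> P"
  have n1: "qd r r' s c \<notin> P" using nP PM_swap(2)[of r r' s c] by blast
  have n2: "qd r r' s e \<notin> P" using n1 i PM_third2[of r r' s e E V R S c] PM_swap(2)[of r r' c e] by blast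
  have "l r c r' e" "l r e r' c" using others[OF nl inV(1,2,3) eV] di e er by auto
  hence "l c r e r'" "l c r' e r" using lk_swap1 lk_swap2 lk_flip by metis+
  moreover have "distinct [r, r', s, c, e]" using di e er by auto
  ultimately show False using sigma[OF ns RV SV el(1,2,4,3) e(1) _ n1 n2] by blast
 qed
 have "\<not> l r r' c e" by (rule nl)
 thus "l s r e r'" using fifth1[OF t(1) inV(2)] by blast
 thus "\<not> l s r' e r" using sigma[OF ns RV SV el(1,2,3,4) e(1) _ nP nPe] di e er by auto
qed

end

text \<open>In the circular picture \<open>d\<close> lies between \<open>s\<close> and
  \<open>r\<close> or is \<open>r\<close>, and \<open>e\<close> lies between \<open>r'\<close> and
  \<open>s\<close> or is \<open>r'\<close>, so \<open>s\<close> and \<open>c\<close> separate them.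
  The cases \<open>d = r\<close> and \<open>e = r'\<close>, outside the scope of
  \<open>strict_side\<close>, are treated on their own.\<close>

lemma opposite_sides:
 assumes el: "r \<in> R" "r' \<in> R" "c \<in> S" "s \<in> S" "s \<notin> R" and di: "distinct [r, r', c, s]"
  and nP: "qd r r' c s \<notin> P"
  and d: "d \<in> S" "d \<noteq> c" "d \<noteq> s" and td: "l s r' c d" "\<not> l s r c d"
  and e: "e \<in> S" "e \<noteq> c" "e \<noteq> s" and te: "l s r c e" "\<not> l s r' c e"
 shows "\<not> l s c d e"
proof
 assume a: "l s c d e"
 note sp = nsep[OF el di nP]
 note iV = inV[OF el di nP]
 have nP': "qd r' r c s \<notin> P" using nP PM_swap(1)[of r' r] by blast
 have di': "distinct [r', r, c, s]" using di by auto
 have V: "d \<in> V" "e \<in> V" using d e SV by auto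
 have ne: "d \<noteq> r'" "e \<noteq> r" "d \<noteq> e" using lk_distinct[OF td(1)] lk_distinct[OF te(1)] td te by auto
 have E: "e = r' \<or> (l s r e r' \<and> \<not> l s r' e r)" using strict_side[OF el di nP e _ te] by blast
 have fin: "False" if "l s c e r" "e \<noteq> r'"
 proof -
  have "l s r' e r \<or> l s c r' r" using lk_fifth[OF cV that(1) iV(2)] by (auto simp: lk_ac)
  moreover have "\<not> l s r' e r" using E that(2) by blast
  ultimately show False using sp by (simp add: lk_ac)
 qed
 show False
 proof (cases "d = r")
  case True
  show False
  proof (cases "e = r'")
   case True
   thus False using a \<open>d = r\<close> sp by blast
  next
   case False
   thus False using fin a True by (simp add: lk_ac)
  qed
 next
  case False
  note dr = this
  have D': "l s r' d r" "\<not> l s r d r'" using strict_side[OF el(2,1,3,4,5) di' nP' d _ td] dr by auto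
  have no_rde: "\<not> l s r d e" if er: "e \<noteq> r'"
  proof
   assume "l s r d e"
   hence "(l s r d r' \<and> l s r e r') \<or> (l s r' d r \<and> l s r' e r)" by (rule lk_tripod) (use iV di ne er in auto)
   thus False using D' E er by blast
  qed
  have f: "(l s r d e \<and> l c r d e) \<or> (l s c d r \<and> l s c e r)" by (rule lk_fifth[OF cV a iV(1)])
  show False
  proof (cases "e = r'")
   case True
   thus False using f D'(2) sp by (simp add: lk_ac)
  next
   case False
   thus False using f no_rde fin by blast
  qed
 qed
qed

text \<open>Modulo the linkages the row of \<open>s\<close> can be expressed through the rows of \<open>r\<close> and \<open>r'\<close>; the
 substitution \<open>\<Theta>\<close> carries this out.\<close>

lemma extend_row:
 assumes el: "r \<in> R" "r' \<in> R" "c \<in> S" "s \<in> S" "s \<notin> R" and di: "distinct [r, r', c, s]"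
  and nP: "qd r r' c s \<notin> P"
  and z: "z \<in> PM E V (insert s R) S" and z0: "\<And>d. Poly_Mapping.lookup z (s, d) = 0"
 shows "z \<in> P"
proof -
 \<comment> \<open>Subtracting \<open>H d\<close> from the entry of row \<open>s\<close> in column
   \<open>d\<close> moves it to row \<open>r\<close> or \<open>r'\<close>, according to the type of
   \<open>d\<close>, up to terms in the column \<open>c\<close>.\<close>
 define H where "H d = (if d = c \<or> l s r c d then qd s r d c else qd s r' d c)" for d
 have Hr: "H d = qd s r d c" if "d = c \<or> l s r c d" for d using that by (simp add: H_def)
 have Hl: "H d - qd s r' d c \<in> P" if "d = c \<or> l s r' c d" "d \<in> S" for d
 proof (cases "d = c \<or> l s r c d")
  case True
  have "H d - qd s r' d c = qd r' r d c" using Hr[OF True] qd_add(1)[of r' r d c s] qd_swap(1)[of r' s d c] by simp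
  moreover have "qd r' r d c \<in> P"
  proof (cases "d = c")
   case False
   thus ?thesis using both_types[OF el di nP that(2)] that(1) True PM_swap(1)[of r' r d c] PM_swap(2)[of r r' d c] by blast
  qed simp
  ultimately show ?thesis by simp
 next
  case False
  thus ?thesis by (simp add: H_def)
 qed
 have RR: "qd s x d e - (H d - H e) \<in> P"
  if h: "x \<in> R" "d \<in> S" "e \<in> S" "d = c \<or> l s r c d" "e = c \<or> l s r c e" "l s x d e" for x d e
 proof -
  have "qd s x d e - (H d - H e) = qd r x d e" unfolding Hr[OF h(4)] Hr[OF h(5)] by (simp add: qd_def algebra_simps)
  also have "\<dots> \<in> P" by (rule base_pair[OF el(1) h(1) el(3) h(2,3) el(4,5) _ _ h(4-6)]) (use di in auto)
  finally show ?thesis .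
 qed
 have LL: "qd s x d e - (H d - H e) \<in> P"
  if h: "x \<in> R" "d \<in> S" "e \<in> S" "d = c \<or> l s r' c d" "e = c \<or> l s r' c e" "l s x d e" for x d e
 proof -
  have "qd s x d e - (H d - H e) = qd r' x d e - ((H d - qd s r' d c) - (H e - qd s r' e c))"
   by (simp add: qd_def algebra_simps)
  moreover have "qd r' x d e \<in> P" by (rule base_pair[OF el(2) h(1) el(3) h(2,3) el(4,5) _ _ h(4-6)]) (use di in auto)
  ultimately show ?thesis using PM_diff Hl h by metis
 qed
 \<comment> \<open>For columns of opposite types \<open>c\<close> serves as intermediate column: by
   \<open>opposite_sides\<close> the fifth vertex has to fall on the side of the columns, which
   provides both linkages with \<open>c\<close>.\<close>
 have LR: "qd s x d e - (H d - H e) \<in> P"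
  if h: "x \<in> R" "d \<in> S" "e \<in> S" "d \<noteq> c" "l s r' c d" "\<not> l s r c d" "e \<noteq> c" "l s r c e" "\<not> l s r' c e" "l s x d e" for x d e
 proof -
  have ne: "d \<noteq> s" "e \<noteq> s" using lk_distinct[OF h(10)] by auto
  have "\<not> l s c d e" by (rule opposite_sides[OF el di nP h(2,4) ne(1) h(5,6) h(3,7) ne(2) h(8,9)])
  hence "l s x d c" "l s x e c" using lk_fifth[OF cV h(10), of c] el SV by blast+
  hence "qd s x d c - (H d - H c) \<in> P" "qd s x c e - (H c - H e) \<in> P"
   using LL[OF h(1,2) el(3)] RR[OF h(1) el(3) h(3)] h(5,8) by (simp_all add: lk_ac)
  hence "(qd s x d c - (H d - H c)) + (qd s x c e - (H c - H e)) \<in> P" by (rule PM_add)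
  moreover have "(qd s x d c - (H d - H c)) + (qd s x c e - (H c - H e)) = qd s x d e - (H d - H e)"
   using qd_add(2)[of s x d e c] by simp
  ultimately show ?thesis by simp
 qed
 have all: "qd s x d e - (H d - H e) \<in> P" if h: "x \<in> R" "d \<in> S" "e \<in> S" "l s x d e" for x d e
 proof -
  have td: "d = c \<or> l s r c d \<or> l s r' c d" "e = c \<or> l s r c e \<or> l s r' c e"
   using lk_distinct[OF h(4)] typed[OF el di nP] h by blast+
  have sw: "qd s x d e - (H d - H e) \<in> P \<longleftrightarrow> qd s x e d - (H e - H d) \<in> P"
   using PM_minus[of "qd s x d e - (H d - H e)"] qd_swap(2)[of s x e d] by (simp add: algebra_simps)
  show ?thesis using RR[OF h(1-3) _ _ h(4)] LL[OF h(1-3) _ _ h(4)] LR[OF h(1-3) _ _ _ _ _ _ h(4)]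
    LR[OF h(1,3,2) _ _ _ _ _ _ lk_swap2[OF h(4)]] td sw by blast
 qed
 define \<Theta> where "\<Theta> = frag_extend (\<lambda>(p, q). if p = s then H q else 0)"
 have T: "\<Theta> (qd a b d e) = (if a = s then H d - H e else 0) - (if b = s then H d - H e else 0)" for a b d e
  unfolding \<Theta>_def qd_def by (simp add: frag_extend_add frag_extend_diff)
 \<comment> \<open>Subtracting the substitution takes the larger span into \<open>P\<close>, and it
   does not change an element without entries in row \<open>s\<close>.\<close>
 have "PM E V (insert s R) S \<subseteq> {z. z - \<Theta> z \<in> P}" unfolding PM_def[of E V "insert s R" S]
 proof (rule frag.span_minimal)
  show "frag.subspace {z. z - \<Theta> z \<in> P}"
  proof (rule frag.subspaceI)
   show "x + y \<in> {z. z - \<Theta> z \<in> P}" if "x \<in> {z. z - \<Theta> z \<in> P}" "y \<in> {z. z - \<Theta> z \<in> P}" for x y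
    using PM_add[of "x - \<Theta> x" _ _ _ _ "y - \<Theta> y"] that by (simp add: \<Theta>_def frag_extend_add algebra_simps)
   show "frag_cmul k x \<in> {z. z - \<Theta> z \<in> P}" if "x \<in> {z. z - \<Theta> z \<in> P}" for k x
    using frag.subspace_scale[OF PM_subspace, of "x - \<Theta> x"] that by (simp add: \<Theta>_def frag_extend_cmul frag_cmul_diff_distrib frag.scale_right_diff_distrib)
  qed (simp add: \<Theta>_def)
  show "{qd a b c d |a b c d. a \<in> insert s R \<and> b \<in> insert s R \<and> c \<in> S \<and> d \<in> S \<and> l a b c d} \<subseteq> {z. z - \<Theta> z \<in> P}"
  proof clarify
   fix a b d e
   assume h: "a \<in> insert s R" "b \<in> insert s R" "d \<in> S" "e \<in> S" "l a b d e"
   consider "a = s" "b = s" | "a = s" "b \<in> R" "b \<noteq> s" | "a \<in> R" "a \<noteq> s" "b = s" | "a \<in> R" "b \<in> R" "a \<noteq> s" "b \<noteq> s"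
    using h by blast
   thus "qd a b d e - \<Theta> (qd a b d e) \<in> P"
   proof cases
    case 3
    have "- (qd s a d e - (H d - H e)) \<in> P"
     unfolding PM_minus by (rule all[OF 3(1) h(3,4)]) (use h(5) 3 in \<open>simp add: lk_ac\<close>)
    thus ?thesis unfolding T using 3 qd_swap(1)[of s a d e] by (simp add: algebra_simps)
   qed (unfold T, use h all[of b d e] PM_base[of a R b d S e E V] in simp_all)
  qed
 qed
 hence "z - \<Theta> z \<in> P" using z by blast
 moreover have "\<Theta> z = 0" unfolding \<Theta>_def
 proof (rule frag_extend_eq_0)
  fix x assume "x \<in> Poly_Mapping.keys z"
  thus "(case x of (p, q) \<Rightarrow> if p = s then H q else 0) = 0" using z0 by (cases x) (auto simp: in_keys_iff)
 qed
 ultimately show ?thesis by simp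
qed

end

section \<open>Generating the module of balanced elements\<close>

abbreviation lo where "lo \<equiv> Poly_Mapping.lookup"

lemma L_iff: "z \<in> L_module R S \<longleftrightarrow> (\<forall>r s. lo z (r, s) \<noteq> 0 \<longrightarrow> r \<in> R \<and> s \<in> S) \<and> (\<forall>r. lo z (r, r) = 0) \<and>
  (\<forall>s\<in>S. (\<Sum>r\<in>R. lo z (r, s)) = 0) \<and> (\<forall>r\<in>R. (\<Sum>s\<in>S. lo z (r, s)) = 0)" unfolding L_module_def by (auto simp: in_keys_iff)

lemma L_subspace: "frag.subspace (L_module R S)"
proof (rule frag.subspaceI)
 show "0 \<in> L_module R S" by (simp add: L_iff)
 fix x y assume x: "x \<in> L_module R S" and y: "y \<in> L_module R S"
 have "r \<in> R \<and> s \<in> S" if "lo (x + y) (r, s) \<noteq> 0" for r s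
 proof -
  have "lo x (r, s) \<noteq> 0 \<or> lo y (r, s) \<noteq> 0" using that by (auto simp: lookup_add)
  thus ?thesis using x y unfolding L_iff by blast
 qed
 thus "x + y \<in> L_module R S" using x y unfolding L_iff by (simp add: lookup_add sum.distrib)
next
 fix c x assume x: "x \<in> L_module R S"
 have "r \<in> R \<and> s \<in> S" if "lo (frag_cmul c x) (r, s) \<noteq> 0" for r s using that x unfolding L_iff by auto
 moreover have "lo (frag_cmul c x) (r, r) = 0" for r using x unfolding L_iff by simp
 moreover have "s \<in> S ==> (\<Sum>r\<in>R. lo (frag_cmul c x) (r, s)) = 0" "s \<in> R ==> (\<Sum>r\<in>S. lo (frag_cmul c x) (s, r)) = 0" for s
  using x unfolding L_iff by (simp_all add: sum_distrib_left[symmetric])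
 ultimately show "frag_cmul c x \<in> L_module R S" unfolding L_iff by blast
qed

lemma lo_qd: "lo (qd a b c d) (x, y) = (if x = a then 1 else 0) * (if y = c then 1 else 0) - (if x = a then 1 else 0) * (if y = d then 1 else 0)
  - (if x = b then 1 else 0) * (if y = c then 1 else 0) + (if x = b then 1 else 0) * (if y = d then 1 else 0)"
 unfolding qd_def by (simp add: lookup_add lookup_minus)

lemma qd_L:
 assumes "finite R" "finite S" "a \<in> R" "b \<in> R" "c \<in> S" "d \<in> S" "{a, b} \<inter> {c, d} = {}"
 shows "qd a b c d \<in> L_module R S"
proof -
 have d: "a \<noteq> c" "a \<noteq> d" "b \<noteq> c" "b \<noteq> d" using assms(7) by auto
 have "(\<Sum>r\<in>R. lo (qd a b c d) (r, s)) = 0" for s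
  unfolding lo_qd using assms(1,3,4) by (simp add: sum.distrib sum_subtractf sum_distrib_right[symmetric])
 moreover have "(\<Sum>s\<in>S. lo (qd a b c d) (r, s)) = 0" for r
  unfolding lo_qd using assms(2,5,6) by (simp add: sum.distrib sum_subtractf sum_distrib_left[symmetric])
 ultimately show ?thesis unfolding L_iff using assms(3-6) d by (auto simp: lo_qd split: if_splits)
qed

definition sw :: "('v \<times> 'v \<Rightarrow>\<^sub>0 int) \<Rightarrow> ('v \<times> 'v \<Rightarrow>\<^sub>0 int)" where
 "sw z = frag_extend (\<lambda>(a, b). frag_of (b, a)) z"

lemma lo_sw [simp]: "lo (sw z) (a, b) = lo z (b, a)"
proof -
 have "lo (sw z) (a, b) = (\<Sum>i\<in>Poly_Mapping.keys z. if i = (b, a) then lo z i else 0)"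
  unfolding sw_def frag_extend_def lookup_sum by (intro sum.cong) (auto split: if_splits prod.splits)
 also have "\<dots> = lo z (b, a)" by (simp add: in_keys_iff)
 finally show ?thesis .
qed

lemma sw_sw [simp]: "sw (sw z) = z"
 by (rule poly_mapping_eqI) auto

lemma sw_L [simp]: "sw z \<in> L_module S R \<longleftrightarrow> z \<in> L_module R S"
 unfolding L_iff by auto

lemma sw_qd: "sw (qd a b c d) = qd c d a b"
 by (rule poly_mapping_eqI) (auto simp: lo_qd)

lemma sw_linear: "sw (x + y) = sw x + sw y" "sw (frag_cmul k x) = frag_cmul k (sw x)" "sw 0 = 0"
 by (simp_all add: sw_def frag_extend_add frag_extend_cmul)

lemma sw_subspace: "frag.subspace K ==> frag.subspace {z. sw z \<in> K}"
 by (rule frag.subspaceI) (auto simp: sw_linear frag.subspace_add frag.subspace_scale frag.subspace_0)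

lemma sw_PM: "z \<in> PM E V R S ==> sw z \<in> PM E V S R"
proof -
 have "PM E V R S \<subseteq> {z. sw z \<in> PM E V S R}" unfolding PM_def[of E V R S]
 proof (rule frag.span_minimal[OF _ sw_subspace[OF PM_subspace]])
  show "{qd a b c d |a b c d. a \<in> R \<and> b \<in> R \<and> c \<in> S \<and> d \<in> S \<and> lk E V a b c d} \<subseteq> {z. sw z \<in> PM E V S R}"
   by (auto simp: sw_qd intro!: PM_base lk_flip)
 qed
 thus "z \<in> PM E V R S ==> sw z \<in> PM E V S R" by blast
qed

text \<open>The row \<open>t\<close> of an element can be cleared by elements of \<open>K\<close>:
  its entries sum to zero over the columns other than \<open>t\<close>, and these columns are
  connected by moves in \<open>K\<close>, which carry all entries to one fixed column
  \<open>y0\<close>.\<close>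

lemma gen_row:
 assumes K: "frag.subspace K" and fin: "finite R" "finite S" and t: "t \<notin> R" and LK: "L_module R S \<subseteq> K"
  and con: "\<And>y z. y \<in> S - {t} ==> z \<in> S - {t} ==>
   (y, z) \<in> {(y, z). y \<in> S - {t} \<and> z \<in> S - {t} \<and> (\<exists>x\<in>R. x \<noteq> y \<and> x \<noteq> z \<and> qd t x y z \<in> K)}\<^sup>*"
 shows "L_module (insert t R) S \<subseteq> K"
proof
 fix z assume z: "z \<in> L_module (insert t R) S"
 let ?R = "insert t R"
 have z': "\<And>r s. lo z (r, s) \<noteq> 0 ==> r \<in> ?R \<and> s \<in> S" "\<And>r. lo z (r, r) = 0"
  "\<And>s. s \<in> S ==> (\<Sum>r\<in>?R. lo z (r, s)) = 0" "\<And>r. r \<in> ?R ==> (\<Sum>s\<in>S. lo z (r, s)) = 0"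
  using z unfolding L_iff by blast+
 have restrict: "w \<in> K" if w: "w \<in> L_module ?R S" "\<And>d. lo w (t, d) = 0" for w
 proof -
  have "w \<in> L_module R S" using w fin t unfolding L_iff by (auto split: if_splits)
  thus ?thesis using LK by blast
 qed
 show "z \<in> K"
 proof (cases "S - {t} = {}")
  case True
  hence "lo z (t, d) = 0" for d using z'(1)[of t d] z'(2)[of t] by (cases "d = t") auto
  thus ?thesis using restrict[OF z] by blast
 next
  case False
  then obtain y0 where y0: "y0 \<in> S - {t}" by blast
  \<comment> \<open>Along a chain of columns the moves telescope in row \<open>t\<close>.\<close>
  have "\<exists>k. k \<in> K \<and> k \<in> L_module ?R S \<and> (\<forall>d. lo k (t, d) = (if d = y then 1 else 0) - (if d = y0 then 1 else 0))"
   if y: "y \<in> S - {t}" for y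
   using con[OF y0 y]
  proof (induction rule: rtrancl_induct)
   case base
   show ?case by (rule exI[of _ 0]) (auto simp: frag.subspace_0[OF K] frag.subspace_0[OF L_subspace])
  next
   case (step y y')
   then obtain k where k: "k \<in> K" "k \<in> L_module ?R S" "\<forall>d. lo k (t, d) = (if d = y then 1 else 0) - (if d = y0 then 1 else 0)" by blast
   obtain x where x: "x \<in> R" "x \<noteq> y" "x \<noteq> y'" "qd t x y y' \<in> K" and yy: "y \<in> S - {t}" "y' \<in> S - {t}" using step(2) by blast
   have "x \<noteq> t" using x(1) t by auto
   have "k - qd t x y y' \<in> K" using frag.subspace_diff[OF K k(1) x(4)] .
   moreover have "qd t x y y' \<in> L_module ?R S" by (rule qd_L) (use fin x yy in auto)
   hence "k - qd t x y y' \<in> L_module ?R S" using frag.subspace_diff[OF L_subspace k(2)] by blast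
   moreover have "lo (k - qd t x y y') (t, d) = (if d = y' then 1 else 0) - (if d = y0 then 1 else 0)" for d
    using k(3)[rule_format, of d] \<open>x \<noteq> t\<close> by (simp add: lookup_minus lo_qd)
   ultimately show ?case by blast
  qed
  then obtain \<kappa> where \<kappa>: "\<And>y. y \<in> S - {t} ==> \<kappa> y \<in> K \<and> \<kappa> y \<in> L_module ?R S"
   "\<And>y d. y \<in> S - {t} ==> lo (\<kappa> y) (t, d) = (if d = y then 1 else 0) - (if d = y0 then 1 else 0)"
   by metis
  define u where "u = (\<Sum>y\<in>S - {t}. frag_cmul (lo z (t, y)) (\<kappa> y))"
  have uK: "u \<in> K" unfolding u_def by (intro frag.subspace_sum[OF K] frag.subspace_scale[OF K]) (use \<kappa> in blast)
  have uL: "u \<in> L_module ?R S"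
   unfolding u_def by (intro frag.subspace_sum[OF L_subspace] frag.subspace_scale[OF L_subspace]) (use \<kappa> in blast)
  have "z - u \<in> K"
  proof (rule restrict)
   show "z - u \<in> L_module ?R S" using frag.subspace_diff[OF L_subspace z uL] .
   fix d
   have "lo u (t, d) = (\<Sum>y\<in>S - {t}. lo z (t, y) * ((if d = y then 1 else 0) - (if d = y0 then 1 else 0)))"
    unfolding u_def lookup_sum by (intro sum.cong) (auto simp: \<kappa>)
   also have "\<dots> = (\<Sum>y\<in>S - {t}. if d = y then lo z (t, y) else 0) - (\<Sum>y\<in>S - {t}. lo z (t, y)) * (if d = y0 then 1 else 0)"
    unfolding right_diff_distrib sum_subtractf sum_distrib_right by (intro arg_cong2[of _ _ _ _ "(-)"] sum.cong) auto
   also have "(\<Sum>y\<in>S - {t}. lo z (t, y)) = 0" using z'(4)[of t] z'(2)[of t] fin by (simp add: sum_diff1)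
   also have "(\<Sum>y\<in>S - {t}. if d = y then lo z (t, y) else 0) = lo z (t, d)"
    using fin z'(1)[of t d] z'(2)[of t] by (auto simp: sum.delta')
   finally show "lo (z - u) (t, d) = 0" by (simp add: lookup_minus)
  qed
  hence "z - u + u \<in> K" by (rule frag.subspace_add[OF K _ uK])
  thus ?thesis by simp
 qed
qed

lemma gen_col:
 assumes K: "frag.subspace K" and fin: "finite R" "finite S" and t: "t \<notin> S" and LK: "L_module R S \<subseteq> K"
  and con: "\<And>y z. y \<in> R - {t} ==> z \<in> R - {t} ==>
   (y, z) \<in> {(y, z). y \<in> R - {t} \<and> z \<in> R - {t} \<and> (\<exists>x\<in>S. x \<noteq> y \<and> x \<noteq> z \<and> qd y z t x \<in> K)}\<^sup>*"
 shows "L_module R (insert t S) \<subseteq> K"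
proof -
 have "L_module (insert t S) R \<subseteq> {z. sw z \<in> K}"
 proof (rule gen_row[OF sw_subspace[OF K] fin(2,1) t])
  show "L_module S R \<subseteq> {z. sw z \<in> K}" using LK sw_L by blast
  show "(y, z) \<in> {(y, z). y \<in> R - {t} \<and> z \<in> R - {t} \<and> (\<exists>x\<in>S. x \<noteq> y \<and> x \<noteq> z \<and> qd t x y z \<in> {z. sw z \<in> K})}\<^sup>*"
   if "y \<in> R - {t}" "z \<in> R - {t}" for y z
   using con[OF that] by (simp add: sw_qd)
 qed
 thus ?thesis using sw_L[of _ "insert t S" R] by (metis (no_types, lifting) CollectD subsetD subsetI sw_sw)
qed

lemma base_L:
 assumes K: "frag.subspace K" and d: "distinct [r, r', c, d]" and q: "qd r r' c d \<in> K"
 shows "L_module {r, r'} {c, d} \<subseteq> K"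
proof
 fix z assume z: "z \<in> L_module {r, r'} {c, d}"
 have z': "\<And>x y. lo z (x, y) \<noteq> 0 ==> x \<in> {r, r'} \<and> y \<in> {c, d}"
  "lo z (r, c) + lo z (r', c) = 0" "lo z (r, d) + lo z (r', d) = 0" "lo z (r, c) + lo z (r, d) = 0"
  using z d unfolding L_iff by auto
 have "z = frag_cmul (lo z (r, c)) (qd r r' c d)"
 proof (rule poly_mapping_eqI)
  fix k :: "'a \<times> 'a"
  obtain x y where k: "k = (x, y)" by (metis surj_pair)
  show "lo z k = lo (frag_cmul (lo z (r, c)) (qd r r' c d)) k" using z'(1) k z'(2-4) d by (auto simp: lo_qd)
 qed
 thus "z \<in> K" using frag.subspace_scale[OF K q] by metis
qed

text \<open>The module is built up from a 2 by 2 block: first rows are added against the two columns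
  \<open>c\<close>, \<open>d\<close>, then columns one at a time. A new row \<open>t\<close> in
  \<open>{c, d}\<close> has only one column besides \<open>t\<close> itself, so its columns are
  trivially connected and \<open>row\<close> need not cover it.\<close>

lemma gen_all:
 assumes K: "frag.subspace K" and fin: "finite R" "finite S"
  and el: "r \<in> R" "r' \<in> R" "c \<in> S" "d \<in> S" and di: "distinct [r, r', c, d]" and q: "qd r r' c d \<in> K"
  and row: "\<And>t. t \<in> R ==> t \<notin> {r, r', c, d} ==> \<exists>x\<in>{r, r'}. qd t x c d \<in> K"
  and col: "\<And>t S' y z. t \<in> S - S' ==> {c, d} \<subseteq> S' ==> S' \<subseteq> S ==> y \<in> R - {t} ==> z \<in> R - {t} ==>
   (y, z) \<in> {(y, z). y \<in> R - {t} \<and> z \<in> R - {t} \<and> (\<exists>x\<in>S'. x \<noteq> y \<and> x \<noteq> z \<and> qd y z t x \<in> K)}\<^sup>*"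
 shows "L_module R S \<subseteq> K"
proof -
 have rows: "L_module ({r, r'} \<union> X) {c, d} \<subseteq> K" if "finite X" "X \<subseteq> R" for X using that
 proof (induction X rule: finite_induct)
  case empty
  thus ?case using base_L[OF K di q] by simp
 next
  case (insert t X)
  show ?case
  proof (cases "t \<in> {r, r'} \<union> X")
   case True
   thus ?thesis using insert by (simp add: insert_absorb)
  next
   case False
   have "L_module (insert t ({r, r'} \<union> X)) {c, d} \<subseteq> K"
   proof (rule gen_row[OF K _ _ False])
    show "L_module ({r, r'} \<union> X) {c, d} \<subseteq> K" using insert by auto
    fix y z assume yz: "y \<in> {c, d} - {t}" "z \<in> {c, d} - {t}"
    let ?r = "{(y, z). y \<in> {c, d} - {t} \<and> z \<in> {c, d} - {t} \<and> (\<exists>x\<in>{r, r'} \<union> X. x \<noteq> y \<and> x \<noteq> z \<and> qd t x y z \<in> K)}"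
    show "(y, z) \<in> ?r\<^sup>*"
    proof (cases "y = z")
     case False
     then obtain x where x: "x \<in> {r, r'}" "qd t x c d \<in> K" using yz row[of t] \<open>t \<notin> {r, r'} \<union> X\<close> insert by auto
     show ?thesis using frag.subspace_neg[OF K x(2)] qd_swap(2)[of t x d c] x yz False x(1) di by auto
    qed simp
   qed (use insert in auto)
   thus ?thesis by simp
  qed
 qed
 have R: "{r, r'} \<union> R = R" using el by auto
 have cols: "L_module R ({c, d} \<union> X) \<subseteq> K" if "finite X" "X \<subseteq> S" for X using that
 proof (induction X rule: finite_induct)
  case empty
  thus ?case using rows[OF fin(1)] R by simp
 next
  case (insert t X)
  show ?case
  proof (cases "t \<in> {c, d} \<union> X")
   case True
   thus ?thesis using insert by (simp add: insert_absorb)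
  next
   case False
   have "L_module R (insert t ({c, d} \<union> X)) \<subseteq> K"
   proof (rule gen_col[OF K fin(1) _ False])
    show "L_module R ({c, d} \<union> X) \<subseteq> K" using insert by auto
   qed (use insert col[of t "{c, d} \<union> X"] False el in auto)
   thus ?thesis by simp
  qed
 qed
 have "{c, d} \<union> S = S" using el by auto
 thus ?thesis using cols[OF fin(2)] by simp
qed

lemma gen_quads:
 assumes K: "frag.subspace K" and fin: "finite R" "finite S"
  and el: "r \<in> R" "r' \<in> R" "c \<in> S" "d \<in> S" and di: "distinct [r, r', c, d]"
  and q: "\<And>a b x y. a \<in> R ==> b \<in> R ==> x \<in> S ==> y \<in> S ==> distinct [a, b, x, y] ==> qd a b x y \<in> K"
 shows "L_module R S \<subseteq> K"
proof (rule gen_all[OF K fin el di])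
 show "qd r r' c d \<in> K" by (rule q[OF el di])
 show "\<exists>x\<in>{r, r'}. qd t x c d \<in> K" if "t \<in> R" "t \<notin> {r, r', c, d}" for t using q[of t r c d] that el di by auto
 fix t S' y z assume h: "t \<in> S - S'" "{c, d} \<subseteq> S'" "S' \<subseteq> S" "y \<in> R - {t}" "z \<in> R - {t}"
 let ?r = "{(y, z). y \<in> R - {t} \<and> z \<in> R - {t} \<and> (\<exists>x\<in>S'. x \<noteq> y \<and> x \<noteq> z \<and> qd y z t x \<in> K)}"
 have one: "(y, z) \<in> ?r\<^sup>*" if h1: "y \<in> R - {t}" "z \<in> R - {t}" "{y, z} \<noteq> {c, d}" for y z
 proof (cases "y = z")
  case False
  obtain x where x: "x \<in> {c, d}" "x \<noteq> y" "x \<noteq> z" using h1(3) di False by auto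
  have xS: "x \<in> S'" "x \<in> S" "t \<in> S" "t \<noteq> x" using x(1) h by auto
  have "qd y z t x \<in> K" by (rule q) (use h1 x xS False in auto)
  thus ?thesis using h1 x xS by blast
 qed simp
 show "(y, z) \<in> ?r\<^sup>*"
 \<comment> \<open>The auxiliary element \<open>x\<close> must differ from both ends of a move, so
   for the pair \<open>c\<close>, \<open>d\<close> the chain makes a detour through \<open>r\<close>
   or \<open>r'\<close>.\<close>
 proof (cases "{y, z} = {c, d}")
  case True
  obtain u where u: "u \<in> {r, r'}" "u \<noteq> t" using di by auto
  hence "(y, u) \<in> ?r\<^sup>*" "(u, z) \<in> ?r\<^sup>*" using el di one h by auto
  thus ?thesis by (rule rtrancl_trans)
 qed (use one h in blast)
qed

lemma L_trivial:
 assumes "z \<in> L_module R S" "finite R" "finite S" "z \<noteq> 0"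
 shows "2 \<le> card R" "2 \<le> card S"
proof -
 have *: "2 \<le> card R" if z: "z \<in> L_module R S" "z \<noteq> 0" and fin: "finite R" for z :: "'a \<times> 'a \<Rightarrow>\<^sub>0 int" and R S
 proof (rule ccontr)
  assume "\<not> 2 \<le> card R"
  hence "card R = 0 \<or> card R = 1" by auto
  hence "R = {} \<or> (\<exists>x. R = {x})" using fin by (auto simp: card_1_singleton_iff)
  hence "lo z (x, y) = 0" for x y using z unfolding L_iff by fastforce
  hence "z = 0" by (intro poly_mapping_eqI) auto
  thus False using z by blast
 qed
 show "2 \<le> card R" by (rule *[OF assms(1,4,2)])
 have "sw z \<noteq> 0" using assms(4) sw_sw[of z] by (metis sw_linear(3))
 thus "2 \<le> card S" using *[of "sw z" S R] assms by simp
qed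

lemma two_elements: "finite A ==> 2 \<le> card A ==> \<exists>x y. x \<in> A \<and> y \<in> A \<and> x \<noteq> y"
 by (metis card_2_iff' card_le_Suc_iff numeral_2_eq_2 One_nat_def card_le_Suc0_iff_eq not_less_eq_eq)

text \<open>If two elements of \<open>R\<close> lie outside \<open>S\<close>, they can be combined
  with any two elements of \<open>S\<close>. Otherwise \<open>S\<close> has at least three elements,
  and \<open>r\<close>, \<open>r'\<close> are picked so that two elements of \<open>S\<close>
  remain.\<close>

lemma exists_quad:
 assumes fin: "finite R" "finite S" and c: "4 \<le> card (R \<union> S)" "2 \<le> card R" "2 \<le> card S"
 obtains r r' x y where "r \<in> R" "r' \<in> R" "x \<in> S" "y \<in> S" "distinct [r, r', x, y]"
proof -
 have "\<exists>r r' x y. r \<in> R \<and> r' \<in> R \<and> x \<in> S \<and> y \<in> S \<and> distinct [r, r', x, y]"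
 proof (cases "2 \<le> card (R - S)")
  case True
  then obtain r r' where "r \<in> R - S" "r' \<in> R - S" "r \<noteq> r'" using two_elements[of "R - S"] fin by auto
  moreover obtain x y where "x \<in> S" "y \<in> S" "x \<noteq> y" using two_elements[OF fin(2) c(3)] by auto
  ultimately show ?thesis by fastforce
 next
  case False
  have RS: "R \<union> S = S \<union> (R - S)" by auto
  have cu: "card (R \<union> S) = card S + card (R - S)" unfolding RS by (rule card_Un_disjoint) (use fin in auto)
  obtain r r' where r: "r \<in> R" "r' \<in> R" "r \<noteq> r'" "r' \<in> S \<longrightarrow> (r \<in> S \<longrightarrow> 4 \<le> card S)" "3 \<le> card S" "r \<notin> S \<or> r' \<notin> S \<or> 4 \<le> card S"
  proof (cases "R \<subseteq> S")
   case True
   hence "R - S = {}" by auto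
   hence "card (R - S) = 0" by (metis card.empty)
   hence "4 \<le> card S" using cu c(1) by linarith
   moreover obtain r r' where "r \<in> R" "r' \<in> R" "r \<noteq> r'" using two_elements[OF fin(1) c(2)] by auto
   ultimately show ?thesis using that by auto
  next
   case f: False
   then obtain r where r: "r \<in> R" "r \<notin> S" by auto
   obtain r' where "r' \<in> R" "r' \<noteq> r" using two_elements[OF fin(1) c(2)] by metis
   thus ?thesis using that[of r r'] r cu c(1) False by auto
  qed
  have "card (S \<inter> {r, r'}) \<le> (if 4 \<le> card S then 2 else 1)"
  proof (cases "4 \<le> card S")
   case True
   have "card (S \<inter> {r, r'}) \<le> card {r, r'}" by (intro card_mono) auto
   thus ?thesis using True by (simp add: card_insert_if split: if_splits)
  next
   case False
   hence "S \<inter> {r, r'} \<subseteq> {r} \<or> S \<inter> {r, r'} \<subseteq> {r'}" using r by auto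
   hence "card (S \<inter> {r, r'}) \<le> 1" by (metis card_mono finite.emptyI finite_insert is_singletonI is_singleton_altdef)
   thus ?thesis using False by simp
  qed
  moreover have "card (S - {r, r'}) = card S - card (S \<inter> {r, r'})" by (rule card_Diff_subset_Int) simp
  ultimately have "2 \<le> card (S - {r, r'})" using r(5) by (auto split: if_splits)
  then obtain x y where "x \<in> S - {r, r'}" "y \<in> S - {r, r'}" "x \<noteq> y" using two_elements[of "S - {r, r'}"] fin by auto
  thus ?thesis using r by (intro exI[of _ r] exI[of _ r'] exI[of _ x] exI[of _ y]) auto
 qed
 thus ?thesis using that by blast
qed

section \<open>Making both sets equal\<close>

context twoc begin

text \<open>Elements of \<open>S\<close> become rows one at a time. The same \<open>z\<close> stays
  outside the span in each step by \<open>extend_row\<close>, once a suitable pair of rows and a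
  column have been found.\<close>

lemma add_rows:
 assumes ns: "nosd E V R S" "nosd E V S R" and RS: "R \<subseteq> V" "S \<subseteq> V" and c: "4 \<le> card (R \<union> S)"
  and z: "z \<in> L_module R S" "z \<notin> PM E V R S"
 shows "\<exists>z. z \<in> L_module (R \<union> S) S \<and> z \<notin> PM E V (R \<union> S) S"
proof -
 have fS: "finite S" using RS finV finite_subset by blast
 have "X \<subseteq> S ==> \<exists>z. z \<in> L_module (R \<union> X) S \<and> z \<notin> PM E V (R \<union> X) S" if "finite X" for X using that
 proof (induction X rule: finite_induct)
  case empty
  thus ?case using z by auto
 next
  case (insert s X)
  let ?R = "R \<union> X"
  obtain z where z: "z \<in> L_module ?R S" "z \<notin> PM E V ?R S" using insert by auto
  show ?case
  proof (cases "s \<in> ?R")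
   case True
   thus ?thesis using z by (intro exI[of _ z]) (simp add: insert_absorb)
  next
   case False
   have sS: "s \<in> S" using insert by auto
   have fR: "finite ?R" using RS finV insert finite_subset by blast
   have RV: "?R \<subseteq> V" using RS insert by auto
   have ns': "nosd E V ?R S" unfolding nosd_def
   proof (intro allI impI)
    fix I w w' s e
    assume h: "w \<noteq> w'" "w \<in> V - I" "w' \<in> V - I" "I \<subseteq> V" "nb E V I \<subseteq> {w, w'}" "V - I - {w, w'} \<noteq> {}" "I \<inter> ?R = {}"
     "s \<in> S \<inter> I" "e \<in> S \<inter> I" "s \<noteq> e" "lk E (I \<union> {w, w'}) s w e w'"
    have "I \<inter> R = {}" using h(7) by auto
    from ns(1)[unfolded nosd_def, rule_format, OF h(1-6) this h(8-11)]
    show "\<not> lk E (I \<union> {w, w'}) s w' e w" .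
   qed
   interpret rs V E ?R S by unfold_locales (use RV RS ns' in auto)
   have "z \<noteq> 0" using z(2) by auto
   note c2 = L_trivial[OF z(1) fR fS this]
   have "card (R \<union> S) \<le> card (?R \<union> S)" by (intro card_mono) (use fR fS in auto)
   hence c4: "4 \<le> card (?R \<union> S)" using c by linarith
   obtain r r' x y where q: "r \<in> ?R" "r' \<in> ?R" "x \<in> S" "y \<in> S" "distinct [r, r', x, y]" using exists_quad[OF fR fS c4 c2] .
   have "\<exists>r r' x y. r \<in> ?R \<and> r' \<in> ?R \<and> x \<in> S \<and> y \<in> S \<and> distinct [r, r', x, y] \<and> qd r r' x y \<notin> P"
   proof (rule ccontr)
    assume "\<not> ?thesis"
    hence "L_module ?R S \<subseteq> P" by (intro gen_quads[OF PM_subspace fR fS q]) blast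
    thus False using z by blast
   qed
   then obtain r r' x y where q: "r \<in> ?R" "r' \<in> ?R" "x \<in> S" "y \<in> S" "distinct [r, r', x, y]" "qd r r' x y \<notin> P" by blast
   \<comment> \<open>Up to sign, \<open>qd r r' x y\<close> is the difference of the elements for
     the columns \<open>x\<close>, \<open>s\<close> and \<open>y\<close>, \<open>s\<close>, so one
     of these is outside the span.\<close>
   obtain x' where x': "x' \<in> S" "distinct [r, r', x', s]" "qd r r' x' s \<notin> P"
   proof (cases "qd r r' x s \<in> P")
    case True
    hence n: "qd r r' y s \<notin> P" using q(6) PM_third2[of r r' x s E V ?R S y] PM_swap(2)[of r r' y s] by blast
    thus ?thesis using that[of y] q n False by force
   next
    case f: False
    thus ?thesis using that[of x] q f False by force
   qed
   have "z \<notin> PM E V (insert s ?R) S"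
   proof
    assume "z \<in> PM E V (insert s ?R) S"
    moreover have "lo z (s, d) = 0" for d using z(1) False unfolding L_iff by blast
    ultimately have "z \<in> P" using extend_row[OF q(1,2) x'(1) sS False x'(2,3)] by blast
    thus False using z by blast
   qed
   moreover have "z \<in> L_module (insert s ?R) S"
   proof -
    have "lo z (s, d) = 0" for d using z(1) False unfolding L_iff by blast
    thus ?thesis using z(1) False fR unfolding L_iff by auto
   qed
   ultimately show ?thesis by (intro exI[of _ z]) simp
  qed
 qed
 from this[OF fS] show ?thesis by simp
qed

text \<open>The rows are completed first; transposing the element then turns columns into
  rows.\<close>

lemma equalize:
 assumes ns: "nosd E V R S" "nosd E V S R" and RS: "R \<subseteq> V" "S \<subseteq> V" and c: "4 \<le> card (R \<union> S)"
  and z: "z \<in> L_module R S" "z \<notin> PM E V R S"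
 shows "\<exists>z. z \<in> L_module (R \<union> S) (R \<union> S) \<and> z \<notin> PM E V (R \<union> S) (R \<union> S)"
proof -
 let ?T = "R \<union> S"
 obtain y where y: "y \<in> L_module ?T S" "y \<notin> PM E V ?T S" using add_rows[OF assms] by blast
 \<comment> \<open>A set without vertices of \<open>S\<close> meets \<open>?T\<close> only in
   \<open>R\<close>, so the separation would be one for \<open>R\<close>. The companion condition
   \<open>ns2\<close> is vacuous because \<open>S\<close> is part of \<open>?T\<close>.\<close>
 have ns1: "nosd E V S ?T" unfolding nosd_def
 proof (intro allI impI)
  fix I w w' s e
  assume h: "w \<noteq> w'" "w \<in> V - I" "w' \<in> V - I" "I \<subseteq> V" "nb E V I \<subseteq> {w, w'}" "V - I - {w, w'} \<noteq> {}" "I \<inter> S = {}"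
   "s \<in> ?T \<inter> I" "e \<in> ?T \<inter> I" "s \<noteq> e" "lk E (I \<union> {w, w'}) s w e w'"
  have "s \<in> R \<inter> I" "e \<in> R \<inter> I" using h(7-9) by auto
  from ns(2)[unfolded nosd_def, rule_format, OF h(1-7) this h(10,11)]
  show "\<not> lk E (I \<union> {w, w'}) s w' e w" .
 qed
 have ns2: "nosd E V ?T S" unfolding nosd_def by blast
 have "\<exists>z. z \<in> L_module (S \<union> ?T) ?T \<and> z \<notin> PM E V (S \<union> ?T) ?T"
 proof (rule add_rows[OF ns1 ns2 RS(2) _ _ , of "sw y"])
  show "sw y \<in> L_module S ?T" using y by simp
  show "sw y \<notin> PM E V S ?T" using sw_PM[of "sw y" E V S ?T] y by auto
  have "S \<union> (R \<union> S) = R \<union> S" by auto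
  thus "4 \<le> card (S \<union> ?T)" using c by simp
 qed (use RS in auto)
 moreover have "S \<union> ?T = ?T" by auto
 ultimately show ?thesis by simp
qed

end

lemma finite_max_element:
 fixes f :: "'a \<Rightarrow> nat"
 assumes "finite A" "A \<noteq> {}"
 shows "\<exists>x\<in>A. \<forall>y\<in>A. f y \<le> f x"
proof -
 have "Max (f ` A) \<in> f ` A" using assms by (intro Max_in) auto
 thus ?thesis using Max_ge[of "f ` A"] assms by fastforce
qed

section \<open>From separation to a cyclic order\<close>

lemma sorted_list_exists:
 assumes "finite A" "\<And>x y. x \<in> A ==> y \<in> A ==> x \<noteq> y ==> r x y \<or> r y x"
  "\<And>x y z. x \<in> A ==> y \<in> A ==> z \<in> A ==> r x y ==> r y z ==> r x z"
 shows "\<exists>xs. distinct xs \<and> set xs = A \<and> sorted_wrt r xs"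
 using assms
proof (induction A rule: finite_induct)
 case empty
 show ?case by (rule exI[of _ "[]"]) simp
next
 case (insert x A)
 have tot: "\<And>u v. u \<in> insert x A ==> v \<in> insert x A ==> u \<noteq> v ==> r u v \<or> r v u"
  and tr: "\<And>u v w. u \<in> insert x A ==> v \<in> insert x A ==> w \<in> insert x A ==> r u v ==> r v w ==> r u w"
  using insert.prems by blast+
 have "\<exists>xs. distinct xs \<and> set xs = A \<and> sorted_wrt r xs"
 proof (rule insert.IH)
  show "\<And>u v. u \<in> A ==> v \<in> A ==> u \<noteq> v ==> r u v \<or> r v u" using tot by blast
  show "\<And>u v w. u \<in> A ==> v \<in> A ==> w \<in> A ==> r u v ==> r v w ==> r u w" using tr by (metis insertI2)
 qed
 then obtain xs where xs: "distinct xs" "set xs = A" "sorted_wrt r xs" by blast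
 let ?l = "filter (\<lambda>y. r y x) xs @ x # filter (\<lambda>y. \<not> r y x) xs"
 have "distinct ?l" using xs insert.hyps by auto
 moreover have "set ?l = insert x A" using xs by auto
 moreover have "sorted_wrt r ?l"
 proof -
  have 1: "r x y" if "y \<in> set xs" "\<not> r y x" for y using tot[of x y] that xs(2) insert.hyps by auto
  hence "r y z" if "y \<in> set xs" "r y x" "z \<in> set xs" "\<not> r z x" for y z using tr[of y x z] that xs(2) by auto
  thus ?thesis unfolding sorted_wrt_append using xs(3) 1 by (simp add: sorted_wrt_filter)
 qed
 ultimately show ?case by blast
qed

lemma distinct_nth4:
 assumes "distinct ys" "i < j" "j < k" "k < l" "l < length ys"
 shows "distinct [ys ! i, ys ! j, ys ! k, ys ! l]"
 using assms by (simp add: nth_eq_iff_index_eq)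

text \<open>\<open>\<sigma> a b c d\<close>: the pairs \<open>a, b\<close> and \<open>c, d\<close> separate each other on the circle.\<close>

locale sep_rel =
 fixes T :: "'a set" and \<sigma> :: "'a \<Rightarrow> 'a \<Rightarrow> 'a \<Rightarrow> 'a \<Rightarrow> bool"
 assumes finT: "finite T"
  and sym: "\<sigma> a b c d ==> \<sigma> b a c d" "\<sigma> a b c d ==> \<sigma> c d a b"
  and one: "\<sigma> a b c d ==> distinct [a, b, c, d] ==> {a, b, c, d} \<subseteq> T ==> \<not> \<sigma> a c b d"
  and add: "\<sigma> a b c d ==> distinct [a, b, c, d, e] ==> {a, b, c, d, e} \<subseteq> T ==> \<sigma> a b c e \<or> \<sigma> a b e d"
begin

lemma ac: "\<sigma> b a c d \<longleftrightarrow> \<sigma> a b c d" "\<sigma> a b d c \<longleftrightarrow> \<sigma> a b c d" "\<sigma> c d a b \<longleftrightarrow> \<sigma> a b c d"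
 using sym by metis+

definition full where
 "full A \<longleftrightarrow> (\<forall>a b c d. {a, b, c, d} \<subseteq> A \<longrightarrow> distinct [a, b, c, d] \<longrightarrow> \<not> \<sigma> a b c d)"

text \<open>\<open>full\<close> describes a defect that the axioms alone permit: no two pairs of the
  set separate each other. A separated quadruple formed by \<open>t\<close> and three points of a
  defective set is driven by \<open>add\<close> through the fourth point, until \<open>one\<close>
  is violated.\<close>

lemma full_propagate:
 assumes f: "full {a, b, c, d}" and T: "{a, b, c, d, t} \<subseteq> T" and di: "distinct [a, b, c, d, t]"
 shows "\<not> \<sigma> t a c d"
proof
 assume s: "\<sigma> t a c d"
 have nf: "\<not> \<sigma> a b c d" "\<not> \<sigma> a c b d" "\<not> \<sigma> a d b c" using f di unfolding full_def by auto
 have aux: "\<sigma> t a c b ==> \<not> \<sigma> a b c d ==> \<not> \<sigma> a c b d ==> \<not> \<sigma> a d b c ==> \<sigma> t a c d ==>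
   distinct [a, b, c, d, t] ==> {a, b, c, d, t} \<subseteq> T ==> False" for b c d
 proof -
  assume h: "\<sigma> t a c b" "\<not> \<sigma> a b c d" "\<not> \<sigma> a c b d" "\<not> \<sigma> a d b c" "\<sigma> t a c d" and
   di: "distinct [a, b, c, d, t]" and T: "{a, b, c, d, t} \<subseteq> T"
  have "\<sigma> c d t b \<or> \<sigma> c d b a" by (rule add) (use h(5) di T in \<open>auto simp: ac\<close>)
  hence 1: "\<sigma> t b c d" using h(2) by (simp add: ac)
  have "\<sigma> c b t d \<or> \<sigma> c b d a" by (rule add) (use h(1) di T in \<open>auto simp: ac\<close>)
  hence 2: "\<sigma> t d c b" using h(4) by (simp add: ac)
  have "\<sigma> t b c a \<or> \<sigma> t b a d" by (rule add) (use 1 di T in auto)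
  moreover have "\<not> \<sigma> t b a c" by (rule one) (use h(1) di T in \<open>auto simp: ac\<close>)
  ultimately have 3: "\<sigma> t b a d" by (simp add: ac)
  have "\<sigma> t d c a \<or> \<sigma> t d a b" by (rule add) (use 2 di T in auto)
  moreover have "\<not> \<sigma> t d a c" by (rule one) (use h(5) di T in \<open>auto simp: ac\<close>)
  moreover have "\<not> \<sigma> t d b a" by (rule one) (use 3 di T in \<open>auto simp: ac\<close>)
  ultimately show False by (simp add: ac)
 qed
 have "\<sigma> t a c b \<or> \<sigma> t a b d" by (rule add) (use s di T in auto)
 thus False
 proof
  assume "\<sigma> t a c b"
  thus False using aux[of c b d] s nf di T by (auto simp: ac)
 next
  assume "\<sigma> t a b d"
  thus False using aux[of d b c] s nf di T by (auto simp: ac)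
 qed
qed

lemma four_set: "card A = 4 ==> a \<in> A ==> b \<in> A ==> c \<in> A ==> d \<in> A ==> distinct [a, b, c, d] ==> {a, b, c, d} = A"
 by (rule card_subset_eq) (auto intro: card_ge_0_finite)

lemma full_exchange:
 assumes f: "full A" "card A = 4" "A \<subseteq> T" and t: "t \<in> T - A" and s: "s \<in> A"
 shows "full (insert t (A - {s}))"
 unfolding full_def
proof (intro allI impI)
 fix a b c d assume sub: "{a, b, c, d} \<subseteq> insert t (A - {s})" and di: "distinct [a, b, c, d]"
 have key: "\<not> \<sigma> t b c d" if h: "{b, c, d} \<subseteq> A - {s}" "distinct [b, c, d]" for b c d
 proof (rule full_propagate[of b s c d t])
  have "{b, s, c, d} = A" by (rule four_set) (use f h s in auto)
  thus "full {b, s, c, d}" "{b, s, c, d, t} \<subseteq> T" using f t by auto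
  show "distinct [b, s, c, d, t]" using h t s f by auto
 qed
 show "\<not> \<sigma> a b c d"
 proof (cases "t \<in> {a, b, c, d}")
  case False
  thus ?thesis using sub f(1) di unfolding full_def by auto
 next
  case True
  consider "t = a" | "t = b" | "t = c" | "t = d" using True by auto
  thus ?thesis
  proof cases
   case 1
   thus ?thesis using key[of b c d] sub di by auto
  next
   case 2
   thus ?thesis using key[of a c d] sub di by (auto simp: ac)
  next
   case 3
   hence "\<not> \<sigma> t d a b" using key[of d a b] sub di by auto
   thus ?thesis using 3 by (simp add: ac)
  next
   case 4
   hence "\<not> \<sigma> t c a b" using key[of c a b] sub di by auto
   thus ?thesis using 4 by (simp add: ac)
  qed
 qed
qed

text \<open>Exchanging one point at a time carries the defect from \<open>A\<close> to
  \<open>B\<close>. Hence a single separated quadruple rules it out for every four points.\<close>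

lemma full_all:
 assumes "full A" "card A = 4" "A \<subseteq> T" "card B = 4" "B \<subseteq> T"
 shows "full B"
 using assms
proof (induction "card (B - A)" arbitrary: A)
 case 0
 have "B = A" using 0(4) finT finite_subset 0 card_subset_eq[of A B] by (simp add: card_ge_0_finite)
 thus ?case using 0 by simp
next
 case (Suc n)
 have fin: "finite A" "finite B" using Suc(5,7) finT finite_subset by blast+
 obtain t where t: "t \<in> B - A" using Suc(2) by (metis card.empty ex_in_conv nat.simps(3))
 obtain s where s: "s \<in> A" "s \<notin> B" using card_subset_eq[OF fin(2)] Suc(4,6) t by auto
 let ?A = "insert t (A - {s})"
 have "full ?A" using full_exchange[OF Suc(3-5)] t s Suc(7) by blast
 moreover have "card ?A = 4" using t s fin Suc(4) by simp
 moreover have "?A \<subseteq> T" using t Suc(5,7) by blast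
 moreover have "B - ?A = (B - A) - {t}" using s by auto
 hence "n = card (B - ?A)" using Suc(2) t fin by simp
 ultimately show ?case using Suc(1) Suc(6,7) by blast
qed

section \<open>Cutting the circle open at a point\<close>

context
 fixes a
 assumes a: "a \<in> T" and ex: "\<And>b c d. distinct [a, b, c, d] ==> {a, b, c, d} \<subseteq> T ==> \<sigma> a b c d \<or> \<sigma> a c b d \<or> \<sigma> a d b c"
begin

text \<open>With the circle cut open at \<open>a\<close>, this says that \<open>y\<close> lies
  between \<open>x\<close> and \<open>z\<close> on the resulting line.\<close>

abbreviation B where "B x y z \<equiv> \<sigma> a y x z"
abbreviation di where "di xs \<equiv> distinct xs \<and> set xs \<subseteq> T - {a}"

lemma B_sym: "B x y z \<longleftrightarrow> B z y x"
 by (simp add: ac)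

lemma B_ex: "di [x, y, z] ==> B x y z \<or> B y x z \<or> B x z y"
 using ex[of y x z] a by (auto simp: ac)

lemma B_one: "B x y z ==> di [x, y, z] ==> \<not> B y x z \<and> \<not> B x z y"
proof -
 assume h: "B x y z" "di [x, y, z]"
 have "\<not> \<sigma> a x y z" by (rule one) (use h a in auto)
 moreover have "\<not> \<sigma> a z y x" by (rule one) (use h a in \<open>auto simp: ac\<close>)
 ultimately show ?thesis by (simp add: ac)
qed

lemma B_add: "B x y z ==> di [x, y, z, e] ==> B x y e \<or> B e y z"
 by (rule add) (use a in auto)

text \<open>Choose \<open>e\<close>, \<open>f\<close> with the largest number of points in between.
  If \<open>e\<close> were between \<open>x\<close> and \<open>f\<close>, the pair \<open>x\<close>,
  \<open>f\<close> would have more.\<close>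

lemma endpoint:
 assumes "T - {a} \<noteq> {}"
 obtains e where "e \<in> T - {a}" "\<And>x y. di [x, e, y] ==> \<not> B x e y"
proof -
 let ?b = "\<lambda>(e, f). card {y \<in> T - {a, e, f}. e \<noteq> f \<and> B e y f}"
 have fin: "finite ((T - {a}) \<times> (T - {a}))" using finT by simp
 have ne: "(T - {a}) \<times> (T - {a}) \<noteq> {}" using assms by auto
 obtain p where p: "p \<in> (T - {a}) \<times> (T - {a})" "\<And>q. q \<in> (T - {a}) \<times> (T - {a}) ==> ?b q \<le> ?b p"
  using finite_max_element[OF fin ne, of ?b] by blast
 obtain e f where ef: "p = (e, f)" by fastforce
 have e: "e \<in> T - {a}" "f \<in> T - {a}" using p(1) unfolding ef by auto
 have max: "card {y \<in> T - {a, x, z}. x \<noteq> z \<and> B x y z} \<le> card {y \<in> T - {a, e, f}. e \<noteq> f \<and> B e y f}"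
  if "x \<in> T - {a}" "z \<in> T - {a}" for x z
 proof -
  have "(x, z) \<in> (T - {a}) \<times> (T - {a})" using that by auto
  from p(2)[OF this] show ?thesis unfolding ef by simp
 qed
 have no: "\<not> B x e f" if x: "di [x, e, f]" for x
 proof
  assume b: "B x e f"
  have "insert e {y \<in> T - {a, e, f}. e \<noteq> f \<and> B e y f} \<subseteq> {y \<in> T - {a, x, f}. x \<noteq> f \<and> B x y f}"
  proof
   fix y assume "y \<in> insert e {y \<in> T - {a, e, f}. e \<noteq> f \<and> B e y f}"
   then consider "y = e" | "y \<in> T - {a, e, f}" "B e y f" by blast
   thus "y \<in> {y \<in> T - {a, x, f}. x \<noteq> f \<and> B x y f}"
   proof cases
    case 1
    thus ?thesis using b x by auto
   next
    case 2
    have "y \<noteq> x" using B_one[OF b x] 2 B_sym by blast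
    hence d: "di [x, e, f, y]" "di [e, y, f, x]" "di [e, y, x]" "di [e, y, f]" "di [x, e, y]" using 2 x by auto
    have "\<not> B e y x"
    proof
     assume c: "B e y x"
     have "B x e y \<or> B y e f" using B_add[OF b d(1)] .
     thus False using B_one[OF c d(3)] B_one[OF 2(2) d(4)] B_sym by blast
    qed
    thus ?thesis using B_add[OF 2(2) d(2)] 2 \<open>y \<noteq> x\<close> x by auto
   qed
  qed
  hence "card (insert e {y \<in> T - {a, e, f}. e \<noteq> f \<and> B e y f}) \<le> card {y \<in> T - {a, x, f}. x \<noteq> f \<and> B x y f}"
   by (intro card_mono) (use finT in auto)
  moreover have "card (insert e {y \<in> T - {a, e, f}. e \<noteq> f \<and> B e y f}) = Suc (card {y \<in> T - {a, e, f}. e \<noteq> f \<and> B e y f})"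
   using finT by simp
  ultimately show False using max[of x f] x by auto
 qed
 show ?thesis
 proof (rule that[OF e(1)])
  fix x y assume d: "di [x, e, y]"
  show "\<not> B x e y"
  proof
   assume b: "B x e y"
   consider "f = e" | "f = x" | "f = y" | "f \<notin> {x, y, e}" by auto
   thus False
   proof cases
    case 1
    have "{u \<in> T - {a, x, y}. x \<noteq> y \<and> B x u y} = {}" using max[of x y] d 1 finT by simp
    thus False using b d by auto
   next
    case 2
    thus False using no[of y] b d B_sym by auto
   next
    case 3
    thus False using no[of x] b d by auto
   next
    case 4
    hence "B x e f \<or> B f e y" using B_add[OF b, of f] d e by auto
    thus False using no[of x] no[of y] B_sym 4 d e by auto
   qed
  qed
 qed
qed

text \<open>The points are sorted as seen from the endpoint \<open>e\<close>, a nearer point being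
  between \<open>e\<close> and a farther one; \<open>a\<close> is put in front.\<close>

lemma order_from_point:
 obtains ts where "distinct ts" "set ts = T" "\<And>i j k l. i < j ==> j < k ==> k < l ==> l < length ts ==> \<sigma> (ts ! i) (ts ! k) (ts ! j) (ts ! l)"
proof (cases "T - {a} = {}")
 case True
 thus ?thesis using a by (intro that[of "[a]"]) auto
next
 case False
 obtain e where e: "e \<in> T - {a}" "\<And>x y. di [x, e, y] ==> \<not> B x e y" using endpoint[OF False] by blast
 define r where "r x y \<longleftrightarrow> B e x y" for x y
 let ?U = "T - {a, e}"
 have trans2: "r x z \<and> B x y z" if h: "{x, y, z} \<subseteq> ?U" "distinct [x, y, z]" "r x y" "r y z" for x y z
 proof -
  have d: "di [e, x, y]" "di [e, x, y, z]" "di [e, y, z]" "di [e, y, z, x]" "di [z, x, y]" "di [x, y, z]" using h e by auto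
  have b: "B e x y" "B e y z" using h r_def by auto
  have "B e x z \<or> B z x y" using B_add[OF b(1) d(2)] .
  moreover have "B e y x \<or> B x y z" using B_add[OF b(2) d(4)] .
  moreover have "\<not> B e y x" using B_one[OF b(1) d(1)] by blast
  moreover have "\<not> (B x y z \<and> B z x y)" 
  proof
   assume h: "B x y z \<and> B z x y"
   show False using B_one[OF conjunct1[OF h] d(6)] h B_sym[where x = z and y = x and z = y] by blast
  qed
  ultimately show ?thesis unfolding r_def by blast
 qed
 have rtot: "r x y \<or> r y x" if "x \<in> ?U" "y \<in> ?U" "x \<noteq> y" for x y
 proof -
  have d: "di [e, x, y]" "di [x, e, y]" using that e by auto
  show ?thesis using B_ex[OF d(1)] e(2)[OF d(2)] unfolding r_def by blast
 qed
 have rasym: "\<not> r y x" if "x \<in> ?U" "y \<in> ?U" "x \<noteq> y" "r x y" for x y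
 proof -
  have d: "di [e, x, y]" using that e by auto
  show ?thesis using B_one[OF _ d] that(4) unfolding r_def by metis
 qed
 have "\<exists>xs. distinct xs \<and> set xs = ?U \<and> sorted_wrt (\<lambda>x y. x \<noteq> y \<and> r x y) xs"
 proof (rule sorted_list_exists)
  show "finite ?U" using finT by simp
  show "x \<noteq> y \<and> r x y \<or> y \<noteq> x \<and> r y x" if "x \<in> ?U" "y \<in> ?U" "x \<noteq> y" for x y using rtot that by blast
  fix x y z assume h: "x \<in> ?U" "y \<in> ?U" "z \<in> ?U" "x \<noteq> y \<and> r x y" "y \<noteq> z \<and> r y z"
  show "x \<noteq> z \<and> r x z" using rasym[of x y] h trans2[of x y z] by auto
 qed
 then obtain xs where xs: "distinct xs" "set xs = ?U" "sorted_wrt (\<lambda>x y. x \<noteq> y \<and> r x y) xs" by blast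
 let ?ys = "e # xs"
 have ys: "distinct ?ys" "set ?ys = T - {a}" using xs e by auto
 have Bys: "B (?ys ! i) (?ys ! j) (?ys ! k)" if h: "i < j" "j < k" "k < length ?ys" for i j k
 proof -
  obtain j' k' where jk: "j = Suc j'" "k = Suc k'" using h by (metis Nat.lessE less_imp_Suc_add)
  have jk': "j' < k'" "k' < length xs" using h jk by auto
  have U: "xs ! j' \<in> ?U" "xs ! k' \<in> ?U" using xs(2) jk' nth_mem by (metis less_trans)+
  have rjk: "xs ! j' \<noteq> xs ! k' \<and> r (xs ! j') (xs ! k')" using sorted_wrt_nth_less[OF xs(3) jk'] .
  show ?thesis
  proof (cases i)
   case 0
   thus ?thesis using rjk jk unfolding r_def by simp
  next
   case (Suc i')
   have ij: "i' < j'" "j' < length xs" "i' < length xs" using h jk jk' Suc by auto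
   have U': "xs ! i' \<in> ?U" using xs(2) ij nth_mem by metis
   have rij: "xs ! i' \<noteq> xs ! j' \<and> r (xs ! i') (xs ! j')" using sorted_wrt_nth_less[OF xs(3) ij(1,2)] .
   show ?thesis
    using xs(1) ij jk' nth_eq_iff_index_eq trans2[of "xs ! i'" "xs ! j'" "xs ! k'"] U U' rij rjk jk Suc by fastforce
  qed
 qed
 \<comment> \<open>Quadruples without \<open>a\<close> follow from betweenness: the fourth point is
   added to a quadruple formed by \<open>a\<close> and the other three.\<close>
 have quad: "\<sigma> (?ys ! i) (?ys ! k) (?ys ! j) (?ys ! l)" if h: "i < j" "j < k" "k < l" "l < length ?ys" for i j k l
 proof -
  define x y z w where d: "x = ?ys ! i" "y = ?ys ! j" "z = ?ys ! k" "w = ?ys ! l"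
  have b: "B x y z" "B y z w" "B x y w" "B x z w" unfolding d by (rule Bys; use h in linarith)+
  have dd: "distinct [x, y, z, w]" unfolding d by (rule distinct_nth4[OF ys(1) h])
  have "x \<in> set ?ys" "y \<in> set ?ys" "z \<in> set ?ys" "w \<in> set ?ys" unfolding d using h by (intro nth_mem; linarith)+
  hence dT: "{x, y, z, w} \<subseteq> T - {a}" using ys(2) by auto
  have "\<sigma> y w z x \<or> \<sigma> y w x a" by (rule add) (use b(2) dd dT a in \<open>auto simp: ac\<close>)
  moreover have "\<not> \<sigma> a x y w" using B_one[OF b(3)] dd dT by auto
  ultimately show "\<sigma> x z y w" by (simp add: ac)
 qed
 have all: "\<sigma> ((a # ?ys) ! i) ((a # ?ys) ! k) ((a # ?ys) ! j) ((a # ?ys) ! l)"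
  if h: "i < j" "j < k" "k < l" "l < length (a # ?ys)" for i j k l
 proof -
  obtain j' k' l' where s: "j = Suc j'" "k = Suc k'" "l = Suc l'" using h by (metis Nat.lessE less_imp_Suc_add)
  have s': "j' < k'" "k' < l'" "l' < length ?ys" using h s by auto
  show ?thesis
  proof (cases i)
   case 0
   thus ?thesis using Bys[OF s'] s by (simp only: nth_Cons_0 nth_Cons_Suc)
  next
   case (Suc i')
   thus ?thesis using h s quad[OF _ s', of i'] Suc by (simp only: nth_Cons_Suc)
  qed
 qed
 have "distinct (a # ?ys)" "set (a # ?ys) = T" using ys a by auto
 thus ?thesis using that all by blast
qed

end

lemma order_exists:
 assumes q: "\<sigma> p q r s" "distinct [p, q, r, s]" "{p, q, r, s} \<subseteq> T"
 obtains ts where "distinct ts" "set ts = T" "\<And>i j k l. i < j ==> j < k ==> k < l ==> l < length ts ==> \<sigma> (ts ! i) (ts ! k) (ts ! j) (ts ! l)"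
proof -
 have ex: "\<sigma> a b c d \<or> \<sigma> a c b d \<or> \<sigma> a d b c" if h: "distinct [a, b, c, d]" "{a, b, c, d} \<subseteq> T" for a b c d
 proof (rule ccontr)
  assume n: "\<not> ?thesis"
  have "full {a, b, c, d}" unfolding full_def
  proof (intro allI impI)
   fix x y z w assume x: "{x, y, z, w} \<subseteq> {a, b, c, d}" "distinct [x, y, z, w]"
   show "\<not> \<sigma> x y z w" using x(1) x(2) n by (auto simp: ac)
  qed
  hence "full {p, q, r, s}" using h q full_all h(2) q(3) by auto
  thus False using q unfolding full_def by blast
 qed
 have "p \<in> T" using q by auto
 from order_from_point[OF this ex] show ?thesis using that by blast
qed

end

context twoc begin

text \<open>The axiom \<open>add\<close> holds because \<open>qd\<close> splits at a further vertex,
  and \<open>one\<close> because by \<open>A0\<close> two of the three pairings of four vertices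
  cannot both be unlinked.\<close>

lemma separation_order:
 assumes T: "T \<subseteq> V" "4 \<le> card T" and z: "z \<in> L_module T T" "z \<notin> PM E V T T"
 obtains ts where "distinct ts" "set ts = T"
  "\<And>i j k l. i < j ==> j < k ==> k < l ==> l < length ts ==> \<not> lk E V (ts ! i) (ts ! k) (ts ! j) (ts ! l)"
proof -
 let ?P = "PM E V T T"
 let ?s = "\<lambda>a b c d. {a, b, c, d} \<subseteq> T \<and> qd a b c d \<notin> ?P"
 have fT: "finite T" using T finV finite_subset by blast
 have flip: "qd c d a b \<in> ?P \<longleftrightarrow> qd a b c d \<in> ?P" for a b c d using sw_PM[of _ E V T T] sw_qd by metis
 interpret sep_rel T ?s
 proof
  show "finite T" using fT .
  show "?s a b c d ==> ?s b a c d" for a b c d using PM_swap(1)[of a b c d E V T T] by auto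
  show "?s a b c d ==> ?s c d a b" for a b c d using flip[of a b c d] by auto
  show "\<not> ?s a c b d" if h: "?s a b c d" "distinct [a, b, c, d]" "{a, b, c, d} \<subseteq> T" for a b c d
   using h PM_base[of a T b c T d E V] T A0[of a d b c] A0[of a c b d] h(2) PM_base[of a T c b T d E V] that by (auto simp: lk_ac)
  show "?s a b c e \<or> ?s a b e d" if "?s a b c d" "distinct [a, b, c, d, e]" "{a, b, c, d, e} \<subseteq> T" for a b c d e
   using that PM_third2[of a b c e E V T T d] by auto
 qed
 have c2: "2 \<le> card T" using z(2) L_trivial(1)[OF z(1) fT fT] by force
 have c4: "4 \<le> card (T \<union> T)" using T(2) by simp
 obtain r r' x y where q: "r \<in> T" "r' \<in> T" "x \<in> T" "y \<in> T" "distinct [r, r', x, y]" using exists_quad[OF fT fT c4 c2 c2] .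
 have "\<exists>a b x y. a \<in> T \<and> b \<in> T \<and> x \<in> T \<and> y \<in> T \<and> distinct [a, b, x, y] \<and> qd a b x y \<notin> ?P"
 proof (rule ccontr)
  assume "\<not> ?thesis"
  hence "L_module T T \<subseteq> ?P" by (intro gen_quads[OF PM_subspace fT fT q]) blast
  thus False using z by blast
 qed
 then obtain a b x y where "?s a b x y" "distinct [a, b, x, y]" by auto
 then obtain ts where ts: "distinct ts" "set ts = T"
   "\<And>i j k l. i < j ==> j < k ==> k < l ==> l < length ts ==> ?s (ts ! i) (ts ! k) (ts ! j) (ts ! l)"
  using order_exists by metis
 show ?thesis
 proof (rule that[OF ts(1,2)])
  fix i j k l :: nat assume "i < j" "j < k" "k < l" "l < length ts"
  from ts(3)[OF this] show "\<not> lk E V (ts ! i) (ts ! k) (ts ! j) (ts ! l)"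
   using PM_base[of "ts ! i" T "ts ! k" "ts ! j" T "ts ! l" E V] by blast
 qed
qed

end

section \<open>Cross-free societies\<close>

text \<open>Increasing positions suffice for a cyclic order, since whether two pairs alternate is
  invariant under rotation of the list.\<close>

definition crossfree :: "'v set set \<Rightarrow> 'v set \<Rightarrow> 'v list \<Rightarrow> bool" where
 "crossfree E V ts \<longleftrightarrow> (\<forall>i j k l. i < j \<longrightarrow> j < k \<longrightarrow> k < l \<longrightarrow> l < length ts \<longrightarrow>
   \<not> lk E V (ts ! i) (ts ! k) (ts ! j) (ts ! l))"

text \<open>Sets without vertices of \<open>T\<close> and with at most three neighbours have been removed.\<close>

definition irred :: "'v set set \<Rightarrow> 'v set \<Rightarrow> 'v set \<Rightarrow> bool" where
 "irred E V T \<longleftrightarrow> (\<forall>X. X \<subseteq> V - T \<longrightarrow> X \<noteq> {} \<longrightarrow> 4 \<le> card (nb E V X))"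

lemma conn_seg:
 assumes "\<And>i. m \<le> i ==> i < k ==> {xs ! i, xs ! Suc i} \<in> E"
 shows "conn E ((!) xs ` {m..k})"
 using assms
proof (induction k)
 case 0
 show ?case by (cases m) auto
next
 case (Suc k)
 show ?case
 proof (cases "m \<le> k")
  case True
  hence "{m..Suc k} = insert (Suc k) {m..k}" by auto
  hence "(!) xs ` {m..Suc k} = insert (xs ! Suc k) ((!) xs ` {m..k})" by auto
  moreover have "conn E ((!) xs ` {m..k})" using Suc by auto
  moreover have "{xs ! k, xs ! Suc k} \<in> E" using Suc.prems True by auto
  ultimately show ?thesis using conn_insert[of E "(!) xs ` {m..k}" "xs ! k" "xs ! Suc k"] True by auto
 next
  case False
  hence "{m..Suc k} = {} \<or> {m..Suc k} = {Suc k}" by auto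
  thus ?thesis by (metis conn_empty conn_singleton image_empty image_insert)
 qed
qed

lemma last_hit:
 assumes "D \<inter> (A \<union> B) = {x}" "A \<inter> B = {}"
 shows "(x \<in> A \<and> x \<notin> B \<and> D \<inter> A \<noteq> {} \<and> D \<inter> B = {}) \<or> (x \<in> B \<and> x \<notin> A \<and> D \<inter> B \<noteq> {} \<and> D \<inter> A = {})"
proof -
 have x: "x \<in> D" "x \<in> A \<or> x \<in> B" using assms(1) unfolding set_eq_iff by blast+
 have u: "y = x" if "y \<in> D" "y \<in> A \<or> y \<in> B" for y using assms(1) that unfolding set_eq_iff by blast
 from x(2) show ?thesis using x(1) u assms(2) by blast
qed

lemma pth_nth_edge: "pth E P ==> Suc i < length P ==> {P ! i, P ! Suc i} \<in> E"
 unfolding pth_def by (metis successively_conv_nth)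

lemma pth_seg: "pth E P ==> k < length P ==> conn E ((!) P ` {m..k})"
 by (rule conn_seg) (use pth_nth_edge[of E P] in auto)

text \<open>The case in which gluing is impossible: by \<open>nochord\<close> no two boundary
  vertices that are not neighbours on the rim cut the boundary into two parts. The edge
  \<open>{a, b}\<close> is the one to be peeled.\<close>

locale society =
 fixes V :: "'v set" and E :: "'v set set" and a b :: 'v and rest :: "'v list"
 assumes finV: "finite V" and edge: "e \<in> E ==> e \<subseteq> V \<and> card e = 2"
  and dist: "distinct (a # b # rest)" and sub: "set (a # b # rest) \<subseteq> V"
  and irr: "irred E V (set (a # b # rest))" and cf: "crossfree E V (a # b # rest)"
  and rim: "Suc i < length (a # b # rest) ==> {(a # b # rest) ! i, (a # b # rest) ! Suc i} \<in> E"
  and rim': "{last rest, a} \<in> E" and len: "2 \<le> length rest"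
  and nochord: "Suc i < j ==> j < length (a # b # rest) ==> i \<noteq> 0 \<or> Suc j \<noteq> length (a # b # rest) ==>
   \<exists>X. conn E X \<and> X \<subseteq> V - {(a # b # rest) ! i, (a # b # rest) ! j} \<and>
    (\<exists>k. i < k \<and> k < j \<and> (a # b # rest) ! k \<in> X) \<and>
    (\<exists>k < length (a # b # rest). (k < i \<or> j < k) \<and> (a # b # rest) ! k \<in> X)"
begin

definition ts where "ts = a # b # rest"
definition n where "n = length ts"
definition E0 where "E0 = E - {{a, b}}"

lemma ts0: "ts ! 0 = a" "ts ! 1 = b" "ts ! Suc 0 = b" "3 < n" "distinct ts" "set ts \<subseteq> V" "a \<in> set ts" "b \<in> set ts"
 "a \<noteq> b" "a \<in> V" "b \<in> V" "{a, b} \<in> E"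
 using len dist sub rim[of 0] by (auto simp: ts_def n_def)

lemma ts_nth: "k < n ==> ts ! k \<in> set ts" "k < n ==> l < n ==> ts ! k = ts ! l \<longleftrightarrow> k = l"
 using ts0(5) nth_eq_iff_index_eq unfolding n_def by auto

lemma ts_index: "t \<in> set ts ==> t \<noteq> a ==> t \<noteq> b ==> \<exists>k. 2 \<le> k \<and> k < n \<and> ts ! k = t"
proof -
 assume h: "t \<in> set ts" "t \<noteq> a" "t \<noteq> b"
 then obtain k where "k < n" "ts ! k = t" by (metis in_set_conv_nth n_def)
 moreover have "k \<noteq> 0" "k \<noteq> 1" using h(2,3) \<open>ts ! k = t\<close> ts0(1,2) by metis+
 ultimately show ?thesis by (intro exI[of _ k]) auto
qed

lemma no_cross: "conn E X ==> conn E Y ==> X \<subseteq> V ==> Y \<subseteq> V ==> X \<inter> Y = {} ==> i < j ==> j < k ==> k < l ==> l < n ==>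
  ts ! i \<in> X ==> ts ! j \<in> Y ==> ts ! k \<in> X ==> ts ! l \<in> Y ==> False"
 using cf lkI unfolding crossfree_def ts_def n_def by metis

lemma cross_ab: "conn E X ==> conn E Y ==> X \<subseteq> V ==> Y \<subseteq> V ==> X \<inter> Y = {} ==> 2 \<le> k ==> k < l ==> l < n ==>
  a \<in> X ==> b \<in> Y ==> ts ! k \<in> X ==> ts ! l \<in> Y ==> False"
 using no_cross[of X Y 0 1 k l] ts0 by auto

lemma E0E: "E0 \<subseteq> E" by (auto simp: E0_def)

lemma conn0: "conn E X ==> a \<notin> X \<or> b \<notin> X ==> conn E0 X"
proof (rule connI)
 fix Y assume c: "conn E X" and ab: "a \<notin> X \<or> b \<notin> X" and Y: "Y \<subseteq> X" "Y \<noteq> {}" "\<And>y x. y \<in> Y ==> x \<in> X - Y ==> {x, y} \<notin> E0"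
 show "Y = X"
 proof (rule ccontr)
  assume "Y \<noteq> X"
  then obtain y x where yx: "y \<in> Y" "x \<in> X - Y" "{x, y} \<in> E" using conn_edge[OF c Y(1,2)] by blast
  hence "{x, y} = {a, b}" using Y(3)[OF yx(1,2)] unfolding E0_def by blast
  thus False using ab yx Y(1) by (metis DiffD1 insertCI insert_iff singletonD subsetD)
 qed
qed

lemma conn0E: "conn E0 X ==> conn E X"
 using conn_mono E0E by blast

text \<open>The largest attached set leaves exactly an induced path from \<open>a\<close> to \<open>b\<close> that avoids the edge \<open>{a, b}\<close>.
 Its second vertex is the vertex exposed when \<open>{a, b}\<close> is removed.\<close>

definition att where
 "att Z \<longleftrightarrow> Z \<subseteq> V - {a, b} \<and> (\<forall>z\<in>Z. comp E Z z \<inter> set ts \<noteq> {}) \<and> (\<exists>X. conn E0 X \<and> X \<subseteq> V - Z \<and> a \<in> X \<and> b \<in> X)"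

lemma seg_rim: "k < n ==> conn E ((!) ts ` {m..k})"
 by (rule conn_seg) (use rim in \<open>auto simp: ts_def n_def\<close>)

lemma att_empty: "att {}"
proof -
 let ?X = "(!) ts ` {1..n - 1}"
 have "a \<notin> ?X"
 proof
  assume "a \<in> ?X"
  then obtain k where "k \<in> {1..n - 1}" "ts ! k = ts ! 0" using ts0(1) by auto
  moreover have "k < n" "k \<noteq> 0" "0 < n" using calculation(1) ts0(4) by auto
  ultimately show False using ts_nth(2)[of k 0] by simp
 qed
 hence c: "conn E0 ?X" using conn0 seg_rim[of "n - 1" 1] ts0(4) by auto
 have l: "last rest = ts ! (n - 1)" "last rest \<in> ?X"
 proof -
  have "ts \<noteq> []" "last ts = last rest" using len by (auto simp: ts_def)
  thus "last rest = ts ! (n - 1)" unfolding n_def using last_conv_nth by metis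
  thus "last rest \<in> ?X" using ts0(4) by auto
 qed
 have "{last rest, a} \<in> E0" using l(1) ts_nth(2)[of "n - 1" 1] ts0 rim' unfolding E0_def by (auto simp: doubleton_eq_iff)
 hence "conn E0 (insert a ?X)" using conn_insert[OF c l(2)] by blast
 moreover have "b \<in> ?X" using ts0 by (auto intro!: image_eqI[of _ _ 1])
 moreover have "?X \<subseteq> V" using ts_nth(1) ts0 by fastforce
 ultimately show ?thesis unfolding att_def using ts0(10) by (intro conjI) (auto intro!: exI[of _ "insert a ?X"])
qed

lemma frame:
 obtains Z P where "Z \<subseteq> V - {a, b}" "\<And>z. z \<in> Z ==> comp E Z z \<inter> set ts \<noteq> {}" "pth E0 P" "hd P = a" "last P = b"
  "set P = V - Z" "\<And>v X. v \<in> V - Z - {a, b} ==> conn E0 X ==> X \<subseteq> V - Z - {v} ==> a \<in> X ==> b \<in> X ==> False"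
proof -
 have "finite {Z. att Z}" by (rule finite_subset[of _ "Pow V"]) (use finV in \<open>auto simp: att_def\<close>)
 moreover have "{Z. att Z} \<noteq> {}" using att_empty by blast
 ultimately obtain Z where Z: "att Z" and max: "\<And>Z'. att Z' ==> card Z' \<le> card Z"
  using finite_max_element[of "{Z. att Z}" card] by blast
 have Z1: "Z \<subseteq> V - {a, b}" "\<And>z. z \<in> Z ==> comp E Z z \<inter> set ts \<noteq> {}" using Z unfolding att_def by blast+
 obtain X1 where X1: "conn E0 X1" "X1 \<subseteq> V - Z" "a \<in> X1" "b \<in> X1" using Z unfolding att_def by blast
 obtain P where P: "pth E0 P" "hd P = a" "last P = b" "set P \<subseteq> X1" using conn_obtain_pth[OF X1(1,3,4)] .
 have PV: "set P \<subseteq> V - Z" using P X1 by blast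
 \<comment> \<open>The vertices that every connection of \<open>a\<close> and \<open>b\<close>
   outside \<open>Z\<close> has to use. In the end they are exactly the inner vertices of
   \<open>P\<close>.\<close>
 define C where "C = {v \<in> V - Z - {a, b}. \<forall>X. conn E0 X \<longrightarrow> X \<subseteq> V - Z - {v} \<longrightarrow> a \<in> X \<longrightarrow> b \<notin> X}"
 \<comment> \<open>Such a vertex could otherwise be added to \<open>Z\<close>, against
   maximality.\<close>
 have cut: "v \<in> C" if v: "v \<in> V - Z - {a, b}" "v \<in> set ts \<or> v \<in> nb E V Z" for v
 proof (rule ccontr)
  assume "v \<notin> C"
  then obtain X where X: "conn E0 X" "X \<subseteq> V - Z - {v}" "a \<in> X" "b \<in> X" unfolding C_def using v by blast
  have cm: "comp E Z z \<subseteq> comp E (insert v Z) z" for z by (rule comp_mono) blast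
  have "comp E (insert v Z) z \<inter> set ts \<noteq> {}" if z: "z \<in> insert v Z" for z
  proof (cases "z = v")
   case False
   thus ?thesis using z Z1(2)[of z] cm[of z] by blast
  next
   case True
   show ?thesis
   proof (cases "v \<in> set ts")
    case True
    thus ?thesis using comp_self[of v "insert v Z" E] \<open>z = v\<close> by blast
   next
    case False
    then obtain y where y: "y \<in> Z" "{y, v} \<in> E" using v(2) unfolding nb_def by blast
    have "y \<in> comp E (insert v Z) v" using comp_step[OF comp_self[of v "insert v Z" E], of y] y by blast
    hence "comp E (insert v Z) y = comp E (insert v Z) v" by (rule comp_eq)
    thus ?thesis using Z1(2)[OF y(1)] cm[of y] \<open>z = v\<close> by auto
   qed
  qed
  hence "att (insert v Z)" unfolding att_def using Z1(1) v(1) X by (intro conjI exI[of _ X]) auto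
  from max[OF this] have "card (insert v Z) \<le> card Z" .
  moreover have "finite Z" using Z1 finV finite_subset by blast
  ultimately show False using v(1) by simp
 qed
 have Pne: "P \<noteq> []" "distinct P" using P(1) unfolding pth_def by auto
 have ab: "P ! 0 = a" "P ! (length P - 1) = b" using P(2,3) Pne by (auto simp: hd_conv_nth last_conv_nth)
 have CP: "C \<subseteq> set P" using conn_pth[OF P(1)] P Pne hd_in_set last_in_set PV unfolding C_def by blast
 have "V - Z - {a, b} - C = {}"
 proof (rule ccontr)
  assume "\<not> ?thesis"
  then obtain x0 where x0: "x0 \<in> V - Z - {a, b} - C" by blast
  define X where "X = comp E (V - Z - {a, b} - C) x0"
  have X: "X \<subseteq> V - Z - {a, b} - C" "x0 \<in> X" "conn E X"
   unfolding X_def using comp_subset[of E "V - Z - {a, b} - C" x0] comp_self[OF x0] by auto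
  have cX: "conn E0 X" by (rule conn0) (use X in auto)
  have XT: "X \<subseteq> V - set ts" using X cut by blast
  have nbX: "nb E V X \<subseteq> C \<union> {a, b}"
  proof
   fix y assume "y \<in> nb E V X"
   then obtain x where y: "y \<in> V - X" "x \<in> X" "{x, y} \<in> E" unfolding nb_def by blast
   have "y \<notin> Z" using y X cut[of x] unfolding nb_def by (force simp: insert_commute)
   moreover have "y \<notin> V - Z - {a, b} - C"
    using comp_step[of x E _ x0 y] y(2,3) y unfolding X_def by (auto simp: insert_commute)
   ultimately show "y \<in> C \<union> {a, b}" using y by blast
  qed
  define I where "I = {i. i < length P \<and> P ! i \<in> nb E V X}"
  have "C \<union> {a, b} \<subseteq> set P" using CP P Pne hd_in_set last_in_set by auto
  have "nb E V X \<subseteq> (!) P ` I"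
  proof
   fix y assume y: "y \<in> nb E V X"
   hence "y \<in> set P" using nbX \<open>C \<union> {a, b} \<subseteq> set P\<close> by blast
   then obtain m where "m < length P" "P ! m = y" by (metis in_set_conv_nth)
   thus "y \<in> (!) P ` I" using y unfolding I_def by blast
  qed
  hence "nb E V X = (!) P ` I" unfolding I_def by blast
  moreover have "4 \<le> card (nb E V X)" using irr XT X(2) unfolding irred_def ts_def by blast
  moreover have finI: "finite I" unfolding I_def by simp
  ultimately have cI: "4 \<le> card I" using card_image_le[of I "(!) P"] by simp
  hence Ine: "I \<noteq> {}" by auto
  define i k where "i = Min I" and "k = Max I"
  have ik: "i \<in> I" "k \<in> I" unfolding i_def k_def using Min_in Max_in finI Ine by blast+
  have bd: "i \<le> j" "j \<le> k" if "j \<in> I" for j using that finI unfolding i_def k_def by auto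
  have "\<exists>j\<in>I. j \<noteq> i \<and> j \<noteq> k"
  proof (rule ccontr)
   assume "\<not> ?thesis"
   hence "card I \<le> card {i, k}" by (intro card_mono) auto
   also have "\<dots> \<le> 2" by (simp add: card_insert_if)
   finally show False using cI by simp
  qed
  then obtain j where j: "j \<in> I" "i < j" "j < k" using bd by (metis le_neq_implies_less)
  have kl: "k < length P" using ik unfolding I_def by auto
  let ?X = "(!) P ` {0..i} \<union> X \<union> (!) P ` {k..length P - 1}"
  have c1: "conn E0 ((!) P ` {0..i})" "conn E0 ((!) P ` {k..length P - 1})"
   by (rule pth_seg[OF P(1)]; use ik kl in \<open>auto simp: I_def\<close>)+
  obtain x y where xy: "x \<in> X" "{x, P ! i} \<in> E" "y \<in> X" "{y, P ! k} \<in> E" using ik unfolding I_def nb_def by blast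
  have "{x, P ! i} \<in> E0" "{y, P ! k} \<in> E0" using xy X unfolding E0_def by (auto simp: doubleton_eq_iff)
  hence "conn E0 (X \<union> (!) P ` {0..i})" using conn_Un_edge[OF cX c1(1) xy(1), of "P ! i"] by simp
  hence "conn E0 (X \<union> (!) P ` {0..i} \<union> (!) P ` {k..length P - 1})"
   by (rule conn_Un_edge[OF _ c1(2), of _ y "P ! k"]) (use xy kl \<open>{y, P ! k} \<in> E0\<close> in auto)
  hence "conn E0 ?X" by (simp add: Un_ac)
  moreover have "a \<in> ?X" "b \<in> ?X" using ab(1) kl ab(2) by auto
  moreover have "?X \<subseteq> V - Z - {P ! j}"
  proof -
   have jl: "j < length P" using j kl by simp
   have pj: "P ! m = P ! j \<longleftrightarrow> m = j" if "m < length P" for m using nth_eq_iff_index_eq[OF Pne(2) that jl] .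
   have "P ! j \<notin> X" using j(1) unfolding I_def nb_def by blast
   moreover have "P ! m \<in> V - Z - {P ! j}" if "m < length P" "m \<noteq> j" for m using PV that pj nth_mem by blast
   ultimately show ?thesis using X(1) j kl by auto
  qed
  moreover have "P ! j \<in> C"
  proof -
   have "P ! j \<noteq> P ! 0" "P ! j \<noteq> P ! (length P - 1)" by (subst nth_eq_iff_index_eq[OF Pne(2)]; use j kl in linarith)+
   moreover have "P ! j \<in> C \<union> {a, b}" using j(1) nbX unfolding I_def by blast
   ultimately show ?thesis using ab by auto
  qed
  ultimately show False unfolding C_def by blast
 qed
 hence SP: "set P = V - Z" using CP P Pne hd_in_set last_in_set PV by blast
 show ?thesis
 proof (rule that[OF Z1(1) Z1(2) P(1-3) SP])
  fix v X assume "v \<in> V - Z - {a, b}" "conn E0 X" "X \<subseteq> V - Z - {v}" "a \<in> X" "b \<in> X"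
  moreover have "v \<in> C" using \<open>V - Z - {a, b} - C = {}\<close> calculation(1) by blast
  ultimately show False unfolding C_def by blast
 qed
qed

section \<open>The induced path outside a largest attached set\<close>

context
 fixes Z P
 assumes Z: "Z \<subseteq> V - {a, b}" "\<And>z. z \<in> Z ==> comp E Z z \<inter> set ts \<noteq> {}"
  and P: "pth E0 P" "hd P = a" "last P = b" "set P = V - Z"
  and cut: "\<And>v X. v \<in> V - Z - {a, b} ==> conn E0 X ==> X \<subseteq> V - Z - {v} ==> a \<in> X ==> b \<in> X ==> False"
begin

abbreviation p where "p i \<equiv> P ! i"
abbreviation L where "L \<equiv> length P - 1"
abbreviation seg where "seg i j \<equiv> (!) P ` {i..j}"

lemma Pne: "P \<noteq> []" "distinct P"
 using P(1) unfolding pth_def by auto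

lemma p_ends: "p 0 = a" "p L = b"
 using P(2,3) Pne by (auto simp: hd_conv_nth last_conv_nth)

lemma p_eq: "i \<le> L ==> j \<le> L ==> p i = p j \<longleftrightarrow> i = j"
proof -
 assume "i \<le> L" "j \<le> L"
 thus ?thesis using Pne(1) nth_eq_iff_index_eq[OF Pne(2)] by (cases P; simp)+
qed

lemma p_in: "i \<le> L ==> p i \<in> V" "i \<le> L ==> p i \<notin> Z"
proof -
 assume "i \<le> L"
 hence "i < length P" using Pne(1) by (cases P) auto
 hence "p i \<in> set P" by (rule nth_mem)
 thus "p i \<in> V" "p i \<notin> Z" using P(4) by auto
qed

lemma p_ab: "i \<le> L ==> p i = a \<longleftrightarrow> i = 0" "i \<le> L ==> p i = b \<longleftrightarrow> i = L"
 using p_eq[of i 0] p_eq[of i L] p_ends by auto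

lemma p_cases: "v \<in> V ==> v \<notin> Z ==> \<exists>i\<le>L. v = p i"
proof -
 assume "v \<in> V" "v \<notin> Z"
 hence "v \<in> set P" using P(4) by auto
 then obtain i where "i < length P" "v = p i" by (metis in_set_conv_nth)
 thus ?thesis by (intro exI[of _ i]) auto
qed

lemma seg_conn: "j \<le> L ==> conn E0 (seg i j)" "j \<le> L ==> conn E (seg i j)"
proof -
 assume "j \<le> L"
 hence "j < length P" using Pne(1) by (cases P) auto
 thus "conn E0 (seg i j)" by (rule pth_seg[OF P(1)])
 thus "conn E (seg i j)" by (rule conn0E)
qed

lemma seg_sub: "j \<le> L ==> seg i j \<subseteq> V - Z"
 using p_in by auto

lemma seg_disj: "j < k ==> l \<le> L ==> seg i j \<inter> seg k l = {}"
proof (rule ccontr)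
 assume h: "j < k" "l \<le> L" and "seg i j \<inter> seg k l \<noteq> {}"
 then obtain x y where xy: "p x = p y" "x \<le> j" "k \<le> y" "y \<le> l" by fastforce
 moreover have "x \<le> L" "y \<le> L" "x \<noteq> y" using xy h by auto
 ultimately show False using p_eq by blast
qed

lemma seg_mem: "i \<le> k ==> k \<le> j ==> p k \<in> seg i j"
 by auto

text \<open>A shortcut would bypass \<open>p (Suc i)\<close>, which every connection of
  \<open>a\<close> and \<open>b\<close> outside \<open>Z\<close> has to use.\<close>

lemma induced_less: "i < j ==> j \<le> L ==> {p i, p j} \<in> E0 ==> j = Suc i"
proof (rule ccontr)
 assume h: "i < j" "j \<le> L" "{p i, p j} \<in> E0" "j \<noteq> Suc i"
 let ?X = "seg 0 i \<union> seg j L"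
 have s: "Suc i < j" "Suc i \<le> L" using h by auto
 have "conn E0 ?X" by (rule conn_Un_edge[OF seg_conn(1) seg_conn(1), of _ _ "p i" _ "p j"]) (use h in auto)
 moreover have "a \<in> ?X" "b \<in> ?X" using p_ends seg_mem[of 0 0 i] seg_mem[of j L L] h by auto
 moreover have "?X \<subseteq> V - Z - {p (Suc i)}"
 proof -
  have "p m \<noteq> p (Suc i)" if "m \<le> i \<or> j \<le> m" "m \<le> L" for m using p_eq[OF that(2) s(2)] that(1) s by auto
  moreover have "seg 0 i \<subseteq> V - Z" "seg j L \<subseteq> V - Z" using seg_sub h by auto
  ultimately show ?thesis using h by fastforce
 qed
 moreover have "p (Suc i) \<in> V - Z - {a, b}" using p_in[OF s(2)] p_ab[OF s(2)] s h by auto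
 ultimately show False using cut by blast
qed

lemma induced: "i \<le> L ==> j \<le> L ==> {p i, p j} \<in> E0 ==> j = Suc i \<or> i = Suc j"
proof -
 assume h: "i \<le> L" "j \<le> L" "{p i, p j} \<in> E0"
 have "i \<noteq> j" using h(3) edge E0E by force
 thus ?thesis using induced_less[of i j] induced_less[of j i] h by (metis insert_commute nat_neq_iff)
qed

lemma E_E0: "{x, y} \<in> E ==> x \<noteq> a \<and> x \<noteq> b \<or> y \<noteq> a \<and> y \<noteq> b ==> {x, y} \<in> E0"
 unfolding E0_def by (auto simp: doubleton_eq_iff)

lemma L2: "2 \<le> L"
proof (rule ccontr)
 assume "\<not> 2 \<le> L"
 hence "L = 0 \<or> L = 1" by auto
 thus False
 proof
  assume "L = 0"
  thus False using p_ends ts0 by auto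
 next
  assume l: "L = 1"
  hence "{p 0, p (Suc 0)} \<in> E0" using pth_nth_edge[OF P(1), of 0] by auto
  thus False using p_ends l unfolding E0_def by auto
 qed
qed

lemma ts_distinct: "k < n ==> 2 \<le> k ==> ts ! k \<noteq> a \<and> ts ! k \<noteq> b"
 using ts_nth(2)[of k 0] ts_nth(2)[of k 1] ts0 by auto

lemma ts_V: "k < n ==> ts ! k \<in> V"
 using ts_nth(1) ts0(6) by blast

text \<open>If \<open>p i\<close> were \<open>ts ! j\<close>, the path would divide the boundary
  there. The connection that \<open>nochord\<close> provides across \<open>ts ! 0\<close>,
  \<open>ts ! 2\<close> or across \<open>ts ! 1\<close>, \<open>ts ! j\<close> must get past the
  path, and an edge where it does so is a chord of the induced path or yields disjoint sets that
  join \<open>a\<close> and \<open>b\<close> to boundary vertices in crossing position.\<close>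

lemma noT: "0 < i ==> i < L ==> p i \<notin> set ts"
proof
 assume i: "0 < i" "i < L" and "p i \<in> set ts"
 then obtain j where j: "2 \<le> j" "j < n" "ts ! j = p i" using p_ab[of i] i ts_index by auto
 have F2: False if q: "j < q" "q < n" "D \<subseteq> Z" "conn E D" "ts ! q \<in> D" "d \<in> D" "{d, p l} \<in> E" "i < l" "l \<le> L" for q D d l
 proof (rule cross_ab[of "seg 0 i" "D \<union> seg l L" j q])
  show "conn E (D \<union> seg l L)" by (rule conn_Un_edge[OF q(4) seg_conn(2), of _ d "p l"]) (use q in auto)
  have "seg 0 i \<subseteq> V - Z" using seg_sub[of i 0] i by simp
  moreover have "seg 0 i \<inter> seg l L = {}" using seg_disj[OF q(8), of L 0] by simp
  ultimately show "seg 0 i \<inter> (D \<union> seg l L) = {}" using q(3) by blast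
  show "b \<in> D \<union> seg l L" using seg_mem[of l L L] q(9) p_ends by auto
  show "a \<in> seg 0 i" using seg_mem[of 0 0 i] p_ends by auto
  show "seg 0 i \<subseteq> V" "D \<union> seg l L \<subseteq> V" using seg_sub[of i 0] seg_sub[of L l] q(3) Z i by auto
  show "ts ! j \<in> seg 0 i" unfolding j(3) using i by auto
 qed (use seg_conn i j q in auto)
 have F2': False if q: "j < q" "q < n" "ts ! q = p l" "i < l" "l \<le> L" for q l
 proof (rule cross_ab[of "seg 0 i" "seg l L" j q])
  show "seg 0 i \<inter> seg l L = {}" using seg_disj[OF q(4), of L 0] by blast
  show "b \<in> seg l L" using seg_mem[of l L L] q(5) p_ends by auto
  show "a \<in> seg 0 i" using seg_mem[of 0 0 i] p_ends by auto
  show "seg 0 i \<subseteq> V" "seg l L \<subseteq> V" using seg_sub[of i 0] seg_sub[of L l] i by auto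
  show "ts ! j \<in> seg 0 i" unfolding j(3) using i by auto
  show "ts ! q \<in> seg l L" unfolding q(3) using q by auto
 qed (use seg_conn i j q in auto)
 have idx: "\<exists>r. 2 \<le> r \<and> r < n \<and> r \<noteq> j \<and> ts ! r \<in> comp E Z z" if "z \<in> Z" for z
 proof -
  obtain t where t: "t \<in> comp E Z z" "t \<in> set ts" using Z(2)[OF \<open>z \<in> Z\<close>] by blast
  hence tZ: "t \<in> Z" using comp_subset[of E Z z] by blast
  then obtain r where r: "2 \<le> r" "r < n" "ts ! r = t" using ts_index[OF t(2)] Z(1) by blast
  thus ?thesis using tZ j(3) p_in(2)[of i] i r t by auto
 qed
 show False
 proof (cases "j = 2")
  case True
  have "\<exists>X. conn E X \<and> X \<subseteq> V - {ts ! 0, ts ! 2} \<and> (\<exists>k. 0 < k \<and> k < 2 \<and> ts ! k \<in> X) \<and> (\<exists>k<n. (k < 0 \<or> 2 < k) \<and> ts ! k \<in> X)"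
   unfolding ts_def n_def by (rule nochord) (use ts0(4) in \<open>auto simp: ts_def n_def\<close>)
  then obtain X k1 k where X: "conn E X" "X \<subseteq> V - {ts ! 0, ts ! 2}" "0 < k1" "k1 < 2" "ts ! k1 \<in> X" "k < n" "2 < k" "ts ! k \<in> X" by auto
  have "k1 = 1" using X(3,4) by auto
  hence bX: "b \<in> X" using X(5) ts0(2) by metis
  let ?A = "X \<inter> seg (Suc i) L"
  have "b \<in> ?A" using bX seg_mem[of "Suc i" L L] i p_ends by auto
  moreover have "ts ! k \<notin> ?A"
  proof
   assume "ts ! k \<in> ?A"
   then obtain l where "ts ! k = p l" "i < l" "l \<le> L" by auto
   thus False using F2'[of k l] X True by auto
  qed
  ultimately obtain y x where yx: "y \<in> ?A" "x \<in> X - ?A" "{x, y} \<in> E" using conn_edge[OF X(1), of ?A] X(8) by blast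
  obtain l where l: "y = p l" "i < l" "l \<le> L" using yx by auto
  show False
  proof (cases "x \<in> Z")
   case True
   obtain r where r: "2 \<le> r" "r < n" "r \<noteq> j" "ts ! r \<in> comp E Z x" using idx[OF True] by blast
   show False using F2[OF _ r(2) comp_subset conn_comp r(4) comp_self[OF True], of l] yx(3) l r \<open>j = 2\<close> by auto
  next
   case False
   then obtain h where h: "x = p h" "h \<le> L" using p_cases[of x] yx X by blast
   have "h \<le> i" using yx(2) h seg_mem[of "Suc i" h L] by (auto simp: not_less_eq_eq)
   moreover have "x \<noteq> p i" using yx(2) X(2) j(3) True by auto
   ultimately have hi: "h < i" using h(1) by (cases "h = i") auto
   have "{p h, p l} \<in> E0" using yx(2) X(2) ts0 p_ab[OF h(2)] h(1) hi i E_E0 yx(3) h l by auto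
   thus False using induced_less[of h l] hi l by auto
  qed
 next
  case False
  have "\<exists>X. conn E X \<and> X \<subseteq> V - {ts ! 1, ts ! j} \<and> (\<exists>k. 1 < k \<and> k < j \<and> ts ! k \<in> X) \<and> (\<exists>k<n. (k < 1 \<or> j < k) \<and> ts ! k \<in> X)"
   unfolding ts_def n_def by (rule nochord) (use j False in \<open>auto simp: ts_def n_def\<close>)
  then obtain X k q where X: "conn E X" "X \<subseteq> V - {ts ! 1, ts ! j}" "1 < k" "k < j" "ts ! k \<in> X" "q < n" "q < 1 \<or> j < q" "ts ! q \<in> X" by auto
  have bX: "b \<notin> X" "p i \<notin> X" using X(2) ts0 j by auto
  \<comment> \<open>The vertices of \<open>Z\<close> whose component reaches the boundary strictly
    between \<open>b\<close> and \<open>ts ! j\<close>.\<close>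
  define S where "S = {z \<in> Z. \<exists>k. 1 < k \<and> k < j \<and> ts ! k \<in> comp E Z z}"
  let ?A = "X \<inter> (seg (Suc i) L \<union> S)"
  have F1: False if k: "1 < k" "k < j" "conn E D" "D \<subseteq> V" "D \<inter> seg i L = {}" "ts ! k \<in> D" "a \<in> D" for k D
  proof (rule cross_ab[of D "seg i L" k j])
   show "b \<in> seg i L" using seg_mem[of i L L] i p_ends by auto
   show "ts ! j \<in> seg i L" unfolding j(3) using i by auto
  qed (use k j seg_conn(2)[of L i] seg_sub[of L i] in auto)
  have "ts ! k \<in> ?A"
  proof (cases "ts ! k \<in> Z")
   case True
   thus ?thesis using X comp_self[OF True, of E] unfolding S_def by blast
  next
   case f: False
   have kn: "k < n" using X j by auto
   obtain h where h: "ts ! k = p h" "h \<le> L" using p_cases[OF ts_V[OF kn] f] by blast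
   have "\<not> h < i"
   proof
    assume "h < i"
    thus False
     using F1[of k "seg 0 h"] X seg_conn(2)[of h 0] seg_sub[of h 0] seg_disj[of h i L 0] h seg_mem[of 0 0 h] seg_mem[of 0 h h] p_ends by auto
   qed
   moreover have "h \<noteq> i" using h j ts_nth(2)[OF kn j(2)] X by auto
   ultimately show ?thesis using h X(5) by auto
  qed
  moreover have "ts ! q \<notin> ?A"
  proof
   assume A: "ts ! q \<in> ?A"
   have "q \<noteq> 0"
   proof
    assume "q = 0"
    then obtain l where "a = p l" "Suc i \<le> l" "l \<le> L" using A ts0 unfolding S_def using Z(1) by auto
    thus False using p_ab(1)[of l] by auto
   qed
   hence q: "j < q" using X(7) by auto
   show False
   proof (cases "ts ! q \<in> Z")
    case True
    then obtain k' where k': "1 < k'" "k' < j" "ts ! k' \<in> comp E Z (ts ! q)"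
     using seg_sub[of L "Suc i"] A unfolding S_def by blast
    show False
    proof (rule no_cross[of "seg i L" "comp E Z (ts ! q)" 1 k' j q])
     show "seg i L \<inter> comp E Z (ts ! q) = {}" using seg_sub[of L i] comp_subset[of E Z "ts ! q"] by auto
     show "ts ! 1 \<in> seg i L" using seg_mem[of i L L] i p_ends ts0 by auto
     show "ts ! j \<in> seg i L" unfolding j(3) using i by auto
     show "ts ! q \<in> comp E Z (ts ! q)" using comp_self True .
     show "comp E Z (ts ! q) \<subseteq> V" using comp_subset[of E Z "ts ! q"] Z(1) by auto
    qed (use k' q X j seg_conn(2)[of L i] seg_sub[of L i] in auto)
   next
    case f: False
    then obtain l where l: "ts ! q = p l" "Suc i \<le> l" "l \<le> L" using A unfolding S_def by auto
    show False by (rule F2'[OF q X(6) l(1) _ l(3)]) (use l in simp)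
   qed
  qed
  ultimately obtain y x where yx: "y \<in> ?A" "x \<in> X - ?A" "{x, y} \<in> E" using conn_edge[OF X(1), of ?A] X(8) by blast
  have xP: "\<exists>h<i. x = p h" if xz: "x \<notin> Z"
  proof -
   obtain h where h: "x = p h" "h \<le> L" using yx(2) X(2) p_cases[OF _ xz] by blast
   have "h \<le> i" using yx(2) h seg_mem[of "Suc i" h L] by (auto simp: not_less_eq_eq)
   moreover have "x \<noteq> p i" using yx(2) bX by auto
   ultimately show ?thesis using h by (metis le_neq_implies_less)
  qed
  show False
  proof (cases "y \<in> Z")
   case False
   then obtain l where l: "y = p l" "i < l" "l \<le> L" using yx unfolding S_def by auto
   show False
   proof (cases "x \<in> Z")
    case True
    obtain r where r: "2 \<le> r" "r < n" "r \<noteq> j" "ts ! r \<in> comp E Z x" using idx[OF True] by blast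
    have "\<not> r < j"
    proof
     assume "r < j"
     moreover have "1 < r" using r(1) by simp
     ultimately have "x \<in> S" using r True unfolding S_def by blast
     thus False using yx by blast
    qed
    hence "j < r" using r by auto
    thus False using F2[OF _ r(2) comp_subset conn_comp r(4) comp_self[OF True], of l] yx(3) l by auto
   next
    case False
    then obtain h where h: "x = p h" "h < i" using xP by blast
    have "{p h, p l} \<in> E0" using yx(1) bX p_ab[OF l(3)] l E_E0 yx(3) h by auto
    thus False using induced_less[of h l] h l by auto
   qed
  next
   case True
   then obtain k' where k': "1 < k'" "k' < j" "ts ! k' \<in> comp E Z y" using seg_sub[of L "Suc i"] yx unfolding S_def by blast
   show False
   proof (cases "x \<in> Z")
    case t: True
    have "x \<in> comp E Z y" by (rule comp_step[OF comp_self[OF True] t yx(3)])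
    hence "comp E Z x = comp E Z y" by (rule comp_eq)
    hence "x \<in> S" using k' t unfolding S_def by auto
    thus False using yx by blast
   next
    case False
    then obtain h where h: "x = p h" "h < i" using xP by blast
    have c: "conn E (seg 0 h \<union> comp E Z y)"
     by (rule conn_Un_edge[OF seg_conn(2) conn_comp, of _ "p h" _ y]) (use h i yx comp_self[OF True] in auto)
    have d: "(seg 0 h \<union> comp E Z y) \<inter> seg i L = {}"
     using seg_disj[OF h(2), of L 0] seg_sub[of L i] comp_subset[of E Z y] by blast
    have v: "seg 0 h \<union> comp E Z y \<subseteq> V" using seg_sub[of h 0] h i comp_subset[of E Z y] Z(1) by fastforce
    show False using F1[OF k'(1,2) c v d] k'(3) seg_mem[of 0 0 h] p_ends by auto
   qed
  qed
 qed
qed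

lemma TZ: "2 \<le> k ==> k < n ==> ts ! k \<in> Z"
proof (rule ccontr)
 assume k: "2 \<le> k" "k < n" "ts ! k \<notin> Z"
 obtain i where i: "ts ! k = p i" "i \<le> L" using p_cases[OF ts_V[OF k(2)] k(3)] by blast
 hence "i \<noteq> 0" "i \<noteq> L" using ts_distinct[OF k(2,1)] p_ends by metis+
 thus False using noT[of i] i ts_nth(1)[OF k(2)] by auto
qed

lemma conn_Z: "conn E Z"
proof -
 let ?T = "(!) ts ` {2..n - 1}"
 have T: "conn E ?T" "?T \<subseteq> Z" "ts ! 2 \<in> ?T" using seg_rim[of "n - 1" 2] TZ ts0(4) by auto
 have "z \<in> comp E Z (ts ! 2)" if "z \<in> Z" for z
 proof -
  obtain t where t: "t \<in> comp E Z z" "t \<in> set ts" using Z(2)[OF \<open>z \<in> Z\<close>] by blast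
  hence tZ: "t \<in> Z" using comp_subset[of E Z z] by blast
  then obtain r where r: "2 \<le> r" "r < n" "ts ! r = t" using ts_index[OF t(2)] Z(1) by blast
  hence "t \<in> comp E Z (ts ! 2)" using comp_superset[OF T] by auto
  hence "comp E Z t = comp E Z (ts ! 2)" by (rule comp_eq)
  thus ?thesis using comp_sym[OF t(1)] by simp
 qed
 hence "Z = comp E Z (ts ! 2)" using comp_subset[of E Z "ts ! 2"] by blast
 thus ?thesis using conn_comp[of E Z "ts ! 2"] by simp
qed

text \<open>Two disjoint parts of \<open>Z\<close> whose attachments to the path interleave, where
  the part in the middle reaches the boundary. In a planar picture this cannot occur;
  \<open>nobad\<close> derives its absence from crossfreeness and irreducibility.\<close>

definition bad where
 "bad k i l \<longleftrightarrow> k < i \<and> i < l \<and> l \<le> L \<and> (\<exists>\<alpha> \<beta>. conn E \<alpha> \<and> conn E \<beta> \<and> \<alpha> \<subseteq> Z \<and> \<beta> \<subseteq> Z \<and> \<alpha> \<inter> \<beta> = {} \<and>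
   \<alpha> \<inter> set ts \<noteq> {} \<and> (\<exists>x\<in>\<alpha>. {x, p i} \<in> E) \<and> (\<exists>x\<in>\<beta>. {x, p k} \<in> E) \<and> (\<exists>x\<in>\<beta>. {x, p l} \<in> E))"

lemma badI: "conn E \<alpha> ==> conn E \<beta> ==> \<alpha> \<subseteq> Z ==> \<beta> \<subseteq> Z ==> \<alpha> \<inter> \<beta> = {} ==> \<alpha> \<inter> set ts \<noteq> {} ==>
  \<exists>x\<in>\<alpha>. {x, p i} \<in> E ==> \<exists>x\<in>\<beta>. {x, p k} \<in> E ==> \<exists>x\<in>\<beta>. {x, p l} \<in> E ==> k < i ==> i < l ==> l \<le> L ==> bad k i l"
 unfolding bad_def by blast

text \<open>Both parts reach the boundary. Prolong the middle part along the path to one of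
  \<open>a\<close>, \<open>b\<close> and the other part to the opposite end; the order of the two
  boundary vertices tells which choice gives a crossing.\<close>

lemma two_exits:
 assumes c: "conn E \<alpha>" "conn E \<beta>" "\<alpha> \<subseteq> Z" "\<beta> \<subseteq> Z" "\<alpha> \<inter> \<beta> = {}" and T: "\<alpha> \<inter> set ts \<noteq> {}" "\<beta> \<inter> set ts \<noteq> {}"
  and adj: "\<exists>x\<in>\<alpha>. {x, p j} \<in> E" "\<exists>x\<in>\<beta>. {x, p k} \<in> E" "\<exists>x\<in>\<beta>. {x, p l} \<in> E" and kl: "k < j" "j < l" "l \<le> L"
 shows False
proof -
 have ex: "\<exists>x. 2 \<le> x \<and> x < n \<and> ts ! x \<in> \<alpha>" if "\<alpha> \<subseteq> Z" "\<alpha> \<inter> set ts \<noteq> {}" for \<alpha> using that ts_index Z(1) by blast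
 obtain x y where x: "2 \<le> x" "x < n" "ts ! x \<in> \<alpha>" and y: "2 \<le> y" "y < n" "ts ! y \<in> \<beta>" using ex c T by meson
 have "x \<noteq> y" using x y c(5) by auto
 have left: "conn E (seg 0 m \<union> \<alpha>)" "a \<in> seg 0 m \<union> \<alpha>" "seg 0 m \<union> \<alpha> \<subseteq> V" if h: "conn E \<alpha>" "\<alpha> \<subseteq> Z" "\<exists>x\<in>\<alpha>. {x, p m} \<in> E" "m \<le> L" for m \<alpha>
 proof -
  obtain u where u: "u \<in> \<alpha>" "{u, p m} \<in> E" using h by blast
  show "conn E (seg 0 m \<union> \<alpha>)"
   by (rule conn_Un_edge[OF seg_conn(2) h(1), of _ "p m" _ u]) (use u h in \<open>auto simp: insert_commute\<close>)
  show "a \<in> seg 0 m \<union> \<alpha>" using seg_mem[of 0 0 m] p_ends by auto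
  show "seg 0 m \<union> \<alpha> \<subseteq> V" using seg_sub[of m 0] h Z(1) by auto
 qed
 have right: "conn E (seg m L \<union> \<alpha>)" "b \<in> seg m L \<union> \<alpha>" "seg m L \<union> \<alpha> \<subseteq> V" if h: "conn E \<alpha>" "\<alpha> \<subseteq> Z" "\<exists>x\<in>\<alpha>. {x, p m} \<in> E" "m \<le> L" for m \<alpha>
 proof -
  obtain u where u: "u \<in> \<alpha>" "{u, p m} \<in> E" using h by blast
  show "conn E (seg m L \<union> \<alpha>)"
   by (rule conn_Un_edge[OF seg_conn(2) h(1), of _ "p m" _ u]) (use u h in \<open>auto simp: insert_commute\<close>)
  show "b \<in> seg m L \<union> \<alpha>" using seg_mem[of m L L] h(4) p_ends by auto
  show "seg m L \<union> \<alpha> \<subseteq> V" using seg_sub[of L m] h Z(1) by auto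
 qed
 have dis: "(seg 0 m \<union> \<alpha>) \<inter> (seg m' L \<union> \<beta>) = {}" if h: "m < m'" "m' \<le> L" "\<alpha> \<subseteq> Z" "\<beta> \<subseteq> Z" "\<alpha> \<inter> \<beta> = {}" for m m' \<alpha> \<beta>
 proof -
  have "seg 0 m \<subseteq> V - Z" "seg m' L \<subseteq> V - Z" using seg_sub[of m 0] seg_sub[of L m'] h by auto
  thus ?thesis using seg_disj[OF h(1), of L 0] h(3-5) by blast
 qed
 show False
 proof (cases "x < y")
  case True
  have jL: "j \<le> L" using kl by simp
  show False by (rule cross_ab[OF left(1)[OF c(1,3) adj(1) jL] right(1)[OF c(2,4) adj(3) kl(3)] left(3)[OF c(1,3) adj(1) jL]
    right(3)[OF c(2,4) adj(3) kl(3)] dis[OF kl(2,3) c(3-5)] x(1) True y(2)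
    left(2)[OF c(1,3) adj(1) jL] right(2)[OF c(2,4) adj(3) kl(3)]]) (use x y in auto)
 next
  case False
  hence yx: "y < x" using \<open>x \<noteq> y\<close> by simp
  have jL: "j \<le> L" "k \<le> L" using kl by simp_all
  have d: "\<beta> \<inter> \<alpha> = {}" using c(5) by blast
  show False
   by (rule cross_ab[OF left(1)[OF c(2,4) adj(2) jL(2)] right(1)[OF c(1,3) adj(1) jL(1)] left(3)[OF c(2,4) adj(2) jL(2)]
    right(3)[OF c(1,3) adj(1) jL(1)] dis[OF kl(1) jL(1) c(4,3) d] y(1) yx x(2)
    left(2)[OF c(2,4) adj(2) jL(2)] right(2)[OF c(1,3) adj(1) jL(1)]]) (use x y in auto)
 qed
qed

text \<open>The vertices that \<open>z\<close> cuts off from the boundary inside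
  \<open>Z\<close>.\<close>

definition Dz where "Dz z = {x \<in> Z - {z}. comp E (Z - {z}) x \<inter> set ts = {}}"

text \<open>\<open>Dz z\<close> and the part of the path strictly between \<open>q1\<close> and
  \<open>q2\<close> have no neighbours other than \<open>z\<close>, \<open>p q1\<close> and
  \<open>p q2\<close>, which irreducibility forbids.\<close>

lemma trap:
 assumes z: "z \<in> Z" and q: "q1 < q2" "q2 \<le> L"
  and h1: "\<And>x j. x \<in> Dz z ==> j \<le> L ==> {x, p j} \<in> E ==> q1 \<le> j \<and> j \<le> q2"
  and h2: "\<And>j y. q1 < j ==> j < q2 ==> y \<in> Z ==> {y, p j} \<in> E ==> y \<in> Dz z \<union> {z}"
  and ne: "Dz z \<noteq> {} \<or> Suc q1 < q2"
 shows False
proof -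
 let ?X = "Dz z \<union> (!) P ` {q1<..<q2}"
 have DZ: "Dz z \<subseteq> Z" unfolding Dz_def by blast
 have "nb E V ?X \<subseteq> {z, p q1, p q2}"
 proof
  fix v assume "v \<in> nb E V ?X"
  then obtain x where v: "v \<in> V" "v \<notin> ?X" "x \<in> ?X" "{x, v} \<in> E" unfolding nb_def by blast
  show "v \<in> {z, p q1, p q2}"
  proof (cases "x \<in> Dz z")
   case True
   show ?thesis
   proof (cases "v \<in> Z")
    case t: True
    have "v = z"
    proof (rule ccontr)
     assume "v \<noteq> z"
     have "x \<in> Z - {z}" using True unfolding Dz_def by blast
     have "v \<in> comp E (Z - {z}) x"
      by (rule comp_step[OF comp_self[OF \<open>x \<in> Z - {z}\<close>]]) (use t \<open>v \<noteq> z\<close> v(4) in \<open>auto simp: insert_commute\<close>)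
     hence "comp E (Z - {z}) v = comp E (Z - {z}) x" by (rule comp_eq)
     hence "v \<in> Dz z" using True t \<open>v \<noteq> z\<close> unfolding Dz_def by auto
     thus False using v(2) by blast
    qed
    thus ?thesis by blast
   next
    case False
    then obtain j where j: "v = p j" "j \<le> L" using p_cases v(1) by blast
    hence "q1 \<le> j" "j \<le> q2" using h1[OF True j(2)] v(4) by auto
    moreover have "\<not> (q1 < j \<and> j < q2)" using v(2) j(1) by auto
    ultimately show ?thesis using j by auto
   qed
  next
   case False
   then obtain j where j: "x = p j" "q1 < j" "j < q2" using v(3) by auto
   show ?thesis
   proof (cases "v \<in> Z")
    case True
    thus ?thesis using h2[OF j(2,3)] v(4) j(1) v(2) by (auto simp: insert_commute)
   next
    case False
    then obtain h where h: "v = p h" "h \<le> L" using p_cases v(1) by blast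
    have jL: "j \<le> L" using j q by auto
    have "h = Suc j \<or> j = Suc h" using p_ab[OF jL] j q E_E0 v(4) h induced jL by auto
    hence "q1 \<le> h" "h \<le> q2" using j by auto
    moreover have "\<not> (q1 < h \<and> h < q2)" using v(2) h(1) by auto
    ultimately show ?thesis using h by auto
   qed
  qed
 qed
 hence "card (nb E V ?X) \<le> card {z, p q1, p q2}" by (intro card_mono) auto
 also have "\<dots> \<le> 3" by (simp add: card_insert_if)
 finally have "card (nb E V ?X) \<le> 3" .
 moreover have "?X \<subseteq> V - set ts"
 proof -
  have "Dz z \<inter> set ts = {}" using comp_self[of _ "Z - {z}" E] unfolding Dz_def by blast
  moreover have "Dz z \<subseteq> V" using DZ Z(1) by blast
  moreover have "p j \<in> V - set ts" if "q1 < j" "j < q2" for j using noT[of j] p_in(1)[of j] that q by auto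
  ultimately show ?thesis by auto
 qed
 moreover have "?X \<noteq> {}" using ne by auto
 moreover have "irred E V (set ts)" using irr unfolding ts_def .
 ultimately have "4 \<le> card (nb E V ?X)" unfolding irred_def by blast
 thus False using \<open>card (nb E V ?X) \<le> 3\<close> by simp
qed

text \<open>In each case \<beta> borrows one of the two paths to reach the boundary, while the other
  path, if necessary reached through \<open>D\<close>, is attached to \<open>P\<close> strictly
  between \<open>k\<close> and \<open>l\<close>. This is the situation excluded by
  \<open>two_exits\<close>.\<close>

lemma link_beta:
 assumes AB: "pth E A" "pth E B" "set A \<subseteq> Z" "set B \<subseteq> Z" "set A \<inter> set B = {}"
  and T: "last A \<in> set ts" "last B \<in> set ts"
  and \<beta>: "conn E \<beta>" "\<beta> \<subseteq> Z" "\<exists>x\<in>\<beta>. {x, p k} \<in> E" "\<exists>x\<in>\<beta>. {x, p l} \<in> E" and l: "l \<le> L"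
  and U: "set A \<inter> U = {hd A}" "set B \<inter> U = {hd B}"
   "U = \<beta> \<union> {y \<in> Z. \<exists>j. k < j \<and> j < l \<and> {y, p j} \<in> E}"
 shows "hd A \<in> \<beta> ==> hd B \<notin> \<beta> ==> False"
  and "hd A \<notin> \<beta> ==> hd B \<notin> \<beta> ==> conn E D ==> D \<subseteq> Z ==> D \<inter> \<beta> \<noteq> {} ==> D \<inter> set A \<noteq> {} ==> D \<inter> set B = {} ==> False"
  and "hd A \<in> \<beta> ==> hd B \<in> \<beta> ==> conn E D ==> D \<subseteq> Z ==> D \<inter> \<beta> = {} ==> D \<inter> set A \<noteq> {} ==> D \<inter> set B = {} ==>
   k < j ==> j < l ==> \<exists>x\<in>D. {x, p j} \<in> E ==> False"
proof -
 have ne: "A \<noteq> []" "B \<noteq> []" "hd A \<in> set A" "hd B \<in> set B" "last A \<in> set A" "last B \<in> set B"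
  using AB unfolding pth_def by auto
 have cAB: "conn E (set A)" "conn E (set B)" using AB conn_pth by blast+
 have \<beta>U: "\<beta> \<subseteq> U" using U(3) by blast
 have adj: "\<exists>j. k < j \<and> j < l \<and> (\<exists>x\<in>set B. {x, p j} \<in> E)" if hB: "hd B \<notin> \<beta>"
 proof -
  have "hd B \<in> set B \<inter> U" unfolding U(2) by simp
  hence "hd B \<in> U" by simp
  thus ?thesis using hB unfolding U(3) using ne(4) by blast
 qed
 have B\<beta>: "set B \<inter> \<beta> = {}" if hB: "hd B \<notin> \<beta>"
 proof (rule equals0I)
  fix x assume x: "x \<in> set B \<inter> \<beta>"
  hence "x \<in> set B \<inter> U" using \<beta>U by auto
  hence "x = hd B" unfolding U(2) by simp
  thus False using x hB by simp
 qed
 show False if h: "hd A \<in> \<beta>" "hd B \<notin> \<beta>"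
 proof -
  obtain j where j: "k < j" "j < l" "\<exists>x\<in>set B. {x, p j} \<in> E" using adj[OF h(2)] by blast
  have "conn E (\<beta> \<union> set A)" using conn_Un[OF \<beta>(1) cAB(1) h(1) ne(3)] .
  moreover have "set B \<inter> (\<beta> \<union> set A) = {}" using B\<beta>[OF h(2)] AB(5) by blast
  moreover have "\<exists>x\<in>\<beta> \<union> set A. {x, p k} \<in> E" "\<exists>x\<in>\<beta> \<union> set A. {x, p l} \<in> E" using \<beta>(3,4) by blast+
  moreover have "set B \<inter> set ts \<noteq> {}" "(\<beta> \<union> set A) \<inter> set ts \<noteq> {}" using T ne by blast+
  moreover have "\<beta> \<union> set A \<subseteq> Z" using \<beta>(2) AB(3) by blast
  ultimately show False using two_exits[OF cAB(2), of "\<beta> \<union> set A" j k l] AB(4) j l by blast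
 qed
 show False if h: "hd A \<notin> \<beta>" "hd B \<notin> \<beta>" "conn E D" "D \<subseteq> Z" "D \<inter> \<beta> \<noteq> {}" "D \<inter> set A \<noteq> {}" "D \<inter> set B = {}"
 proof -
  obtain j where j: "k < j" "j < l" "\<exists>x\<in>set B. {x, p j} \<in> E" using adj[OF h(2)] by blast
  obtain u v where u: "u \<in> D" "u \<in> \<beta>" and v: "v \<in> D" "v \<in> set A" using h by blast
  let ?\<beta> = "\<beta> \<union> D \<union> set A"
  have "conn E ?\<beta>" using conn_Un[OF conn_Un[OF \<beta>(1) h(3) u(2,1)] cAB(1) _ v(2)] v(1) by blast
  moreover have "set B \<inter> ?\<beta> = {}" using B\<beta>[OF h(2)] AB(5) h(7) by blast
  moreover have "\<exists>x\<in>?\<beta>. {x, p k} \<in> E" "\<exists>x\<in>?\<beta>. {x, p l} \<in> E" using \<beta>(3,4) by blast+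
  moreover have "set B \<inter> set ts \<noteq> {}" "?\<beta> \<inter> set ts \<noteq> {}" using T ne by blast+
  moreover have "?\<beta> \<subseteq> Z" using \<beta>(2) AB(3) h(4) by blast
  ultimately show False using two_exits[OF cAB(2), of ?\<beta> j k l] AB(4) j l by blast
 qed
 show False if h: "hd A \<in> \<beta>" "hd B \<in> \<beta>" "conn E D" "D \<subseteq> Z" "D \<inter> \<beta> = {}" "D \<inter> set A \<noteq> {}" "D \<inter> set B = {}"
  and j: "k < j" "j < l" "\<exists>x\<in>D. {x, p j} \<in> E"
 proof -
  obtain v where v: "v \<in> D" "v \<in> set A" using h by blast
  have A: "A = hd A # tl A" using ne by simp
  have "v \<noteq> hd A" using v h by blast
  hence vt: "v \<in> set (tl A)" using v(2) A by (metis set_ConsD)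
  hence t: "tl A \<noteq> []" by auto
  have "pth E (tl A)" using pth_append(2)[of E "[hd A]" "tl A"] AB(1) A t by simp
  hence "conn E (set (tl A))" by (rule conn_pth)
  hence c: "conn E (D \<union> set (tl A))" using conn_Un[OF h(3) _ v(1) vt] by blast
  have tA: "set (tl A) \<subseteq> set A" using A by (metis list.set_sel(2) ne(1) subsetI)
  have "distinct (hd A # tl A)" using AB(1) A unfolding pth_def by simp
  have "set (tl A) \<inter> \<beta> = {}"
  proof (rule equals0I)
   fix x assume x: "x \<in> set (tl A) \<inter> \<beta>"
   hence "x \<in> set A \<inter> U" using \<beta>U tA by auto
   hence "x = hd A" unfolding U(1) by simp
   thus False using x \<open>distinct (hd A # tl A)\<close> by simp
  qed
  moreover have "conn E (\<beta> \<union> set B)" using conn_Un[OF \<beta>(1) cAB(2) h(2) ne(4)] .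
  ultimately have "(D \<union> set (tl A)) \<inter> (\<beta> \<union> set B) = {}" using h(5,7) tA AB(5) by blast
  moreover have "last A \<in> set (tl A)" using t by (metis A last_ConsR last_in_set)
  hence "(D \<union> set (tl A)) \<inter> set ts \<noteq> {}" using T by blast
  moreover have "(\<beta> \<union> set B) \<inter> set ts \<noteq> {}" using T ne by blast
  moreover have "\<exists>x\<in>\<beta> \<union> set B. {x, p k} \<in> E" "\<exists>x\<in>\<beta> \<union> set B. {x, p l} \<in> E" using \<beta>(3,4) by blast+
  moreover have "\<exists>x\<in>D \<union> set (tl A). {x, p j} \<in> E" using j(3) by blast
  moreover have "D \<union> set (tl A) \<subseteq> Z" "\<beta> \<union> set B \<subseteq> Z" using tA AB(3,4) h(4) \<beta>(2) by blast+
  ultimately show False using two_exits[OF c \<open>conn E (\<beta> \<union> set B)\<close>, of j k l] j l by blast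
 qed
qed

lemma Dz_conn:
 assumes z: "z \<in> Z"
 shows "conn E (Dz z \<union> {z})"
proof -
 have "d \<in> comp E (Dz z \<union> {z}) z" if d: "d \<in> Dz z" for d
 proof -
  let ?c = "comp E (Z - {z}) d"
  have dZ: "d \<in> Z - {z}" using d unfolding Dz_def by blast
  have "?c \<subseteq> Dz z" using comp_eq d comp_subset[of E "Z - {z}" d] unfolding Dz_def by force
  moreover obtain y x where yx: "y \<in> ?c" "x \<in> Z - (Z - {z})" "{x, y} \<in> E"
   using z comp_subset[of E "Z - {z}" d] comp_edge_out[OF conn_Z _ dZ, of z] by blast
  hence "conn E (insert z ?c)" using conn_insert[OF conn_comp yx(1)] yx(3) by (simp add: insert_commute)
  moreover have "d \<in> ?c" using comp_self[OF dZ] .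
  ultimately show ?thesis using comp_superset[of E "insert z ?c" "Dz z \<union> {z}" z] by blast
 qed
 hence "Dz z \<union> {z} = comp E (Dz z \<union> {z}) z" using comp_self[of z "Dz z \<union> {z}" E] comp_subset[of E "Dz z \<union> {z}" z] by blast
 thus ?thesis using conn_comp[of E "Dz z \<union> {z}" z] by simp
qed

lemma finE: "finite E"
 using finV edge by (meson PowI finite_Pow_iff finite_subset subsetI)

text \<open>Take a bad triple of largest span. By Menger's theorem either two disjoint paths lead
  from \<open>U\<close> to the boundary, which \<open>link_beta\<close> and \<open>two_exits\<close>
  exclude, or one vertex \<open>z\<close> cuts \<open>U\<close> off. Then \<open>trap\<close>
  applies to the extreme attachments of \<open>Dz z\<close>, unless something attached between them
  reaches the boundary without \<open>z\<close>; but that gives a bad triple of larger span.\<close>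

lemma nobad: "\<not> bad k i l"
proof
 assume "bad k i l"
 let ?B = "{(k, i, l). bad k i l}"
 have "?B \<subseteq> {..L} \<times> {..L} \<times> {..L}" unfolding bad_def by auto
 hence "finite ?B" by (rule finite_subset) simp
 then obtain t where t: "t \<in> ?B" and mx: "\<forall>u\<in>?B. (\<lambda>(k, i, l). l - k) u \<le> (\<lambda>(k, i, l). l - k) t"
  using \<open>bad k i l\<close> finite_max_element[of ?B "\<lambda>(k, i, l). l - k"] by blast
 obtain k i l where tt: "t = (k, i, l)" by (metis prod_cases3)
 have b: "bad k i l" using t tt by simp
 have max: "l' - k' \<le> l - k" if "bad k' i' l'" for k' i' l' using mx[rule_format, of "(k', i', l')"] that tt by simp
 obtain \<alpha> \<beta> where c: "conn E \<alpha>" "conn E \<beta>" "\<alpha> \<subseteq> Z" "\<beta> \<subseteq> Z" "\<alpha> \<inter> \<beta> = {}" "\<alpha> \<inter> set ts \<noteq> {}" and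
  adj: "\<exists>x\<in>\<alpha>. {x, p i} \<in> E" "\<exists>x\<in>\<beta>. {x, p k} \<in> E" "\<exists>x\<in>\<beta>. {x, p l} \<in> E" and kil: "k < i" "i < l" "l \<le> L"
  using b unfolding bad_def by blast
 have \<beta>T: "\<beta> \<inter> set ts = {}" using two_exits[OF c(1-6) _ adj kil] by blast
 \<comment> \<open>Besides \<beta> these are the vertices of \<open>Z\<close> attached to the path
   strictly between \<open>k\<close> and \<open>l\<close>; the set \<alpha> contains one of
   them.\<close>
 define U where "U = \<beta> \<union> {y \<in> Z. \<exists>j. k < j \<and> j < l \<and> {y, p j} \<in> E}"
 have UZ: "U \<subseteq> Z" using c(4) unfolding U_def by blast
 obtain x1 where x1: "x1 \<in> \<alpha>" "x1 \<in> U" using adj(1) kil c(3) unfolding U_def by blast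
 define Q where "Q z X \<longleftrightarrow> conn E X \<and> X \<subseteq> Z - {z} \<and> X \<inter> U \<noteq> {} \<and> X \<inter> set ts \<noteq> {}" for z X
 show False
 proof (cases "\<forall>z. \<exists>X. Q z X")
  case True
  obtain A B where AB: "pth E A" "pth E B" "set A \<subseteq> Z" "set B \<subseteq> Z" "set A \<inter> set B = {}"
   "set A \<inter> U = {hd A}" "set A \<inter> set ts = {last A}" "set B \<inter> U = {hd B}" "set B \<inter> set ts = {last B}"
   using menger2[OF finE, of Z U "set ts"] True unfolding Q_def by blast
  have l: "last A \<in> set ts" "last B \<in> set ts" using AB(7,9) by blast+
  have BA: "set B \<inter> set A = {}" using AB(5) by blast
  note AtoB = link_beta[OF AB(1-5) l c(2,4) adj(2,3) kil(3) AB(6,8) U_def]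
  note BtoA = link_beta[OF AB(2,1,4,3) BA l(2,1) c(2,4) adj(2,3) kil(3) AB(8,6) U_def]
  consider "hd A \<in> \<beta>" "hd B \<in> \<beta>" | "hd A \<notin> \<beta>" "hd B \<notin> \<beta>" using AtoB(1) BtoA(1) by blast
  thus False
  proof cases
   case 1
   show False
   proof (cases "\<alpha> \<inter> (set A \<union> set B) = {}")
    case True
    have cA: "conn E (\<beta> \<union> set A)" using conn_Un[OF c(2) conn_pth[OF AB(1)] 1(1)] AB(1) unfolding pth_def by simp
    have "(\<beta> \<union> set A) \<inter> set ts \<noteq> {}" using AB(7) by blast
    moreover have "\<alpha> \<inter> (\<beta> \<union> set A) = {}" using True c(5) by blast
    moreover have "\<beta> \<union> set A \<subseteq> Z" using c(4) AB(3) by blast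
    moreover have "\<exists>x\<in>\<beta> \<union> set A. {x, p k} \<in> E" "\<exists>x\<in>\<beta> \<union> set A. {x, p l} \<in> E" using adj by blast+
    ultimately show False using two_exits[OF c(1) cA c(3) _ _ c(6) _ adj(1) _ _ kil] by blast
   next
    case False
    have "\<alpha> \<inter> {x1} \<noteq> {}" using x1 by blast
    obtain D where D: "pth E D" "set D \<subseteq> \<alpha>" "set D \<inter> {x1} = {hd D}" "set D \<inter> (set A \<union> set B) = {last D}"
     using conn_obtain_trimmed[OF c(1) \<open>\<alpha> \<inter> {x1} \<noteq> {}\<close> False] .
    have Dc: "conn E (set D)" "set D \<subseteq> Z" "set D \<inter> \<beta> = {}" using conn_pth[OF D(1)] D(2) c(3,5) by blast+
    obtain j where j: "k < j" "j < l" "{x1, p j} \<in> E" using x1(1) c(5) x1(2) unfolding U_def by auto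
    have "hd D \<in> set D \<inter> {x1}" unfolding D(3) by simp
    hence "x1 \<in> set D" by (metis IntE singletonD)
    hence j': "\<exists>x\<in>set D. {x, p j} \<in> E" using j by blast
    have "last D \<in> set A \<or> last D \<in> set B" using last_hit[OF D(4) AB(5)] by blast
    thus False
    proof
     assume "last D \<in> set A"
     hence "set D \<inter> set A \<noteq> {}" "set D \<inter> set B = {}" using last_hit[OF D(4) AB(5)] by auto
     thus False using AtoB(3)[OF 1 Dc _ _ j(1,2) j'] by blast
    next
     assume "last D \<in> set B"
     hence "set D \<inter> set B \<noteq> {}" "set D \<inter> set A = {}" using last_hit[OF D(4) AB(5)] by auto
     thus False using BtoA(3)[OF 1(2,1) Dc _ _ j(1,2) j'] by blast
    qed
   qed
  next
   case 2
   have "Z \<inter> \<beta> \<noteq> {}" using adj(2) c(4) by auto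
   have "A \<noteq> []" using AB(1) unfolding pth_def by simp
   hence "Z \<inter> (set A \<union> set B) \<noteq> {}" using AB(3) by (cases A) auto
   obtain D where D: "pth E D" "set D \<subseteq> Z" "set D \<inter> \<beta> = {hd D}" "set D \<inter> (set A \<union> set B) = {last D}"
    using conn_obtain_trimmed[OF conn_Z \<open>Z \<inter> \<beta> \<noteq> {}\<close> \<open>Z \<inter> (set A \<union> set B) \<noteq> {}\<close>] .
   have Dc: "conn E (set D)" "set D \<subseteq> Z" "set D \<inter> \<beta> \<noteq> {}" using conn_pth[OF D(1)] D(2,3) by blast+
   have "last D \<in> set A \<or> last D \<in> set B" using last_hit[OF D(4) AB(5)] by blast
   thus False
   proof
    assume "last D \<in> set A"
    hence "set D \<inter> set A \<noteq> {}" "set D \<inter> set B = {}" using last_hit[OF D(4) AB(5)] by auto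
    thus False using AtoB(2)[OF 2 Dc] by blast
   next
    assume "last D \<in> set B"
    hence "set D \<inter> set B \<noteq> {}" "set D \<inter> set A = {}" using last_hit[OF D(4) AB(5)] by auto
    thus False using BtoA(2)[OF 2(2,1) Dc] by blast
   qed
  qed
 next
  case False
  then obtain z where zz: "\<nexists>X. conn E X \<and> X \<subseteq> Z - {z} \<and> X \<inter> U \<noteq> {} \<and> X \<inter> set ts \<noteq> {}" unfolding Q_def[symmetric] by blast
  have z: "X \<inter> set ts = {}" if "conn E X" "X \<subseteq> Z - {z}" "X \<inter> U \<noteq> {}" for X
   by (rule ccontr) (rule notE[OF zz], intro exI[of _ X] conjI that)
  have z\<alpha>: "z \<in> \<alpha>" using z[OF c(1)] c(3,6) x1 by blast
  hence zZ: "z \<in> Z" using c(3) by blast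
  have UD: "U \<subseteq> Dz z \<union> {z}"
  proof
   fix u assume u: "u \<in> U"
   show "u \<in> Dz z \<union> {z}"
   proof (cases "u = z")
    case False
    hence uZ: "u \<in> Z - {z}" using u UZ by blast
    thus ?thesis using z[OF conn_comp comp_subset, of u] comp_self[OF uZ] u uZ unfolding Dz_def by blast
   qed blast
  qed
  let ?J = "{j. j \<le> L \<and> (\<exists>x\<in>Dz z. {x, p j} \<in> E)}"
  have finJ: "finite ?J" by simp
  \<comment> \<open>Since \<open>z\<close> lies in \<alpha>, all of \<beta> is contained in
    \<open>Dz z\<close>, and so \<open>k\<close> and \<open>l\<close> are among the attachments of
    \<open>Dz z\<close>.\<close>
  have kJ: "k \<in> ?J" "l \<in> ?J" using UD z\<alpha> c(5) unfolding U_def using adj kil by auto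
  define q1 q2 where "q1 = Min ?J" and "q2 = Max ?J"
  have q: "q1 \<in> ?J" "q2 \<in> ?J" unfolding q1_def q2_def using Min_in[OF finJ] Max_in[OF finJ] kJ by blast+
  have bd: "q1 \<le> j" "j \<le> q2" if "j \<in> ?J" for j using that finJ unfolding q1_def q2_def by auto
  have ql: "q1 \<le> k" "l \<le> q2" using bd kJ by blast+
  show False
  proof (rule trap[OF zZ, of q1 q2])
   show "q1 < q2" using ql kil by simp
   show "q2 \<le> L" using q by blast
   show "q1 \<le> j \<and> j \<le> q2" if "x \<in> Dz z" "j \<le> L" "{x, p j} \<in> E" for x j using bd[of j] that by blast
   show "Dz z \<noteq> {} \<or> Suc q1 < q2" using q by blast
   fix j y assume j: "q1 < j" "j < q2" "y \<in> Z" "{y, p j} \<in> E"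
   show "y \<in> Dz z \<union> {z}"
   proof (rule ccontr)
    assume y: "y \<notin> Dz z \<union> {z}"
    show False
    proof (cases "q1 = k \<and> q2 = l")
     case True
     hence "y \<in> U" using j unfolding U_def by blast
     thus False using UD y by blast
    next
     case False
     have yZ: "y \<in> Z - {z}" using y j by blast
     let ?a = "comp E (Z - {z}) y"
     have a: "?a \<inter> set ts \<noteq> {}" using y yZ unfolding Dz_def by blast
     have "x \<notin> ?a" if x: "x \<in> Dz z \<union> {z}" for x
      using comp_eq comp_subset[of E "Z - {z}" y] a x that unfolding Dz_def by force
     hence d: "?a \<inter> (Dz z \<union> {z}) = {}" by blast
     have "bad q1 j q2"
     proof (rule badI[of ?a "Dz z \<union> {z}"])
      show "conn E (Dz z \<union> {z})" using Dz_conn[OF zZ] .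
      show "?a \<subseteq> Z" using comp_subset[of E "Z - {z}" y] by blast
      show "Dz z \<union> {z} \<subseteq> Z" using zZ unfolding Dz_def by blast
      show "\<exists>x\<in>?a. {x, p j} \<in> E" using comp_self[OF yZ] j(4) by blast
      show "\<exists>x\<in>Dz z \<union> {z}. {x, p q1} \<in> E" "\<exists>x\<in>Dz z \<union> {z}. {x, p q2} \<in> E" using q by blast+
     qed (use j q a d in auto)
     from max[OF this] show False using ql False kil by auto
    qed
   qed
  qed
 qed
qed

text \<open>A common neighbour \<open>c\<close> in \<open>Z\<close> would give a bad triple spanning
  the whole path, with \<open>{c}\<close> as outer part, or cut off a set with three neighbours. On
  the path only \<open>p 1\<close> is joined to \<open>a\<close> by an edge other than
  \<open>{a, b}\<close>. This determines the triangle over the peeled edge.\<close>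

lemma common_neighbour:
 assumes c: "{a, c} \<in> E" "{b, c} \<in> E"
 shows "c = p 1"
proof -
 have "card {a, c} = 2" "card {b, c} = 2" using c edge by blast+
 hence cab: "c \<noteq> a" "c \<noteq> b" by auto
 have cV: "c \<in> V" using c edge by blast
 show ?thesis
 proof (cases "c \<in> Z")
  case False
  then obtain i where i: "c = p i" "i \<le> L" using p_cases[OF cV] by blast
  show ?thesis using E_E0[OF c(1)] cab i p_ends induced[of 0 i] by simp
 next
  case True
  have False
  proof (rule trap[OF True, of 0 L])
   show "0 < L" "Dz c \<noteq> {} \<or> Suc 0 < L" using L2 by auto
   fix j y assume j: "0 < j" "j < L" "y \<in> Z" "{y, p j} \<in> E"
   show "y \<in> Dz c \<union> {c}"
   proof (rule ccontr)
    assume y: "y \<notin> Dz c \<union> {c}"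
    have yZ: "y \<in> Z - {c}" using y j by blast
    let ?a = "comp E (Z - {c}) y"
    have a: "?a \<inter> set ts \<noteq> {}" using y yZ unfolding Dz_def by blast
    have "bad 0 j L"
    proof (rule badI[of ?a "{c}"])
     show "?a \<subseteq> Z" "?a \<inter> {c} = {}" using comp_subset[of E "Z - {c}" y] by blast+
     show "\<exists>x\<in>?a. {x, p j} \<in> E" using comp_self[OF yZ] j(4) by blast
     show "\<exists>x\<in>{c}. {x, p 0} \<in> E" "\<exists>x\<in>{c}. {x, p L} \<in> E" using c p_ends by (auto simp: insert_commute)
    qed (use j a True in auto)
    thus False using nobad by blast
   qed
  qed auto
  thus ?thesis by blast
 qed
qed

text \<open>The boundary vertex \<open>ts ! x\<close> of \<open>X\<close> leaves \<open>Z\<close> at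
  some \<open>p i\<close>. Beyond \<open>p i\<close> the set \<open>Y\<close> cannot reach the path:
  it would have to use a chord of the path or produce a bad triple. For \<open>y = 1\<close> this is
  already a contradiction; otherwise \<open>Y\<close> is prolonged along the path to
  \<open>a\<close> and \<open>X\<close> to \<open>b\<close>, which gives a crossing of the old
  boundary.\<close>

lemma cross_w:
 assumes c: "conn E0 X" "conn E0 Y" "X \<subseteq> V" "Y \<subseteq> V" "X \<inter> Y = {}"
  and m: "p 1 \<in> X" "a \<in> Y" "1 \<le> y" "y < x" "x < n" "ts ! y \<in> Y" "ts ! x \<in> X"
 shows False
proof -
 have exit: "\<exists>i\<le>L. p i \<in> X \<and> (\<exists>u\<in>comp E (X \<inter> Z) t. {u, p i} \<in> E)"
  if h: "conn E0 X" "X \<subseteq> V" "t \<in> X" "t \<in> Z" "v \<in> X" "v \<notin> Z" for X t v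
 proof -
  have t: "t \<in> X \<inter> Z" using h by blast
  have "v \<in> X - comp E (X \<inter> Z) t" using h comp_subset[of E "X \<inter> Z" t] by blast
  from comp_edge_out[OF conn0E[OF h(1)] _ t this] obtain u v' where
   u: "u \<in> comp E (X \<inter> Z) t" "v' \<in> X - X \<inter> Z" "{v', u} \<in> E" by blast
  obtain i where "v' = p i" "i \<le> L" using u(2) h(2) p_cases by blast
  thus ?thesis using u by (auto simp: insert_commute)
 qed
 have L1: "1 \<le> L" using L2 by simp
 have pZ: "p 1 \<notin> Z" "a \<notin> Z" using p_in(2)[OF L1] Z(1) by auto
 have xZ: "ts ! x \<in> Z" using TZ m by simp
 let ?\<alpha> = "comp E (X \<inter> Z) (ts ! x)"
 obtain i where i: "i \<le> L" "p i \<in> X" "\<exists>u\<in>?\<alpha>. {u, p i} \<in> E" using exit[OF c(1,3) m(7) xZ m(1) pZ(1)] by blast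
 have \<alpha>: "ts ! x \<in> ?\<alpha>" "?\<alpha> \<subseteq> X \<inter> Z" using comp_self[of "ts ! x" "X \<inter> Z" E] m xZ comp_subset[of E "X \<inter> Z" "ts ! x"] by auto
 have xts: "ts ! x \<in> set ts" using ts_nth m by blast
 have jump: False if l: "i < l" "l \<le> L" "p l \<in> Y" for l
 proof -
  have "0 < i" using i(2) m(2) c(5) p_ends by (cases i) auto
  let ?A = "Y \<inter> (seg 0 (i - 1) \<union> {z \<in> Z. \<exists>u\<in>comp E (Y \<inter> Z) z. \<exists>s<i. {u, p s} \<in> E})"
  have "a \<in> ?A" using m(2) seg_mem[of 0 0 "i - 1"] p_ends by auto
  moreover have "p l \<in> Y - ?A" using seg_disj[of "i - 1" l l 0] l \<open>0 < i\<close> p_in(2)[OF l(2)] by auto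
  ultimately obtain v u where vu: "v \<in> ?A" "u \<in> Y - ?A" "{u, v} \<in> E0" using conn_edge[OF c(2), of ?A] by blast
  have uV: "u \<in> V" using vu c(4) by blast
  have vuE: "{u, v} \<in> E" using vu E0E by blast
  have uP: "\<exists>t\<le>L. i < t \<and> u = p t" if uz: "u \<notin> Z"
  proof -
   obtain t where t: "u = p t" "t \<le> L" using p_cases[OF uV uz] by blast
   have "t \<noteq> i" using t vu(2) i(2) c(5) by blast
   moreover have "\<not> t < i" using vu unfolding t(1) by auto
   ultimately show ?thesis using t by (metis nat_neq_iff)
  qed
  show False
  proof (cases "v \<in> Z")
   case False
   then obtain s where s: "v = p s" "s < i" using vu(1) \<open>0 < i\<close> by auto
   show False
   proof (cases "u \<in> Z")
    case True
    have "u \<in> comp E (Y \<inter> Z) u" by (rule comp_self) (use vu True in blast)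
    hence "u \<in> {z \<in> Z. \<exists>u\<in>comp E (Y \<inter> Z) z. \<exists>s<i. {u, p s} \<in> E}" using s vuE True by blast
    thus False using vu by blast
   next
    case False
    then obtain t where "t \<le> L" "i < t" "u = p t" using uP by blast
    thus False using induced_less[of s t] s vu(3) by (auto simp: insert_commute)
   qed
  next
   case True
   have "i - 1 \<le> L" using i by simp
   hence "seg 0 (i - 1) \<subseteq> V - Z" by (rule seg_sub)
   then obtain u' s where us: "u' \<in> comp E (Y \<inter> Z) v" "s < i" "{u', p s} \<in> E" using True vu(1) by blast
   have vYZ: "v \<in> Y \<inter> Z" using vu True by blast
   show False
   proof (cases "u \<in> Z")
    case t: True
    have "u \<in> comp E (Y \<inter> Z) v" by (rule comp_step[OF comp_self[OF vYZ] _ vuE]) (use t vu in blast)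
    hence "comp E (Y \<inter> Z) u = comp E (Y \<inter> Z) v" by (rule comp_eq)
    hence "u \<in> {z \<in> Z. \<exists>u\<in>comp E (Y \<inter> Z) z. \<exists>s<i. {u, p s} \<in> E}" using us t by auto
    thus False using vu by blast
   next
    case False
    then obtain t where t: "t \<le> L" "i < t" "u = p t" using uP by blast
    have "bad s i t"
    proof (rule badI[of ?\<alpha> "comp E (Y \<inter> Z) v"])
     show "?\<alpha> \<subseteq> Z" "comp E (Y \<inter> Z) v \<subseteq> Z" "?\<alpha> \<inter> comp E (Y \<inter> Z) v = {}" using \<alpha>(2) comp_subset[of E "Y \<inter> Z" v] c(5) by blast+
     show "?\<alpha> \<inter> set ts \<noteq> {}" using \<alpha>(1) xts by blast
     show "\<exists>x\<in>comp E (Y \<inter> Z) v. {x, p s} \<in> E" using us by blast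
     show "\<exists>x\<in>comp E (Y \<inter> Z) v. {x, p t} \<in> E" using comp_self[OF vYZ] vuE t by (auto simp: insert_commute)
    qed (use us t i in auto)
    thus False using nobad by blast
   qed
  qed
 qed
 show False
 proof (cases "y = 1")
  case True
  hence "p L \<in> Y" using m ts0 p_ends by simp
  moreover have "i \<noteq> L" using calculation i(2) c(5) by blast
  ultimately show False using jump[of L] i by auto
 next
  case False
  hence y2: "2 \<le> y" "y < n" using m by auto
  hence yZ: "ts ! y \<in> Z" using TZ by blast
  let ?\<beta> = "comp E (Y \<inter> Z) (ts ! y)"
  obtain l where l: "l \<le> L" "p l \<in> Y" "\<exists>u\<in>?\<beta>. {u, p l} \<in> E" using exit[OF c(2,4) m(6) yZ m(2) pZ(2)] by blast
  have \<beta>: "ts ! y \<in> ?\<beta>" "?\<beta> \<subseteq> Y \<inter> Z" using comp_self[of "ts ! y" "Y \<inter> Z" E] m yZ comp_subset[of E "Y \<inter> Z" "ts ! y"] by auto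
  have "l \<noteq> i" using l(2) i(2) c(5) by blast
  hence "l < i" using jump[OF _ l(1,2)] by (metis nat_neq_iff)
  obtain u v where u: "u \<in> ?\<beta>" "{u, p l} \<in> E" and v: "v \<in> ?\<alpha>" "{v, p i} \<in> E" using l(3) i(3) by blast
  show False
  proof (rule cross_ab[of "seg 0 l \<union> ?\<beta>" "seg i L \<union> ?\<alpha>" y x])
   show "conn E (seg 0 l \<union> ?\<beta>)"
    by (rule conn_Un_edge[OF seg_conn(2)[OF l(1)] conn_comp, of "p l" 0 u]) (use u in \<open>auto simp: insert_commute\<close>)
   show "conn E (seg i L \<union> ?\<alpha>)"
    by (rule conn_Un_edge[OF seg_conn(2) conn_comp, of L "p i" i v]) (use v i in \<open>auto simp: insert_commute\<close>)
   have s: "seg 0 l \<subseteq> V - Z" "seg i L \<subseteq> V - Z" using seg_sub[of l 0] seg_sub[of L i] l by auto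
   thus "seg 0 l \<union> ?\<beta> \<subseteq> V" "seg i L \<union> ?\<alpha> \<subseteq> V" using \<alpha>(2) \<beta>(2) c(3,4) by blast+
   have "seg 0 l \<inter> seg i L = {}" using seg_disj[OF \<open>l < i\<close>, of L 0] by simp
   thus "(seg 0 l \<union> ?\<beta>) \<inter> (seg i L \<union> ?\<alpha>) = {}" using s \<alpha>(2) \<beta>(2) c(5) by blast
   show "a \<in> seg 0 l \<union> ?\<beta>" using seg_mem[of 0 0 l] p_ends by auto
   show "b \<in> seg i L \<union> ?\<alpha>" using seg_mem[of i L L] i p_ends by auto
  qed (use y2 m \<alpha> \<beta> in auto)
 qed
qed

text \<open>The new vertex has position 1, so it can only be the first or the second of four
  increasing positions. If it is the first and \<open>a\<close> is not in the opposite set, the edge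
  from \<open>a\<close> to \<open>p 1\<close> lets \<open>a\<close> take its place; otherwise
  \<open>cross_w\<close> applies.\<close>

lemma crossfree_w: "crossfree E0 V (a # p 1 # b # rest)"
 unfolding crossfree_def
proof (intro allI impI notI)
 fix i j k l :: nat
 let ?ts = "a # p 1 # b # rest"
 assume o: "i < j" "j < k" "k < l" "l < length ?ts"
  and "lk E0 V (?ts ! i) (?ts ! k) (?ts ! j) (?ts ! l)"
 then obtain X Y where c: "conn E0 X" "conn E0 Y" "X \<subseteq> V" "Y \<subseteq> V" "X \<inter> Y = {}"
  and m: "?ts ! i \<in> X" "?ts ! k \<in> X" "?ts ! j \<in> Y" "?ts ! l \<in> Y" unfolding lk_def by blast
 \<comment> \<open>Behind the inserted vertex all positions are shifted by one.\<close>
 have tn: "?ts ! q = ts ! (q - 1)" if "2 \<le> q" for q using that unfolding ts_def by (cases q; cases "q - 1") auto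
 have n: "length ?ts = Suc n" unfolding n_def ts_def by simp
 have YX: "Y \<inter> X = {}" using c by blast
 consider "i = 1" | "j = 1" | "i \<noteq> 1" "j \<noteq> 1" by blast
 thus False
 proof cases
  case 1
  have mm: "p 1 \<in> X" "ts ! (k - 1) \<in> X" "ts ! (j - 1) \<in> Y" "ts ! (l - 1) \<in> Y" using m tn[of k] tn[of j] tn[of l] 1 o by auto
  show False
  proof (cases "a \<in> Y")
   case True
   show False by (rule cross_w[OF c mm(1) True, of "j - 1" "k - 1"]) (use o 1 n mm in auto)
  next
   case False
   have "{p 0, p (Suc 0)} \<in> E0" by (rule pth_nth_edge[OF P(1)]) (use L2 in auto)
   hence "conn E0 (insert a X)" using conn_insert[OF c(1) mm(1), of a] p_ends by (simp add: insert_commute)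
   hence "conn E (insert a X)" by (rule conn0E)
   moreover have "insert a X \<subseteq> V" "insert a X \<inter> Y = {}" using c(3,5) ts0(10) False by auto
   moreover have "0 < j - 1" "j - 1 < k - 1" "k - 1 < l - 1" "l - 1 < n" using o 1 n by auto
   moreover have "ts ! 0 \<in> insert a X" "ts ! (k - 1) \<in> insert a X" using ts0(1) mm by auto
   ultimately show False using no_cross[of "insert a X" Y 0 "j - 1" "k - 1" "l - 1"] conn0E[OF c(2)] c(4) mm by blast
  qed
 next
  case 2
  have mm: "a \<in> X" "p 1 \<in> Y" "ts ! (k - 1) \<in> X" "ts ! (l - 1) \<in> Y" using m tn[of k] tn[of l] 2 o by auto
  show False by (rule cross_w[OF c(2,1,4,3) YX mm(2,1), of "k - 1" "l - 1"]) (use o 2 n mm in auto)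
 next
  case 3
  have ti: "?ts ! i = ts ! (i - 1)" using tn[of i] 3 unfolding ts_def by (cases i) auto
  have mm: "ts ! (i - 1) \<in> X" "ts ! (k - 1) \<in> X" "ts ! (j - 1) \<in> Y" "ts ! (l - 1) \<in> Y"
   using m tn[of k] tn[of l] tn[of j] ti 3 o by auto
  have "i - 1 < j - 1" "j - 1 < k - 1" "k - 1 < l - 1" "l - 1 < n" using o 3 n by auto
  from no_cross[OF conn0E[OF c(1)] conn0E[OF c(2)] c(3-5) this mm(1,3,2,4)] show False .
 qed
qed

end

lemma peel:
 obtains w where "w \<in> V" "w \<notin> set (a # b # rest)" "crossfree (E - {{a, b}}) V (a # w # b # rest)"
  "\<And>c. {a, c} \<in> E ==> {b, c} \<in> E ==> c = w"
proof -
 obtain Z P where f: "Z \<subseteq> V - {a, b}" "\<And>z. z \<in> Z ==> comp E Z z \<inter> set ts \<noteq> {}" "pth E0 P" "hd P = a" "last P = b"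
  "set P = V - Z" "\<And>v X. v \<in> V - Z - {a, b} ==> conn E0 X ==> X \<subseteq> V - Z - {v} ==> a \<in> X ==> b \<in> X ==> False"
  by (rule frame) blast
 show ?thesis
 proof (rule that[of "P ! 1"])
  have l: "2 \<le> length P - 1" by (rule L2[OF f])
  show "P ! 1 \<in> V" by (rule p_in(1)[OF f]) (use l in auto)
  show "P ! 1 \<notin> set (a # b # rest)" using noT[OF f, where i = 1] l unfolding ts_def by auto
  show "crossfree (E - {{a, b}}) V (a # P ! 1 # b # rest)" using crossfree_w[OF f] unfolding E0_def .
  show "\<And>c. {a, c} \<in> E ==> {b, c} \<in> E ==> c = P ! 1" by (rule common_neighbour[OF f])
 qed
qed

end

section \<open>Webs\<close>

text \<open>A web has the boundary cycle given by its last argument; \<open>M\<close> collects triangles that must stay facial.\<close>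

inductive web :: "'v set \<Rightarrow> 'v set set \<Rightarrow> 'v set set \<Rightarrow> 'v list \<Rightarrow> bool" where
 tri: "distinct [a, b, c] ==> web {a, b, c} {{a, b}, {b, c}, {a, c}} {{a, b, c}} [a, b, c]"
| peel: "web V E M (u # w # v # ys) ==> ys \<noteq> [] ==>
  web V (insert {u, v} E) (insert {u, w, v} {m \<in> M. \<not> {u, v} \<subseteq> m}) (u # v # ys)"
| glue: "web V1 E1 M1 (xs @ u # v # ys) ==> web V2 E2 M2 (u # zs @ [v]) ==> V1 \<inter> V2 = {u, v} ==>
  zs \<noteq> [] ==> xs @ ys \<noteq> [] ==> web (V1 \<union> V2) (E1 \<union> E2) (M1 \<union> M2) (xs @ u # zs @ v # ys)"

definition rim :: "'v list \<Rightarrow> 'v set set" where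
 "rim ts = insert {last ts, hd ts} {{ts ! i, ts ! Suc i} | i. Suc i < length ts}"

lemma conn_insert_other: "conn (insert {u, v} E) X ==> u \<notin> X \<or> v \<notin> X ==> conn E X"
proof (rule connI)
 fix Y assume c: "conn (insert {u, v} E) X" and ab: "u \<notin> X \<or> v \<notin> X" and Y: "Y \<subseteq> X" "Y \<noteq> {}" "\<And>y x. y \<in> Y ==> x \<in> X - Y ==> {x, y} \<notin> E"
 show "Y = X"
 proof (rule ccontr)
  assume "Y \<noteq> X"
  then obtain y x where yx: "y \<in> Y" "x \<in> X - Y" "{x, y} \<in> insert {u, v} E" using conn_edge[OF c Y(1,2)] by blast
  hence "{x, y} = {u, v}" using Y(3)[OF yx(1,2)] by blast
  thus False using ab yx Y(1) by (metis DiffD1 insertCI insert_iff singletonD subsetD)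
 qed
qed

lemma conn_insert_split:
 assumes c: "conn (insert {u, v} E) X" "a \<in> X" "b \<in> X" and n: "b \<notin> comp E X a"
 shows "(u \<in> comp E X a \<and> v \<in> comp E X b) \<or> (v \<in> comp E X a \<and> u \<in> comp E X b)"
proof -
 have out: "u \<in> comp E X a \<or> v \<in> comp E X a" if h: "a \<in> X" "b \<in> X" "b \<notin> comp E X a" for a b
 proof -
  obtain y x where yx: "y \<in> comp E X a" "x \<in> X - comp E X a" "{x, y} \<in> insert {u, v} E"
   using comp_self[OF h(1)] h conn_edge[OF c(1) comp_subset] by blast+
  thus ?thesis using comp_step[OF yx(1)] yx(1) by (auto simp: doubleton_eq_iff)
 qed
 have n': "a \<notin> comp E X b" using n comp_sym by metis
 have "False" if "t \<in> comp E X a" "t \<in> comp E X b" for t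
  using comp_eq[OF that(1)] comp_eq[OF that(2)] comp_self[OF c(3)] n by metis
 thus ?thesis using out[OF c(2,3) n] out[OF c(3,2) n'] by blast
qed

lemma lk_insert_aux:
 assumes c: "conn (insert {u, v} E) X" "conn E Y" "X \<subseteq> V" "Y \<subseteq> V" "X \<inter> Y = {}" "a \<in> X" "b \<in> X" "c \<in> Y" "d \<in> Y"
 shows "lk E V a b c d \<or> lk E V a u c d \<and> lk E V v b c d \<or> lk E V a v c d \<and> lk E V u b c d"
proof (cases "b \<in> comp E X a")
 case True
 have "lk E V a b c d" by (rule lkI[of E "comp E X a" Y]) (use c True comp_self[of a X E] comp_subset[of E X a] in auto)
 thus ?thesis by blast
next
 case False
 have l: "lk E V x y c d" if "x \<in> comp E X y'" "y \<in> comp E X y'" for x y y'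
  by (rule lkI[of E "comp E X y'" Y]) (use c that comp_subset[of E X y'] in auto)
 show ?thesis using conn_insert_split[OF c(1,6,7) False] l comp_self[OF c(6), of E] comp_self[OF c(7), of E] by blast
qed

text \<open>Only one of two disjoint sets can use the new edge; cutting it there leaves two
  linkages, one ending in \<open>u\<close> and one in \<open>v\<close>.\<close>

lemma lk_insert:
 assumes "lk (insert {u, v} E) V a b c d"
 shows "lk E V a b c d \<or> (lk E V a u c d \<and> lk E V v b c d) \<or> (lk E V a v c d \<and> lk E V u b c d) \<or>
  (lk E V a b c u \<and> lk E V a b v d) \<or> (lk E V a b c v \<and> lk E V a b u d)"
proof -
 obtain X Y where c: "X \<subseteq> V" "Y \<subseteq> V" "X \<inter> Y = {}" "conn (insert {u, v} E) X" "conn (insert {u, v} E) Y"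
  "a \<in> X" "b \<in> X" "c \<in> Y" "d \<in> Y" using assms unfolding lk_def by blast
 have YX: "Y \<inter> X = {}" using c(3) by blast
 have "u \<notin> X \<or> u \<notin> Y" using c(3) by blast
 then consider "conn E Y" | "conn E X" using conn_insert_other c(4,5) by metis
 thus ?thesis
 proof cases
  case 1
  show ?thesis using lk_insert_aux[OF c(4) 1 c(1-3,6-9)] by blast
 next
  case 2
  have "lk E V c d a b \<or> lk E V c u a b \<and> lk E V v d a b \<or> lk E V c v a b \<and> lk E V u d a b"
   using lk_insert_aux[OF c(5) 2 c(2,1) YX c(8,9,6,7)] .
  thus ?thesis by (simp add: lk_ac) (metis lk_ac)
 qed
qed

text \<open>The positions \<open>q\<close> and \<open>s\<close> lie on different sides of the pair
  \<open>p\<close>, \<open>r\<close>; the four disjuncts run through the possible orders within the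
  pairs.\<close>

definition alt where
 "alt p r q (s::nat) \<longleftrightarrow> (p < q \<and> q < r \<and> (s < p \<or> r < s)) \<or> (r < q \<and> q < p \<and> (s < r \<or> p < s)) \<or>
  (p < s \<and> s < r \<and> (q < p \<or> r < q)) \<or> (r < s \<and> s < p \<and> (q < r \<or> p < q))"

lemma crossfree_alt:
 assumes cf: "crossfree E V ts" and a: "alt p r q s" and b: "p < length ts" "q < length ts" "r < length ts" "s < length ts"
 shows "\<not> lk E V (ts ! p) (ts ! r) (ts ! q) (ts ! s)"
proof -
 have c: "\<not> lk E V (ts ! i) (ts ! k) (ts ! j) (ts ! l)" if "i < j" "j < k" "k < l" "l < length ts" for i j k l
  using cf that unfolding crossfree_def by blast
 consider "p < q" "q < r" "s < p" | "p < q" "q < r" "r < s" | "r < q" "q < p" "s < r" | "r < q" "q < p" "p < s"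
  | "p < s" "s < r" "q < p" | "p < s" "s < r" "r < q" | "r < s" "s < p" "q < r" | "r < s" "s < p" "p < q"
  using a unfolding alt_def by blast
 thus ?thesis
 proof cases
  case 1 thus ?thesis using c[of s p q r] b by (simp add: lk_ac)
 next
  case 2 thus ?thesis using c[of p q r s] b by (simp add: lk_ac)
 next
  case 3 thus ?thesis using c[of s r q p] b by (simp add: lk_ac)
 next
  case 4 thus ?thesis using c[of r q p s] b by (simp add: lk_ac)
 next
  case 5 thus ?thesis using c[of q p s r] b by (simp add: lk_ac)
 next
  case 6 thus ?thesis using c[of p s r q] b by (simp add: lk_ac)
 next
  case 7 thus ?thesis using c[of q r s p] b by (simp add: lk_ac)
 next
  case 8 thus ?thesis using c[of r s p q] b by (simp add: lk_ac)
 qed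
qed

text \<open>Neighbouring positions on the rim lie on the same side of every pair that avoids them.
  So if a crossing linkage used the new edge, one of the two linkages obtained by cutting it there
  would still cross.\<close>

lemma crossfree_rim_edge:
 assumes cf: "crossfree E V ts" and d: "distinct ts" and n: "i < length ts" "j < length ts" and ij: "j = Suc i \<or> (i = length ts - 1 \<and> j = 0)"
 shows "crossfree (insert {ts ! i, ts ! j} E) V ts"
 unfolding crossfree_def
proof (intro allI impI notI)
 fix p q r s assume o: "p < q" "q < r" "r < s" "s < length ts"
  and lk: "lk (insert {ts ! i, ts ! j} E) V (ts ! p) (ts ! r) (ts ! q) (ts ! s)"
 have b: "p < length ts" "q < length ts" "r < length ts" using o by auto
 note b = b o(4)
 have no: "\<not> lk E V (ts ! x) (ts ! y) (ts ! z) (ts ! w)" if "alt x y z w" "x < length ts" "y < length ts" "z < length ts" "w < length ts" for x y z w using crossfree_alt[OF cf] that by blast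
 have ne: "x \<noteq> z \<and> x \<noteq> w \<and> y \<noteq> z \<and> y \<noteq> w" if "lk E V (ts ! x) (ts ! y) (ts ! z) (ts ! w)" for x y z w
  using lk_distinct[OF that] by auto
 have "\<not> lk E V (ts ! p) (ts ! r) (ts ! q) (ts ! s)" using cf o unfolding crossfree_def by blast
 hence cc: "(lk E V (ts ! p) (ts ! i) (ts ! q) (ts ! s) \<and> lk E V (ts ! j) (ts ! r) (ts ! q) (ts ! s)) \<or>
  (lk E V (ts ! p) (ts ! j) (ts ! q) (ts ! s) \<and> lk E V (ts ! i) (ts ! r) (ts ! q) (ts ! s)) \<or>
  (lk E V (ts ! p) (ts ! r) (ts ! q) (ts ! i) \<and> lk E V (ts ! p) (ts ! r) (ts ! j) (ts ! s)) \<or>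
  (lk E V (ts ! p) (ts ! r) (ts ! q) (ts ! j) \<and> lk E V (ts ! p) (ts ! r) (ts ! i) (ts ! s))"
  using lk_insert[OF lk] by blast
 have side: "(lo < i \<and> i < hi) \<longleftrightarrow> (lo < j \<and> j < hi)" if "hi < length ts" "i \<noteq> lo" "i \<noteq> hi" "j \<noteq> lo" "j \<noteq> hi" for lo hi
  using ij that n by linarith
 from cc consider "lk E V (ts ! p) (ts ! i) (ts ! q) (ts ! s)" "lk E V (ts ! j) (ts ! r) (ts ! q) (ts ! s)"
  | "lk E V (ts ! p) (ts ! j) (ts ! q) (ts ! s)" "lk E V (ts ! i) (ts ! r) (ts ! q) (ts ! s)"
  | "lk E V (ts ! p) (ts ! r) (ts ! q) (ts ! i)" "lk E V (ts ! p) (ts ! r) (ts ! j) (ts ! s)"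
  | "lk E V (ts ! p) (ts ! r) (ts ! q) (ts ! j)" "lk E V (ts ! p) (ts ! r) (ts ! i) (ts ! s)" by blast
 thus False
 proof cases
  case 1
  have "i \<noteq> q" "i \<noteq> s" "j \<noteq> q" "j \<noteq> s" using ne[OF 1(1)] ne[OF 1(2)] by auto
  hence "alt p i q s \<or> alt j r q s" using side[of s q] o unfolding alt_def by auto
  thus False using 1 no b n by blast
 next
  case 2
  have "i \<noteq> q" "i \<noteq> s" "j \<noteq> q" "j \<noteq> s" using ne[OF 2(1)] ne[OF 2(2)] by auto
  hence "alt p j q s \<or> alt i r q s" using side[of s q] o unfolding alt_def by auto
  thus False using 2 no b n by blast
 next
  case 3
  have "i \<noteq> p" "i \<noteq> r" "j \<noteq> p" "j \<noteq> r" using ne[OF 3(1)] ne[OF 3(2)] by auto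
  hence "alt p r q i \<or> alt p r j s" using side[of r p] o b unfolding alt_def by auto
  thus False using 3 no b n by blast
 next
  case 4
  have "i \<noteq> p" "i \<noteq> r" "j \<noteq> p" "j \<noteq> r" using ne[OF 4(1)] ne[OF 4(2)] by auto
  hence "alt p r q j \<or> alt p r i s" using side[of r p] o b unfolding alt_def by auto
  thus False using 4 no b n by blast
 qed
qed

lemma rim_finite: "finite (rim ts)"
proof -
 have "{{ts ! i, ts ! Suc i} | i. Suc i < length ts} \<subseteq> (\<lambda>i. {ts ! i, ts ! Suc i}) ` {..<length ts}" by auto
 thus ?thesis unfolding rim_def by (simp add: finite_subset)
qed

lemma crossfree_rim:
 assumes cf: "crossfree E V ts" and d: "distinct ts" "ts \<noteq> []"
 shows "crossfree (E \<union> rim ts) V ts"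
proof -
 have "F \<subseteq> rim ts ==> crossfree (E \<union> F) V ts" if "finite F" for F using that
 proof (induction F rule: finite_induct)
  case empty thus ?case using cf by simp
 next
  case (insert e F)
  obtain i j where "e = {ts ! i, ts ! j}" "i < length ts" "j < length ts" "j = Suc i \<or> (i = length ts - 1 \<and> j = 0)"
   using insert unfolding rim_def using d(2) by (auto simp: last_conv_nth hd_conv_nth)
  thus ?case using crossfree_rim_edge[of "E \<union> F" V ts i j] insert d by auto
 qed
 thus ?thesis using rim_finite by blast
qed

lemma rim_sub: "e \<in> rim ts ==> ts \<noteq> [] ==> e \<subseteq> set ts"
 unfolding rim_def by (auto dest: Suc_lessD)

lemma rim_card: "e \<in> rim ts ==> distinct ts ==> 2 \<le> length ts ==> card e = 2"
proof -
 assume e: "e \<in> rim ts" and d: "distinct ts" "2 \<le> length ts"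
 have ne: "ts \<noteq> []" using d by auto
 obtain i j where "e = {ts ! i, ts ! j}" "i < length ts" "j < length ts" "i \<noteq> j"
  using d ne e unfolding rim_def by (auto simp: last_conv_nth hd_conv_nth)
 thus ?thesis using d by (simp add: nth_eq_iff_index_eq)
qed

lemma irred_rim:
 assumes "irred E V T" "rim ts \<subseteq> Pow T" "finite V"
 shows "irred (E \<union> rim ts) V T"
 unfolding irred_def
proof (intro allI impI)
 fix X assume "X \<subseteq> V - T" "X \<noteq> {}"
 hence "4 \<le> card (nb E V X)" using assms unfolding irred_def by blast
 also have "\<dots> \<le> card (nb (E \<union> rim ts) V X)" by (rule card_mono) (use assms(3) in \<open>auto simp: nb_def\<close>)
 finally show "4 \<le> card (nb (E \<union> rim ts) V X)" .
qed

lemma subseq_index: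
 assumes "subseq xs ys"
 shows "\<exists>f. (\<forall>i j. i < j \<longrightarrow> j < length xs \<longrightarrow> f i < (f j :: nat)) \<and> (\<forall>i<length xs. f i < length ys \<and> xs ! i = ys ! f i)"
 using assms
proof (induction rule: list_emb.induct)
 case (list_emb_Nil ys)
 show ?case by auto
next
 case (list_emb_Cons xs ys y)
 then obtain f where "\<forall>i j. i < j \<longrightarrow> j < length xs \<longrightarrow> f i < (f j :: nat)" "\<forall>i<length xs. f i < length ys \<and> xs ! i = ys ! f i"
  by blast
 thus ?case by (intro exI[of _ "\<lambda>i. Suc (f i)"]) auto
next
 case (list_emb_Cons2 x y xs ys)
 then obtain f where f: "\<forall>i j. i < j \<longrightarrow> j < length xs \<longrightarrow> f i < (f j :: nat)" "\<forall>i<length xs. f i < length ys \<and> xs ! i = ys ! f i" by blast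
 show ?case
 proof (intro exI[of _ "\<lambda>i. case i of 0 \<Rightarrow> 0 | Suc i \<Rightarrow> Suc (f i)"] conjI allI impI)
  fix i j assume "i < j" "j < length (x # xs)"
  thus "(case i of 0 \<Rightarrow> 0 | Suc i \<Rightarrow> Suc (f i)) < (case j of 0 \<Rightarrow> 0 | Suc i \<Rightarrow> Suc (f i))" using f(1) by (cases i; cases j) auto
 next
  fix i assume "i < length (x # xs)"
  thus "(case i of 0 \<Rightarrow> 0 | Suc i \<Rightarrow> Suc (f i)) < length (y # ys)" "(x # xs) ! i = (y # ys) ! (case i of 0 \<Rightarrow> 0 | Suc i \<Rightarrow> Suc (f i))" using f(2) list_emb_Cons2 by (cases i; auto)+
 qed
qed

lemma subseq_nth4:
 assumes "i < j" "j < k" "k < l" "l < length ts"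
 shows "subseq [ts ! i, ts ! j, ts ! k, ts ! l] ts"
proof -
 have step: "subseq (ts ! i # xs) (drop m ts)" if "subseq xs (drop (Suc i) ts)" "m \<le> i" "i < length ts" for i m xs
 proof -
  have "drop m ts = take (i - m) (drop m ts) @ ts ! i # drop (Suc i) ts"
   using that append_take_drop_id[of "i - m" "drop m ts"] Cons_nth_drop_Suc[of i ts] by simp
  moreover have "subseq (ts ! i # xs) (ts ! i # drop (Suc i) ts)" using that by simp
  ultimately show ?thesis by (metis subseq_drop_many)
 qed
 have "subseq [] (drop (Suc l) ts)" by simp
 from step[OF this, of "Suc k"] have "subseq [ts ! l] (drop (Suc k) ts)" using assms by simp
 from step[OF this, of "Suc j"] have "subseq [ts ! k, ts ! l] (drop (Suc j) ts)" using assms by simp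
 from step[OF this, of "Suc i"] have "subseq [ts ! j, ts ! k, ts ! l] (drop (Suc i) ts)" using assms by simp
 from step[OF this, of 0] show ?thesis using assms by simp
qed

lemma crossfree_subseq:
 assumes "crossfree E V ts" "subseq us ts"
 shows "crossfree E V us"
proof -
 obtain f where f: "\<forall>i j. i < j \<longrightarrow> j < length us \<longrightarrow> f i < (f j :: nat)" "\<forall>i<length us. f i < length ts \<and> us ! i = ts ! f i"
  using subseq_index[OF assms(2)] by blast
 show ?thesis unfolding crossfree_def
 proof (intro allI impI)
  fix i j k l :: nat assume o: "i < j" "j < k" "k < l" "l < length us"
  thus "\<not> lk E V (us ! i) (us ! k) (us ! j) (us ! l)" using f assms(1) unfolding crossfree_def using f(2) o by simp
 qed
qed

lemma conn_replace_edge: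
 assumes c: "conn (insert {u, v} E) X" "conn E W" "u \<in> W" "v \<in> W" "u \<in> X"
 shows "conn E (X \<union> W)"
proof (rule connI)
 fix Y assume Y: "Y \<subseteq> X \<union> W" "Y \<noteq> {}" "\<And>y x. y \<in> Y ==> x \<in> X \<union> W - Y ==> {x, y} \<notin> E"
 have W: "W \<subseteq> Y" if "W \<inter> Y \<noteq> {}"
 proof -
  have "W \<inter> Y = W" by (rule ccontr) (use conn_edge[OF c(2), of "W \<inter> Y"] that Y(3) in blast)
  thus ?thesis by blast
 qed
 have X: "X \<subseteq> Y" if h: "X \<inter> Y \<noteq> {}" "W \<subseteq> Y \<or> W \<inter> Y = {}"
 proof -
  have "X \<inter> Y = X"
  proof (rule ccontr)
   assume "X \<inter> Y \<noteq> X"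
   then obtain y x where yx: "y \<in> X \<inter> Y" "x \<in> X - X \<inter> Y" "{x, y} \<in> insert {u, v} E"
    using conn_edge[OF c(1), of "X \<inter> Y"] h(1) by blast
   hence "(x \<in> W \<and> y \<in> W)" using Y(3) c(3,4) by force
   thus False using h(2) yx by blast
  qed
  thus ?thesis by blast
 qed
 show "Y = X \<union> W" using Y(1,2) X c(3,5) W Y(1) by blast
qed

text \<open>The connected set \<open>W\<close> on the other side takes the place of the virtual edge
  \<open>{u, v}\<close>, and at most one of the two disjoint sets can use it.\<close>

lemma crossfree_side:
 assumes cf: "crossfree E V us" and V': "V' \<subseteq> V" and E': "F \<subseteq> E"
  and W: "conn E W" "u \<in> W" "v \<in> W" "W \<subseteq> V" "W \<inter> V' \<subseteq> {u, v}"
 shows "crossfree (insert {u, v} F) V' us"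
 unfolding crossfree_def
proof (intro allI impI notI)
 fix i j k l :: nat assume o: "i < j" "j < k" "k < l" "l < length us"
  and "lk (insert {u, v} F) V' (us ! i) (us ! k) (us ! j) (us ! l)"
 then obtain X Y where c: "conn (insert {u, v} F) X" "conn (insert {u, v} F) Y" "X \<subseteq> V'" "Y \<subseteq> V'" "X \<inter> Y = {}"
  and m: "us ! i \<in> X" "us ! k \<in> X" "us ! j \<in> Y" "us ! l \<in> Y" unfolding lk_def by blast
 have one: "lk E V a b c d" if h: "conn (insert {u, v} F) X" "conn (insert {u, v} F) Y" "X \<subseteq> V'" "Y \<subseteq> V'" "X \<inter> Y = {}" "a \<in> X" "b \<in> X" "c \<in> Y" "d \<in> Y"
  "u \<notin> Y \<or> v \<notin> Y" for X Y a b c d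
 proof -
  have Y: "conn E Y" using conn_insert_other[OF h(2,10)] conn_mono E' by metis
  show ?thesis
  proof (cases "u \<in> X \<and> v \<in> X")
   case True
   have "conn (insert {u, v} E) X" using conn_mono[OF h(1)] E' by blast
   hence XW: "conn E (X \<union> W)" using conn_replace_edge W(1-3) True by metis
   have d: "(X \<union> W) \<inter> Y = {}" using h(4,5) W(5) True by blast
   have s: "X \<union> W \<subseteq> V" "Y \<subseteq> V" using h(3,4) V' W(4) by blast+
   show ?thesis by (rule lkI[OF XW Y s d _ _ h(8,9)]) (use h(6,7) in simp_all)
  next
   case False
   hence X: "conn E X" using conn_insert_other[OF h(1)] conn_mono E' by metis
   have s: "X \<subseteq> V" "Y \<subseteq> V" using h(3,4) V' by blast+
   show ?thesis by (rule lkI[OF X Y s h(5-9)])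
  qed
 qed
 have "lk E V (us ! i) (us ! k) (us ! j) (us ! l)"
 proof (cases "u \<in> Y \<and> v \<in> Y")
  case True
  have "lk E V (us ! j) (us ! l) (us ! i) (us ! k)" by (rule one[OF c(2,1,4,3)]) (use c(5) m True in auto)
  thus ?thesis by (rule lk_flip)
 next
  case False
  thus ?thesis using one[OF c m] by blast
 qed
 thus False using cf o unfolding crossfree_def by blast
qed

lemma irred_side:
 assumes "irred F V T" "finite V'" "V' - T' \<subseteq> V - T"
  and "\<And>x y. x \<in> V' - T' ==> {x, y} \<in> F ==> y \<in> V ==> y \<in> V' \<and> {x, y} \<in> F'"
 shows "irred F' V' T'"
 unfolding irred_def
proof (intro allI impI)
 fix X assume X: "X \<subseteq> V' - T'" "X \<noteq> {}"
 hence "4 \<le> card (nb F V X)" using assms(1,3) unfolding irred_def by blast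
 also have "\<dots> \<le> card (nb F' V' X)"
 proof (rule card_mono)
  show "finite (nb F' V' X)" using assms(2) unfolding nb_def by simp
  show "nb F V X \<subseteq> nb F' V' X" unfolding nb_def using X(1) assms(4) by blast
 qed
 finally show "4 \<le> card (nb F' V' X)" .
qed

text \<open>Peeling makes the boundary longer by one. Each side of a gluing loses some number
  \<open>k > 0\<close> of boundary positions together with at least \<open>k\<close> vertices; the
  factor 2 makes the measure drop in this case as well.\<close>

theorem society_web:
 assumes "finite V" "\<And>e. e \<in> E ==> e \<subseteq> V \<and> card e = 2" "distinct ts" "set ts \<subseteq> V" "3 \<le> length ts"
  and "irred E V (set ts)" "crossfree E V ts"
  and "\<And>m. m \<in> M ==> m \<subseteq> V \<and> card m = 3 \<and> (\<forall>x\<in>m. \<forall>y\<in>m. x \<noteq> y \<longrightarrow> {x, y} \<in> E)"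
 shows "\<exists>E' M'. E \<subseteq> E' \<and> M \<subseteq> M' \<and> web V E' M' ts"
 using assms
proof (induction "2 * card V - length ts" arbitrary: V E M ts rule: less_induct)
 case less
 note fin = less.prems(1) and dist = less.prems(3) and sub = less.prems(4) and len = less.prems(5)
 \<comment> \<open>Completing the rim keeps the order crossfree and supplies the boundary cycle on
   which both reductions rely.\<close>
 define F where "F = E \<union> rim ts"
 have EF: "E \<subseteq> F" unfolding F_def by blast
 have ne: "ts \<noteq> []" using len by auto
 have edge: "e \<in> F ==> e \<subseteq> V \<and> card e = 2" for e
  using less.prems(2)[of e] rim_sub[of e ts] rim_card[of e ts] ne dist len sub unfolding F_def by auto
 have rimF: "rim ts \<subseteq> F" unfolding F_def by blast
 have irr: "irred F V (set ts)" unfolding F_def by (rule irred_rim[OF less.prems(6) _ fin]) (use rim_sub ne in blast)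
 have cf: "crossfree F V ts" unfolding F_def by (rule crossfree_rim[OF less.prems(7) dist ne])
 have M: "m \<subseteq> V \<and> card m = 3 \<and> (\<forall>x\<in>m. \<forall>y\<in>m. x \<noteq> y \<longrightarrow> {x, y} \<in> F)" if "m \<in> M" for m
  using less.prems(8)[OF that] EF by (meson subsetD)
 have lV: "length ts \<le> card V" using card_mono[OF fin sub] distinct_card[OF dist] by simp
 have rimE: "{ts ! i, ts ! Suc i} \<in> F" if "Suc i < length ts" for i using rimF that unfolding rim_def by blast
 have "{last ts, hd ts} \<in> rim ts" unfolding rim_def by simp
 hence rimL: "{last ts, hd ts} \<in> F" using rimF by blast
 note IH = less.hyps
 have "\<exists>E' M'. F \<subseteq> E' \<and> M \<subseteq> M' \<and> web V E' M' ts"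
 proof (cases "length ts = 3")
  case True
  then obtain a b c where ts: "ts = [a, b, c]" by (auto simp: numeral_3_eq_3 length_Suc_conv)
  have "V - set ts = {}"
  proof (rule ccontr)
   assume n: "V - set ts \<noteq> {}"
   hence "4 \<le> card (nb F V (V - set ts))" using irr unfolding irred_def by blast
   moreover have "card (nb F V (V - set ts)) \<le> card (set ts)" unfolding nb_def by (intro card_mono) auto
   ultimately show False using distinct_card[OF dist] True by simp
  qed
  hence V: "V = {a, b, c}" using sub ts by auto
  have d: "distinct [a, b, c]" using dist ts by simp
  have "F \<subseteq> {{a, b}, {b, c}, {a, c}}"
  proof
   fix e assume "e \<in> F"
   then obtain x y where "e = {x, y}" "x \<noteq> y" "x \<in> V" "y \<in> V" using edge by (metis card_2_iff insert_subset)
   thus "e \<in> {{a, b}, {b, c}, {a, c}}" unfolding V by (auto simp: insert_commute)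
  qed
  moreover have "M \<subseteq> {{a, b, c}}"
  proof
   fix m assume m: "m \<in> M"
   thus "m \<in> {{a, b, c}}" using card_subset_eq[OF fin, of m] M[OF m] V d by simp
  qed
  ultimately show ?thesis using web.tri[OF d] unfolding V ts by blast
 next
  case False
  hence n4: "4 \<le> length ts" using len by simp
  have ix: "ts ! i \<in> V" if "i < length ts" for i using sub that nth_mem by blast
  show ?thesis
  proof (cases "\<exists>i j. Suc i < j \<and> j < length ts \<and> (i \<noteq> 0 \<or> Suc j \<noteq> length ts) \<and>
    (\<nexists>X. conn F X \<and> X \<subseteq> V - {ts ! i, ts ! j} \<and> (\<exists>k. i < k \<and> k < j \<and> ts ! k \<in> X) \<and>
     (\<exists>k < length ts. (k < i \<or> j < k) \<and> ts ! k \<in> X))")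
   case True
   then obtain i j where ij: "Suc i < j" "j < length ts" "i \<noteq> 0 \<or> Suc j \<noteq> length ts"
    and no: "\<nexists>X. conn F X \<and> X \<subseteq> V - {ts ! i, ts ! j} \<and> (\<exists>k. i < k \<and> k < j \<and> ts ! k \<in> X) \<and>
     (\<exists>k < length ts. (k < i \<or> j < k) \<and> ts ! k \<in> X)" by blast
   define u v xs ys zs where "u = ts ! i" and "v = ts ! j" and "xs = take i ts" and "ys = drop (Suc j) ts"
    and "zs = take (j - Suc i) (drop (Suc i) ts)"
   have d2: "drop (Suc i) ts = zs @ v # ys"
   proof -
    have "drop (Suc i) ts = zs @ drop (j - Suc i) (drop (Suc i) ts)"
     unfolding zs_def by (rule append_take_drop_id[symmetric])
    also have "drop (j - Suc i) (drop (Suc i) ts) = drop j ts" using ij by simp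
    also have "drop j ts = v # ys" unfolding v_def ys_def using ij by (simp add: Cons_nth_drop_Suc)
    finally show ?thesis .
   qed
   have ts: "ts = xs @ u # zs @ v # ys"
    unfolding d2[symmetric] unfolding xs_def u_def using ij id_take_nth_drop[of i ts] by simp
   have lens: "length zs = j - Suc i" "length xs = i" "length ys = length ts - Suc j"
    unfolding zs_def xs_def ys_def using ij by auto
   have uv: "u \<in> V" "v \<in> V" "u \<noteq> v" using ix ij dist unfolding u_def v_def by (auto simp: nth_eq_iff_index_eq)
   have zmem: "\<exists>k. i < k \<and> k < j \<and> z = ts ! k" if z: "z \<in> set zs" for z
   proof -
    obtain q where q: "q < length zs" "z = zs ! q" using z by (metis in_set_conv_nth)
    have "zs ! q = ts ! (Suc i + q)" unfolding zs_def using q lens ij by (simp add: zs_def)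
    thus ?thesis using q lens by (intro exI[of _ "Suc i + q"]) auto
   qed
   have omem: "\<exists>k<length ts. (k < i \<or> j < k) \<and> z = ts ! k" if z: "z \<in> set xs \<union> set ys" for z
   proof (cases "z \<in> set xs")
    case True
    then obtain q where "q < i" "z = ts ! q" using lens ij unfolding xs_def by (metis in_set_conv_nth nth_take)
    thus ?thesis using ij by (intro exI[of _ q]) auto
   next
    case False
    hence "z \<in> set ys" using z by blast
    then obtain q where q: "q < length ys" "z = ys ! q" by (metis in_set_conv_nth)
    thus ?thesis unfolding ys_def using ij q lens by (intro exI[of _ "Suc j + q"]) auto
   qed
   let ?C = "V - {u, v}"
   \<comment> \<open>\<open>A\<close> consists of the components of \<open>V - {u, v}\<close> that
     contain vertices of \<open>zs\<close>. Components without boundary vertices go to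
     \<open>V1\<close>.\<close>
   define A where "A = (\<Union>z\<in>set zs. comp F ?C z)"
   define V1 V2 where "V1 = V - A" and "V2 = A \<union> {u, v}"
   have A: "A \<subseteq> ?C" unfolding A_def using comp_subset[of F ?C] by blast
   have zsC: "set zs \<subseteq> ?C" and oC: "set xs \<union> set ys \<subseteq> ?C" using dist sub unfolding ts by auto
   have zsA: "set zs \<subseteq> A"
   proof
    fix z assume z: "z \<in> set zs"
    hence "z \<in> comp F ?C z" using zsC by (intro comp_self) auto
    thus "z \<in> A" unfolding A_def using z by (rule UN_I[rotated])
   qed
   have oA: "(set xs \<union> set ys) \<inter> A = {}"
   proof (rule equals0I)
    fix x assume "x \<in> (set xs \<union> set ys) \<inter> A"
    then obtain z where z: "z \<in> set zs" "x \<in> comp F ?C z" "x \<in> set xs \<union> set ys" unfolding A_def by blast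
    obtain k where k: "i < k" "k < j" "z = ts ! k" using zmem z(1) by blast
    obtain k' where k': "k' < length ts" "k' < i \<or> j < k'" "x = ts ! k'" using omem z(3) by blast
    have "z \<in> comp F ?C z" using z(1) zsC by (intro comp_self) auto
    hence "conn F (comp F ?C z) \<and> comp F ?C z \<subseteq> V - {ts ! i, ts ! j} \<and> (\<exists>k. i < k \<and> k < j \<and> ts ! k \<in> comp F ?C z) \<and>
     (\<exists>k < length ts. (k < i \<or> j < k) \<and> ts ! k \<in> comp F ?C z)"
     using k k' z(2) comp_subset[of F ?C z] conn_comp[of F ?C z] unfolding u_def v_def by blast
    thus False using no by blast
   qed
   have Astep: "y \<in> V2" if "x \<in> A" "{x, y} \<in> F" for x y
   proof (cases "y \<in> ?C")
    case t: True
    obtain z where z: "z \<in> set zs" "x \<in> comp F ?C z" using \<open>x \<in> A\<close> unfolding A_def by blast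
    have "y \<in> comp F ?C z" using comp_step[OF z(2) t] that(2) by (simp add: insert_commute)
    thus ?thesis using z unfolding V2_def A_def by blast
   next
    case False
    thus ?thesis using edge[OF that(2)] unfolding V2_def by blast
   qed
   have V12: "V1 \<union> V2 = V" "V1 \<inter> V2 = {u, v}" "V1 \<subseteq> V" "V2 \<subseteq> V" using A uv unfolding V1_def V2_def by auto
   define F1 F2 where "F1 = {e \<in> F. e \<subseteq> V1}" and "F2 = {e \<in> F. e \<subseteq> V2}"
   have F12: "F \<subseteq> F1 \<union> F2"
   proof
    fix e assume e: "e \<in> F"
    then obtain x y where xy: "e = {x, y}" using edge by (metis card_2_iff)
    show "e \<in> F1 \<union> F2"
     using e xy edge[OF e] Astep[of x y] Astep[of y x] unfolding F1_def F2_def V1_def V2_def by (auto simp: insert_commute)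
   qed
   let ?t1 = "xs @ u # v # ys" and ?t2 = "u # zs @ [v]"
   have t1: "distinct ?t1" "set ?t1 \<subseteq> V1" "length ?t1 = length ts - length zs" and t2: "distinct ?t2" "set ?t2 \<subseteq> V2" "length ?t2 = length zs + 2" using dist oA oC uv A zsA unfolding ts V1_def V2_def by auto
   have ztl: "0 < length zs" "0 < length xs + length ys" "length ts = length xs + length ys + length zs + 2"
    using lens ij unfolding ts by auto
   have fV: "finite V1" "finite V2" using V12 fin finite_subset by blast+
   have c1: "card V1 + length zs \<le> card V"
   proof -
    have "card V1 + card (set zs) = card (V1 \<union> set zs)" using zsA fV by (subst card_Un_disjoint) (auto simp: V1_def)
    also have "\<dots> \<le> card V" using V12 zsC fin by (intro card_mono) auto
    finally show ?thesis using distinct_card[of zs] dist unfolding ts by simp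
   qed
   have c2: "card V2 + (length xs + length ys) \<le> card V"
   proof -
    have "distinct (xs @ ys)" using dist unfolding ts by auto
    have "(set xs \<union> set ys) \<inter> V2 = {}" using oA oC unfolding V2_def by blast
    hence "card V2 + card (set (xs @ ys)) = card (V2 \<union> set (xs @ ys))" using fV by (subst card_Un_disjoint) auto
    also have "\<dots> \<le> card V" using V12 oC fin by (intro card_mono) auto
    finally show ?thesis using distinct_card[of "xs @ ys"] \<open>distinct (xs @ ys)\<close> by simp
   qed
   define M1 M2 where "M1 = {m \<in> M. m \<subseteq> V1}" and "M2 = {m \<in> M. m \<subseteq> V2}"
   have M12: "M \<subseteq> M1 \<union> M2"
   proof
    fix m assume m: "m \<in> M"
    show "m \<in> M1 \<union> M2"
    proof (cases "m \<inter> A = {}")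
     case True
     thus ?thesis using m conjunct1[OF M[OF m]] unfolding M1_def V1_def by blast
    next
     case False
     then obtain x where x: "x \<in> m" "x \<in> A" by blast
     have "y \<in> V2" if y: "y \<in> m" for y
     proof (cases "y = x")
      case False
      thus ?thesis using M[OF m, THEN conjunct2, THEN conjunct2, rule_format, OF x(1) y] Astep[OF x(2)] by blast
     qed (use x in \<open>auto simp: V2_def\<close>)
     thus ?thesis using m unfolding M2_def by blast
    qed
   qed
   have P: "pth F ts" unfolding pth_def using ne dist rimE by (simp add: successively_conv_nth)
   have sp: "conn F (set ?t2)" "conn F (insert u (insert v (set xs \<union> set ys)))"
   proof -
    show "conn F (set ?t2)" using pth_append(2)[of F xs "?t2 @ ys"] P ts pth_append(1)[of F ?t2 ys] by (intro conn_pth) simp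
    have "conn F (set (xs @ [u]))" using pth_append(1)[of F "xs @ [u]" "zs @ v # ys"] P ts by (intro conn_pth) simp
    moreover have "conn F (set (v # ys))" using pth_append(2)[of F "xs @ u # zs" "v # ys"] P ts by (intro conn_pth) simp
    ultimately have "conn F (set (xs @ [u]) \<union> set (v # ys))" by (rule conn_Un_edge[where x = "hd ts" and y = "last ts"])
      (use rimL in \<open>auto simp: ts hd_append insert_commute\<close>)
    thus "conn F (insert u (insert v (set xs \<union> set ys)))" by (simp add: insert_commute)
   qed
   have cf1: "crossfree (insert {u, v} F1) V1 ?t1"
   proof (rule crossfree_side[OF _ V12(3) _ sp(1)])
    have "subseq (xs @ [u] @ [] @ v # ys) (xs @ [u] @ zs @ v # ys)" by (intro list_emb_append_mono) auto
    thus "crossfree F V ?t1" by (intro crossfree_subseq[OF cf]) (simp add: ts)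
    show "set ?t2 \<inter> V1 \<subseteq> {u, v}" using zsA unfolding V1_def by auto
   qed (use V12 t2 in \<open>auto simp: F1_def\<close>)
   have cf2: "crossfree (insert {u, v} F2) V2 ?t2"
   proof (rule crossfree_side[OF _ V12(4) _ sp(2)])
    have "subseq ([] @ (u # zs @ [v]) @ []) (xs @ (u # zs @ [v]) @ ys)" by (intro list_emb_append_mono) auto
    thus "crossfree F V ?t2" by (intro crossfree_subseq[OF cf]) (simp add: ts)
    show "insert u (insert v (set xs \<union> set ys)) \<inter> V2 \<subseteq> {u, v}" using oA unfolding V2_def by auto
   qed (use V12 t1 in \<open>auto simp: F2_def\<close>)
   have ir1: "irred (insert {u, v} F1) V1 (set ?t1)"
   proof (rule irred_side[OF irr fV(1)])
    show "V1 - set ?t1 \<subseteq> V - set ts" using zsA unfolding ts V1_def by auto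
    show "y \<in> V1 \<and> {x, y} \<in> insert {u, v} F1" if "x \<in> V1 - set ?t1" "{x, y} \<in> F" "y \<in> V" for x y
     using Astep[of y x] that unfolding F1_def V1_def V2_def by (auto simp: insert_commute)
   qed
   have ir2: "irred (insert {u, v} F2) V2 (set ?t2)"
   proof (rule irred_side[OF irr fV(2)])
    show "V2 - set ?t2 \<subseteq> V - set ts" using oA A unfolding ts V2_def by auto
    show "y \<in> V2 \<and> {x, y} \<in> insert {u, v} F2" if "x \<in> V2 - set ?t2" "{x, y} \<in> F" "y \<in> V" for x y
     using Astep[of x y] that unfolding F2_def V2_def by auto
   qed
   have side: "\<exists>E' M'. insert {u, v} {e \<in> F. e \<subseteq> W} \<subseteq> E' \<and> {m \<in> M. m \<subseteq> W} \<subseteq> M' \<and> web W E' M' t"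
    if W: "finite W" "distinct t" "set t \<subseteq> W" "irred (insert {u, v} {e \<in> F. e \<subseteq> W}) W (set t)"
     "crossfree (insert {u, v} {e \<in> F. e \<subseteq> W}) W t" "{u, v} \<subseteq> W" "3 \<le> length t"
     "2 * card W - length t < 2 * card V - length ts" for W t
   proof (rule IH[OF W(8,1) _ W(2,3,7,4,5)])
    show "e \<subseteq> W \<and> card e = 2" if "e \<in> insert {u, v} {e \<in> F. e \<subseteq> W}" for e using that edge[of e] uv(3) W(6) by auto
    show "m \<subseteq> W \<and> card m = 3 \<and> (\<forall>x\<in>m. \<forall>y\<in>m. x \<noteq> y \<longrightarrow> {x, y} \<in> insert {u, v} {e \<in> F. e \<subseteq> W})" if "m \<in> {m \<in> M. m \<subseteq> W}" for m
    proof -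
     have "{x, y} \<in> insert {u, v} {e \<in> F. e \<subseteq> W}" if "x \<in> m" "y \<in> m" "x \<noteq> y" for x y
      using M[of m, THEN conjunct2, THEN conjunct2, rule_format, OF _ that] that \<open>m \<in> _\<close> by auto
     thus ?thesis using M[of m] that by simp
    qed
   qed
   have "2 * card V1 - length ?t1 < 2 * card V - length ts" "2 * card V2 - length ?t2 < 2 * card V - length ts"
    "3 \<le> length ?t1" "3 \<le> length ?t2"
    unfolding t1(3) t2(3) using c1 c2 ztl lV by linarith+
   note l = this
   have uv12: "{u, v} \<subseteq> V1" "{u, v} \<subseteq> V2" using V12(2) by blast+
   obtain E1 N1 where w1: "insert {u, v} F1 \<subseteq> E1" "M1 \<subseteq> N1" "web V1 E1 N1 ?t1"
    using side[OF fV(1) t1(1,2) ir1[unfolded F1_def] cf1[unfolded F1_def] uv12(1) l(3,1)] unfolding F1_def[symmetric] M1_def[symmetric] by metis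
   obtain E2 N2 where w2: "insert {u, v} F2 \<subseteq> E2" "M2 \<subseteq> N2" "web V2 E2 N2 ?t2"
    using side[OF fV(2) t2(1,2) ir2[unfolded F2_def] cf2[unfolded F2_def] uv12(2) l(4,2)] unfolding F2_def[symmetric] M2_def[symmetric] by metis
   have nz: "zs \<noteq> []" "xs @ ys \<noteq> []" using ztl by auto
   have "web (V1 \<union> V2) (E1 \<union> E2) (N1 \<union> N2) (xs @ u # zs @ v # ys)" by (rule web.glue[OF w1(3) w2(3) V12(2) nz])
   moreover have "F \<subseteq> E1 \<union> E2" "M \<subseteq> N1 \<union> N2" using F12 M12 w1(1,2) w2(1,2) by auto
   ultimately show ?thesis unfolding V12(1) ts[symmetric] by blast
  next
   case no: False
   obtain a b rest where ts: "ts = a # b # rest" using n4 by (cases ts; cases "tl ts") auto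
   have rl: "2 \<le> length rest" using n4 ts by simp
   have so: "society V F a b rest"
   proof
    show "finite V" "distinct (a # b # rest)" "set (a # b # rest) \<subseteq> V" "2 \<le> length rest"
     using fin dist sub rl unfolding ts by auto
    show "irred F V (set (a # b # rest))" "crossfree F V (a # b # rest)" using irr cf unfolding ts by auto
    show "{(a # b # rest) ! i, (a # b # rest) ! Suc i} \<in> F" if "Suc i < length (a # b # rest)" for i
     using rimE[of i] that unfolding ts by blast
    show "{last rest, a} \<in> F" using rimL rl unfolding ts by (auto split: if_splits)
    show "e \<subseteq> V \<and> card e = 2" if "e \<in> F" for e using edge[OF that] .
    show "\<exists>X. conn F X \<and> X \<subseteq> V - {(a # b # rest) ! i, (a # b # rest) ! j} \<and>
      (\<exists>k. i < k \<and> k < j \<and> (a # b # rest) ! k \<in> X) \<and>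
      (\<exists>k < length (a # b # rest). (k < i \<or> j < k) \<and> (a # b # rest) ! k \<in> X)"
     if h: "Suc i < j" "j < length (a # b # rest)" "i \<noteq> 0 \<or> Suc j \<noteq> length (a # b # rest)" for i j
     using no h unfolding ts by blast
   qed
   obtain w where w: "w \<in> V" "w \<notin> set (a # b # rest)" "crossfree (F - {{a, b}}) V (a # w # b # rest)"
    "\<And>c. {a, c} \<in> F ==> {b, c} \<in> F ==> c = w"
    using society.peel[OF so] by blast
   let ?F = "F - {{a, b}}" and ?t = "a # w # b # rest"
   define M0 where "M0 = {m \<in> M. \<not> {a, b} \<subseteq> m}"
   have "\<exists>E' M'. ?F \<subseteq> E' \<and> M0 \<subseteq> M' \<and> web V E' M' ?t"
   proof (rule IH)
    have "set ts \<subset> V" using w(1,2) sub unfolding ts by blast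
    hence "length ts < card V" using psubset_card_mono[OF fin] distinct_card[OF dist] by metis
    thus "2 * card V - length ?t < 2 * card V - length ts" unfolding ts by simp
    show "finite V" by (rule fin)
    show "e \<subseteq> V \<and> card e = 2" if "e \<in> ?F" for e using edge[of e] that by blast
    show "distinct ?t" "set ?t \<subseteq> V" "3 \<le> length ?t" using dist sub w(1,2) rl unfolding ts by auto
    show "crossfree ?F V ?t" by (rule w(3))
    show "irred ?F V (set ?t)" by (rule irred_side[OF irr fin]) (auto simp: ts doubleton_eq_iff)
    show "m \<subseteq> V \<and> card m = 3 \<and> (\<forall>x\<in>m. \<forall>y\<in>m. x \<noteq> y \<longrightarrow> {x, y} \<in> ?F)" if "m \<in> M0" for m
    proof -
     have m: "m \<in> M" "\<not> {a, b} \<subseteq> m" using that unfolding M0_def by auto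
     have "{x, y} \<in> ?F" if "x \<in> m" "y \<in> m" "x \<noteq> y" for x y
      using M[OF m(1), THEN conjunct2, THEN conjunct2, rule_format, OF that] that m(2) by (auto simp: doubleton_eq_iff)
     thus ?thesis using m M[OF m(1)] by simp
    qed
   qed
   then obtain E1 N1 where e: "?F \<subseteq> E1" "M0 \<subseteq> N1" "web V E1 N1 ?t" by blast
   have "rest \<noteq> []" using rl by auto
   have "web V (insert {a, b} E1) (insert {a, w, b} {m \<in> N1. \<not> {a, b} \<subseteq> m}) (a # b # rest)"
    by (rule web.peel[OF e(3) \<open>rest \<noteq> []\<close>])
   moreover have "F \<subseteq> insert {a, b} E1" using e(1) by blast
   \<comment> \<open>The third vertex of a triangle over the edge \<open>{a, b}\<close> is adjacent
     to both \<open>a\<close> and \<open>b\<close>, so it is \<open>w\<close>.\<close>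
   moreover have "M \<subseteq> insert {a, w, b} {m \<in> N1. \<not> {a, b} \<subseteq> m}"
   proof
    fix m assume m: "m \<in> M"
    show "m \<in> insert {a, w, b} {m \<in> N1. \<not> {a, b} \<subseteq> m}"
    proof (cases "{a, b} \<subseteq> m")
     case False
     thus ?thesis using m e(2) unfolding M0_def by blast
    next
     case True
     have ab: "a \<noteq> b" using dist ts by auto
     obtain c where c: "c \<in> m" "c \<noteq> a" "c \<noteq> b"
     proof -
      have "\<not> m \<subseteq> {a, b}"
      proof
       assume "m \<subseteq> {a, b}"
       hence "card m \<le> card {a, b}" by (intro card_mono) auto
       thus False using M[OF m] ab by simp
      qed
      thus ?thesis using that by blast
     qed
     have "{a, c} \<in> F" "{b, c} \<in> F" using M[OF m] True c by auto
     hence cw: "c = w" by (rule w(4))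
     have "{a, w, b} \<subseteq> m" using True c cw by blast
     moreover have "finite m" using M[OF m] fin finite_subset by blast
     moreover have "card {a, w, b} = card m" using M[OF m] c cw ab by simp
     ultimately have "{a, w, b} = m" by (intro card_subset_eq)
     thus ?thesis by blast
    qed
   qed
   ultimately show ?thesis unfolding ts by blast
  qed
 qed
 then obtain E' M' where "F \<subseteq> E'" "M \<subseteq> M'" "web V E' M' ts" by blast
 thus ?case unfolding F_def by blast
qed

section \<open>Drawings of webs\<close>

text \<open>Arcs are kept as point sets, so that homeomorphisms act on drawings by taking images;
  parametrisations are chosen only in \<open>web_disc\<close>.\<close>

definition isarc :: "complex set \<Rightarrow> complex set \<Rightarrow> bool" where
 "isarc A P \<longleftrightarrow> (\<exists>g. arc g \<and> path_image g = A \<and> {pathstart g, pathfinish g} = P)"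

definition draw :: "'v set \<Rightarrow> 'v set set \<Rightarrow> ('v \<Rightarrow> complex) \<Rightarrow> ('v set \<Rightarrow> complex set) \<Rightarrow> bool" where
 "draw V E pos A \<longleftrightarrow> inj_on pos V \<and>
   (\<forall>e\<in>E. e \<subseteq> V \<and> card e = 2 \<and> isarc (A e) (pos ` e) \<and> A e \<inter> pos ` V = pos ` e) \<and>
   (\<forall>e\<in>E. \<forall>f\<in>E. e \<noteq> f \<longrightarrow> A e \<inter> A f \<subseteq> pos ` (e \<inter> f))"

lemma drawD:
 assumes "draw V E pos A"
 shows "inj_on pos V" "e \<in> E ==> e \<subseteq> V" "e \<in> E ==> card e = 2" "e \<in> E ==> isarc (A e) (pos ` e)"
  "e \<in> E ==> A e \<inter> pos ` V = pos ` e" "e \<in> E ==> f \<in> E ==> e \<noteq> f ==> A e \<inter> A f \<subseteq> pos ` (e \<inter> f)"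
 using assms unfolding draw_def by simp_all

lemma drawI:
 assumes "inj_on pos V" "\<And>e. e \<in> E ==> e \<subseteq> V" "\<And>e. e \<in> E ==> card e = 2" "\<And>e. e \<in> E ==> isarc (A e) (pos ` e)"
  "\<And>e. e \<in> E ==> A e \<inter> pos ` V = pos ` e" "\<And>e f. e \<in> E ==> f \<in> E ==> e \<noteq> f ==> A e \<inter> A f \<subseteq> pos ` (e \<inter> f)"
 shows "draw V E pos A"
 using assms unfolding draw_def by simp

definition pic :: "'v set \<Rightarrow> 'v set set \<Rightarrow> ('v \<Rightarrow> complex) \<Rightarrow> ('v set \<Rightarrow> complex set) \<Rightarrow> complex set" where
 "pic V E pos A = pos ` V \<union> (\<Union>e\<in>E. A e)"

text \<open>A face is described without mentioning components, in a form that persists when pieces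
  avoiding \<open>F\<close> are added to the drawing. \<open>component_face\<close> turns it into a
  component of the complement.\<close>

definition face :: "'v set \<Rightarrow> 'v set set \<Rightarrow> ('v \<Rightarrow> complex) \<Rightarrow> ('v set \<Rightarrow> complex set) \<Rightarrow> 'v set \<Rightarrow> complex set \<Rightarrow> bool" where
 "face V E pos A m F \<longleftrightarrow> open F \<and> connected F \<and> F \<inter> pic V E pos A = {} \<and> frontier F = (\<Union>e\<in>{e \<in> E. e \<subseteq> m}. A e)"

text \<open>All heights are multiples of one parabola over the segment from \<open>p\<close> to
  \<open>q\<close>. The segment itself is \<open>curve 0 p q\<close>, and a lens is the open set
  between it and \<open>curve c p q\<close>.\<close>

definition lens :: "real \<Rightarrow> real \<Rightarrow> real \<Rightarrow> complex set" where
 "lens c p q = {z. 0 < Im z \<and> Im z < c * ((Re z - p) * (q - Re z))}"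

definition curve :: "real \<Rightarrow> real \<Rightarrow> real \<Rightarrow> complex set" where
 "curve c p q = {z. p \<le> Re z \<and> Re z \<le> q \<and> Im z = c * ((Re z - p) * (q - Re z))}"

definition region :: "real \<Rightarrow> real \<Rightarrow> complex set" where
 "region p q = {z. p \<le> Re z \<and> Re z \<le> q \<and> 0 \<le> Im z \<and> Im z \<le> (Re z - p) * (q - Re z)}"

section \<open>Moving drawings by homeomorphisms of the plane\<close>

definition homeo :: "(complex \<Rightarrow> complex) \<Rightarrow> bool" where
 "homeo S \<longleftrightarrow> (\<exists>T. continuous_on UNIV S \<and> continuous_on UNIV T \<and> (\<forall>z. T (S z) = z) \<and> (\<forall>z. S (T z) = z))"

lemma homeo_inj: "homeo S ==> inj S"
 unfolding homeo_def by (metis injI)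

lemma homeo_cont: "homeo S ==> continuous_on X S"
 unfolding homeo_def by (metis continuous_on_subset subset_UNIV)

lemma homeo_map: "homeo S ==> homeomorphic_map euclidean euclidean S"
 unfolding homeo_def homeomorphic_map_maps homeomorphic_maps_def by auto

lemma homeo_open: "homeo S ==> open F ==> open (S ` F)"
 using homeomorphic_map_openness[OF homeo_map, of S F] by simp

lemma homeo_frontier: "homeo S ==> frontier (S ` F) = S ` frontier F"
 using homeomorphic_map_frontier_of[OF homeo_map, of S F] by simp

lemma isarc_homeo: "homeo S ==> isarc A P ==> isarc (S ` A) (S ` P)"
proof -
 assume S: "homeo S" and "isarc A P"
 then obtain g where g: "arc g" "path_image g = A" "{pathstart g, pathfinish g} = P" unfolding isarc_def by blast
 have "path (S \<circ> g)" using g(1) path_continuous_image[OF _ homeo_cont[OF S]] unfolding arc_def by blast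
 moreover have "inj_on (S \<circ> g) {0..1}"
  using g(1) comp_inj_on[OF _ inj_on_subset[OF homeo_inj[OF S] subset_UNIV]] unfolding arc_def by blast
 ultimately have "arc (S \<circ> g)" unfolding arc_def by blast
 moreover have "path_image (S \<circ> g) = S ` A" using g(2) by (simp add: path_image_compose)
 moreover have "{pathstart (S \<circ> g), pathfinish (S \<circ> g)} = S ` P"
  using g(3) by (auto simp: pathstart_compose pathfinish_compose)
 ultimately show ?thesis unfolding isarc_def by blast
qed

lemma draw_homeo:
 assumes S: "homeo S" and d: "draw V E pos A"
 shows "draw V E (S \<circ> pos) (\<lambda>e. S ` A e)"
proof -
 note inj = homeo_inj[OF S]
 have int: "S ` X \<inter> S ` Y = S ` (X \<inter> Y)" for X Y using image_Int[OF inj] by blast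
 show ?thesis
 proof (rule drawI)
  show "inj_on (S \<circ> pos) V" by (rule comp_inj_on[OF drawD(1)[OF d] inj_on_subset[OF inj subset_UNIV]])
  fix e assume e: "e \<in> E"
  show "isarc (S ` A e) ((S \<circ> pos) ` e)" using isarc_homeo[OF S drawD(4)[OF d e]] unfolding image_comp .
  show "S ` A e \<inter> (S \<circ> pos) ` V = (S \<circ> pos) ` e" unfolding image_comp[symmetric] int drawD(5)[OF d e] ..
  show "e \<subseteq> V" "card e = 2" using drawD(2,3)[OF d e] .
  fix f assume "f \<in> E" "e \<noteq> f"
  thus "S ` A e \<inter> S ` A f \<subseteq> (S \<circ> pos) ` (e \<inter> f)" unfolding image_comp[symmetric] int by (intro image_mono drawD(6)[OF d e])
 qed
qed

lemma pic_homeo: "pic V E (S \<circ> pos) (\<lambda>e. S ` A e) = S ` pic V E pos A"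
 unfolding pic_def by auto

lemma face_homeo:
 assumes S: "homeo S" and f: "face V E pos A m F"
 shows "face V E (S \<circ> pos) (\<lambda>e. S ` A e) m (S ` F)"
proof -
 have "S ` F \<inter> S ` pic V E pos A = {}" using f image_Int[OF homeo_inj[OF S]] unfolding face_def by (metis image_empty)
 moreover have "connected (S ` F)" using f homeo_cont[OF S] connected_continuous_image unfolding face_def by blast
 ultimately show ?thesis
  using f homeo_open[OF S] homeo_frontier[OF S, of F] unfolding face_def pic_homeo by (auto simp: image_UN)
qed

lemma draw_cong:
 assumes d: "draw V E pos A" and p: "\<And>v. v \<in> V ==> pos' v = pos v" and a: "\<And>e. e \<in> E ==> A' e = A e"
 shows "draw V E pos' A'"
proof -
 have im: "pos' ` X = pos ` X" if "X \<subseteq> V" for X using p that by (intro image_cong) auto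
 note eV = drawD(2)[OF d]
 show ?thesis
 proof (rule drawI)
  show "inj_on pos' V" using drawD(1)[OF d] p inj_on_cong by blast
  fix e assume e: "e \<in> E"
  show "isarc (A' e) (pos' ` e)" using drawD(4)[OF d e] im[OF eV[OF e]] a[OF e] by simp
  show "A' e \<inter> pos' ` V = pos' ` e" using drawD(5)[OF d e] im[OF eV[OF e]] im[of V] a[OF e] by simp
  show "e \<subseteq> V" "card e = 2" using drawD(2,3)[OF d e] .
  fix f assume f: "f \<in> E" "e \<noteq> f"
  show "A' e \<inter> A' f \<subseteq> pos' ` (e \<inter> f)" using eV[OF e] drawD(6)[OF d e f] im[of "e \<inter> f"] a e f(1) by force
 qed
qed

lemma pic_cong: "(\<And>v. v \<in> V ==> pos' v = pos v) ==> (\<And>e. e \<in> E ==> A' e = A e) ==> pic V E pos' A' = pic V E pos A"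
 unfolding pic_def by (intro arg_cong2[of _ _ _ _ "(\<union>)"] image_cong SUP_cong) auto

lemma face_cong:
 assumes "face V E pos A m F" "\<And>v. v \<in> V ==> pos' v = pos v" "\<And>e. e \<in> E ==> A' e = A e"
 shows "face V E pos' A' m F"
proof -
 have "(\<Union>e\<in>{e \<in> E. e \<subseteq> m}. A' e) = (\<Union>e\<in>{e \<in> E. e \<subseteq> m}. A e)" using assms(3) by (intro SUP_cong) auto
 moreover have "pic V E pos' A' = pic V E pos A" by (rule pic_cong) (use assms in auto)
 ultimately show ?thesis using assms(1) unfolding face_def by simp
qed

text \<open>By \<open>sep\<close> the two drawings touch only on the arc of \<open>{u, v}\<close>.
  This arc belongs to both, so its contacts with vertices and other arcs are known in each of
  them.\<close>

lemma draw_union: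
 assumes d1: "draw V1 E1 pos A" and d2: "draw V2 E2 pos A" and V: "V1 \<inter> V2 = {u, v}"
  and uv: "{u, v} \<in> E1" "{u, v} \<in> E2" and sep: "pic V1 E1 pos A \<inter> pic V2 E2 pos A \<subseteq> A {u, v}"
 shows "draw (V1 \<union> V2) (E1 \<union> E2) pos A"
proof -
 have sym: "(\<forall>x\<in>V1. \<forall>y\<in>V2. pos x = pos y \<longrightarrow> x = y) \<and>
   (\<forall>e\<in>E1. A e \<inter> pos ` V2 \<subseteq> pos ` e) \<and> (\<forall>e\<in>E1. \<forall>f\<in>E2. e \<noteq> f \<longrightarrow> A e \<inter> A f \<subseteq> pos ` (e \<inter> f))"
  if d1: "draw V1 E1 pos A" and d2: "draw V2 E2 pos A" and V: "V1 \<inter> V2 = {u, v}"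
  and uv: "{u, v} \<in> E1" "{u, v} \<in> E2" and sep: "pic V1 E1 pos A \<inter> pic V2 E2 pos A \<subseteq> A {u, v}" for V1 E1 V2 E2
 proof (intro conjI ballI impI)
  note inj = drawD(1)[OF d1] drawD(1)[OF d2]
  have uvV: "u \<in> V1" "v \<in> V1" "u \<in> V2" "v \<in> V2" using V by auto
  have on1: "x \<in> {u, v}" if "x \<in> V1" "pos x \<in> A {u, v}" for x
  proof -
   have "A {u, v} \<inter> pos ` V1 = pos ` {u, v}" by (rule drawD(5)[OF d1 uv(1)])
   hence "pos x \<in> pos ` {u, v}" using that by blast
   thus ?thesis using inj_on_image_mem_iff[OF inj(1) that(1), of "{u, v}"] uvV by blast
  qed
  have on2: "x \<in> {u, v}" if "x \<in> V2" "pos x \<in> A {u, v}" for x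
  proof -
   have "A {u, v} \<inter> pos ` V2 = pos ` {u, v}" by (rule drawD(5)[OF d2 uv(2)])
   hence "pos x \<in> pos ` {u, v}" using that by blast
   thus ?thesis using inj_on_image_mem_iff[OF inj(2) that(1), of "{u, v}"] uvV by blast
  qed
  show "x = y" if "x \<in> V1" "y \<in> V2" "pos x = pos y" for x y
  proof -
   have "pos x \<in> pos ` V1" using that(1) by (rule imageI)
   moreover have "pos x \<in> pos ` V2" unfolding that(3) using that(2) by (rule imageI)
   ultimately      have "pos x \<in> pic V1 E1 pos A \<inter> pic V2 E2 pos A" unfolding pic_def by blast
   thus ?thesis using on1[OF that(1)] sep inj_onD[OF inj(2) that(3)] that(2) uvV by blast
  qed
  show "A e \<inter> pos ` V2 \<subseteq> pos ` e" if e: "e \<in> E1" for e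
  proof
   fix z assume z: "z \<in> A e \<inter> pos ` V2"
   then obtain y where y: "y \<in> V2" "z = pos y" by blast
   have "z \<in> pic V1 E1 pos A \<inter> pic V2 E2 pos A" using z e unfolding pic_def by auto
   hence "y \<in> {u, v}" using on2[OF y(1)] sep y(2) by blast
   thus "z \<in> pos ` e" using z y uvV drawD(5)[OF d1 e] by blast
  qed
  show "A e \<inter> A f \<subseteq> pos ` (e \<inter> f)" if e: "e \<in> E1" "f \<in> E2" "e \<noteq> f" for e f
  proof
   fix z assume z: "z \<in> A e \<inter> A f"
   have zs: "z \<in> A {u, v}" using z e sep unfolding pic_def by blast
   have 1: "z \<in> pos ` (e \<inter> {u, v})" if "e \<noteq> {u, v}" using drawD(6)[OF d1 e(1) uv(1) that] z zs by blast
   have 2: "z \<in> pos ` (f \<inter> {u, v})" if "f \<noteq> {u, v}" using drawD(6)[OF d2 e(2) uv(2) that] z zs by blast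
   show "z \<in> pos ` (e \<inter> f)"
   proof (cases "e = {u, v} \<or> f = {u, v}")
    case True
    thus ?thesis using 1 2 e(3) by (metis Int_commute)
   next
    case False
    then obtain x y where "x \<in> e \<inter> {u, v}" "z = pos x" "y \<in> f \<inter> {u, v}" "z = pos y" using 1 2 by blast
    moreover from this have "x = y" using inj_onD[OF inj(1), of x y] uvV by blast
    ultimately show ?thesis by blast
   qed
  qed
 qed
 have V': "V2 \<inter> V1 = {u, v}" "pic V2 E2 pos A \<inter> pic V1 E1 pos A \<subseteq> A {u, v}" using V sep by blast+
 note s1 = sym[OF d1 d2 V uv sep]
 note s2 = sym[OF d2 d1 V'(1) uv(2,1) V'(2)]
 note inj = drawD(1)[OF d1] drawD(1)[OF d2]
 show ?thesis
 proof (rule drawI)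
  show "inj_on pos (V1 \<union> V2)"
  proof (rule inj_onI)
   fix x y assume "x \<in> V1 \<union> V2" "y \<in> V1 \<union> V2" "pos x = pos y"
   thus "x = y" using s1 s2 inj_onD[OF inj(1)] inj_onD[OF inj(2)] by (metis UnE)
  qed
  fix e assume "e \<in> E1 \<union> E2"
  then consider "e \<in> E1" | "e \<in> E2" by blast
  hence "e \<subseteq> V1 \<union> V2 \<and> card e = 2 \<and> isarc (A e) (pos ` e) \<and> A e \<inter> pos ` (V1 \<union> V2) = pos ` e"
  proof cases
   case 1
   thus ?thesis using s1 drawD(5)[OF d1 1] unfolding image_Un Int_Un_distrib using drawD(2-4)[OF d1 1] by force
  next
   case 2
   thus ?thesis using s2 drawD(5)[OF d2 2] unfolding image_Un Int_Un_distrib using drawD(2-4)[OF d2 2] by force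
  qed
  thus "e \<subseteq> V1 \<union> V2" "card e = 2" "isarc (A e) (pos ` e)" "A e \<inter> pos ` (V1 \<union> V2) = pos ` e" by blast+
 next
  fix e f assume h: "e \<in> E1 \<union> E2" "f \<in> E1 \<union> E2" "e \<noteq> f"
  then consider "e \<in> E1" "f \<in> E1" | "e \<in> E2" "f \<in> E2" | "e \<in> E1" "f \<in> E2" | "e \<in> E2" "f \<in> E1" by blast
  thus "A e \<inter> A f \<subseteq> pos ` (e \<inter> f)"
  proof cases
   case 1 show ?thesis by (rule drawD(6)[OF d1 1 h(3)])
  next
   case 2 show ?thesis by (rule drawD(6)[OF d2 2 h(3)])
  next
   case 3 thus ?thesis using s1 h(3) by simp
  next
   case 4 thus ?thesis using s2 h(3) by simp
  qed
 qed
qed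

section \<open>Parabolic arcs and the regions below them\<close>

lemma isarc_curve:
 assumes "p < q"
 shows "isarc (curve c p q) {Complex p 0, Complex q 0}"
proof -
 define x where "x t = p + t * (q - p)" for t
 define g where "g t = Complex (x t) (c * ((x t - p) * (q - x t)))" for t
 have "path g" unfolding path_def g_def x_def by (intro continuous_intros)
 moreover have "inj_on g {0..1}" unfolding g_def x_def by (rule inj_onI) (use assms in auto)
 moreover have "path_image g = curve c p q"
 proof (intro equalityI subsetI)
  fix z assume "z \<in> path_image g"
  then obtain t where t: "0 \<le> t" "t \<le> 1" "z = g t" unfolding path_image_def by auto
  have "0 \<le> t * (q - p)" "t * (q - p) \<le> 1 * (q - p)" using t assms by (auto intro: mult_right_mono)
  thus "z \<in> curve c p q" unfolding curve_def t(3) g_def x_def by auto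
 next
  fix z assume z: "z \<in> curve c p q"
  let ?t = "(Re z - p) / (q - p)"
  have "x ?t = Re z" unfolding x_def using assms by simp
  hence "g ?t = z" using z unfolding g_def curve_def by (simp add: complex_eq_iff)
  moreover have "?t \<in> {0..1}" using z assms unfolding curve_def by (auto simp: divide_simps)
  ultimately show "z \<in> path_image g" unfolding path_image_def by (metis imageI)
 qed
 moreover have "pathstart g = Complex p 0" "pathfinish g = Complex q 0"
  unfolding pathstart_def pathfinish_def g_def x_def by auto
 ultimately show ?thesis unfolding isarc_def arc_def by (intro exI[of _ g]) simp
qed

lemma lens_bounds: "p < q ==> 0 < c ==> 0 \<le> Im z ==> Im z < c * ((Re z - p) * (q - Re z)) ==> p < Re z \<and> Re z < q"
proof (rule ccontr)
 assume h: "p < q" "0 < c" "0 \<le> Im z" "Im z < c * ((Re z - p) * (q - Re z))" "\<not> (p < Re z \<and> Re z < q)"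
 hence "c * ((Re z - p) * (q - Re z)) \<le> 0" using h(2) by (auto simp: mult_le_0_iff)
 thus False using h by linarith
qed

lemma concave_mix:
 fixes c p q x y t :: real
 shows "c * (((1 - t) * x + t * y - p) * (q - ((1 - t) * x + t * y))) =
  (1 - t) * (c * ((x - p) * (q - x))) + t * (c * ((y - p) * (q - y))) + c * (t * (1 - t) * (x - y)^2)"
 by (simp add: algebra_simps power2_eq_square)

text \<open>By concavity of the parabola, a point of the closed region that is moved towards a point
  of the lens enters the lens at once. This gives both convexity and the closure.\<close>

lemma lens_face:
 assumes pq: "p < q" and c: "0 < c"
 shows "open (lens c p q)" "connected (lens c p q)" "frontier (lens c p q) = curve 0 p q \<union> curve c p q"
proof -
 let ?L = "lens c p q" and ?C = "{z. 0 \<le> Im z \<and> Im z \<le> c * ((Re z - p) * (q - Re z))}"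
 show o: "open ?L" unfolding lens_def by (intro open_Collect_conj open_Collect_less continuous_intros)
 have cl: "closed ?C" by (intro closed_Collect_conj closed_Collect_le continuous_intros)
 have mix: "(1 - t) *\<^sub>R z + t *\<^sub>R w \<in> ?L" if z: "z \<in> ?C" and w: "w \<in> ?L" and t: "0 < t" "t \<le> 1" for z w :: complex and t
 proof -
  let ?x = "(1 - t) * Re z + t * Re w"
  have "0 < t * Im w" "0 \<le> (1 - t) * Im z" using z w t unfolding lens_def by auto
  moreover have "(1 - t) * Im z \<le> (1 - t) * (c * ((Re z - p) * (q - Re z)))" using z t by (intro mult_left_mono) auto
  moreover have "t * Im w < t * (c * ((Re w - p) * (q - Re w)))"
   using w t unfolding lens_def by (intro mult_strict_left_mono) auto
  moreover have "0 \<le> c * (t * (1 - t) * (Re z - Re w)^2)" using c t by simp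
  ultimately show ?thesis unfolding lens_def mem_Collect_eq by (simp add: concave_mix)
 qed
 have LC: "?L \<subseteq> ?C" unfolding lens_def by auto
 have "convex ?L" unfolding convex_alt
 proof (intro ballI allI impI)
  fix x y :: complex and u :: real assume h: "x \<in> ?L" "y \<in> ?L" "0 \<le> u \<and> u \<le> 1"
  show "(1 - u) *\<^sub>R x + u *\<^sub>R y \<in> ?L" using mix[of x y u] h LC by force
 qed
 thus "connected ?L" by (rule convex_connected)
 define w where "w = Complex ((p + q) / 2) (c * ((q - p) / 2 * ((q - p) / 2)) / 2)"
 have half: "(p + q) / 2 - p = (q - p) / 2" "q - (p + q) / 2 = (q - p) / 2" by (auto simp: field_simps)
 have w: "w \<in> ?L" using pq c unfolding lens_def w_def mem_Collect_eq complex.sel half by simp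
 have "?C \<subseteq> closure ?L"
 proof
  fix z assume z: "z \<in> ?C"
  define f where "f n = (1 - inverse (real (Suc n))) *\<^sub>R z + inverse (real (Suc n)) *\<^sub>R w" for n
  have "f n \<in> ?L" for n unfolding f_def by (rule mix[OF z w]) (auto simp: divide_simps)
  moreover have "f \<longlonglongrightarrow> (1 - 0) *\<^sub>R z + 0 *\<^sub>R w" unfolding f_def by (intro tendsto_intros LIMSEQ_inverse_real_of_nat)
  ultimately show "z \<in> closure ?L" unfolding closure_sequential by (intro exI[of _ f]) auto
 qed
 moreover have "closure ?L \<subseteq> ?C" by (rule closure_minimal[OF LC cl])
 ultimately have "frontier ?L = ?C - ?L" unfolding frontier_def using interior_open[OF o] by auto
 also have "\<dots> = curve 0 p q \<union> curve c p q"
 proof (intro equalityI subsetI)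
  fix z assume z: "z \<in> ?C - ?L"
  have "p \<le> Re z \<and> Re z \<le> q"
  proof (rule ccontr)
   assume "\<not> ?thesis"
   hence "c * ((Re z - p) * (q - Re z)) < 0" using pq c by (auto simp: mult_less_0_iff)
   thus False using z by auto
  qed
  thus "z \<in> curve 0 p q \<union> curve c p q" using z unfolding curve_def lens_def by auto
 next
  fix z assume z: "z \<in> curve 0 p q \<union> curve c p q"
  thus "z \<in> ?C - ?L" using c unfolding curve_def using z unfolding curve_def lens_def by auto
 qed
 finally show "frontier ?L = curve 0 p q \<union> curve c p q" .
qed

subsection \<open>Making room below an edge\<close>

text \<open>The height of \<open>curve (1/2) p q\<close> over the segment and 0 outside it: the room
  that is made below a lifted edge.\<close>

definition eps :: "real \<Rightarrow> real \<Rightarrow> real \<Rightarrow> real" where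
 "eps p q x = max 0 ((x - p) * (q - x) / 2)"

text \<open>Lifts the segment from \<open>p\<close> to \<open>q\<close> to \<open>curve (1/2) p q\<close> and fixes the part of the axis outside it.\<close>

definition squash :: "real \<Rightarrow> real \<Rightarrow> complex \<Rightarrow> complex" where
 "squash p q z = Complex (Re z) (max (Im z) (eps p q (Re z) + Im z / 2))"

lemma homeo_squash: "homeo (squash p q)"
proof -
 let ?T = "\<lambda>z. Complex (Re z) (min (Im z) (2 * (Im z - eps p q (Re z))))"
 have "continuous_on UNIV (squash p q)" unfolding squash_def eps_def by (intro continuous_intros) auto
 moreover have "continuous_on UNIV ?T" unfolding eps_def by (intro continuous_intros) auto
 moreover have "?T (squash p q z) = z" "squash p q (?T z) = z" for z
  unfolding eps_def squash_def by (auto simp: complex_eq_iff max_def min_def field_simps)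
 ultimately show ?thesis unfolding homeo_def by (intro exI[of _ ?T]) blast
qed

text \<open>Lowers the roof \<open>curve 1 p q\<close> of a drawing to
  \<open>curve (1/2) p q\<close>, so that the drawing fits into the room made by
  \<open>squash p q\<close>.\<close>

definition half :: "complex \<Rightarrow> complex" where
 "half z = Complex (Re z) (Im z / 2)"

lemma homeo_half: "homeo half"
 unfolding homeo_def half_def by (intro exI[of _ "\<lambda>z. Complex (Re z) (2 * Im z)"] conjI continuous_intros) (auto simp: complex_eq_iff)

lemma Re_squash [simp]: "Re (squash p q z) = Re z" "Re (half z) = Re z" "Im (half z) = Im z / 2"
 by (auto simp: squash_def half_def)

lemma squash_fix: "2 * eps p q (Re z) \<le> Im z ==> squash p q z = z"
 unfolding squash_def by (simp add: complex_eq_iff max_def)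

lemma squash_ge: "0 \<le> Im z ==> eps p q (Re z) \<le> Im (squash p q z)" "0 < Im z ==> eps p q (Re z) < Im (squash p q z)"
 "0 \<le> Im z ==> Im z \<le> Im (squash p q z)"
 unfolding squash_def by (auto simp: max_def)

lemma eps_le: "P \<le> p ==> p < q ==> q \<le> Q ==> P \<le> x ==> x \<le> Q ==> 2 * eps p q x \<le> (x - P) * (Q - x)"
proof -
 assume h: "P \<le> p" "p < q" "q \<le> Q" "P \<le> x" "x \<le> Q"
 show ?thesis
 proof (cases "p \<le> x \<and> x \<le> q")
  case True
  hence "(x - p) * (q - x) \<le> (x - P) * (Q - x)" using h by (intro mult_mono) auto
  thus ?thesis using h unfolding eps_def by (simp add: max_def)
 next
  case False
  thus ?thesis using h unfolding eps_def by (auto simp: mult_le_0_iff)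
 qed
qed

lemma squash_le: "P \<le> p ==> p < q ==> q \<le> Q ==> P \<le> Re z ==> Re z \<le> Q ==> Im z \<le> (Re z - P) * (Q - Re z) ==>
  Im (squash p q z) \<le> (Re z - P) * (Q - Re z)"
 "P \<le> p ==> p < q ==> q \<le> Q ==> P \<le> Re z ==> Re z \<le> Q ==> Im z < (Re z - P) * (Q - Re z) ==>
  Im (squash p q z) < (Re z - P) * (Q - Re z)"
 using eps_le[of P p q Q "Re z"] unfolding squash_def by (auto simp: max_def)

lemma squash_region: "P \<le> p ==> p < q ==> q \<le> Q ==> z \<in> region P Q ==> squash p q z \<in> region P Q"
 using squash_le(1)[of P p q Q z] squash_ge(3)[of z p q] unfolding region_def by auto

lemma eps_0: "x \<le> p \<or> q \<le> x ==> p < q ==> eps p q x = 0"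
proof -
 assume "x \<le> p \<or> q \<le> x" "p < q"
 thus ?thesis unfolding eps_def by (auto simp: mult_le_0_iff)
qed

lemma eps_ge: "0 \<le> eps p q x"
 unfolding eps_def by simp

lemma eps_in: "p \<le> x ==> x \<le> q ==> eps p q x = (x - p) * (q - x) / 2"
 unfolding eps_def by (simp add: max_def)

lemma squash_axis: "p < q ==> squash p q ` curve 0 p q = curve (1/2) p q"
proof (intro equalityI subsetI)
 fix z assume "p < q" "z \<in> squash p q ` curve 0 p q"
 then obtain w where w: "z = squash p q w" "w \<in> curve 0 p q" by blast
 thus "z \<in> curve (1/2) p q"
  using eps_in[of p "Re w" q] eps_ge[of p q "Re w"] unfolding curve_def squash_def by (auto simp: max_def)
next
 fix z assume pq: "p < q" and z: "z \<in> curve (1/2) p q"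
 let ?w = "Complex (Re z) 0"
 have "?w \<in> curve 0 p q" using z unfolding curve_def by auto
 moreover have "squash p q ?w = z"
  using z eps_in[of p "Re z" q] eps_ge[of p q "Re z"] unfolding squash_def curve_def by (auto simp: complex_eq_iff max_def)
 ultimately show "z \<in> squash p q ` curve 0 p q" by (metis imageI)
qed

lemma half_curve: "half ` curve c p q = curve (c/2) p q"
proof (intro equalityI subsetI)
 fix z assume z: "z \<in> curve (c/2) p q"
 hence "Complex (Re z) (2 * Im z) \<in> curve c p q" unfolding curve_def by auto
 moreover have "half (Complex (Re z) (2 * Im z)) = z" by (simp add: half_def complex_eq_iff)
 ultimately show "z \<in> half ` curve c p q" by (metis imageI)
qed (auto simp: curve_def half_def)

subsection \<open>Drawing a web above the real axis\<close>

text \<open>The abscissas are prescribed because gluing needs two drawings with common base points.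
  Empty lists and lists of different lengths give \<open>False\<close>.\<close>

fun bottom :: "('v \<Rightarrow> complex) \<Rightarrow> ('v set \<Rightarrow> complex set) \<Rightarrow> 'v set set \<Rightarrow> 'v list \<Rightarrow> real list \<Rightarrow> bool" where
 "bottom pos A E [u] [x] \<longleftrightarrow> pos u = Complex x 0"
| "bottom pos A E (u # v # ts) (x # y # xs) \<longleftrightarrow>
   pos u = Complex x 0 \<and> {u, v} \<in> E \<and> A {u, v} = curve 0 x y \<and> bottom pos A E (v # ts) (y # xs)"
| "bottom pos A E _ _ \<longleftrightarrow> False"

lemma bottom_append:
 "length us = length as ==>
  bottom pos A E (us @ u # vs) (as @ p # bs) \<longleftrightarrow> bottom pos A E (us @ [u]) (as @ [p]) \<and> bottom pos A E (u # vs) (p # bs)"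
proof (induction us as rule: list_induct2)
 case Nil
 show ?case by (cases "(pos, A, E, u # vs, p # bs)" rule: bottom.cases) auto
next
 case (Cons v us q as)
 show ?case using Cons.IH by (cases us; cases as) auto
qed

lemma bottom_cong:
 "bottom pos A E ts xs ==> (\<And>u. u \<in> set ts ==> pos' u = pos u) ==>
  (\<And>e x y. e \<in> E ==> e \<subseteq> set ts ==> A e = curve 0 x y ==> x \<in> set xs ==> y \<in> set xs ==> A' e = A e) ==> E \<subseteq> E' ==> bottom pos' A' E' ts xs"
proof (induction pos A E ts xs rule: bottom.induct)
 case (2 pos A E u v ts x y xs)
 have "bottom pos' A' E' (v # ts) (y # xs)"
 proof (rule 2(1))
  show "bottom pos A E (v # ts) (y # xs)" using 2(2) by simp
  show "pos' w = pos w" if "w \<in> set (v # ts)" for w using 2(3) that by simp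
  show "A' e = A e" if "e \<in> E" "e \<subseteq> set (v # ts)" "A e = curve 0 a b" "a \<in> set (y # xs)" "b \<in> set (y # xs)" for e a b
   using 2(4)[OF that(1) _ that(3)] that by auto
  show "E \<subseteq> E'" by fact
 qed
 thus ?case using 2 by auto
qed auto

lemma bottom_pos: "bottom pos A E ts xs ==> u \<in> set ts ==> \<exists>x\<in>set xs. pos u = Complex x 0"
 by (induction pos A E ts xs rule: bottom.induct) auto

lemma bottom_image:
 assumes "bottom pos A E ts xs" "\<And>z. Im z = 0 ==> c \<le> Re z ==> Re z \<le> d ==> S z = z" "set xs \<subseteq> {c..d}"
 shows "bottom (S \<circ> pos) (\<lambda>e. S ` A e) E ts xs"
proof (rule bottom_cong[OF assms(1)])
 fix u assume "u \<in> set ts"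
 then obtain x where "x \<in> set xs" "pos u = Complex x 0" using bottom_pos[OF assms(1)] by blast
 thus "(S \<circ> pos) u = pos u" using assms(2)[of "Complex x 0"] assms(3) by auto
next
 fix e x y assume "A e = curve 0 x y" "x \<in> set xs" "y \<in> set xs"
 moreover from this have "S z = z" if "z \<in> curve 0 x y" for z
  using that assms(2)[of z] assms(3) unfolding curve_def by fastforce
 ultimately show "S ` A e = A e" by simp
qed simp

text \<open>The boundary cycle is drawn along the real axis and closed by the arc \<open>curve 1\<close> above the drawing.\<close>

definition good where
 "good V E M ts xs pos A \<longleftrightarrow> draw V E pos A \<and> set ts \<subseteq> V \<and> sorted_wrt (<) xs \<and>
   pic V E pos A \<subseteq> region (hd xs) (last xs) \<and> bottom pos A E ts xs \<and>
   {hd ts, last ts} \<in> E \<and> A {hd ts, last ts} = curve 1 (hd xs) (last xs) \<and>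
   (\<forall>m\<in>M. \<exists>F. face V E pos A m F \<and> F \<subseteq> lens 1 (hd xs) (last xs))"

lemma goodD:
 assumes "good V E M ts xs pos A"
 shows "draw V E pos A" "set ts \<subseteq> V" "sorted_wrt (<) xs" "pic V E pos A \<subseteq> region (hd xs) (last xs)" "bottom pos A E ts xs"
  "{hd ts, last ts} \<in> E" "A {hd ts, last ts} = curve 1 (hd xs) (last xs)"
  "m \<in> M ==> \<exists>F. face V E pos A m F \<and> F \<subseteq> lens 1 (hd xs) (last xs)"
 using assms unfolding good_def by simp_all

lemma sorted_bounds: "sorted_wrt (<) (xs :: real list) ==> x \<in> set xs ==> hd xs \<le> x \<and> x \<le> last xs"
proof (induction xs)
 case (Cons y xs)
 show ?case
 proof (cases "xs = []")
  case False
  thus ?thesis using Cons.prems Cons False by (cases "x = y") (auto intro: less_imp_le)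
 qed (use Cons in auto)
qed simp

lemma card2_eq: "card e = 2 ==> e \<subseteq> {u, v} ==> e = {u, v}"
 by (rule card_seteq) (auto simp: card_insert_if)

lemma face_union:
 assumes f: "face V1 E1 pos A m F" and m: "m \<subseteq> V1" and d2: "draw V2 E2 pos A" and V: "V1 \<inter> V2 = {u, v}" "{u, v} \<in> E1"
  and sep: "F \<inter> pic V2 E2 pos A = {}"
 shows "face (V1 \<union> V2) (E1 \<union> E2) pos A m F"
proof -
 have uv: "e = {u, v}" if "e \<in> E2" "e \<subseteq> m" for e by (rule card2_eq) (use drawD(2,3)[OF d2 that(1)] that(2) m V(1) in auto)
 have "{e \<in> E1 \<union> E2. e \<subseteq> m} = {e \<in> E1. e \<subseteq> m}" using uv V(2) by blast
 moreover have "pic (V1 \<union> V2) (E1 \<union> E2) pos A = pic V1 E1 pos A \<union> pic V2 E2 pos A" unfolding pic_def by auto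
 ultimately show ?thesis using f sep unfolding face_def by (simp add: Int_Un_distrib)
qed

text \<open>In the upper half plane \<open>squash\<close> moves only points below
  \<open>curve 1 p q\<close>, so it leaves the roof over the longer segment in place, and it lifts
  every point to height at least \<open>eps\<close>.\<close>

lemma good_squash:
 assumes g: "good V E M ts xs pos A" and pq: "hd xs \<le> p" "p < q" "q \<le> last xs"
 defines "S \<equiv> squash p q"
 shows "draw V E (S \<circ> pos) (\<lambda>e. S ` A e)" "pic V E (S \<circ> pos) (\<lambda>e. S ` A e) \<subseteq> region (hd xs) (last xs)"
  "\<And>z. z \<in> pic V E (S \<circ> pos) (\<lambda>e. S ` A e) ==> eps p q (Re z) \<le> Im z"
  "S ` A {hd ts, last ts} = curve 1 (hd xs) (last xs)"
  "\<And>m. m \<in> M ==> \<exists>F. face V E (S \<circ> pos) (\<lambda>e. S ` A e) m F \<and> F \<subseteq> lens 1 (hd xs) (last xs) \<and> (\<forall>z\<in>F. eps p q (Re z) < Im z)"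
proof -
 have d: "draw V E pos A" and r: "pic V E pos A \<subseteq> region (hd xs) (last xs)" using g unfolding good_def by blast+
 show "draw V E (S \<circ> pos) (\<lambda>e. S ` A e)" unfolding S_def by (rule draw_homeo[OF homeo_squash d])
 show "pic V E (S \<circ> pos) (\<lambda>e. S ` A e) \<subseteq> region (hd xs) (last xs)"
  unfolding pic_homeo using squash_region[OF pq] r unfolding S_def by blast
 show "eps p q (Re z) \<le> Im z" if z: "z \<in> pic V E (S \<circ> pos) (\<lambda>e. S ` A e)" for z
 proof -
  obtain w where w: "z = S w" "w \<in> pic V E pos A" using z unfolding pic_homeo by blast
  thus ?thesis using r unfolding region_def using squash_ge(1)[of w p q] w(1) unfolding S_def by auto
 qed
 have "S z = z" if "z \<in> curve 1 (hd xs) (last xs)" for z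
  unfolding S_def by (rule squash_fix) (use eps_le[OF pq, of "Re z"] that in \<open>auto simp: curve_def\<close>)
 thus "S ` A {hd ts, last ts} = curve 1 (hd xs) (last xs)" using g unfolding good_def by simp
 fix m assume "m \<in> M"
 then obtain F where F: "face V E pos A m F" "F \<subseteq> lens 1 (hd xs) (last xs)" using goodD(8)[OF g] by meson
 have "S z \<in> lens 1 (hd xs) (last xs) \<and> eps p q (Re (S z)) < Im (S z)" if "z \<in> F" for z
 proof -
  have z: "0 < Im z" "Im z < (Re z - hd xs) * (last xs - Re z)" using F(2) that unfolding lens_def by auto
  have "hd xs < Re z \<and> Re z < last xs" by (rule lens_bounds[where c = 1]) (use pq z in auto)
  thus ?thesis
   using squash_le(2)[OF pq, of z] squash_ge(2)[of z p q] squash_ge(3)[of z p q] z unfolding lens_def S_def by auto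
 qed
 hence "S ` F \<subseteq> lens 1 (hd xs) (last xs) \<and> (\<forall>z\<in>S ` F. eps p q (Re z) < Im z)" by blast
 moreover have "face V E (S \<circ> pos) (\<lambda>e. S ` A e) m (S ` F)" unfolding S_def by (rule face_homeo[OF homeo_squash F(1)])
 ultimately show "\<exists>F. face V E (S \<circ> pos) (\<lambda>e. S ` A e) m F \<and> F \<subseteq> lens 1 (hd xs) (last xs) \<and> (\<forall>z\<in>F. eps p q (Re z) < Im z)"
  by blast
qed

lemma squash_fix_axis: "p < q ==> Im z = 0 ==> Re z \<le> p \<or> q \<le> Re z ==> squash p q z = z"
 by (rule squash_fix) (simp add: eps_0)

lemma good_tri:
 assumes d: "distinct [a, b, c]" and xs: "sorted_wrt (<) [x, y, z]"
 shows "\<exists>pos A. good {a, b, c} {{a, b}, {b, c}, {a, c}} {{a, b, c}} [a, b, c] [x, y, z] pos A"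
proof -
 define pos where "pos v = (if v = a then Complex x 0 else if v = b then Complex y 0 else Complex z 0)" for v
 define A where "A e = (if e = {a, b} then curve 0 x y else if e = {b, c} then curve 0 y z else curve 1 x z)" for e
 have o: "x < y" "y < z" "x < z" using xs by auto
 have n: "a \<noteq> b" "a \<noteq> c" "b \<noteq> c" using d by auto
 have P: "pos a = Complex x 0" "pos b = Complex y 0" "pos c = Complex z 0" using n unfolding pos_def by auto
 have A: "A {a, b} = curve 0 x y" "A {b, c} = curve 0 y z" "A {a, c} = curve 1 x z"
  using n unfolding A_def by (auto simp: doubleton_eq_iff)
 have top: "w = Complex x 0 \<or> w = Complex z 0" if w: "w \<in> curve 1 x z" "Im w = 0" for w
  using w that unfolding curve_def by (auto simp: complex_eq_iff)
 have mem: "Complex s 0 \<in> curve 0 p q \<longleftrightarrow> p \<le> s \<and> s \<le> q" for s p q unfolding curve_def by auto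
 have mem1: "Complex x 0 \<in> curve 1 x z" "Complex z 0 \<in> curve 1 x z" "Complex y 0 \<notin> curve 1 x z"
  using o unfolding curve_def by auto
 let ?E = "{{a, b}, {b, c}, {a, c}}" and ?V = "{a, b, c}"
 have dr: "draw ?V ?E pos A"
 proof (rule drawI)
  show "inj_on pos ?V" using o n P by auto
  fix e assume e: "e \<in> ?E"
  show "e \<subseteq> ?V" "card e = 2" using e n by auto
  show "isarc (A e) (pos ` e)" using e A P isarc_curve o by auto
  show "A e \<inter> pos ` ?V = pos ` e" using e A P o mem mem1 by auto
  fix f assume f: "f \<in> ?E" "e \<noteq> f"
  have 1: "curve 0 x y \<inter> curve 0 y z \<subseteq> {Complex y 0}" unfolding curve_def by (auto simp: complex_eq_iff)
  have 2: "curve 0 x y \<inter> curve 1 x z \<subseteq> {Complex x 0}"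
  proof
   fix w assume w: "w \<in> curve 0 x y \<inter> curve 1 x z"
   thus "w \<in> {Complex x 0}" unfolding curve_def using top[of w] w o by auto
  qed
  have 3: "curve 0 y z \<inter> curve 1 x z \<subseteq> {Complex z 0}"
  proof
   fix w assume w: "w \<in> curve 0 y z \<inter> curve 1 x z"
   thus "w \<in> {Complex z 0}" unfolding curve_def using top[of w] w o by auto
  qed
  have i: "{a, b} \<inter> {b, c} = {b}" "{b, c} \<inter> {a, b} = {b}" "{a, b} \<inter> {a, c} = {a}" "{a, c} \<inter> {a, b} = {a}" "{b, c} \<inter> {a, c} = {c}" "{a, c} \<inter> {b, c} = {c}" using n by auto
  have s: "A {a, b} \<inter> A {b, c} \<subseteq> pos ` {b}" "A {a, b} \<inter> A {a, c} \<subseteq> pos ` {a}" "A {b, c} \<inter> A {a, c} \<subseteq> pos ` {c}"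
   using 1 2 3 unfolding A by (simp_all add: P)
  show "A e \<inter> A f \<subseteq> pos ` (e \<inter> f)"
  proof -
   have sy: "A {b, c} \<inter> A {a, b} \<subseteq> pos ` {b}" "A {a, c} \<inter> A {a, b} \<subseteq> pos ` {a}" "A {a, c} \<inter> A {b, c} \<subseteq> pos ` {c}"
    using s by blast+
   consider "e = {a, b}" "f = {b, c}" | "e = {a, b}" "f = {a, c}" | "e = {b, c}" "f = {a, b}" | "e = {b, c}" "f = {a, c}"
    | "e = {a, c}" "f = {a, b}" | "e = {a, c}" "f = {b, c}" using e f by (elim insertE emptyE) simp_all
   thus ?thesis by cases (simp_all only: i s sy)
  qed
 qed
 have reg: "curve 0 s t \<subseteq> region x z" if "x \<le> s" "t \<le> z" for s t using that unfolding curve_def region_def by auto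
 have reg1: "curve 1 x z \<subseteq> region x z" unfolding curve_def region_def by auto
 have "pos ` ?V \<subseteq> region x z" unfolding region_def using o P by auto
 hence pr: "pic ?V ?E pos A \<subseteq> region x z" unfolding pic_def using A reg[of x y] reg[of y z] reg1 o by auto
 have u: "curve 0 x y \<union> curve 0 y z = curve 0 x z" unfolding curve_def using o by auto
 note L = lens_face[OF o(3) zero_less_one]
 have "lens 1 x z \<inter> pic ?V ?E pos A = {}" unfolding pic_def using A P by (auto simp: lens_def curve_def)
 moreover have "{e \<in> ?E. e \<subseteq> ?V} = ?E" by auto
 hence "(\<Union>e\<in>{e \<in> ?E. e \<subseteq> ?V}. A e) = curve 0 x z \<union> curve 1 x z" using A u by auto
 ultimately have f: "face ?V ?E pos A ?V (lens 1 x z)" unfolding face_def using L by simp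
 show ?thesis unfolding good_def using dr pr xs A P f by auto
qed

text \<open>Lifting takes \<open>w\<close> and its two edges off the axis, and the new edge becomes
  the vacated segment. The lens in between is the face of the new triangle.\<close>

lemma good_peel:
 assumes g: "good V E M (u # w # v # ts) (p # r # q # xs) pos A" and d: "u \<noteq> v" "w \<noteq> u" "w \<noteq> v" "w \<notin> set ts" "u \<notin> set ts" "v \<notin> set ts" "ts \<noteq> []"
 shows "\<exists>pos A. good V (insert {u, v} E) (insert {u, w, v} {m \<in> M. \<not> {u, v} \<subseteq> m}) (u # v # ts) (p # q # xs) pos A"
proof -
 let ?S = "squash p q"
 let ?xs = "p # r # q # xs" and ?ts = "u # w # v # ts"
 let ?Q = "last ?xs"
 have so: "sorted_wrt (<) ?xs" using g unfolding good_def by blast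
 have pq: "p < q" "p < r" "r < q" using so by auto
 have qQ: "q \<le> ?Q" using sorted_bounds[OF so, of q] by simp
 have pq': "hd ?xs \<le> p" "p < q" "q \<le> last ?xs" using pq qQ by auto
 note G = good_squash[OF g pq']
 have dr: "draw V E pos A" and tsV: "set ?ts \<subseteq> V" and bt: "bottom pos A E ?ts ?xs" and tE: "{u, last ?ts} \<in> E"
  using g unfolding good_def by auto
 have b: "pos u = Complex p 0" "{u, w} \<in> E" "A {u, w} = curve 0 p r" "{w, v} \<in> E" "A {w, v} = curve 0 r q" "bottom pos A E (v # ts) (q # xs)" using bt by auto
 have bv: "pos v = Complex q 0" using b(6) by (cases ts; cases xs) auto
 define pos' where "pos' = ?S \<circ> pos"
 define A' where "A' e = (if e = {u, v} then curve 0 p q else ?S ` A e)" for e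
 let ?E = "insert {u, v} E"
 have A'e: "A' e = ?S ` A e" if "e \<noteq> {u, v}" for e using that unfolding A'_def by simp
 have A'uv: "A' {u, v} = curve 0 p q" unfolding A'_def by simp
 have pu: "pos' u = Complex p 0" "pos' v = Complex q 0"
  unfolding pos'_def using b(1) bv squash_fix_axis[OF pq(1), of "Complex p 0"] squash_fix_axis[OF pq(1), of "Complex q 0"] by auto
 note D = drawD[OF G(1), folded pos'_def]
 \<comment> \<open>On the segment from \<open>p\<close> to \<open>q\<close> the lifted drawing keeps
   only the two end points, since \<open>eps\<close> is positive in between.\<close>
 have ax: "z = pos' u \<or> z = pos' v" if z: "z \<in> curve 0 p q" "z \<in> pic V E pos' (\<lambda>e. ?S ` A e)" for z
  using G(3)[of z] z eps_in[of p "Re z" q] z(1) pu that unfolding pos'_def curve_def by (force simp: mult_le_0_iff complex_eq_iff)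
 have tv: "u \<in> V" "v \<in> V" using tsV by auto
 have key: "curve 0 p q \<inter> ?S ` A e \<subseteq> pos' ` ({u, v} \<inter> e)" if e: "e \<in> E" for e
 proof
  fix z assume z: "z \<in> curve 0 p q \<inter> ?S ` A e"
  hence "z \<in> pic V E pos' (\<lambda>e. ?S ` A e)" using e unfolding pic_def by auto
  then obtain t where t: "t \<in> {u, v}" "z = pos' t" using ax[of z] z by blast
  thus "z \<in> pos' ` ({u, v} \<inter> e)" using z tv D(5)[OF e] inj_on_image_mem_iff[OF D(1), of t e] D(2)[OF e] t by auto
 qed
 have dr': "draw V ?E pos' A'"
 proof (rule drawI)
  show "inj_on pos' V" by (rule D(1))
  fix e assume e: "e \<in> ?E"
  show "e \<subseteq> V" "card e = 2" using e D(2,3) tv d(1) by auto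
  show "isarc (A' e) (pos' ` e)" using isarc_curve[OF pq(1), of 0] e D(4)[of e] pu unfolding A'_def by auto
  show "A' e \<inter> pos' ` V = pos' ` e"
  proof (cases "e = {u, v}")
   case True
   have "curve 0 p q \<inter> pos' ` V \<subseteq> pos' ` {u, v}" using ax unfolding pic_def by blast
   moreover have "pos' ` {u, v} \<subseteq> curve 0 p q" using pu pq unfolding curve_def by auto
   ultimately show ?thesis using True tv A'uv by auto
  next
   case False
   thus ?thesis using A'e D(5)[of e] e by simp
  qed
  fix f assume f: "f \<in> ?E" "e \<noteq> f"
  consider "e = {u, v}" "f \<in> E" "f \<noteq> {u, v}" | "f = {u, v}" "e \<in> E" "e \<noteq> {u, v}" | "e \<in> E" "f \<in> E" "e \<noteq> {u, v}" "f \<noteq> {u, v}"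
   using e f by blast
  thus "A' e \<inter> A' f \<subseteq> pos' ` (e \<inter> f)"
  proof cases
   case 1
   show ?thesis using key[OF 1(2)] A'uv A'e[OF 1(3)] 1(1) by simp
  next
   case 2
   show ?thesis using key[OF 2(2)] A'uv A'e[OF 2(3)] 2(1) by (simp add: Int_commute)
  next
   case 3
   show ?thesis using D(6)[OF 3(1,2) f(2)] A'e 3 by simp
  qed
 qed
 have pic': "pic V ?E pos' A' \<subseteq> curve 0 p q \<union> pic V E pos' (\<lambda>e. ?S ` A e)"
  unfolding pic_def using A'uv A'e by (auto split: if_splits simp: A'_def)
 have regc: "curve 0 p q \<subseteq> region p ?Q" using qQ unfolding curve_def region_def by auto
 have bot: "bottom pos' A' ?E (u # v # ts) (p # q # xs)"
 proof -
  have "bottom (?S \<circ> pos) (\<lambda>e. ?S ` A e) E (v # ts) (q # xs)"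
  proof (rule bottom_image[OF b(6), of q ?Q])
   show "?S z = z" if "Im z = 0" "q \<le> Re z" for z using squash_fix_axis[OF pq(1)] that by blast
   show "set (q # xs) \<subseteq> {q..?Q}" using sorted_bounds[OF so] so by auto
  qed
  hence "bottom pos' A' ?E (v # ts) (q # xs)" by (rule bottom_cong) (use d(1,5) in \<open>auto simp: pos'_def A'_def\<close>)
  thus ?thesis using pu A'uv by simp
 qed
 have lt: "last ?ts = last (u # v # ts)" "last ?xs = last (p # q # xs)" "last (u # v # ts) \<in> set ts" using d(7) by auto
 hence "{u, last (u # v # ts)} \<noteq> {u, v}" using d by (auto simp: doubleton_eq_iff)
 hence top: "A' {u, last (u # v # ts)} = curve 1 p ?Q" using A'e G(4) lt by simp
 have faces: "\<exists>F. face V ?E pos' A' m F \<and> F \<subseteq> lens 1 p ?Q" if m: "m \<in> M" "\<not> {u, v} \<subseteq> m" for m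
 proof -
  obtain F where F: "face V E pos' (\<lambda>e. ?S ` A e) m F" "F \<subseteq> lens 1 p ?Q" using G(5)[OF m(1)] unfolding pos'_def by auto
  have "F \<inter> curve 0 p q = {}" using F(2) unfolding lens_def curve_def by auto
  hence "F \<inter> pic V ?E pos' A' = {}" using F(1) pic' unfolding face_def by blast
  moreover have "(\<Union>e\<in>{e \<in> ?E. e \<subseteq> m}. A' e) = (\<Union>e\<in>{e \<in> E. e \<subseteq> m}. ?S ` A e)"
  proof (rule SUP_cong)
   have "e \<noteq> {u, v}" if "e \<subseteq> m" for e using that m(2) by blast
   thus "{e \<in> ?E. e \<subseteq> m} = {e \<in> E. e \<subseteq> m}" "\<And>e. e \<in> {e \<in> E. e \<subseteq> m} ==> A' e = ?S ` A e" using A'e by blast+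
  qed
  ultimately show ?thesis using F(1) unfolding face_def using F(2) by auto
 qed
 \<comment> \<open>The images of the two old edges make up \<open>curve (1/2) p q\<close>, the upper
   boundary of the lens.\<close>
 have newface: "face V ?E pos' A' {u, w, v} (lens (1/2) p q)"
 proof -
  note L = lens_face[OF pq(1), of "1/2"]
  have "lens (1/2) p q \<inter> curve 0 p q = {}" unfolding lens_def curve_def by auto
  moreover have "lens (1/2) p q \<inter> pic V E pos' (\<lambda>e. ?S ` A e) = {}"
  proof (rule equals0I)
   fix z assume z: "z \<in> lens (1/2) p q \<inter> pic V E pos' (\<lambda>e. ?S ` A e)"
   hence "eps p q (Re z) \<le> Im z" using G(3)[of z] unfolding pos'_def by blast
   moreover have "Im z < (Re z - p) * (q - Re z) / 2" using z unfolding lens_def by auto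
   ultimately show False unfolding eps_def by simp
  qed
  ultimately have 1: "lens (1/2) p q \<inter> pic V ?E pos' A' = {}" using pic' by blast
  have "{e \<in> ?E. e \<subseteq> {u, w, v}} = {{u, v}, {u, w}, {w, v}}"
  proof
   show "{e \<in> ?E. e \<subseteq> {u, w, v}} \<subseteq> {{u, v}, {u, w}, {w, v}}"
   proof
    fix e assume e: "e \<in> {e \<in> ?E. e \<subseteq> {u, w, v}}"
    hence "card e = 2" using D(3) d(1) by auto
    then obtain x y where "e = {x, y}" "x \<noteq> y" by (meson card_2_iff)
    thus "e \<in> {{u, v}, {u, w}, {w, v}}" using e by (auto simp: insert_commute)
   qed
  qed (use b in auto)
  hence "(\<Union>e\<in>{e \<in> ?E. e \<subseteq> {u, w, v}}. A' e) = curve 0 p q \<union> (?S ` curve 0 p r \<union> ?S ` curve 0 r q)"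
   using d A'e A'uv b(3,5) by (auto simp: doubleton_eq_iff)
  also have "?S ` curve 0 p r \<union> ?S ` curve 0 r q = ?S ` curve 0 p q" using pq unfolding curve_def by force
  also have "\<dots> = curve (1/2) p q" by (rule squash_axis[OF pq(1)])
  finally show ?thesis unfolding face_def using L 1 by simp
 qed
 have newlens: "lens (1/2) p q \<subseteq> lens 1 p ?Q"
 proof
  fix z assume z: "z \<in> lens (1/2) p q"
  hence i: "0 < Im z" "Im z < (Re z - p) * (q - Re z) / 2" unfolding lens_def by auto
  have "p < Re z \<and> Re z < q" by (rule lens_bounds[where c = "1/2"]) (use i pq in auto)
  hence "(Re z - p) * (q - Re z) \<le> (Re z - p) * (?Q - Re z)" "0 \<le> (Re z - p) * (q - Re z)"
   using qQ by (auto intro: mult_left_mono)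
  thus "z \<in> lens 1 p ?Q" using i unfolding lens_def by simp
 qed
 have "pic V E pos' (\<lambda>e. ?S ` A e) \<subseteq> region p ?Q" using G(2) unfolding pos'_def by simp
 hence "pic V ?E pos' A' \<subseteq> region p ?Q" using pic' regc by (meson Un_least order_trans)
 moreover have "{u, last (u # v # ts)} \<in> ?E" using tE lt(1) by simp
 moreover have "sorted_wrt (<) (p # q # xs)" using so by auto
 moreover have "set (u # v # ts) \<subseteq> V" using tsV by auto
 moreover have "\<forall>m\<in>insert {u, w, v} {m \<in> M. \<not> {u, v} \<subseteq> m}. \<exists>F. face V ?E pos' A' m F \<and> F \<subseteq> lens 1 p ?Q"
  using faces newface newlens by blast
 ultimately have "good V ?E (insert {u, w, v} {m \<in> M. \<not> {u, v} \<subseteq> m}) (u # v # ts) (p # q # xs) pos' A'"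
  unfolding good_def using dr' bot top lt(2) by (simp only: list.sel simp_thms)
 thus ?thesis by blast
qed

lemma bottom_length: "bottom pos A E ts xs ==> length ts = length xs"
 by (induction pos A E ts xs rule: bottom.induct) auto

text \<open>The first drawing is lifted until its edge \<open>{u, v}\<close> becomes
  \<open>curve (1/2) p q\<close>, and the second is halved, which brings its roof, the arc of the
  same edge, to the same curve. The drawings meet nowhere else, one lying above this curve and the
  other below.\<close>

lemma good_glue:
 assumes g1: "good V1 E1 M1 (us @ u # v # vs) (as @ p # q # bs) pos1 A1" and l: "length us = length as"
  and g2: "good V2 E2 M2 (u # zs @ [v]) (p # cs @ [q]) pos2 A2"
  and V: "V1 \<inter> V2 = {u, v}" and so: "sorted_wrt (<) (as @ p # cs @ q # bs)"
  and m12: "\<And>m. m \<in> M1 ==> m \<subseteq> V1" "\<And>m. m \<in> M2 ==> m \<subseteq> V2"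
 shows "\<exists>pos A. good (V1 \<union> V2) (E1 \<union> E2) (M1 \<union> M2) (us @ u # zs @ v # vs) (as @ p # cs @ q # bs) pos A"
proof -
 let ?t1 = "us @ u # v # vs" and ?x1 = "as @ p # q # bs" and ?ts = "us @ u # zs @ v # vs" and ?xs = "as @ p # cs @ q # bs"
 let ?P = "hd ?x1" and ?Q = "last ?x1"
 have so1: "sorted_wrt (<) ?x1" by (rule goodD(3)[OF g1])
 have pq: "p < q" using so1 by (simp add: sorted_wrt_append)
 have Pp: "?P \<le> p" "q \<le> ?Q" using sorted_bounds[OF so1, of p] sorted_bounds[OF so1, of q] by auto
 have hx: "hd ?xs = ?P" "last ?xs = ?Q" "hd ?ts = hd ?t1" "last ?ts = last ?t1" by (cases as; cases us; auto)+
 let ?S = "squash p q"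
 note G = good_squash[OF g1 Pp(1) pq Pp(2)]
 define pos where "pos x = (if x \<in> V1 then ?S (pos1 x) else half (pos2 x))" for x
 define A where "A e = (if e \<in> E1 then ?S ` A1 e else half ` A2 e)" for e
 have b1: "bottom pos1 A1 E1 (us @ [u]) (as @ [p])" "bottom pos1 A1 E1 (u # v # vs) (p # q # bs)"
  using iffD1[OF bottom_append[OF l] goodD(5)[OF g1]] by blast+
 have b2: "bottom pos2 A2 E2 (u # zs @ [v]) (p # cs @ [q])" by (rule goodD(5)[OF g2])
 have lz: "length zs = length cs" using bottom_length[OF b2] by simp
 have P1: "pos1 u = Complex p 0" "{u, v} \<in> E1" "A1 {u, v} = curve 0 p q" "bottom pos1 A1 E1 (v # vs) (q # bs)"
  using b1(2) by auto
 have P1v: "pos1 v = Complex q 0" using P1(4) by (cases vs; cases bs) auto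
 have P2u: "pos2 u = Complex p 0" using b2 by (cases zs; cases cs) auto
 have P2v: "pos2 v = Complex q 0" using b2 bottom_append[of "u # zs" "p # cs" pos2 A2 E2 v "[]" q "[]"] lz by simp
 have E2uv: "{u, v} \<in> E2" "A2 {u, v} = curve 1 p q" using goodD(6,7)[OF g2] by auto
 have Sf: "?S (Complex p 0) = Complex p 0" "?S (Complex q 0) = Complex q 0"
  using squash_fix_axis[OF pq, of "Complex p 0"] squash_fix_axis[OF pq, of "Complex q 0"] by auto
 have uvV: "u \<in> V1" "v \<in> V1" "u \<in> V2" "v \<in> V2" using V by auto
 have pos1: "pos x = (?S \<circ> pos1) x" if "x \<in> V1" for x using that unfolding pos_def by simp
 have pos2: "pos x = (half \<circ> pos2) x" if "x \<in> V2" for x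
  using V P1(1) P1v P2u P2v Sf uvV that unfolding pos_def by (force simp: half_def)
 have "card e = 2 \<and> e \<subseteq> {u, v}" if "e \<in> E1" "e \<in> E2" for e
 proof -
  have "e \<subseteq> V1 \<inter> V2" using drawD(2)[OF goodD(1)[OF g1] that(1)] drawD(2)[OF goodD(1)[OF g2] that(2)] by blast
  hence "e \<subseteq> {u, v}" unfolding V .
  thus ?thesis using drawD(3)[OF goodD(1)[OF g2] that(2)] by (intro conjI)
 qed
 note E12' = this
 have E12: "e = {u, v}" if "e \<in> E1" "e \<in> E2" for e using E12'[OF that] by (intro card2_eq) auto
 have A1: "A e = ?S ` A1 e" if "e \<in> E1" for e using that unfolding A_def by simp
 have Auv: "?S ` A1 {u, v} = curve (1/2) p q" "half ` A2 {u, v} = curve (1/2) p q"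
  using squash_axis[OF pq] half_curve[of 1 p q] P1(3) E2uv(2) by auto
 have A2: "A e = half ` A2 e" if "e \<in> E2" for e using that E12[of e] Auv unfolding A_def by auto
 have Acv: "A {u, v} = curve (1/2) p q" using A1[OF P1(2)] Auv by simp
 have d1: "draw V1 E1 pos A" by (rule draw_cong[OF G(1) pos1 A1])
 have d2: "draw V2 E2 pos A" by (rule draw_cong[OF draw_homeo[OF homeo_half goodD(1)[OF g2]] pos2 A2])
 have p1: "pic V1 E1 pos A = pic V1 E1 (?S \<circ> pos1) (\<lambda>e. ?S ` A1 e)" by (rule pic_cong[OF pos1 A1])
 have p2: "pic V2 E2 pos A = half ` pic V2 E2 pos2 A2" unfolding pic_homeo[symmetric] by (rule pic_cong[OF pos2 A2])
 have reg2: "p \<le> Re z \<and> Re z \<le> q \<and> 0 \<le> Im z \<and> Im z \<le> eps p q (Re z)" if "z \<in> pic V2 E2 pos A" for z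
 proof -
  obtain w where w: "z = half w" "w \<in> pic V2 E2 pos2 A2" using \<open>z \<in> pic V2 E2 pos A\<close> unfolding p2 by blast
  thus ?thesis using goodD(4)[OF g2] eps_in[of p "Re w" q] w(1) unfolding region_def by auto
 qed
 have sep: "pic V1 E1 pos A \<inter> pic V2 E2 pos A \<subseteq> A {u, v}"
 proof
  fix z assume z: "z \<in> pic V1 E1 pos A \<inter> pic V2 E2 pos A"
  thus "z \<in> A {u, v}"
   using G(3)[of z] unfolding p1 using reg2[of z] z unfolding Acv curve_def using eps_in[of p "Re z" q] by auto
 qed
 have dr: "draw (V1 \<union> V2) (E1 \<union> E2) pos A" by (rule draw_union[OF d1 d2 V P1(2) E2uv(1) sep])
 have pu: "pic (V1 \<union> V2) (E1 \<union> E2) pos A = pic V1 E1 pos A \<union> pic V2 E2 pos A" unfolding pic_def by auto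
 have "pic V2 E2 pos A \<subseteq> region ?P ?Q"
 proof
  fix z assume "z \<in> pic V2 E2 pos A"
  hence z: "p \<le> Re z" "Re z \<le> q" "0 \<le> Im z" "Im z \<le> eps p q (Re z)" using reg2 by auto
  have "2 * eps p q (Re z) \<le> (Re z - ?P) * (?Q - Re z)" by (rule eps_le[OF Pp(1) pq Pp(2)]) (use z Pp in linarith)+
  thus "z \<in> region ?P ?Q" unfolding region_def using z Pp eps_ge[of p q "Re z"] by auto
 qed
 hence preg: "pic (V1 \<union> V2) (E1 \<union> E2) pos A \<subseteq> region ?P ?Q" using G(2) unfolding pu p1 by blast
 have sa: "set as \<subseteq> {?P..p}" "set bs \<subseteq> {q..?Q}" using so1 sorted_bounds[OF so1] by (auto simp: sorted_wrt_append less_imp_le)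
 have bot: "bottom pos A (E1 \<union> E2) ?ts ?xs"
 proof -
  have l1: "bottom pos A (E1 \<union> E2) (us @ [u]) (as @ [p])"
  proof (rule bottom_cong)
   show "bottom (?S \<circ> pos1) (\<lambda>e. ?S ` A1 e) E1 (us @ [u]) (as @ [p])"
    by (rule bottom_image[OF b1(1), of ?P p]) (use squash_fix_axis[OF pq] sa Pp in auto)
   show "pos x = (?S \<circ> pos1) x" if "x \<in> set (us @ [u])" for x by (rule pos1) (use that goodD(2)[OF g1] in auto)
  qed (use A1 in auto)
  have l3: "bottom pos A (E1 \<union> E2) (v # vs) (q # bs)"
  proof (rule bottom_cong)
   show "bottom (?S \<circ> pos1) (\<lambda>e. ?S ` A1 e) E1 (v # vs) (q # bs)"
    by (rule bottom_image[OF P1(4), of q ?Q]) (use squash_fix_axis[OF pq] sa Pp in auto)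
   show "pos x = (?S \<circ> pos1) x" if "x \<in> set (v # vs)" for x by (rule pos1) (use that goodD(2)[OF g1] in auto)
  qed (use A1 in auto)
  have so2: "sorted_wrt (<) (p # cs @ [q])" by (rule goodD(3)[OF g2])
  have l2: "bottom pos A (E1 \<union> E2) (u # zs @ [v]) (p # cs @ [q])"
  proof (rule bottom_cong)
   show "bottom (half \<circ> pos2) (\<lambda>e. half ` A2 e) E2 (u # zs @ [v]) (p # cs @ [q])"
    by (rule bottom_image[OF b2, of p q]) (use sorted_bounds[OF so2] in \<open>auto simp: half_def complex_eq_iff\<close>)
   show "pos x = (half \<circ> pos2) x" if "x \<in> set (u # zs @ [v])" for x by (rule pos2) (use that goodD(2)[OF g2] in auto)
  qed (use A2 in auto)
  show ?thesis
   using bottom_append[of "u # zs" "p # cs" pos A "E1 \<union> E2" v vs q bs] lz l2 l3 bottom_append[OF l, of pos A "E1 \<union> E2" u "zs @ v # vs" p "cs @ q # bs"] l1 by simp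
 qed
 have f1: "\<exists>F. face (V1 \<union> V2) (E1 \<union> E2) pos A m F \<and> F \<subseteq> lens 1 ?P ?Q" if m: "m \<in> M1" for m
 proof -
  obtain F where F: "face V1 E1 (?S \<circ> pos1) (\<lambda>e. ?S ` A1 e) m F" "F \<subseteq> lens 1 ?P ?Q" "\<forall>z\<in>F. eps p q (Re z) < Im z"
   using G(5)[OF m] by blast
  have "F \<inter> pic V2 E2 pos A = {}" using reg2 F(3) by force
  moreover have "face V1 E1 pos A m F" by (rule face_cong[OF F(1) pos1 A1])
  ultimately have "face (V1 \<union> V2) (E1 \<union> E2) pos A m F" by (intro face_union[OF _ m12(1)[OF m] d2 V P1(2)])
  thus ?thesis using F(2) by blast
 qed
 have f2: "\<exists>F. face (V1 \<union> V2) (E1 \<union> E2) pos A m F \<and> F \<subseteq> lens 1 ?P ?Q" if m: "m \<in> M2" for m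
 proof -
  obtain F where F: "face V2 E2 pos2 A2 m F" "F \<subseteq> lens 1 p q" using goodD(8)[OF g2 m] by auto
  have hz: "p < Re z \<and> Re z < q \<and> 0 < Im z \<and> Im z < eps p q (Re z)" if "z \<in> half ` F" for z
  proof -
   obtain w where w: "z = half w" "w \<in> F" using \<open>z \<in> half ` F\<close> by blast
   have i: "0 < Im w" "Im w < (Re w - p) * (q - Re w)" using F(2) w(2) unfolding lens_def by auto
   have "p < Re w \<and> Re w < q" by (rule lens_bounds[where c = 1]) (use i pq in auto)
   thus ?thesis using i w(1) eps_in[of p "Re w" q] by auto
  qed
  have "half ` F \<inter> pic V1 E1 pos A = {}" using G(3) hz unfolding p1 by force
  moreover have "V2 \<inter> V1 = {u, v}" using V by blast
  ultimately have "face (V2 \<union> V1) (E2 \<union> E1) pos A m (half ` F)"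
   by (intro face_union[OF face_cong[OF face_homeo[OF homeo_half F(1)] pos2 A2] m12(2)[OF m] d1 _ E2uv(1)])
  hence "face (V1 \<union> V2) (E1 \<union> E2) pos A m (half ` F)" by (simp only: Un_commute)
  moreover have "half ` F \<subseteq> lens 1 ?P ?Q"
  proof
   fix z assume "z \<in> half ` F"
   hence z: "p < Re z" "Re z < q" "0 < Im z" "Im z < eps p q (Re z)" using hz by auto
   have "2 * eps p q (Re z) \<le> (Re z - ?P) * (?Q - Re z)" by (rule eps_le[OF Pp(1) pq Pp(2)]) (use z Pp in linarith)+
   thus "z \<in> lens 1 ?P ?Q" unfolding lens_def using z by auto
  qed
  ultimately show ?thesis by blast
 qed
 have "good (V1 \<union> V2) (E1 \<union> E2) (M1 \<union> M2) ?ts ?xs pos A"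
  unfolding good_def hx using dr so preg bot f1 f2 goodD(2)[OF g1] goodD(2)[OF g2] goodD(6)[OF g1] G(4) A1 by auto
 thus ?thesis by blast
qed

lemma web_distinct: "web V E M ts ==> distinct ts \<and> set ts \<subseteq> V"
proof (induction rule: web.induct)
 case (glue V1 E1 M1 xs u v ys V2 E2 M2 zs)
 show ?case using glue.IH glue.hyps(3) by auto
qed auto

lemma web_rim: "web V E M ts ==> successively (\<lambda>x y. {x, y} \<in> E) ts"
proof (induction rule: web.induct)
 case (peel V E M u w v ys)
 thus ?case by (auto elim: successively_mono)
next
 case (glue V1 E1 M1 xs u v ys V2 E2 M2 zs)
 have "successively (\<lambda>x y. {x, y} \<in> E1 \<union> E2) (xs @ u # v # ys)" "successively (\<lambda>x y. {x, y} \<in> E1 \<union> E2) (u # zs @ [v])"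
  using glue.IH by (auto elim: successively_mono)
 thus ?case using glue.hyps(4) by (auto simp: successively_append_iff successively_Cons hd_append)
qed simp

lemma web_clique:
 "web V E M ts ==> m \<in> M ==> m \<subseteq> V \<and> card m = 3 \<and> (\<forall>x\<in>m. \<forall>y\<in>m. x \<noteq> y \<longrightarrow> {x, y} \<in> E)"
proof (induction rule: web.induct)
 case (peel V E M u w v ys)
 thus ?case using web_distinct[OF peel.hyps(1)] web_rim[OF peel.hyps(1)] peel.IH by (auto simp: insert_commute)
qed (auto simp: insert_commute)

text \<open>The base points are arbitrary, so that in the gluing step both parts can be drawn over
  sections of one list.\<close>

theorem web_drawing:
 assumes "web V E M ts"
 shows "\<And>xs. length xs = length ts ==> sorted_wrt (<) xs ==> \<exists>pos A. good V E M ts xs pos A"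
 using assms
proof (induction rule: web.induct)
 case (tri a b c)
 then obtain x y z where "xs = [x, y, z]" by (auto simp: length_Suc_conv)
 thus ?case using good_tri[of a b c x y z] tri by simp
next
 case (peel V E M u w v ys)
 obtain p q bs where xs: "xs = p # q # bs" using peel.prems(1) by (cases xs; cases "tl xs") auto
 \<comment> \<open>The vertex \<open>w\<close> leaves the boundary, so it may be placed anywhere
   between \<open>p\<close> and \<open>q\<close>.\<close>
 let ?xs = "p # ((p + q) / 2) # q # bs"
 have s: "sorted_wrt (<) ?xs" using peel.prems(2) xs unfolding xs by auto
 obtain pos A where g: "good V E M (u # w # v # ys) ?xs pos A" using peel.prems(1) xs peel.IH s by force
 have d: "distinct (u # w # v # ys)" using web_distinct[OF peel.hyps(1)] by blast
 show ?case unfolding xs by (rule good_peel[OF g]) (use d peel.hyps(2) in auto)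
next
 case (glue V1 E1 M1 us u v vs V2 E2 M2 zs)
 define as r1 where "as = take (length us) xs" and "r1 = drop (length us) xs"
 have x1: "xs = as @ r1" "length as = length us" "length r1 = length zs + length vs + 2"
  unfolding as_def r1_def using glue.prems(1) by auto
 obtain p r2 where r1: "r1 = p # r2" using x1(3) by (cases r1) auto
 define cs r3 where "cs = take (length zs) r2" and "r3 = drop (length zs) r2"
 have x2: "r2 = cs @ r3" "length cs = length zs" "length r3 = length vs + 1" unfolding cs_def r3_def using x1(3) r1 by auto
 obtain q bs where r3: "r3 = q # bs" using x2(3) by (cases r3) auto
 have xs: "xs = as @ p # cs @ q # bs" using x1 x2 r1 r3 by simp
 have so: "sorted_wrt (<) (as @ p # cs @ q # bs)" using glue.prems(2) xs by simp
 have s1: "sorted_wrt (<) (as @ p # q # bs)" and s2: "sorted_wrt (<) (p # cs @ [q])"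
  using so by (auto simp: sorted_wrt_append)
 obtain pos1 A1 where g1: "good V1 E1 M1 (us @ u # v # vs) (as @ p # q # bs) pos1 A1"
  using glue.IH(1)[OF _ s1] x1(2) x2(3) r3 by auto
 obtain pos2 A2 where g2: "good V2 E2 M2 (u # zs @ [v]) (p # cs @ [q]) pos2 A2" using glue.IH(2)[OF _ s2] x2(2) by auto
 show ?case
  unfolding xs by (rule good_glue[OF g1 x1(2)[symmetric] g2 glue.hyps(3) so]) (use web_clique glue.hyps(1,2) in blast)+
qed

section \<open>Nearly planar drawings from cross-free orders\<close>

text \<open>A vertical shear that takes the real axis over [-1, 1] to the lower unit semicircle.
  Outside this interval \<open>sqrt\<close> is continued as an odd function, so the map is a
  homeomorphism of the whole plane.\<close>

definition to_disc :: "complex \<Rightarrow> complex" where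
 "to_disc z = Complex (Re z) (Im z - sqrt (1 - (Re z)\<^sup>2))"

lemma homeo_to_disc: "homeo to_disc"
 unfolding homeo_def to_disc_def by (intro exI[of _ "\<lambda>z. Complex (Re z) (Im z + sqrt (1 - (Re z)\<^sup>2))"] conjI continuous_intros) (auto simp: complex_eq_iff)

text \<open>With \<open>x\<close> the real part, the height is at most \<open>1 - x^2\<close> and
  hence at most \<open>sqrt (1 - x^2)\<close>, so the shear keeps the point between the two
  semicircles.\<close>

lemma to_disc_region:
 assumes "- 1 \<le> p" "q \<le> 1" "z \<in> region p q"
 shows "to_disc z \<in> cball 0 1"
proof -
 let ?x = "Re z" and ?y = "Im z"
 define s where "s = sqrt (1 - ?x\<^sup>2)"
 have x: "p \<le> ?x" "?x \<le> q" and y: "0 \<le> ?y" "?y \<le> (?x - p) * (q - ?x)" using assms(3) unfolding region_def by auto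
 have "(?x - p) * (q - ?x) \<le> (?x + 1) * (1 - ?x)" using x assms by (intro mult_mono) auto
 hence y2: "?y \<le> 1 - ?x\<^sup>2" using y by (simp add: algebra_simps power2_eq_square)
 have "?x\<^sup>2 \<le> 1" using x assms by (simp add: abs_square_le_1 abs_le_iff)
 hence s: "0 \<le> s" "s\<^sup>2 = 1 - ?x\<^sup>2" "s \<le> 1" unfolding s_def by auto
 hence "\<bar>?y - s\<bar> \<le> s" using mult_right_mono[of s 1 s] y(1) y2 s by (simp add: power2_eq_square)
 hence "(?y - s)\<^sup>2 \<le> s\<^sup>2" using s(1) by (metis abs_le_square_iff abs_of_nonneg)
 thus ?thesis using s(2) unfolding to_disc_def s_def by (simp add: cmod_def)
qed

lemma bottom_nth: "bottom pos A E ts xs ==> k < length ts ==> pos (ts ! k) = Complex (xs ! k) 0"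
proof (induction pos A E ts xs arbitrary: k rule: bottom.induct)
 case (2 pos A E u v ts x y xs)
 thus ?case by (cases k) auto
qed auto

lemma component_face:
 assumes "open F" "connected F" "F \<noteq> {}" "F \<inter> I = {}" "frontier F \<subseteq> (I :: complex set)"
 shows "F \<in> components (- I)"
proof -
 obtain x where x: "x \<in> F" using assms(3) by blast
 let ?C = "connected_component_set (- I) x"
 have FC: "F \<subseteq> ?C" by (rule connected_component_maximal) (use x assms in auto)
 have "?C \<subseteq> F"
 proof (rule ccontr)
  assume "\<not> ?C \<subseteq> F"
  hence "?C \<inter> frontier F \<noteq> {}" by (intro connected_Int_frontier connected_connected_component) (use FC x in auto)
  thus False using assms(5) connected_component_subset[of "- I" x] by blast
 qed
 thus ?thesis using FC x assms(4) unfolding components_def by blast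
qed

text \<open>\<open>H\<close> may have fewer edges than the web. The triangles in \<open>M0\<close>
  have all their edges in \<open>H\<close>, so dropping the others does not change the frontiers of
  their faces.\<close>

lemma web_disc:
 assumes w: "web V E M ts" and H: "verts H = V" "edges H \<subseteq> E" and ne: "ts \<noteq> []"
  and M0: "M0 \<subseteq> M" "\<And>m x y. m \<in> M0 ==> x \<in> m ==> y \<in> m ==> x \<noteq> y ==> {x, y} \<in> edges H"
 shows "\<exists>pos arcs. disc_drawing H pos arcs \<and> (\<forall>m\<in>M0. facial_triangle H pos arcs m) \<and> on_boundary_in_order pos ts"
proof -
 define n where "n = length ts"
 \<comment> \<open>Equally spaced abscissas in [0, 1), which end up on the lower right quarter of
   the unit circle.\<close>
 define xs where "xs = map (\<lambda>k. real k / real n) [0..<n]"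
 have n0: "0 < n" using ne unfolding n_def by simp
 have lx: "length xs = length ts" unfolding xs_def n_def by simp
 have so: "sorted_wrt (<) xs" unfolding sorted_wrt_iff_nth_less using n0 by (auto simp: xs_def divide_strict_right_mono)
 obtain pos A where g: "good V E M ts xs pos A" using web_drawing[OF w lx so] by blast
 have bd: "0 \<le> x \<and> x \<le> 1" if "x \<in> set xs" for x using that n0 unfolding xs_def by auto
 have xne: "xs \<noteq> []" using lx ne by auto
 have hl: "- 1 \<le> hd xs" "last xs \<le> 1" using bd[of "hd xs"] bd[of "last xs"] xne by auto
 let ?pos = "to_disc \<circ> pos" and ?A = "\<lambda>e. to_disc ` A e"
 note D = drawD[OF draw_homeo[OF homeo_to_disc goodD(1)[OF g]]]
 have pc: "pic V E ?pos ?A \<subseteq> cball 0 1" unfolding pic_homeo using to_disc_region[OF hl] goodD(4)[OF g] by blast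
 define arcs where "arcs e = (SOME g. arc g \<and> path_image g = ?A e \<and> {pathstart g, pathfinish g} = ?pos ` e)" for e
 have ar: "arc (arcs e) \<and> path_image (arcs e) = ?A e \<and> {pathstart (arcs e), pathfinish (arcs e)} = ?pos ` e" if "e \<in> E" for e
  using someI_ex[OF D(4)[OF that, unfolded isarc_def]] unfolding arcs_def .
 have HE: "e \<in> E" if "e \<in> edges H" for e using H that by blast
 have dr: "disc_drawing H ?pos arcs" unfolding disc_drawing_def H(1)
 proof (intro conjI ballI impI)
  show "inj_on ?pos V" by (rule D(1))
  show "?pos ` V \<subseteq> cball 0 1" using pc unfolding pic_def by blast
  fix e assume e: "e \<in> edges H"
  show "arc (arcs e)" "{pathstart (arcs e), pathfinish (arcs e)} = ?pos ` e" using ar[OF HE[OF e]] by blast+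
  show "path_image (arcs e) \<subseteq> cball 0 1" using HE[OF e] ar[OF HE[OF e]] pc unfolding pic_def by blast
  show "path_image (arcs e) \<inter> ?pos ` V = ?pos ` e" using ar[OF HE[OF e]] D(5)[OF HE[OF e]] by simp
  fix f assume f: "f \<in> edges H" "e \<noteq> f"
  show "path_image (arcs e) \<inter> path_image (arcs f) \<subseteq> ?pos ` (e \<inter> f)"
   using ar[OF HE[OF e]] ar[OF HE[OF f(1)]] D(6)[OF HE[OF e] HE[OF f(1)] f(2)] by simp
 qed
 have im: "drawing_image H ?pos arcs \<subseteq> pic V E ?pos ?A"
 proof -
  have "(\<Union>e\<in>edges H. path_image (arcs e)) = (\<Union>e\<in>edges H. ?A e)" by (rule SUP_cong) (use ar HE in auto)
  also have "\<dots> \<subseteq> (\<Union>e\<in>E. ?A e)" using H(2) by (intro UN_mono) auto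
  finally show ?thesis unfolding drawing_image_def pic_def H(1) by (rule Un_mono[OF order_refl])
 qed
 have fa: "facial_triangle H ?pos arcs m" if m: "m \<in> M0" for m
 proof -
  have mM: "m \<in> M" using m M0 by blast
  obtain F0 where "face V E pos A m F0" using goodD(8)[OF g mM] by blast
  then obtain F where F: "face V E ?pos ?A m F" using face_homeo[OF homeo_to_disc] by blast
  have c3: "card m = 3" and mV: "m \<subseteq> V" using web_clique[OF w mM] by auto
  have eq: "{e \<in> edges H. e \<subseteq> m} = {e \<in> E. e \<subseteq> m}"
  proof -
   have "e \<in> edges H" if e: "e \<in> E" "e \<subseteq> m" for e
   proof -
    obtain x y where "e = {x, y}" "x \<noteq> y" using D(3)[OF e(1)] by (meson card_2_iff)
    thus ?thesis using M0(2)[OF m, of x y] e(2) by simp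
   qed
   thus ?thesis using HE by blast
  qed
  have fr: "frontier F = (\<Union>e\<in>{e \<in> edges H. e \<subseteq> m}. path_image (arcs e))"
  proof -
   have "(\<Union>e\<in>{e \<in> edges H. e \<subseteq> m}. path_image (arcs e)) = (\<Union>e\<in>{e \<in> edges H. e \<subseteq> m}. ?A e)"
    by (rule SUP_cong) (use ar HE in auto)
   thus ?thesis using F unfolding face_def eq by simp
  qed
  obtain x y where xy: "x \<in> m" "y \<in> m" "x \<noteq> y"
   using c3 by (metis card_le_Suc0_iff_eq card.infinite numeral_3_eq_3 Suc_le_mono not_less_eq_eq zero_neq_numeral le0)
  have exy: "{x, y} \<in> {e \<in> edges H. e \<subseteq> m}" using M0(2)[OF m xy] xy by simp
  have "frontier F \<noteq> {}" unfolding fr using exy by blast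
  hence Fne: "F \<noteq> {}" by auto
  have "frontier F \<subseteq> drawing_image H ?pos arcs" unfolding fr drawing_image_def by blast
  hence "F \<in> components (- drawing_image H ?pos arcs)" by (intro component_face) (use F Fne im in \<open>auto simp: face_def\<close>)
  thus ?thesis unfolding facial_triangle_def using mV H(1) c3 M0(2)[OF m] fr by blast
 qed
 \<comment> \<open>The point of the lower semicircle with abscissa \<open>x\<close> has angle
   \<open>- arccos x\<close>, which increases with \<open>x\<close>.\<close>
 have "on_boundary_in_order ?pos ts" unfolding on_boundary_in_order_def
 proof (intro exI[of _ "\<lambda>t. - arccos (Re (pos t))"] conjI ballI)
  fix t assume "t \<in> set ts"
  then obtain k where k: "k < n" "t = ts ! k" unfolding n_def by (metis in_set_conv_nth)
  have p: "pos t = Complex (xs ! k) 0" using bottom_nth[OF goodD(5)[OF g], of k] k unfolding n_def by simp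
  have "xs ! k \<in> set xs" using k lx unfolding n_def by simp
  hence b: "- 1 \<le> xs ! k" "xs ! k \<le> 1" using bd by fastforce+
  show "?pos t = cis (- arccos (Re (pos t)))"
   unfolding o_def p to_disc_def using b by (simp add: complex_eq_iff cos_arccos sin_arccos)
 next
  show "sorted_wrt (\<lambda>u v. - arccos (Re (pos u)) < - arccos (Re (pos v)) \<and> - arccos (Re (pos v)) < - arccos (Re (pos u)) + 2 * pi) ts" unfolding sorted_wrt_iff_nth_less
  proof (intro allI impI)
   fix i j assume ij: "i < j" "j < length ts"
   have p: "pos (ts ! i) = Complex (xs ! i) 0" "pos (ts ! j) = Complex (xs ! j) 0"
    using bottom_nth[OF goodD(5)[OF g]] ij by auto
   have "xs ! i \<in> set xs" "xs ! j \<in> set xs" using ij lx by auto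
   hence b: "- 1 \<le> xs ! i" "xs ! j \<le> 1" "xs ! i \<le> 1" "- 1 \<le> xs ! j" using bd by fastforce+
   have lt: "xs ! i < xs ! j" using sorted_wrt_nth_less[OF so] ij lx by simp
   have "arccos (xs ! j) < arccos (xs ! i)" using arccos_less_arccos[OF b(1) lt b(2)] .
   moreover have "0 \<le> arccos (xs ! j)" "arccos (xs ! i) \<le> pi" using b arccos_lbound arccos_ubound by auto
   ultimately show "- arccos (Re (pos (ts ! i))) < - arccos (Re (pos (ts ! j))) \<and>
     - arccos (Re (pos (ts ! j))) < - arccos (Re (pos (ts ! i))) + 2 * pi"
    unfolding p using pi_gt_zero by simp
  qed
 qed
 thus ?thesis using dr fa by blast
qed

section \<open>Replacing sets with few neighbours by triangles\<close>

locale separated_sets =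
 fixes G :: "'v ugraph" and \<A> :: "'v set set"
 assumes G: "fin_graph G" and sep: "separated G \<A>"
begin

abbreviation "V \<equiv> verts G"
abbreviation "E \<equiv> edges G"
abbreviation "V' \<equiv> verts (p_graph G \<A>)"
abbreviation "E' \<equiv> edges (p_graph G \<A>)"

lemma finV: "finite V" and Ecard: "e \<in> E ==> e \<subseteq> V \<and> card e = 2"
 using G unfolding fin_graph_def by auto

lemma V': "V' = V - \<Union>\<A>" by (simp add: p_graph_def)

lemma A_sub: "A \<in> \<A> ==> A \<subseteq> V"
 using sep unfolding separated_def by blast

lemma A_disj: "A \<in> \<A> ==> B \<in> \<A> ==> A \<noteq> B ==> A \<inter> B = {}"
 using sep unfolding separated_def pairwise_def disjnt_def by blast

lemma nbrs_V': "A \<in> \<A> ==> nbrs G A \<subseteq> V'"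
proof
 fix v assume A: "A \<in> \<A>" and v: "v \<in> nbrs G A"
 hence "v \<in> V" "v \<notin> A" unfolding nbrs_def by auto
 moreover have "v \<notin> B" if "B \<in> \<A>" for B using sep A v that \<open>v \<notin> A\<close> unfolding separated_def by blast
 ultimately show "v \<in> V'" unfolding V' by blast
qed

lemma E'_iff: "e \<in> E' \<longleftrightarrow> (e \<in> E \<and> e \<inter> \<Union>\<A> = {}) \<or> (\<exists>x y A. e = {x, y} \<and> A \<in> \<A> \<and> x \<in> nbrs G A \<and> y \<in> nbrs G A \<and> x \<noteq> y)"
 unfolding p_graph_def delete_verts_def by auto

lemma E'_card: "e \<in> E' ==> e \<subseteq> V' \<and> card e = 2"
proof -
 assume "e \<in> E'"
 then consider "e \<in> E" "e \<inter> \<Union>\<A> = {}" | x y A where "e = {x, y}" "A \<in> \<A>" "x \<in> nbrs G A" "y \<in> nbrs G A" "x \<noteq> y"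
  unfolding E'_iff by blast
 thus ?thesis
 proof cases
  case 1
  thus ?thesis using Ecard[of e] unfolding V' by auto
 next
  case 2
  thus ?thesis using nbrs_V'[of A] by auto
 qed
qed

text \<open>A connection through a member of the family enters and leaves it by neighbours of that
  member, and these are pairwise adjacent in \<open>p_graph\<close>.\<close>

lemma conn_down:
 assumes X: "conn E X" "X \<subseteq> V"
 shows "conn E' (X - \<Union>\<A>)"
proof (rule connI)
 let ?U = "\<Union>\<A>"
 fix Y assume Y: "Y \<subseteq> X - ?U" "Y \<noteq> {}" "\<And>y x. y \<in> Y ==> x \<in> X - ?U - Y ==> {x, y} \<notin> E'"
 have inA: "C \<subseteq> A" if C: "conn E C" "C \<subseteq> X \<inter> ?U" "y \<in> C" and A: "A \<in> \<A>" "y \<in> A" for C y A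
 proof -
  have "C \<inter> A = C"
  proof (rule conn_cut[OF C(1)])
   show "y \<in> C \<inter> A" using C A by blast
   fix y x assume h: "y \<in> C \<inter> A" "x \<in> C - C \<inter> A"
   then obtain B where B: "B \<in> \<A>" "x \<in> B" "B \<noteq> A" using C(2) by blast
   show "{x, y} \<notin> E" using h C(2) X(2) nbrs_V'[OF A(1)] B unfolding nbrs_def V' by (auto simp: insert_commute)
  qed blast
  thus ?thesis by blast
 qed
 \<comment> \<open>\<open>Y\<close> is completed by the deleted vertices of \<open>X\<close> whose
   component among the deleted vertices is adjacent to \<open>Y\<close>.\<close>
 define Z where "Z = Y \<union> {x \<in> X \<inter> ?U. \<exists>u\<in>comp E (X \<inter> ?U) x. \<exists>y\<in>Y. {u, y} \<in> E}"
 obtain y0 where y0: "y0 \<in> Y" using Y(2) by blast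
 have "Z = X"
 proof (rule conn_cut[OF X(1)])
  show "Z \<subseteq> X" unfolding Z_def using Y(1) by blast
  show "y0 \<in> Z" unfolding Z_def using y0 by blast
  fix y x assume y: "y \<in> Z" and x: "x \<in> X - Z"
  show "{x, y} \<notin> E"
  proof
   assume e: "{x, y} \<in> E"
   show False
   proof (cases "y \<in> Y")
    case True
    show False
    proof (cases "x \<in> ?U")
     case xU: True
     have "x \<in> comp E (X \<inter> ?U) x" by (rule comp_self) (use x xU in blast)
     hence "x \<in> Z" unfolding Z_def using True e x xU by blast
     thus False using x by blast
    next
     case False
     hence "{x, y} \<in> E'" unfolding E'_iff using e Y(1) True by blast
     thus False using Y(3)[OF True] x False unfolding Z_def by blast
    qed
   next
    case False
    then obtain u y1 where u: "y \<in> X \<inter> ?U" "u \<in> comp E (X \<inter> ?U) y" "y1 \<in> Y" "{u, y1} \<in> E" using y unfolding Z_def by blast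
    show False
    proof (cases "x \<in> ?U")
     case True
     have "x \<in> comp E (X \<inter> ?U) y" by (rule comp_step[OF comp_self[OF u(1)] _ e]) (use x True in blast)
     hence "comp E (X \<inter> ?U) x = comp E (X \<inter> ?U) y" by (rule comp_eq)
     hence "x \<in> Z" unfolding Z_def using u(2-4) x True by auto
     thus False using x by blast
    next
     case xU: False
     obtain A where A: "A \<in> \<A>" "y \<in> A" using u(1) by blast
     have "comp E (X \<inter> ?U) y \<subseteq> A" by (rule inA[OF conn_comp comp_subset comp_self[OF u(1)] A])
     hence uA: "u \<in> A" using u(2) by blast
     have n1: "x \<in> nbrs G A" unfolding nbrs_def using x X(2) xU A e by (auto simp: insert_commute)
     have n2: "y1 \<in> nbrs G A" unfolding nbrs_def using u(3,4) Y(1) X(2) uA A(1) by blast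
     have "{x, y1} \<in> E'" using x u(3) unfolding Z_def E'_iff using A(1) n1 n2 by blast
     thus False using Y(3)[OF u(3)] x xU unfolding Z_def by blast
    qed
   qed
  qed
 qed
 thus "Y = X - ?U" unfolding Z_def using Y(1) by blast
qed

end

locale bags = separated_sets +
 assumes cA: "\<And>A. A \<in> \<A> ==> conn (edges G) A"
  and nA: "\<And>A. A \<in> \<A> ==> A \<noteq> {}" and N3: "\<And>A. A \<in> \<A> ==> card (nbrs G A) \<le> 3"
begin

lemma conn_lift:
 assumes X: "conn E' X" "X \<subseteq> V'" and C: "C \<subseteq> \<A>" "\<And>A. A \<in> C ==> nbrs G A \<inter> X \<noteq> {}"
  and two: "\<And>A x y. A \<in> \<A> ==> x \<in> nbrs G A \<inter> X ==> y \<in> nbrs G A \<inter> X ==> x \<noteq> y ==> A \<in> C"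
 shows "conn E (X \<union> \<Union>C)"
proof (rule connI)
 fix Y assume Y: "Y \<subseteq> X \<union> \<Union>C" "Y \<noteq> {}" "\<And>y x. y \<in> Y ==> x \<in> X \<union> \<Union>C - Y ==> {x, y} \<notin> E"
 have AY: "A \<subseteq> Y" if A: "A \<in> C" "A \<inter> Y \<noteq> {}" for A
 proof -
  have "A \<inter> Y = A"
  proof (rule ccontr)
   assume "A \<inter> Y \<noteq> A"
   then obtain y x where "y \<in> A \<inter> Y" "x \<in> A - A \<inter> Y" "{x, y} \<in> E" using conn_edge[OF cA, of A "A \<inter> Y"] A C(1) by blast
   thus False using Y(3)[of y x] A(1) by blast
  qed
  thus ?thesis by blast
 qed
 have step: "A \<subseteq> Y \<longleftrightarrow> x \<in> Y" if A: "A \<in> C" "x \<in> nbrs G A" "x \<in> X" for A x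
 proof -
  obtain a where a: "a \<in> A" "{a, x} \<in> E" using A(2) unfolding nbrs_def by blast
  show ?thesis using Y(3)[of a x] Y(3)[of x a] a A(1,3) AY[OF A(1)] a(1) by (auto simp: insert_commute)
 qed
 have XY: "X \<inter> Y \<noteq> {}"
 proof (cases "\<exists>A\<in>C. A \<inter> Y \<noteq> {}")
  case True
  then obtain A where A: "A \<in> C" "A \<subseteq> Y" using AY by blast
  thus ?thesis using C(2)[OF A(1)] step[OF A(1)] by blast
 qed (use Y(1,2) in blast)
 have "X \<inter> Y = X"
 proof (rule ccontr)
  assume "X \<inter> Y \<noteq> X"
  then obtain y x where yx: "y \<in> X \<inter> Y" "x \<in> X - X \<inter> Y" "{x, y} \<in> E'" using conn_edge[OF X(1), of "X \<inter> Y"] XY by blast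
  obtain x' y' A where A: "{x, y} = {x', y'}" "A \<in> \<A>" "x' \<in> nbrs G A" "y' \<in> nbrs G A" "x' \<noteq> y'"
   using Y(3)[of y x] yx yx(3) unfolding E'_iff by blast
  hence n: "x \<in> nbrs G A" "y \<in> nbrs G A" "x \<noteq> y" by (auto simp: doubleton_eq_iff)
  hence "A \<in> C" using two[OF A(2)] yx by blast
  thus False using step[of A x] step[of A y] n yx by blast
 qed
 hence "X \<subseteq> Y" by blast
 moreover have "A \<subseteq> Y" if "A \<in> C" for A using C(2)[OF that] step[OF that] \<open>X \<subseteq> Y\<close> by blast
 ultimately show "Y = X \<union> \<Union>C" using Y(1) by blast
qed

text \<open>An edge added for a member \<open>A\<close> is replaced by a passage through
  \<open>A\<close>. The two sets never need the same \<open>A\<close>, because that would take four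
  neighbours of \<open>A\<close>.\<close>

lemma lk_lift:
 assumes "lk E' V' a b c d"
 shows "lk E V a b c d"
proof -
 obtain X Y where XY: "X \<subseteq> V'" "Y \<subseteq> V'" "X \<inter> Y = {}" "conn E' X" "conn E' Y" "a \<in> X" "b \<in> X" "c \<in> Y" "d \<in> Y"
  using assms unfolding lk_def by blast
 define C where "C X = {A \<in> \<A>. \<exists>x y. x \<in> nbrs G A \<inter> X \<and> y \<in> nbrs G A \<inter> X \<and> x \<noteq> y}" for X
 have c: "conn E (X \<union> \<Union>(C X))" if "conn E' X" "X \<subseteq> V'" for X by (rule conn_lift[OF that]) (auto simp: C_def)
 have CA: "C X \<subseteq> \<A>" for X unfolding C_def by blast
 have s: "X \<union> \<Union>(C X) \<subseteq> V" if "X \<subseteq> V'" for X using that A_sub CA[of X] unfolding V' by blast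
 have "A \<notin> C Y" if A: "A \<in> C X" for A
 proof
  assume "A \<in> C Y"
  then obtain x x' y y' where h: "x \<in> nbrs G A \<inter> X" "x' \<in> nbrs G A \<inter> X" "x \<noteq> x'" "y \<in> nbrs G A \<inter> Y" "y' \<in> nbrs G A \<inter> Y" "y \<noteq> y'" using A unfolding C_def by blast
  have "distinct [x, x', y, y']" using h XY(3) by auto
  hence "card {x, x', y, y'} = 4" by simp
  moreover have "{x, x', y, y'} \<subseteq> nbrs G A" using h by blast
  moreover have "finite (nbrs G A)" using finV unfolding nbrs_def by simp
  ultimately have "4 \<le> card (nbrs G A)" by (metis card_mono)
  moreover have "card (nbrs G A) \<le> 3" using N3 A CA by blast
  ultimately show False by simp
 qed
 hence CXY: "A \<inter> B = {}" if "A \<in> C X" "B \<in> C Y" for A B using A_disj[of A B] that CA by blast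
 have XC: "X \<inter> A = {}" "Y \<inter> A = {}" if "A \<in> \<A>" for A using that XY(1,2) unfolding V' by blast+
 have "(X \<union> \<Union>(C X)) \<inter> (Y \<union> \<Union>(C Y)) = {}"
 proof (rule equals0I)
  fix v assume "v \<in> (X \<union> \<Union>(C X)) \<inter> (Y \<union> \<Union>(C Y))"
  then consider "v \<in> X" "v \<in> Y" | B where "v \<in> X" "v \<in> B" "B \<in> C Y" | A where "v \<in> A" "A \<in> C X" "v \<in> Y"
   | A B where "v \<in> A" "A \<in> C X" "v \<in> B" "B \<in> C Y" by blast
  thus False
  proof cases
   case 1 thus False using XY(3) by blast
  next
   case 2 thus False using XC(1)[of B] CA by blast
  next
   case 3 thus False using XC(2)[of A] CA by blast
  next
   case 4 thus False using CXY[of A B] by blast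
  qed
 qed
 thus ?thesis using lkI[OF c[OF XY(4,1)] c[OF XY(5,2)] s[OF XY(1)] s[OF XY(2)]] XY(6-9) by blast
qed

text \<open>A component \<open>X0\<close> of the offending set is merged with all members adjacent
  to it. The neighbours of the resulting set are neighbours of \<open>X\<close> in
  \<open>p_graph\<close>, so there are at most three.\<close>

lemma enlarge:
 assumes X: "X \<subseteq> V' - T" "X \<noteq> {}" and small: "card (nb E' V' X) \<le> 3" and T: "\<And>A. A \<in> \<A> ==> A \<inter> T = {}"
 shows "\<exists>\<B>. bags G \<B> \<and> (\<forall>A\<in>\<B>. A \<inter> T = {}) \<and> \<Union>\<A> \<subset> \<Union>\<B>"
proof -
 obtain x0 where x0: "x0 \<in> X" using X by blast
 define X0 where "X0 = comp E' X x0"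
 have X0: "conn E' X0" "X0 \<subseteq> X" "x0 \<in> X0" unfolding X0_def using comp_subset[of E' X x0] comp_self[OF x0] by auto
 have X0V: "X0 \<subseteq> V'" using X0 X by blast
 define C where "C = {A \<in> \<A>. nbrs G A \<inter> X0 \<noteq> {}}"
 define B where "B = X0 \<union> \<Union>C"
 have cB: "conn E B" unfolding B_def by (rule conn_lift[OF X0(1) X0V]) (auto simp: C_def)
 have BV: "B \<subseteq> V" using X0V A_sub unfolding B_def C_def V' by blast
 have nbB: "nbrs G B \<subseteq> nb E' V' X"
 proof
  fix v assume "v \<in> nbrs G B"
  then obtain b where v: "v \<in> V" "v \<notin> B" "b \<in> B" "{b, v} \<in> E" unfolding nbrs_def by blast
  have vA: "v \<notin> A" if A: "A \<in> \<A>" for A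
  proof
   assume vA: "v \<in> A"
   hence AC: "A \<notin> C" using v(2) unfolding B_def by blast
   have bN: "b \<in> nbrs G A"
    using A_disj[OF A] v(3) AC X0V A unfolding B_def C_def V' using v(3,4) vA BV unfolding nbrs_def by (auto simp: insert_commute)
   show False
   proof (cases "b \<in> X0")
    case True
    thus False using bN AC A unfolding C_def by blast
   next
    case False
    then obtain A' where "A' \<in> \<A>" "b \<in> A'" using v(3) unfolding B_def C_def by blast
    thus False using nbrs_V'[OF A] bN unfolding V' by blast
   qed
  qed
  hence vV: "v \<in> V'" using v(1) unfolding V' by blast
  have "\<exists>x\<in>X0. {x, v} \<in> E'"
  proof (cases "b \<in> X0")
   case True
   thus ?thesis unfolding E'_iff using v(4) vA X0V unfolding V' using True by blast
  next
   case False
   then obtain A where A: "A \<in> \<A>" "b \<in> A" "nbrs G A \<inter> X0 \<noteq> {}" using v(3) unfolding B_def C_def by blast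
   then obtain x where x: "x \<in> nbrs G A" "x \<in> X0" by blast
   have "v \<in> nbrs G A" using v(1,4) vA[OF A(1)] A(2) unfolding nbrs_def by blast
   moreover have "x \<noteq> v" using x(2) v(2) unfolding B_def by blast
   ultimately show ?thesis unfolding E'_iff using A(1) x(1) x(2) by blast
  qed
  then obtain x where x: "x \<in> X0" "{x, v} \<in> E'" by blast
  show "v \<in> nb E' V' X"
   using comp_step[of x E' X x0 v] x v(2) unfolding X0_def B_def nb_def using vV x X0(2) by (auto simp: insert_commute)
 qed
 have finN: "finite (nb E' V' X)" using finV unfolding nb_def V' by simp
 define D where "D = \<A> - C"
 have D\<A>: "D \<subseteq> \<A>" unfolding D_def by blast
 have DB: "A \<inter> B = {}" if "A \<in> D" for A using that A_disj[of A] X0V unfolding D_def B_def C_def V' by blast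
 have "separated G (insert B D)" unfolding separated_def
 proof (intro conjI ballI impI)
  show "insert B D \<subseteq> Pow V" using BV A_sub D\<A> by blast
  show "pairwise disjnt (insert B D)"
   using sep D\<A> pairwise_subset DB unfolding separated_def pairwise_insert disjnt_def by (auto simp: Int_commute)
  fix A A' assume h: "A \<in> insert B D" "A' \<in> insert B D" "A \<noteq> A'"
  show "nbrs G A \<inter> A' = {}"
  proof (cases "A' = B")
   case False
   hence A': "A' \<in> \<A>" "A' \<in> D" using h D\<A> by auto
   show ?thesis using nbB A'(1) h A' D\<A> sep unfolding nb_def V' separated_def by blast
  next
   case True
   hence A: "A \<in> D" using h by blast
   hence "nbrs G A \<inter> X0 = {}" unfolding D_def C_def by blast
   moreover have "nbrs G A \<inter> A'' = {}" if "A'' \<in> C" for A'' using nbrs_V'[of A] A D\<A> that unfolding V' C_def by blast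
   ultimately show ?thesis unfolding True B_def by blast
  qed
 qed
 hence "bags G (insert B D)"
  using card_mono[OF finN nbB] small G cA nA N3 cB D\<A> X0(3) unfolding bags_def bags_axioms_def separated_sets_def B_def by auto
 moreover have "A \<inter> T = {}" if A: "A \<in> insert B D" for A
 proof (cases "A = B")
  case True
  show ?thesis using X0 X T unfolding True B_def C_def by blast
 qed (use A T D\<A> in blast)
 moreover have "\<Union>\<A> \<subset> \<Union>(insert B D)" using X0(3) X0V unfolding B_def D_def V' by blast
 ultimately show ?thesis by (intro exI[of _ "insert B D"] conjI ballI)
qed

end

theorem crossfree_nearly_planar:
 assumes G: "fin_graph G" and ts: "distinct ts" "set ts \<subseteq> verts G" "3 \<le> length ts"
  and cf: "crossfree (edges G) (verts G) ts"
 shows "nearly_planar G ts"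
proof -
 let ?T = "set ts"
 \<comment> \<open>Among these families one with the largest union is chosen, so that
   \<open>enlarge\<close> cannot apply; this is irreducibility of \<open>p_graph\<close>.\<close>
 let ?F = "{\<A>. bags G \<A> \<and> (\<forall>A\<in>\<A>. A \<inter> ?T = {})}"
 have "\<A> \<subseteq> Pow (verts G)" if "bags G \<A>" for \<A>
  using separated_sets.sep[OF bags.axioms(1)[OF that]] unfolding separated_def by blast
 hence "?F \<subseteq> Pow (Pow (verts G))" by blast
 moreover have fV: "finite (verts G)" using G unfolding fin_graph_def by blast
 ultimately have "finite ?F" using finite_subset by blast
 moreover have "?F \<noteq> {}" using G unfolding bags_def bags_axioms_def separated_sets_def separated_def by force
 ultimately obtain \<A> where A: "\<A> \<in> ?F" "\<forall>\<B>\<in>?F. card (\<Union>\<B>) \<le> card (\<Union>\<A>)"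
  using finite_max_element[of ?F "\<lambda>\<A>. card (\<Union>\<A>)"] by blast
 interpret bags G \<A> using A(1) by blast
 have AT: "A \<inter> ?T = {}" if "A \<in> \<A>" for A using A(1) that by blast
 have ir: "irred E' V' ?T" unfolding irred_def
 proof (intro allI impI)
  fix X assume X: "X \<subseteq> V' - ?T" "X \<noteq> {}"
  show "4 \<le> card (nb E' V' X)"
  proof (rule ccontr)
   assume "\<not> 4 \<le> card (nb E' V' X)"
   hence "card (nb E' V' X) \<le> 3" by simp
   from enlarge[OF X this AT] obtain \<B> where B: "bags G \<B>" "\<forall>A\<in>\<B>. A \<inter> ?T = {}" "\<Union>\<A> \<subset> \<Union>\<B>" by meson
   have "finite (\<Union>\<B>)"
    using separated_sets.sep[OF bags.axioms(1)[OF B(1)]] unfolding separated_def using fV by (meson Sup_least PowD finite_subset subsetD)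
   hence "card (\<Union>\<A>) < card (\<Union>\<B>)" using B(3) by (rule psubset_card_mono)
   moreover have "\<B> \<in> ?F" using B by blast
   ultimately show False using A(2) by fastforce
  qed
 qed
 have cf': "crossfree E' V' ts" using cf lk_lift unfolding crossfree_def by blast
 have tV: "set ts \<subseteq> V'" using ts(2) AT unfolding V' by blast
 define M where "M = {nbrs G A | A. A \<in> \<A> \<and> card (nbrs G A) = 3}"
 have M: "m \<subseteq> V' \<and> card m = 3 \<and> (\<forall>x\<in>m. \<forall>y\<in>m. x \<noteq> y \<longrightarrow> {x, y} \<in> E')" if m: "m \<in> M" for m
  using m nbrs_V' that unfolding M_def E'_iff by blast
 have fV': "finite V'" using fV unfolding V' by simp
 obtain E2 M2 where w: "E' \<subseteq> E2" "M \<subseteq> M2" "web V' E2 M2 ts"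
  using society_web[OF fV' E'_card ts(1) tV ts(3) ir cf' M] by meson
 have "ts \<noteq> []" using ts(3) by auto
 hence "\<exists>pos arcs. disc_drawing (p_graph G \<A>) pos arcs \<and> (\<forall>m\<in>M. facial_triangle (p_graph G \<A>) pos arcs m) \<and> on_boundary_in_order pos ts" by (intro web_disc[OF w(3) refl w(1) _ w(2)]) (use M in blast)+
 then obtain pos arcs where d: "disc_drawing (p_graph G \<A>) pos arcs" "\<forall>m\<in>M. facial_triangle (p_graph G \<A>) pos arcs m" "on_boundary_in_order pos ts" by blast
 have "nearly_planar_wrt G \<A> ts" unfolding nearly_planar_wrt_def
 proof (intro conjI exI[of _ pos] exI[of _ arcs])
  show "\<forall>A\<in>\<A>. card (nbrs G A) = 3 \<longrightarrow> facial_triangle (p_graph G \<A>) pos arcs (nbrs G A)" using d(2) unfolding M_def by blast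
 qed (use sep N3 tV d V' in auto)
 thus ?thesis unfolding nearly_planar_def by blast
qed

section \<open>Nearly planar orders are cross-free\<close>

lemma cis_eq_imp: "cis a = cis b ==> a \<le> b ==> b < a + 2 * pi ==> a = b"
proof -
 assume h: "cis a = cis b" "a \<le> b" "b < a + 2 * pi"
 have "cis (b - a) = 1" using h(1) by (simp add: cis_divide[symmetric])
 hence "cos (b - a) = 1" by (metis cis.simps(1) one_complex.sel(1))
 then obtain n :: int where n: "b - a = of_int n * 2 * pi" unfolding cos_one_2pi_int by blast
 have "0 \<le> real_of_int n * (2 * pi)" "real_of_int n * (2 * pi) < 1 * (2 * pi)" using n h by linarith+
 hence "n = 0" using pi_gt_zero by (auto simp: zero_le_mult_iff mult_less_cancel_right)
 thus "a = b" using n by simp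
qed

lemma ray_mem: "z \<in> closed_segment (cis a) (2 * cis a) ==> \<exists>r. 1 \<le> r \<and> r \<le> 2 \<and> z = of_real r * cis a"
proof -
 assume "z \<in> closed_segment (cis a) (2 * cis a)"
 then obtain u where u: "0 \<le> u" "u \<le> 1" "z = (1 - u) *\<^sub>R cis a + u *\<^sub>R (2 * cis a)" unfolding closed_segment_def by auto
 have "z = of_real (1 + u) * cis a" unfolding u(3) by (simp add: scaleR_conv_of_real algebra_simps)
 thus ?thesis using u by (intro exI[of _ "1 + u"]) auto
qed

text \<open>The Moebius map that takes the disc around 0 with \<open>w\<close> on its boundary to
  the upper half plane and \<open>w\<close> to infinity.\<close>

definition cayley :: "complex \<Rightarrow> complex \<Rightarrow> complex" where
 "cayley w z = \<i> * ((w + z) / (w - z))"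

lemma cayley_inj: "x \<noteq> w ==> y \<noteq> w ==> w \<noteq> 0 ==> cayley w x = cayley w y ==> x = y"
proof -
 assume h: "x \<noteq> w" "y \<noteq> w" "w \<noteq> 0" "cayley w x = cayley w y"
 have "(w + x) / (w - x) = (w + y) / (w - y)" using h(4) unfolding cayley_def mult_cancel_left by simp
 moreover have "w - x \<noteq> 0" "w - y \<noteq> 0" using h by auto
 ultimately have "(w + x) * (w - y) = (w + y) * (w - x)" by (simp add: frac_eq_eq)
 hence "2 * w * (x - y) = 0" by (simp add: algebra_simps)
 thus "x = y" using h(3) by simp
qed

lemma cayley_Im: "z \<noteq> w ==> cmod z \<le> cmod w ==> 0 \<le> Im (cayley w z)"
proof -
 assume h: "z \<noteq> w" "cmod z \<le> cmod w"
 have "Im (\<i> * q) = Re q" for q by simp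
 hence "Im (cayley w z) = Re ((w + z) / (w - z))" unfolding cayley_def .
 also have "\<dots> = Re ((w + z) * cnj (w - z)) / (cmod (w - z))\<^sup>2"
  by (simp add: complex_div_cnj[of "w + z"] Re_divide_of_real)
 also have "Re ((w + z) * cnj (w - z)) = (cmod w)\<^sup>2 - (cmod z)\<^sup>2"
  unfolding cmod_power2 by (simp add: algebra_simps power2_eq_square)
 finally show ?thesis using power_mono[OF h(2), of 2] by simp
qed

lemma cayley_circle:
 assumes s: "0 < s" "s < pi"
 shows "cayley (2 * cis p) (2 * cis (p + 2 * s)) = of_real (- (cos s / sin s))"
proof -
 have "2 * cis p + 2 * cis (p + 2 * s) = 2 * cis (p + s) * (cis (- s) + cis s)" by (simp add: algebra_simps cis_mult)
 also have "cis (- s) + cis s = of_real (2 * cos s)" by (simp add: complex_eq_iff)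
 finally have 1: "2 * cis p + 2 * cis (p + 2 * s) = 2 * cis (p + s) * of_real (2 * cos s)" .
 have "2 * cis p - 2 * cis (p + 2 * s) = 2 * cis (p + s) * (cis (- s) - cis s)" by (simp add: algebra_simps cis_mult)
 also have "cis (- s) - cis s = - (\<i> * of_real (2 * sin s))" by (simp add: complex_eq_iff)
 finally have 2: "2 * cis p - 2 * cis (p + 2 * s) = 2 * cis (p + s) * - (\<i> * of_real (2 * sin s))" .
 show ?thesis using sin_gt_zero[OF s] unfolding cayley_def 1 2 by (simp add: field_simps)
qed

lemma cot_mono:
 assumes "0 < s" "s < t" "t < pi"
 shows "- (cos s / sin s) < - (cos t / sin t)"
proof -
 have p: "0 < sin s" "0 < sin t" "0 < sin (t - s)" using assms by (auto intro: sin_gt_zero)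
 have "cos s / sin s - cos t / sin t = sin (t - s) / (sin s * sin t)" using p by (simp add: sin_diff field_simps)
 moreover have "0 < sin (t - s) / (sin s * sin t)" using p by simp
 ultimately show ?thesis by linarith
qed

definition vec2 :: "complex \<Rightarrow> real^2" where
 "vec2 z = vector [Re z, Im z]"

lemma vec2_nth [simp]: "vec2 z $ 1 = Re z" "vec2 z $ 2 = Im z"
 unfolding vec2_def by simp_all

lemma vec2_inj: "vec2 x = vec2 y ==> x = y"
 by (metis complex_eq_iff vec2_nth)

lemma continuous_vec2: "continuous_on X vec2"
proof -
 have "vec2 = (\<lambda>z. \<chi> i. if i = 1 then Re z else Im z)" by (rule ext) (simp add: vec_eq_iff forall_2)
 moreover have "continuous_on X (\<lambda>z::complex. \<chi> i::2. if i = 1 then Re z else Im z)"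
 proof (rule continuous_on_vec_lambda)
  show "continuous_on X (\<lambda>z::complex. if i = 1 then Re z else Im z)" for i :: 2
   by (cases "i = 1") (auto intro!: continuous_intros)
 qed
 ultimately show ?thesis by (simp only:)
qed

text \<open>The paths may touch the unit circle anywhere, so they are first prolonged by rays to the
  circle of radius 2. There a pole off the paths is available for the Cayley map, which puts the
  four ends on the bottom side of a box in alternating order, as \<open>fashoda_interlace\<close>
  requires.\<close>

lemma disc_crossing:
 assumes f: "path f" "path_image f \<subseteq> cball 0 1" "pathstart f = cis a" "pathfinish f = cis c"
  and g: "path g" "path_image g \<subseteq> cball 0 1" "pathstart g = cis b" "pathfinish g = cis d"
  and o: "a < b" "b < c" "c < d" "d < a + 2 * pi"
 shows "path_image f \<inter> path_image g \<noteq> {}"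
proof
 assume dis: "path_image f \<inter> path_image g = {}"
 \<comment> \<open>The middle of the arc from \<open>d\<close> to \<open>a + 2 * pi\<close>, shifted
   by a full turn; this direction differs from those of the four ends.\<close>
 define p where "p = (a + d) / 2 - pi"
 define w where "w = 2 * cis p"
 have ang: "p < a" "d < p + 2 * pi" using o unfolding p_def by (auto simp: field_simps)
 have w0: "w \<noteq> 0" "cmod w = 2" unfolding w_def by (auto simp: norm_mult)
 define f' where "f' = linepath (2 * cis a) (cis a) +++ f +++ linepath (cis c) (2 * cis c)"
 define g' where "g' = linepath (2 * cis b) (cis b) +++ g +++ linepath (cis d) (2 * cis d)"
 have pf: "path f'" "pathstart f' = 2 * cis a" "pathfinish f' = 2 * cis c"
  and pg: "path g'" "pathstart g' = 2 * cis b" "pathfinish g' = 2 * cis d"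
  unfolding f'_def g'_def using f g by simp_all
 have imf: "path_image f' = closed_segment (cis a) (2 * cis a) \<union> path_image f \<union> closed_segment (cis c) (2 * cis c)"
  unfolding f'_def using f by (simp add: path_image_join closed_segment_commute Un_assoc)
 have img: "path_image g' = closed_segment (cis b) (2 * cis b) \<union> path_image g \<union> closed_segment (cis d) (2 * cis d)"
  unfolding g'_def using g by (simp add: path_image_join closed_segment_commute Un_assoc)
 have ends: "cis a \<in> path_image f" "cis c \<in> path_image f" "cis b \<in> path_image g" "cis d \<in> path_image g"
  using f g pathstart_in_path_image pathfinish_in_path_image by metis+
 have ne: "cis x \<noteq> cis y" if "x < y" "y < x + 2 * pi" for x y using cis_eq_imp[of x y] that by auto
 have ray_ray: "z \<notin> closed_segment (cis y) (2 * cis y)" if z: "z \<in> closed_segment (cis x) (2 * cis x)" and n: "cis x \<noteq> cis y" for x y z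
 proof
  assume z': "z \<in> closed_segment (cis y) (2 * cis y)"
  obtain r where r: "1 \<le> r" "z = of_real r * cis x" using ray_mem[OF z] by blast
  obtain s where s: "1 \<le> s" "z = of_real s * cis y" using ray_mem[OF z'] by blast
  have "cmod z = r" unfolding r(2) using r(1) by (simp add: norm_mult)
  moreover have "cmod z = s" unfolding s(2) using s(1) by (simp add: norm_mult)
  ultimately have "r = s" by simp
  thus False using r s n by simp
 qed
 have ray_disc: "z = cis x" if zx: "z \<in> closed_segment (cis x) (2 * cis x)" "z \<in> cball 0 1" for x z
  using ray_mem[OF zx(1)] zx(2) that by (auto simp: norm_mult)
 have nn: "cis a \<noteq> cis b" "cis a \<noteq> cis d" "cis c \<noteq> cis b" "cis c \<noteq> cis d"
  using ne[of a b] ne[of a d] ne[of b c] ne[of c d] o by auto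
 have dis': "path_image f' \<inter> path_image g' = {}"
 proof (rule equals0I)
  fix z assume z: "z \<in> path_image f' \<inter> path_image g'"
  have fg: "z \<notin> path_image f \<or> z \<notin> path_image g" using dis by blast
  show False
  proof (cases "z \<in> path_image f")
   case True
   hence "z = cis b \<or> z = cis d" using z fg img True f ray_disc by blast
   thus False using True ends fg by blast
  next
   case False
   then obtain x where x: "x = a \<or> x = c" "z \<in> closed_segment (cis x) (2 * cis x)" using z imf by blast
   show False
   proof (cases "z \<in> path_image g")
    case True
    hence "z = cis x" using ray_disc[OF x(2)] g by blast
    thus False using False ends x(1) by blast
   next
    case False
    then obtain y where y: "y = b \<or> y = d" "z \<in> closed_segment (cis y) (2 * cis y)" using z img by blast
    thus False using ray_ray[OF x(2), of y] x(1) nn by blast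
   qed
  qed
 qed
 have in2: "cmod z \<le> 2 \<and> z \<noteq> w" if z: "z \<in> path_image f' \<union> path_image g'" for z
 proof (cases "z \<in> cball 0 1")
  case True
  thus ?thesis using w0 by auto
 next
  case False
  then obtain x where x: "x \<in> {a, b, c, d}" "z \<in> closed_segment (cis x) (2 * cis x)" using z f g unfolding imf img by blast
  obtain r where r: "1 \<le> r" "r \<le> 2" "z = of_real r * cis x" using ray_mem[OF x(2)] by blast
  have cz: "cmod z = r" unfolding r(3) using r by (simp add: norm_mult)
  show ?thesis using cz w0 r ne[of p x] x(1) ang o unfolding w_def using cz r by auto
 qed
 define h where "h z = vec2 (cayley w z)" for z
 have ch: "continuous_on (path_image f' \<union> path_image g') h"
  unfolding h_def cayley_def using in2 by (intro continuous_on_compose2[OF continuous_vec2[of UNIV]] continuous_intros) auto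
 have pF: "path (h \<circ> f')" "path (h \<circ> g')"
  by (rule path_continuous_image; use pf pg ch in \<open>auto intro: continuous_on_subset\<close>)+
 have "compact (h ` (path_image f' \<union> path_image g'))"
  by (intro compact_continuous_image ch compact_Un compact_path_image pf pg)
 then obtain B where B: "\<And>x. x \<in> h ` (path_image f' \<union> path_image g') ==> norm x \<le> B"
  using compact_imp_bounded bounded_iff by metis
 have sub: "h ` (path_image f' \<union> path_image g') \<subseteq> cbox (vec2 (Complex (- B) 0)) (vec2 (Complex B B))"
 proof
  fix x assume x: "x \<in> h ` (path_image f' \<union> path_image g')"
  then obtain z where z: "z \<in> path_image f' \<union> path_image g'" "x = h z" by blast
  have "0 \<le> x $ 2" using cayley_Im[of z w] in2[OF z(1)] w0 unfolding z(2) h_def by simp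
  moreover have "\<bar>x $ 1\<bar> \<le> B" "\<bar>x $ 2\<bar> \<le> B" using B[OF x] component_le_norm_cart order_trans by blast+
  ultimately show "x \<in> cbox (vec2 (Complex (- B) 0)) (vec2 (Complex B B))" unfolding mem_box_cart forall_2 by auto
 qed
 define \<kappa> where "\<kappa> t = - (cos ((t - p) / 2) / sin ((t - p) / 2))" for t
 have hc: "h (2 * cis t) = vec2 (Complex (\<kappa> t) 0)" if "p < t" "t < p + 2 * pi" for t
  using cayley_circle[of "(t - p) / 2" p] that unfolding w_def \<kappa>_def h_def by (auto simp: field_simps complex_of_real_def)
 have mono: "\<kappa> x < \<kappa> y" if "p < x" "x < y" "y < p + 2 * pi" for x y unfolding \<kappa>_def by (rule cot_mono) (use that in auto)
 have e: "h (2 * cis a) = vec2 (Complex (\<kappa> a) 0)" "h (2 * cis b) = vec2 (Complex (\<kappa> b) 0)"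
  "h (2 * cis c) = vec2 (Complex (\<kappa> c) 0)" "h (2 * cis d) = vec2 (Complex (\<kappa> d) 0)"
  by (rule hc; use ang o in linarith)+
 have k: "\<kappa> a < \<kappa> b" "\<kappa> b < \<kappa> c" "\<kappa> c < \<kappa> d" by (rule mono; use ang o in linarith)+
 obtain x where x: "x \<in> path_image (h \<circ> f')" "x \<in> path_image (h \<circ> g')"
 proof (rule fashoda_interlace[OF pF])
  show "path_image (h \<circ> f') \<subseteq> cbox (vec2 (Complex (- B) 0)) (vec2 (Complex B B))"
   "path_image (h \<circ> g') \<subseteq> cbox (vec2 (Complex (- B) 0)) (vec2 (Complex B B))"
   using sub unfolding path_image_compose by blast+
 qed (use e k pf pg in \<open>simp_all add: pathstart_compose pathfinish_compose\<close>)
 then obtain y z where yz: "y \<in> path_image f'" "z \<in> path_image g'" "h y = h z" unfolding path_image_compose by (metis imageE)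
 hence "y = z" unfolding h_def using vec2_inj cayley_inj[of y w z] in2 yz w0 by blast
 thus False using dis' yz by blast
qed

lemma drawing_path:
 assumes d: "disc_drawing H pos arcs" and P: "pth (edges H) P" "set P \<subseteq> verts H"
 shows "\<exists>g. path g \<and> path_image g \<subseteq> pos ` set P \<union> (\<Union>e\<in>{e \<in> edges H. e \<subseteq> set P}. path_image (arcs e)) \<and>
  pathstart g = pos (hd P) \<and> pathfinish g = pos (last P)"
 using P
proof (induction P)
 case Nil
 thus ?case by (simp add: pth_def)
next
 case (Cons x P)
 show ?case
 proof (cases P)
  case Nil
  thus ?thesis by (intro exI[of _ "\<lambda>_. pos x"]) (auto simp: path_def pathstart_def pathfinish_def path_image_def)
 next
  case (Cons y Q)
  have e: "{x, y} \<in> edges H" and pP: "pth (edges H) P" using Cons.prems(1) Cons by (auto simp: pth_def)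
  obtain g where g: "path g" "path_image g \<subseteq> pos ` set P \<union> (\<Union>e\<in>{e \<in> edges H. e \<subseteq> set P}. path_image (arcs e))"
   "pathstart g = pos y" "pathfinish g = pos (last P)" using Cons.IH[OF pP] Cons.prems Cons by auto
  have a: "arc (arcs {x, y})" "{pathstart (arcs {x, y}), pathfinish (arcs {x, y})} = {pos x, pos y}"
   using d e unfolding disc_drawing_def by auto
  define k where "k = (if pathstart (arcs {x, y}) = pos x then arcs {x, y} else reversepath (arcs {x, y}))"
  have k: "path k" "path_image k = path_image (arcs {x, y})" "pathstart k = pos x" "pathfinish k = pos y"
   using a unfolding k_def by (auto simp: arc_imp_path doubleton_eq_iff)
  have "{x, y} \<subseteq> set (x # P)" using Cons by auto
  hence "path_image (k +++ g) \<subseteq> pos ` set (x # P) \<union> (\<Union>e\<in>{e \<in> edges H. e \<subseteq> set (x # P)}. path_image (arcs e))"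
  proof -
   have "path_image k \<subseteq> (\<Union>e\<in>{e \<in> edges H. e \<subseteq> set (x # P)}. path_image (arcs e))"
    unfolding k(2) by (rule UN_upper) (use e \<open>{x, y} \<subseteq> set (x # P)\<close> in simp)
   moreover have "pos ` set P \<union> (\<Union>e\<in>{e \<in> edges H. e \<subseteq> set P}. path_image (arcs e)) \<subseteq>
     pos ` set (x # P) \<union> (\<Union>e\<in>{e \<in> edges H. e \<subseteq> set (x # P)}. path_image (arcs e))"
    by (intro Un_mono image_mono UN_mono) auto
   ultimately show ?thesis using path_image_join_subset[of k g] g(2) by (meson Un_least Un_upper2 order_trans)
  qed
  thus ?thesis using k g Cons by (intro exI[of _ "k +++ g"]) auto
 qed
qed

theorem nearly_planar_crossfree:
 assumes G: "fin_graph G" and np: "nearly_planar G ts"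
 shows "crossfree (edges G) (verts G) ts"
 unfolding crossfree_def
proof (intro allI impI notI)
 fix i j k l :: nat
 assume o: "i < j" "j < k" "k < l" "l < length ts"
  and "lk (edges G) (verts G) (ts ! i) (ts ! k) (ts ! j) (ts ! l)"
 then obtain X Y where XY: "X \<subseteq> verts G" "Y \<subseteq> verts G" "X \<inter> Y = {}" "conn (edges G) X" "conn (edges G) Y"
  "ts ! i \<in> X" "ts ! k \<in> X" "ts ! j \<in> Y" "ts ! l \<in> Y" unfolding lk_def by blast
 obtain \<A> where np: "nearly_planar_wrt G \<A> ts" using np unfolding nearly_planar_def by blast
 interpret separated_sets G \<A> by unfold_locales (use G np in \<open>auto simp: nearly_planar_wrt_def\<close>)
 let ?H = "p_graph G \<A>"
 obtain pos arcs where d: "disc_drawing ?H pos arcs" and ob: "on_boundary_in_order pos ts" and tV: "set ts \<subseteq> V'"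
  using np unfolding nearly_planar_wrt_def V' by blast
 obtain \<theta> where \<theta>: "\<forall>t\<in>set ts. pos t = cis (\<theta> t)" "sorted_wrt (\<lambda>u v. \<theta> u < \<theta> v \<and> \<theta> v < \<theta> u + 2 * pi) ts"
  using ob unfolding on_boundary_in_order_def by blast
 let ?U = "\<Union>\<A>"
 have pth: "\<exists>g. path g \<and> path_image g \<subseteq> pos ` X \<union> (\<Union>e\<in>{e \<in> E'. e \<subseteq> X}. path_image (arcs e)) \<and> pathstart g = pos s \<and> pathfinish g = pos t"
  if X: "conn E' X" "X \<subseteq> V'" "s \<in> X" "t \<in> X" for X s t
 proof -
  obtain P where P: "pth E' P" "hd P = s" "last P = t" "set P \<subseteq> X" using conn_obtain_pth[OF X(1,3,4)] .
  have "set P \<subseteq> V'" using P X by blast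
  from drawing_path[OF d P(1) this] obtain g where g: "path g"
   "path_image g \<subseteq> pos ` set P \<union> (\<Union>e\<in>{e \<in> E'. e \<subseteq> set P}. path_image (arcs e))" "pathstart g = pos s" "pathfinish g = pos t"
   unfolding P(2,3) by blast
  show ?thesis using P(4) g by force
 qed
 have V'X: "X - ?U \<subseteq> V'" "Y - ?U \<subseteq> V'" using XY(1,2) unfolding V' by blast+
 have tn: "ts ! q \<in> V'" "pos (ts ! q) = cis (\<theta> (ts ! q))" if "q < length ts" for q using tV \<theta>(1) nth_mem[OF that] by blast+
 have ix: "i < length ts" "j < length ts" "k < length ts" using o by auto
 have mem: "ts ! i \<in> X - ?U" "ts ! k \<in> X - ?U" "ts ! j \<in> Y - ?U" "ts ! l \<in> Y - ?U"
  using XY(6-9) tn(1)[OF ix(1)] tn(1)[OF ix(2)] tn(1)[OF ix(3)] tn(1)[OF o(4)] unfolding V' by auto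
 obtain f where f: "path f" "path_image f \<subseteq> pos ` (X - ?U) \<union> (\<Union>e\<in>{e \<in> E'. e \<subseteq> X - ?U}. path_image (arcs e))"
  "pathstart f = pos (ts ! i)" "pathfinish f = pos (ts ! k)" using pth[OF conn_down[OF XY(4,1)] V'X(1) mem(1,2)] by meson
 obtain g where g: "path g" "path_image g \<subseteq> pos ` (Y - ?U) \<union> (\<Union>e\<in>{e \<in> E'. e \<subseteq> Y - ?U}. path_image (arcs e))"
  "pathstart g = pos (ts ! j)" "pathfinish g = pos (ts ! l)" using pth[OF conn_down[OF XY(5,2)] V'X(2) mem(3,4)] by meson
 have D: "inj_on pos V'" "pos ` V' \<subseteq> cball 0 1" "\<And>e. e \<in> E' ==> path_image (arcs e) \<subseteq> cball 0 1"
  "\<And>e. e \<in> E' ==> path_image (arcs e) \<inter> pos ` V' = pos ` e"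
  "\<And>e f. e \<in> E' ==> f \<in> E' ==> e \<noteq> f ==> path_image (arcs e) \<inter> path_image (arcs f) \<subseteq> pos ` (e \<inter> f)"
  using d unfolding disc_drawing_def by simp_all
 \<comment> \<open>The part of the drawing induced on \<open>Z\<close>. Disjoint vertex sets have
   disjoint parts, so a crossing linkage would give two disjoint paths in the disc.\<close>
 define Dr where "Dr Z = pos ` Z \<union> (\<Union>e\<in>{e \<in> E'. e \<subseteq> Z}. path_image (arcs e))" for Z
 have DrE: "(\<exists>x\<in>Z. z = pos x) \<or> (\<exists>e\<in>E'. e \<subseteq> Z \<and> z \<in> path_image (arcs e))" if "z \<in> Dr Z" for z Z
  using that unfolding Dr_def by auto
 have c1: "Dr Z \<subseteq> cball 0 1" if "Z \<subseteq> V'" for Z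
 proof
  fix z assume "z \<in> Dr Z"
  from DrE[OF this] show "z \<in> cball 0 1" using subsetD[OF that] subsetD[OF D(2)] subsetD[OF D(3)] by blast
 qed
 have ve: False if h: "Z \<subseteq> V'" "Z \<inter> W = {}" "W \<subseteq> V'" "x \<in> Z" "e \<in> E'" "e \<subseteq> W" "pos x \<in> path_image (arcs e)" for Z W x e
 proof -
  have "x \<in> V'" by (rule subsetD[OF h(1,4)])
  have "e \<subseteq> V'" by (rule order_trans[OF h(6,3)])
  have "pos x \<in> path_image (arcs e) \<inter> pos ` V'" by (rule IntI[OF h(7) imageI[OF \<open>x \<in> V'\<close>, of pos]])
  hence "pos x \<in> pos ` e" unfolding D(4)[OF h(5)] .
  hence "x \<in> Z \<inter> W" using inj_on_image_mem_iff[OF D(1) \<open>x \<in> V'\<close> \<open>e \<subseteq> V'\<close>] subsetD[OF h(6)] h(4) by simp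
  thus False unfolding h(2) by simp
 qed
 have Dd: "Dr Z \<inter> Dr W = {}" if Z: "Z \<subseteq> V'" "W \<subseteq> V'" "Z \<inter> W = {}" for Z W
 proof (rule equals0I)
  fix z assume z: "z \<in> Dr Z \<inter> Dr W"
  have W: "W \<inter> Z = {}" using Z(3) by blast
  consider x where "x \<in> Z" "z = pos x" | e where "e \<in> E'" "e \<subseteq> Z" "z \<in> path_image (arcs e)" using DrE[of z Z] z by blast
  thus False
  proof cases
   case (1 x)
   consider y where "y \<in> W" "z = pos y" | e where "e \<in> E'" "e \<subseteq> W" "z \<in> path_image (arcs e)" using DrE[of z W] z by blast
   thus False
   proof cases
    case (1 y)
    have "x = y" by (rule inj_onD[OF D(1)]) (use 1(2) \<open>z = pos x\<close> subsetD[OF Z(1) \<open>x \<in> Z\<close>] subsetD[OF Z(2) 1(1)] in simp_all)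
    hence "x \<in> Z \<inter> W" using 1 \<open>x \<in> Z\<close> by simp
    thus False unfolding Z(3) by simp
   next
    case (2 e)
    thus False using ve[OF Z(1,3,2) \<open>x \<in> Z\<close>, of e] \<open>z = pos x\<close> by blast
   qed
  next
   case (2 e)
   consider y where "y \<in> W" "z = pos y" | f where "f \<in> E'" "f \<subseteq> W" "z \<in> path_image (arcs f)" using DrE[of z W] z by blast
   thus False
   proof cases
    case (1 y)
    thus False using ve[OF Z(2) W Z(1), of y e] 2 by blast
   next
    case (2 f)
    have ef: "e \<inter> f = {}" using 2 \<open>e \<subseteq> Z\<close> Z(3) by blast
    moreover have "e \<noteq> {}" using E'_card[OF \<open>e \<in> E'\<close>] by auto
    ultimately have "e \<noteq> f" by blast
    have "z \<in> pos ` (e \<inter> f)" using D(5)[OF \<open>e \<in> E'\<close> 2(1) \<open>e \<noteq> f\<close>] 2(3) \<open>z \<in> path_image (arcs e)\<close> by blast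
    thus False using ef by simp
   qed
  qed
 qed
 have fD: "path_image f \<subseteq> Dr (X - ?U)" and gD: "path_image g \<subseteq> Dr (Y - ?U)" using f(2) g(2) unfolding Dr_def .
 have "(X - ?U) \<inter> (Y - ?U) = {}" using XY(3) by blast
 hence "Dr (X - ?U) \<inter> Dr (Y - ?U) = {}" by (rule Dd[OF V'X])
 hence "path_image f \<inter> path_image g = {}" using fD gD by (meson disjoint_iff subsetD)
 moreover have "path_image f \<inter> path_image g \<noteq> {}"
 proof (rule disc_crossing[OF f(1) _ _ _ g(1)])
  show "path_image f \<subseteq> cball 0 1" "path_image g \<subseteq> cball 0 1" using fD gD c1[OF V'X(1)] c1[OF V'X(2)] by (meson order_trans)+
  show "pathstart f = cis (\<theta> (ts ! i))" "pathfinish f = cis (\<theta> (ts ! k))" "pathstart g = cis (\<theta> (ts ! j))" "pathfinish g = cis (\<theta> (ts ! l))" using f g tn o by auto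
  show "\<theta> (ts ! i) < \<theta> (ts ! j)" "\<theta> (ts ! j) < \<theta> (ts ! k)" "\<theta> (ts ! k) < \<theta> (ts ! l)" "\<theta> (ts ! l) < \<theta> (ts ! i) + 2 * pi"
   using sorted_wrt_nth_less[OF \<theta>(2)] o by auto
 qed
 ultimately show False by blast
qed

section \<open>Paths, linkages and separations\<close>

lemma is_path_iff: "is_path G P \<longleftrightarrow> pth (edges G) P \<and> set P \<subseteq> verts G"
 unfolding is_path_def pth_def by blast

lemma lo_tensor: "lo (tensor a b) (x, y) = lo a x * lo b y"
proof -
 have "lo (tensor a b) (x, y) = (\<Sum>r\<in>Poly_Mapping.keys a. \<Sum>s\<in>Poly_Mapping.keys b.
   if s = y then (if r = x then lo a r * lo b s else 0) else 0)"
  unfolding tensor_def lookup_sum by (intro sum.cong) auto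
 also have "\<dots> = (\<Sum>r\<in>Poly_Mapping.keys a. if r = x then lo a r * lo b y else 0)" by (intro sum.cong) (auto simp: in_keys_iff)
 also have "\<dots> = lo a x * lo b y" by (simp add: in_keys_iff)
 finally show ?thesis .
qed

lemma tensor_boundary: "tensor (boundary P) (boundary Q) = qd (last P) (hd P) (last Q) (hd Q)"
proof (rule poly_mapping_eqI)
 fix k :: "'a \<times> 'a"
 obtain x y where k: "k = (x, y)" by (metis surj_pair)
 show "lo (tensor (boundary P) (boundary Q)) k = lo (qd (last P) (hd P) (last Q) (hd Q)) k"
  unfolding k lo_tensor lo_qd boundary_def by (simp add: lookup_minus algebra_simps)
qed

lemma P_module_eq: "P_module G R S = PM (edges G) (verts G) R S"
proof -
 have "{tensor (boundary P1) (boundary P2) | P1 P2. set_linkage G R S P1 P2} =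
  {qd a b c d | a b c d. a \<in> R \<and> b \<in> R \<and> c \<in> S \<and> d \<in> S \<and> lk (edges G) (verts G) a b c d}" (is "?A = ?B")
 proof (intro equalityI subsetI)
  fix z assume "z \<in> ?A"
  then obtain P Q where z: "z = tensor (boundary P) (boundary Q)" and l: "set_linkage G R S P Q" by blast
  have P: "pth (edges G) P" "set P \<subseteq> verts G" "pth (edges G) Q" "set Q \<subseteq> verts G" "set P \<inter> set Q = {}"
   and m: "hd P \<in> R" "last P \<in> R" "hd Q \<in> S" "last Q \<in> S"
   using l unfolding set_linkage_def is_path_iff by blast+
  have "lk (edges G) (verts G) (last P) (hd P) (last Q) (hd Q)"
   using P unfolding pth_def by (intro lkI[OF conn_pth[OF P(1)] conn_pth[OF P(3)] P(2,4,5)]) auto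
  thus "z \<in> ?B" unfolding z tensor_boundary using m by blast
 next
  fix z assume "z \<in> ?B"
  then obtain a b c d where z: "z = qd a b c d" and m: "a \<in> R" "b \<in> R" "c \<in> S" "d \<in> S" and l: "lk (edges G) (verts G) a b c d" by blast
  obtain X Y where XY: "X \<subseteq> verts G" "Y \<subseteq> verts G" "X \<inter> Y = {}" "conn (edges G) X" "conn (edges G) Y" "a \<in> X" "b \<in> X" "c \<in> Y" "d \<in> Y" using l unfolding lk_def by blast
  obtain P where P: "pth (edges G) P" "hd P = b" "last P = a" "set P \<subseteq> X" using conn_obtain_pth[OF XY(4,7,6)] .
  obtain Q where Q: "pth (edges G) Q" "hd Q = d" "last Q = c" "set Q \<subseteq> Y" using conn_obtain_pth[OF XY(5,9,8)] .
  have "set_linkage G R S P Q" using P(4) Q(4) XY(1-3) unfolding set_linkage_def is_path_iff using P Q m by blast+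
  moreover have "z = tensor (boundary P) (boundary Q)" unfolding tensor_boundary z P Q ..
  ultimately show "z \<in> ?A" by blast
 qed
 thus ?thesis unfolding P_module_def PM_def by simp
qed

lemma connected_graph_conn:
 assumes "connected_graph H" "edges H \<subseteq> E"
 shows "conn E (verts H)"
proof (cases "verts H = {}")
 case False
 then obtain v where v: "v \<in> verts H" by blast
 have "u \<in> comp E (verts H) v" if u: "u \<in> verts H" for u
 proof -
  obtain P where P: "is_path H P" "{hd P, last P} = {v, u}"
   using assms(1) u v unfolding connected_graph_def connects_def by blast
  have p: "pth (edges H) P" "set P \<subseteq> verts H" using P(1) unfolding is_path_iff by blast+
  have ne: "P \<noteq> []" using p unfolding pth_def by blast
  have "conn E (set P)" using conn_mono[OF conn_pth[OF p(1)] assms(2)] .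
  thus ?thesis using ne P(2) subsetD[OF comp_superset[OF _ p(2)]] by (auto simp: doubleton_eq_iff)
 qed
 hence "comp E (verts H) v = verts H" using comp_subset[of E "verts H" v] by blast
 thus ?thesis using conn_comp[of E "verts H" v] by simp
qed simp

lemma two_connected_twoc:
 assumes G: "fin_graph G" and t: "two_connected G"
 shows "twoc (verts G) (edges G)"
proof
 have c: "conn (edges G) (verts G - X)" if X: "X \<subseteq> verts G" "card X < 2" for X
 proof -
  have "connected_graph (delete_verts G X)" using t X unfolding two_connected_def by blast
  hence "conn (edges G) (verts (delete_verts G X))" by (rule connected_graph_conn) (auto simp: delete_verts_def)
  thus ?thesis unfolding delete_verts_def by simp
 qed
 show "conn (edges G) (verts G)" using c[of "{}"] by simp
 show "conn (edges G) (verts G - {x})" for x using c[of "{x}"] c[of "{}"] by (cases "x \<in> verts G") auto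
qed (use G in \<open>auto simp: fin_graph_def\<close>)

lemma is_path_sub:
 assumes "pth E P" "set P \<subseteq> W" "\<forall>e\<in>E. e \<subseteq> W \<longrightarrow> e \<in> edges H" "W = verts H"
 shows "is_path H P"
proof -
 have "successively (\<lambda>x y. {x, y} \<in> edges H) P"
  unfolding successively_conv_nth using pth_nth_edge[OF assms(1)] assms(2) assms(3) by force
 thus ?thesis using assms unfolding is_path_def pth_def by blast
qed

lemma no_sided_nosd:
 assumes G: "fin_graph G" and n: "\<nexists>G1 G2. sided_separation G S R G1 G2"
 shows "nosd (edges G) (verts G) R S"
 unfolding nosd_def
proof (intro allI impI notI)
 let ?E = "edges G" and ?V = "verts G"
 fix I w w' s e
 assume h: "w \<noteq> w'" "w \<in> ?V - I" "w' \<in> ?V - I" "I \<subseteq> ?V" "nb ?E ?V I \<subseteq> {w, w'}" "?V - I - {w, w'} \<noteq> {}" "I \<inter> R = {}"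
  "s \<in> S \<inter> I" "e \<in> S \<inter> I" "s \<noteq> e" and l1: "lk ?E (I \<union> {w, w'}) s w e w'" and l2: "lk ?E (I \<union> {w, w'}) s w' e w"
 let ?W = "I \<union> {w, w'}"
 define G1 where "G1 = \<lparr>verts = ?W, edges = {e \<in> ?E. e \<subseteq> ?W}\<rparr>"
 \<comment> \<open>An edge between \<open>w\<close> and \<open>w'\<close> is given to
   \<open>G1\<close>, which keeps the edge sets disjoint.\<close>
 define G2 where "G2 = \<lparr>verts = ?V - I, edges = {e \<in> ?E. \<not> e \<subseteq> ?W}\<rparr>"
 have fE: "finite ?V" "\<forall>e\<in>?E. e \<subseteq> ?V \<and> card e = 2" using G unfolding fin_graph_def by blast+
 have W: "?W \<subseteq> ?V" using h by blast
 have s1: "subgraph_of G1 G" unfolding subgraph_of_def fin_graph_def G1_def using fE W finite_subset[OF W] by auto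
 have e2: "f \<subseteq> ?V - I" if f: "f \<in> ?E" "\<not> f \<subseteq> ?W" for f
 proof -
  obtain x y where xy: "f = {x, y}" using fE f(1) by (meson card_2_iff)
  have "f \<subseteq> ?V" using fE(2) f(1) by simp
  hence "x \<in> ?V" "y \<in> ?V" using xy by simp_all
  have cl: "b \<in> ?W" if ab: "a \<in> I" "{a, b} \<in> ?E" "b \<in> ?V" for a b using ab subsetD[OF h(5)] that unfolding nb_def by blast
  have "x \<notin> I"
  proof
   assume "x \<in> I"
   hence "y \<in> ?W" using cl[of x y] f xy \<open>y \<in> ?V\<close> by simp
   thus False using f(2) xy \<open>x \<in> I\<close> by simp
  qed
  moreover have "y \<notin> I"
  proof
   assume "y \<in> I"
   hence "x \<in> ?W" using cl[of y x] f xy \<open>x \<in> ?V\<close> by (simp add: insert_commute)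
   thus False using f(2) xy \<open>y \<in> I\<close> by simp
  qed
  ultimately show ?thesis using xy \<open>x \<in> ?V\<close> \<open>y \<in> ?V\<close> by blast
 qed
 have s2: "subgraph_of G2 G" unfolding subgraph_of_def fin_graph_def G2_def using fE e2 by auto
 have v12: "verts G1 \<inter> verts G2 = {w, w'}" "verts G1 - verts G2 = I" "verts G2 - verts G1 = ?V - I - {w, w'}" "verts G1 \<union> verts G2 = ?V" unfolding G1_def G2_def using h(2-4) by auto
 have "two_separation G G1 G2"
  unfolding two_separation_def separation_def using s1 s2 v12 h(1) unfolding G1_def G2_def by auto
 moreover have "card (verts G2 - verts G1) > 0" unfolding v12 using h(6) fE(1) by (simp add: card_gt_0_iff)
 moreover have vl: "\<exists>P1 P2. vertex_linkage G1 a b c d P1 P2" if lk: "lk ?E ?W a b c d" for a b c d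
 proof -
  obtain X Y where XY: "X \<subseteq> ?W" "Y \<subseteq> ?W" "X \<inter> Y = {}" "conn ?E X" "conn ?E Y" "a \<in> X" "b \<in> X" "c \<in> Y" "d \<in> Y"
   using lk unfolding lk_def by blast
  obtain P where P: "pth ?E P" "hd P = a" "last P = b" "set P \<subseteq> X" using conn_obtain_pth[OF XY(4,6,7)] .
  obtain Q where Q: "pth ?E Q" "hd Q = c" "last Q = d" "set Q \<subseteq> Y" using conn_obtain_pth[OF XY(5,8,9)] .
  have "is_path G1 P" by (rule is_path_sub[OF P(1), of ?W]) (use P(4) XY(1) in \<open>auto simp: G1_def\<close>)
  moreover have "is_path G1 Q" by (rule is_path_sub[OF Q(1), of ?W]) (use Q(4) XY(2) in \<open>auto simp: G1_def\<close>)
  moreover have "set P \<inter> set Q = {}" using P(4) Q(4) XY(3) by blast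
  ultimately show ?thesis unfolding vertex_linkage_def connects_def using P Q by blast
 qed
 moreover have "s \<noteq> e \<and> {s, e} \<subseteq> I \<inter> S \<and> {w, w'} = {w, w'} \<and>
   (\<exists>P1 P2. vertex_linkage G1 s w e w' P1 P2) \<and> (\<exists>P1 P2. vertex_linkage G1 s w' e w P1 P2)"
  using h(8-10) vl[OF l1] vl[OF l2] by simp
 hence "\<exists>u1 u2 w1 w2. u1 \<noteq> u2 \<and> {u1, u2} \<subseteq> I \<inter> S \<and> {w, w'} = {w1, w2} \<and>
   (\<exists>P1 P2. vertex_linkage G1 u1 w1 u2 w2 P1 P2) \<and> (\<exists>P1 P2. vertex_linkage G1 u1 w2 u2 w1 P1 P2)"
  by (rule exI[of _ s, OF exI[of _ e, OF exI[of _ w, OF exI[of _ w']]]])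
 ultimately have "sided_separation G S R G1 G2" unfolding sided_separation_def v12 using h(7) by simp
 thus False using n by blast
qed

section \<open>The link form\<close>

lemma link_superset:
 assumes "finite K" "Poly_Mapping.keys z \<subseteq> K"
 shows "link z ts = (\<Sum>(u, v)\<in>K. lo z (u, v) * link_sign ts u v)"
 unfolding link_def by (rule sum.mono_neutral_left) (use assms in \<open>auto simp: in_keys_iff\<close>)

lemma link_add: "link (x + y) ts = link x ts + link y ts"
proof -
 let ?K = "Poly_Mapping.keys x \<union> Poly_Mapping.keys y"
 have K: "finite ?K" "Poly_Mapping.keys (x + y) \<subseteq> ?K" using Poly_Mapping.keys_add[of x y] by auto
 have "link (x + y) ts = (\<Sum>(u, v)\<in>?K. lo x (u, v) * link_sign ts u v + lo y (u, v) * link_sign ts u v)"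
  unfolding link_superset[OF K] by (intro sum.cong) (auto simp: lookup_add algebra_simps)
 also have "\<dots> = (\<Sum>(u, v)\<in>?K. lo x (u, v) * link_sign ts u v) + (\<Sum>(u, v)\<in>?K. lo y (u, v) * link_sign ts u v)"
  unfolding sum.distrib[symmetric] by (intro sum.cong) auto
 also have "\<dots> = link x ts + link y ts" using link_superset[OF K(1), of x] link_superset[OF K(1), of y] by simp
 finally show ?thesis .
qed

lemma link_cmul: "link (frag_cmul k x) ts = k * link x ts"
proof -
 have "link (frag_cmul k x) ts = (\<Sum>(u, v)\<in>Poly_Mapping.keys x. lo (frag_cmul k x) (u, v) * link_sign ts u v)"
  by (rule link_superset) (auto simp: in_keys_iff)
 also have "\<dots> = k * link x ts" unfolding link_def sum_distrib_left by (intro sum.cong) (auto simp: algebra_simps)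
 finally show ?thesis .
qed

lemma link_0: "link 0 ts = 0"
 by (simp add: link_def)

lemma link_subspace: "frag.subspace {z. link z ts = 0}"
 by (rule frag.subspaceI) (auto simp: link_add link_cmul link_0)

lemma link_minus: "link (- x) ts = - link x ts" "link (x - y) ts = link x ts - link y ts"
 using link_add[of x "- x" ts] link_add[of "x - y" y ts] by (auto simp: link_0)

lemma link_frag_of: "link (frag_of (u, v)) ts = link_sign ts u v"
 by (simp add: link_def)

lemma link_qd: "link (qd a b c d) ts = link_sign ts a c - link_sign ts a d - link_sign ts b c + link_sign ts b d"
 unfolding qd_def by (simp add: link_add link_minus link_frag_of)

lemma sign_nth:
 assumes "distinct ts" "i < length ts" "j < length ts"
 shows "link_sign ts (ts ! i) (ts ! j) = (if i < j then 1 else if j < i then - 1 else 0)"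
proof -
 have "comes_before ts (ts ! i) (ts ! j) \<longleftrightarrow> i < j" if "i < length ts" "j < length ts" for i j
  unfolding comes_before_def using that nth_eq_iff_index_eq[OF assms(1)] by (metis less_trans)
 thus ?thesis unfolding link_sign_def using assms by simp
qed

text \<open>For alternating positions the four signs add up to 2 or -2; otherwise they
  cancel.\<close>

lemma link_quad:
 assumes d: "distinct ts" and b: "p < length ts" "r < length ts" "q < length ts" "s < length ts" and di: "distinct [p, r, q, s]"
 shows "link (qd (ts ! p) (ts ! r) (ts ! q) (ts ! s)) ts = 0 \<longleftrightarrow> \<not> alt p r q s"
proof -
 have ne: "p \<noteq> q" "p \<noteq> s" "r \<noteq> q" "r \<noteq> s" "p \<noteq> r" "q \<noteq> s" using di by auto
 show ?thesis
  unfolding link_qd sign_nth[OF d b(1,3)] sign_nth[OF d b(1,4)] sign_nth[OF d b(2,3)] sign_nth[OF d b(2,4)] alt_def using ne by (smt (verit) linorder_neqE_nat less_trans less_asym)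
qed

lemma crossfree_link:
 assumes d: "distinct ts" and cf: "crossfree E V ts" and lk: "lk E V a b c d" and T: "{a, b, c, d} \<subseteq> set ts"
 shows "link (qd a b c d) ts = 0"
proof (cases "a = b \<or> c = d")
 case True
 thus ?thesis by (auto simp: link_0)
next
 case False
 obtain p r q s where i: "p < length ts" "a = ts ! p" "r < length ts" "b = ts ! r" "q < length ts" "c = ts ! q" "s < length ts" "d = ts ! s" using T by (metis in_set_conv_nth insert_subset)
 show ?thesis
  using lk_distinct[OF lk] False i link_quad[OF d i(1,3,5,7)] crossfree_alt[OF cf _ i(1,5,3,7)] lk i(2,4,6,8) by auto
qed

lemma PM_link:
 assumes "distinct ts" "crossfree E V ts" "R \<union> S = set ts" "z \<in> PM E V R S"
 shows "link z ts = 0"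
proof -
 have "PM E V R S \<subseteq> {z. link z ts = 0}" unfolding PM_def
 proof (rule frag.span_minimal[OF _ link_subspace])
  show "{qd a b c d | a b c d. a \<in> R \<and> b \<in> R \<and> c \<in> S \<and> d \<in> S \<and> lk E V a b c d} \<subseteq> {z. link z ts = 0}"
  proof
   fix y assume "y \<in> {qd a b c d | a b c d. a \<in> R \<and> b \<in> R \<and> c \<in> S \<and> d \<in> S \<and> lk E V a b c d}"
   then obtain a b c d where y: "y = qd a b c d" "a \<in> R" "b \<in> R" "c \<in> S" "d \<in> S" "lk E V a b c d" by blast
   have "{a, b, c, d} \<subseteq> set ts" unfolding assms(3)[symmetric] using y(2-5) by simp
   thus "y \<in> {z. link z ts = 0}" using crossfree_link[OF assms(1,2) y(6)] y(1) by simp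
  qed
 qed
 thus ?thesis using assms(4) by blast
qed

text \<open>Of the three pairings of four positions one alternates. Here it is one of the other two;
  it is not linked, and \<open>A0\<close> then leaves the pairing in question.\<close>

lemma (in twoc) noncrossing_lk:
 assumes d: "distinct ts" "set ts \<subseteq> V" and cf: "crossfree E V ts"
  and b: "p < length ts" "r < length ts" "q < length ts" "s < length ts" and di: "distinct [p, r, q, s]" and n: "\<not> alt p r q s"
 shows "lk E V (ts ! p) (ts ! r) (ts ! q) (ts ! s)"
proof -
 have ne: "p \<noteq> q" "p \<noteq> s" "r \<noteq> q" "r \<noteq> s" "p \<noteq> r" "q \<noteq> s" using di by auto
 have "alt p q r s \<or> alt p s r q" using n ne unfolding alt_def by (metis linorder_neqE_nat less_trans)
 hence "\<not> lk E V (ts ! p) (ts ! q) (ts ! r) (ts ! s) \<or> \<not> lk E V (ts ! p) (ts ! s) (ts ! r) (ts ! q)"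
  using crossfree_alt[OF cf] b by blast
 moreover have V: "ts ! p \<in> V" "ts ! r \<in> V" "ts ! q \<in> V" "ts ! s \<in> V" using b d(2) nth_mem by blast+
 have "ts ! p \<noteq> ts ! s" "ts ! r \<noteq> ts ! q" "ts ! p \<noteq> ts ! q" "ts ! r \<noteq> ts ! s" using nth_eq_iff_index_eq[OF d(1)] b ne by auto
 hence "lk E V (ts ! p) (ts ! r) (ts ! q) (ts ! s) \<or> lk E V (ts ! p) (ts ! q) (ts ! s) (ts ! r)"
  "lk E V (ts ! p) (ts ! r) (ts ! s) (ts ! q) \<or> lk E V (ts ! p) (ts ! s) (ts ! q) (ts ! r)"
  using A0[of "ts ! p" "ts ! s" "ts ! r" "ts ! q"] A0[of "ts ! p" "ts ! q" "ts ! r" "ts ! s"] V by (auto simp: lk_ac)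
 ultimately show ?thesis by (auto simp: lk_ac)
qed

section \<open>Cyclic orders\<close>

lemma alt_int: "alt x y z w \<longleftrightarrow>
  (int x < int z \<and> int z < int y \<and> (int w < int x \<or> int y < int w)) \<or>
  (int y < int z \<and> int z < int x \<and> (int w < int y \<or> int x < int w)) \<or>
  (int x < int w \<and> int w < int y \<and> (int z < int x \<or> int y < int z)) \<or>
  (int y < int w \<and> int w < int x \<and> (int z < int y \<or> int x < int z))"
 unfolding alt_def by simp

lemma alt_rotate:
 fixes m n :: nat
 assumes b: "p < n" "r < n" "q < n" "s < n" "m < n" and \<phi>: "\<phi> = (\<lambda>x. if m \<le> x then x - m else x + n - m)"
 shows "alt (\<phi> p) (\<phi> r) (\<phi> q) (\<phi> s) \<longleftrightarrow> alt p r q s"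
proof -
 have z: "int (\<phi> x) = (if int m \<le> int x then int x - int m else int x + int n - int m)" if "x < n" for x
  using b(5) that unfolding \<phi> by auto
 define P R Q S M N where d: "P = int p" "R = int r" "Q = int q" "S = int s" "M = int m" "N = int n"
 have "0 \<le> P" "0 \<le> R" "0 \<le> Q" "0 \<le> S" "0 \<le> M" "P < N" "R < N" "Q < N" "S < N" "M < N" unfolding d using b by auto
 thus ?thesis unfolding alt_int z[OF b(1)] z[OF b(2)] z[OF b(3)] z[OF b(4)] d[symmetric] by smt
qed

lemma alt_ne: "alt p r q s ==> p \<noteq> r \<and> q \<noteq> s \<and> p \<noteq> q \<and> p \<noteq> s \<and> r \<noteq> q \<and> r \<noteq> s"
 unfolding alt_def by auto

lemma rotate_nth:
 assumes "m < length ts" "x < length ts"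
 shows "rotate m ts ! (if m \<le> x then x - m else x + length ts - m) = ts ! x"
proof -
 let ?y = "if m \<le> x then x - m else x + length ts - m"
 have "?y < length ts" using assms by auto
 hence "rotate m ts ! ?y = ts ! ((m + ?y) mod length ts)" by (rule nth_rotate)
 thus ?thesis using assms by simp
qed

lemma crossing_alt:
 assumes "in_cyclic_order ts [a, b, c, d]"
 obtains p q r s where "p < length ts" "q < length ts" "r < length ts" "s < length ts"
  "a = ts ! p" "b = ts ! q" "c = ts ! r" "d = ts ! s" "alt p r q s"
proof -
 let ?n = "length ts"
 obtain m where "subseq [a, b, c, d] (rotate m ts)" using assms unfolding in_cyclic_order_def by blast
 then obtain f where f: "\<forall>i j. i < j \<longrightarrow> j < length [a, b, c, d] \<longrightarrow> f i < (f j :: nat)"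
  "\<forall>i<length [a, b, c, d]. f i < length (rotate m ts) \<and> [a, b, c, d] ! i = rotate m ts ! f i"
  using subseq_index by blast
 have o: "f 0 < f 1" "f 1 < f 2" "f 2 < f 3" "f 0 < ?n" "f 1 < ?n" "f 2 < ?n" "f 3 < ?n"
  using f(1)[rule_format, of 0 1] f(1)[rule_format, of 1 2] f(1)[rule_format, of 2 3]
   f(2)[rule_format, of 0] f(2)[rule_format, of 1] f(2)[rule_format, of 2] f(2)[rule_format, of 3] by auto
 have e: "a = rotate m ts ! f 0" "b = rotate m ts ! f 1" "c = rotate m ts ! f 2" "d = rotate m ts ! f 3"
  using f(2)[rule_format, of 0] f(2)[rule_format, of 1] f(2)[rule_format, of 2] f(2)[rule_format, of 3] by (auto simp: numeral_2_eq_2 numeral_3_eq_3)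
 have n0: "0 < ?n" using o by linarith
 define m' where "m' = m mod ?n"
 define \<psi> where "\<psi> k = (m + k) mod ?n" for k
 define \<phi> where "\<phi> = (\<lambda>x. if m' \<le> x then x - m' else x + ?n - m')"
 have m': "m' < ?n" unfolding m'_def using n0 by simp
 have \<psi>: "\<psi> k < ?n" "rotate m ts ! k = ts ! \<psi> k" if "k < ?n" for k
  unfolding \<psi>_def using n0 nth_rotate[OF that, of m] by simp_all
 have \<phi>\<psi>: "\<phi> (\<psi> k) = k" if "k < ?n" for k
 proof -
  have "\<psi> k = (m' + k) mod ?n" unfolding \<psi>_def m'_def by (simp add: mod_add_left_eq)
  also have "\<dots> = (if m' + k < ?n then m' + k else m' + k - ?n)" using m' that le_mod_geq[of ?n "m' + k"] by auto
  finally show ?thesis unfolding \<phi>_def using m' that by auto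
 qed
 have "alt (\<phi> (\<psi> (f 0))) (\<phi> (\<psi> (f 2))) (\<phi> (\<psi> (f 1))) (\<phi> (\<psi> (f 3)))" unfolding alt_def using o \<phi>\<psi> by simp
 thus ?thesis
  using alt_rotate[OF \<psi>(1) \<psi>(1) \<psi>(1) \<psi>(1) m' \<phi>_def] o that[of "\<psi> (f 0)" "\<psi> (f 1)" "\<psi> (f 2)" "\<psi> (f 3)"] \<psi> e by simp
qed

lemma alt_crossing:
 assumes b: "p < length ts" "r < length ts" "q < length ts" "s < length ts" and a: "alt p r q s"
 shows "in_cyclic_order ts [ts ! p, ts ! q, ts ! r, ts ! s] \<or> in_cyclic_order ts [ts ! p, ts ! s, ts ! r, ts ! q]"
proof -
 let ?n = "length ts"
 define \<phi> where "\<phi> = (\<lambda>x. if p \<le> x then x - p else x + ?n - p)"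
 have "alt (\<phi> p) (\<phi> r) (\<phi> q) (\<phi> s)" using alt_rotate[OF b(1-4,1) \<phi>_def] a by blast
 moreover have "\<phi> p = 0" unfolding \<phi>_def by simp
 ultimately have c: "(\<phi> p < \<phi> q \<and> \<phi> q < \<phi> r \<and> \<phi> r < \<phi> s) \<or> (\<phi> p < \<phi> s \<and> \<phi> s < \<phi> r \<and> \<phi> r < \<phi> q)" unfolding alt_def by auto
 have l: "\<phi> x < length (rotate p ts)" "rotate p ts ! \<phi> x = ts ! x" if "x < ?n" for x
  using rotate_nth[OF b(1) that] that b(1) unfolding \<phi>_def by auto
 from c show ?thesis using subseq_nth4 l(1)[OF b(4)] l(2) b l(1)[OF b(3)] unfolding in_cyclic_order_def by metis
qed

definition btw where "btw x y (z::nat) \<longleftrightarrow> (x < y \<and> y < z) \<or> (z < y \<and> y < x)"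

text \<open>Used for a detour in \<open>link_kernel\<close>: if \<open>v\<close> and
  \<open>v'\<close> both lie in the interval from \<open>y\<close> to \<open>z\<close>, a point
  \<open>u\<close> between them divides the interval so that each part has \<open>v\<close> or
  \<open>v'\<close> outside.\<close>

lemma btw_path:
 assumes "y \<noteq> z" "btw v u v'" "v = y \<or> v = z \<or> btw y v z" "v' = y \<or> v' = z \<or> btw y v' z"
 shows "((v \<noteq> y \<and> v \<noteq> u \<and> \<not> btw y v u) \<or> (v' \<noteq> y \<and> v' \<noteq> u \<and> \<not> btw y v' u)) \<and>
  ((v \<noteq> u \<and> v \<noteq> z \<and> \<not> btw u v z) \<or> (v' \<noteq> u \<and> v' \<noteq> z \<and> \<not> btw u v' z)) \<and> u \<noteq> y \<and> u \<noteq> z"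
proof -
 have a: "btw x y z \<longleftrightarrow> (int x < int y \<and> int y < int z) \<or> (int z < int y \<and> int y < int x)" for x y z unfolding btw_def by simp
 have e: "x = y \<longleftrightarrow> int x = int y" for x y by simp
 define Y Z U A B where d: "Y = int y" "Z = int z" "U = int u" "A = int v" "B = int v'"
 show ?thesis using assms unfolding a e d[symmetric] by smt
qed

lemma alt_btw: "0 < y ==> 0 < z ==> alt y z 0 x \<longleftrightarrow> btw y x z"
 unfolding alt_def btw_def by auto

lemma alt_one_between: "alt u u' v v' ==> (btw v u v' \<and> \<not> btw v u' v') \<or> (btw v u' v' \<and> \<not> btw v u v')"
 unfolding alt_def btw_def by auto

lemma alt_side: "alt u u' v v' ==> t \<noteq> v ==> t \<noteq> v' ==> \<not> alt t u v v' \<or> \<not> alt t u' v v'"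
proof -
 have e: "x = y \<longleftrightarrow> int x = int y" for x y by simp
 assume h: "alt u u' v v'" "t \<noteq> v" "t \<noteq> v'"
 define T U U' A B where d: "T = int t" "U = int u" "U' = int u'" "A = int v" "B = int v'"
 show ?thesis using h unfolding alt_int e d[symmetric] by smt
qed

section \<open>The kernel of the link form\<close>

context twoc begin

context
 fixes R S ts p q r s
 assumes ts: "distinct ts" "set ts = R \<union> S" "R \<union> S \<subseteq> V" and cf: "crossfree E V ts"
  and ix: "p < length ts" "r < length ts" "q < length ts" "s < length ts"
  and el: "ts ! p \<in> R" "ts ! r \<in> R" "ts ! q \<in> S" "ts ! s \<in> S" and al: "alt p r q s"
begin

lemma crossing_quad:
 "qd (ts ! p) (ts ! r) (ts ! q) (ts ! s) \<in> L_module R S" "link (qd (ts ! p) (ts ! r) (ts ! q) (ts ! s)) ts \<noteq> 0"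
proof -
 have fin: "finite R" "finite S" using ts finV finite_subset by blast+
 have n: "distinct [p, r, q, s]" using alt_ne[OF al] by auto
 show "qd (ts ! p) (ts ! r) (ts ! q) (ts ! s) \<in> L_module R S"
  by (rule qd_L[OF fin el]) (use nth_eq_iff_index_eq[OF ts(1)] ix n in auto)
 show "link (qd (ts ! p) (ts ! r) (ts ! q) (ts ! s)) ts \<noteq> 0" using link_quad[OF ts(1) ix n] al by simp
qed

lemma link_kernel:
 assumes z: "z \<in> L_module R S" "link z ts = 0"
 shows "z \<in> PM E V R S"
proof -
 let ?P = "PM E V R S" and ?n = "length ts"
 define q0 where "q0 = qd (ts ! p) (ts ! r) (ts ! q) (ts ! s)"
 define K where "K = {x. \<exists>y c. y \<in> ?P \<and> x = y + frag_cmul c q0}"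
 have fin: "finite R" "finite S" using ts finV finite_subset by blast+
 have K: "frag.subspace K"
 proof (rule frag.subspaceI)
  show "0 \<in> K" unfolding K_def by (intro CollectI exI[of _ 0]) simp
  fix x y assume "x \<in> K" "y \<in> K"
  then obtain x1 c y1 d where h: "x1 \<in> ?P" "x = x1 + frag_cmul c q0" "y1 \<in> ?P" "y = y1 + frag_cmul d q0"
   unfolding K_def by blast
  have "x + y = (x1 + y1) + frag_cmul (c + d) q0" unfolding h(2,4) by (simp add: frag_cmul_distrib algebra_simps)
  thus "x + y \<in> K" unfolding K_def using PM_add[OF h(1,3)] by blast
 next
  fix k x assume "x \<in> K"
  then obtain x1 c where h: "x1 \<in> ?P" "x = x1 + frag_cmul c q0" unfolding K_def by blast
  have "frag_cmul k x = frag_cmul k x1 + frag_cmul (k * c) q0" unfolding h(2) by (simp add: frag_cmul_distrib2)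
  thus "frag_cmul k x \<in> K" unfolding K_def using frag.subspace_scale[OF PM_subspace h(1)] by blast
 qed
 have PK: "?P \<subseteq> K" unfolding K_def by auto
 have qK: "q0 \<in> K" unfolding K_def by (intro CollectI exI[of _ 0] exI[of _ 1]) simp
 have "\<forall>x\<in>set ts. \<exists>k<?n. ts ! k = x" by (metis in_set_conv_nth)
 then obtain f where f: "\<And>x. x \<in> set ts ==> f x < ?n \<and> ts ! f x = x" by metis
 have fnth: "f (ts ! k) = k" if "k < ?n" for k using f[of "ts ! k"] nth_eq_iff_index_eq[OF ts(1)] that by auto
 have finj: "f x = f y \<longleftrightarrow> x = y" if "x \<in> set ts" "y \<in> set ts" for x y using f that by metis
 have tsV: "set ts \<subseteq> V" using ts by simp
 have qdK: "qd a b c d \<in> K" if h: "a \<in> R" "b \<in> R" "c \<in> S" "d \<in> S" "distinct [a, b, c, d]" "\<not> alt (f a) (f b) (f c) (f d)" for a b c d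
 proof -
  have m: "a \<in> set ts" "b \<in> set ts" "c \<in> set ts" "d \<in> set ts" unfolding ts(2) using h by auto
  show ?thesis
   using finj m h(5) noncrossing_lk[OF ts(1) tsV cf, of "f a" "f b" "f c" "f d"] f[OF m(1)] f[OF m(2)] f[OF m(3)] f[OF m(4)] h(6) PM_base[OF h(1-4)] PK by auto
 qed
 have n: "p \<noteq> r" "q \<noteq> s" "p \<noteq> q" "p \<noteq> s" "r \<noteq> q" "r \<noteq> s" using alt_ne[OF al] by auto
 have di: "distinct [ts ! p, ts ! r, ts ! q, ts ! s]" using nth_eq_iff_index_eq[OF ts(1)] ix n by auto
 have "L_module R S \<subseteq> K"
 proof (rule gen_all[OF K fin el di])
  show "qd (ts ! p) (ts ! r) (ts ! q) (ts ! s) \<in> K" using qK unfolding q0_def .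
  fix t assume t: "t \<in> R" "t \<notin> {ts ! p, ts ! r, ts ! q, ts ! s}"
  have tm: "t \<in> set ts" using t ts(2) by auto
  have "f t \<noteq> q" "f t \<noteq> s" using f[OF tm] t(2) by auto
  hence "\<not> alt (f t) p q s \<or> \<not> alt (f t) r q s" by (rule alt_side[OF al])
  thus "\<exists>x\<in>{ts ! p, ts ! r}. qd t x (ts ! q) (ts ! s) \<in> K"
   using qdK[OF t(1) el(1,3,4)] qdK[OF t(1) el(2,3,4)] t(2) di fnth ix by auto
 next
  fix t S' y z
  assume h: "t \<in> S - S'" "{ts ! q, ts ! s} \<subseteq> S'" "S' \<subseteq> S" "y \<in> R - {t}" "z \<in> R - {t}"
  let ?r = "{(y, z). y \<in> R - {t} \<and> z \<in> R - {t} \<and> (\<exists>x\<in>S'. x \<noteq> y \<and> x \<noteq> z \<and> qd y z t x \<in> K)}"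
  have tm: "t \<in> set ts" "y \<in> set ts" "z \<in> set ts" unfolding ts(2) using h by auto
  \<comment> \<open>Positions are counted from \<open>t\<close>; then two elements alternate with
    \<open>t\<close> and a position \<open>k\<close> exactly when \<open>k\<close> lies between
    them.\<close>
  define g where "g = (\<lambda>x. if f t \<le> x then x - f t else x + ?n - f t)"
  have gt: "g (f t) = 0" unfolding g_def by simp
  have gpos: "0 < g k" if "k < ?n" "k \<noteq> f t" for k unfolding g_def using that f[OF tm(1)] by auto
  have ginj: "g k = g l \<longleftrightarrow> k = l" if "k < ?n" "l < ?n" for k l unfolding g_def using that f[OF tm(1)] by auto
  have edge: "(y, z) \<in> ?r" if yz: "y \<in> R - {t}" "z \<in> R - {t}" "y \<noteq> z" and k: "k = q \<or> k = s" "g k \<noteq> g (f y)" "g k \<noteq> g (f z)"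
   "\<not> btw (g (f y)) (g k) (g (f z))" for y z k
  proof -
   have m: "y \<in> set ts" "z \<in> set ts" unfolding ts(2) using yz by auto
   have kn: "k < ?n" using k(1) ix by auto
   have x: "ts ! k \<in> S'" "ts ! k \<noteq> y" "ts ! k \<noteq> z" using k h(2) fnth[OF kn] by auto
   have "\<not> alt (g (f y)) (g (f z)) (g (f t)) (g k)"
    using finj m tm(1) yz unfolding gt using alt_btw gpos f[OF m(1)] f[OF m(2)] k(4) by simp
   hence "qd y z t (ts ! k) \<in> K"
    using alt_rotate[OF _ _ _ kn _ g_def, of "f y" "f z" "f t"] f[OF m(1)] f[OF m(2)] f[OF tm(1)] by (intro qdK) (use yz h x fnth[OF kn] in auto)
   thus ?thesis using yz x by blast
  qed
  show "(y, z) \<in> ?r\<^sup>*"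
  proof (cases "y = z")
   case False
   show ?thesis
   proof (cases "\<exists>k. (k = q \<or> k = s) \<and> g k \<noteq> g (f y) \<and> g k \<noteq> g (f z) \<and> \<not> btw (g (f y)) (g k) (g (f z))")
    case True
    thus ?thesis using edge[OF h(4,5) False] by blast
   next
    \<comment> \<open>Neither of the columns at \<open>q\<close> and \<open>s\<close> lies outside
      the interval from \<open>y\<close> to \<open>z\<close>. The move is split at the row at
      \<open>u\<close>, one of \<open>p\<close> and \<open>r\<close>, which lies between those two
      columns.\<close>
    case no: False
    have fy: "f y < ?n" "f z < ?n" using f tm by auto
    have gyz: "g (f y) \<noteq> g (f z)" using ginj[OF fy] finj tm False by auto
    obtain u where u: "u = p \<or> u = r" "btw (g q) (g u) (g s)"
     using alt_rotate[OF ix _ g_def] f[OF tm(1)] al alt_one_between by blast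
    have c: "g q = g (f y) \<or> g q = g (f z) \<or> btw (g (f y)) (g q) (g (f z))"
     "g s = g (f y) \<or> g s = g (f z) \<or> btw (g (f y)) (g s) (g (f z))" using no by blast+
    note b = btw_path[OF gyz u(2) c]
    have un: "u < ?n" using u(1) ix by auto
    have uR: "ts ! u \<in> R - {t}" using u(2) unfolding btw_def using gt u(1) el fnth[OF un] by auto
    have fu: "f (ts ! u) = u" by (rule fnth[OF un])
    have ne: "y \<noteq> ts ! u" "ts ! u \<noteq> z" using b fu by auto
    have "(y, ts ! u) \<in> ?r" using edge[OF h(4) uR ne(1)] b unfolding fu by blast
    moreover have "(ts ! u, z) \<in> ?r" using edge[OF uR h(5) ne(2)] b unfolding fu by blast
    ultimately show ?thesis by (meson r_into_rtrancl rtrancl_trans)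
   qed
  qed simp
 qed
 then obtain y c where y: "y \<in> ?P" "z = y + frag_cmul c q0" using z(1) unfolding K_def by blast
 have "link y ts = 0" by (rule PM_link[OF ts(1) cf ts(2)[symmetric] y(1)])
 hence "c * link q0 ts = 0" using z(2) unfolding y(2) by (simp add: link_add link_cmul)
 moreover have "link q0 ts \<noteq> 0" unfolding q0_def by (rule crossing_quad(2))
 ultimately show ?thesis using y by simp
qed

end

end

section \<open>Two equal sets of three vertices\<close>

lemma sum_three: "distinct [a, b, c] ==> (\<Sum>x\<in>{a, b, c}. g x) = g a + g b + g c" for g :: "'a \<Rightarrow> int"
 by (simp add: add.assoc)

lemma sign_three:
 assumes "distinct [a, b, c]"
 shows "link_sign [a, b, c] a b = 1" "link_sign [a, b, c] a c = 1" "link_sign [a, b, c] b c = 1"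
  "link_sign [a, b, c] b a = - 1" "link_sign [a, b, c] c a = - 1" "link_sign [a, b, c] c b = - 1"
 using sign_nth[OF assms, of 0 1] sign_nth[OF assms, of 0 2] sign_nth[OF assms, of 1 2]
  sign_nth[OF assms, of 1 0] sign_nth[OF assms, of 2 0] sign_nth[OF assms, of 2 1] by simp_all

text \<open>The six positions off the diagonal form a cycle in which neighbours share a row or a
  column, and the signs of \<open>h\<close> alternate around it. With three vertices this takes the
  place of a crossing quadruple.\<close>

lemma hexagon:
 assumes d: "distinct [a, b, c]"
 defines "h \<equiv> frag_of (a, b) - frag_of (a, c) + frag_of (b, c) - frag_of (b, a) + frag_of (c, a) - frag_of (c, b)"
 shows "h \<in> L_module {a, b, c} {a, b, c}" "link h [a, b, c] = 2"
proof -
 show "link h [a, b, c] = 2" unfolding h_def by (simp add: link_add link_minus link_frag_of sign_three[OF d])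
 have lo: "lo h (x, y) = (if (x, y) = (a, b) then 1 else 0) - (if (x, y) = (a, c) then 1 else 0) + (if (x, y) = (b, c) then 1 else 0)
   - (if (x, y) = (b, a) then 1 else 0) + (if (x, y) = (c, a) then 1 else 0) - (if (x, y) = (c, b) then 1 else 0)" for x y
  unfolding h_def by (simp add: lookup_add lookup_minus)
 show "h \<in> L_module {a, b, c} {a, b, c}" unfolding L_iff sum_three[OF d] lo using d by (auto split: if_splits)
qed

lemma hexagon_kernel:
 assumes d: "distinct [a, b, c]" and z: "z \<in> L_module {a, b, c} {a, b, c}" "link z [a, b, c] = 0"
 shows "z = 0"
proof -
 let ?T = "{a, b, c}"
 have k: "\<And>x y. lo z (x, y) \<noteq> 0 ==> x \<in> ?T \<and> y \<in> ?T" and dg: "\<And>x. lo z (x, x) = 0"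
  and col: "\<And>y. y \<in> ?T ==> lo z (a, y) + lo z (b, y) + lo z (c, y) = 0"
  and row: "\<And>x. x \<in> ?T ==> lo z (x, a) + lo z (x, b) + lo z (x, c) = 0"
  using z(1) unfolding L_iff sum_three[OF d] by blast+
 have sub: "Poly_Mapping.keys z \<subseteq> ?T \<times> ?T" using k unfolding in_keys_iff subset_iff by force
 have "link z [a, b, c] = (\<Sum>(u, v)\<in>?T \<times> ?T. lo z (u, v) * link_sign [a, b, c] u v)" by (rule link_superset[OF _ sub]) simp
 also have "\<dots> = (\<Sum>u\<in>?T. \<Sum>v\<in>?T. lo z (u, v) * link_sign [a, b, c] u v)" by (simp only: sum.cartesian_product)
 also have "\<dots> = lo z (a, b) + lo z (a, c) - lo z (b, a) + lo z (b, c) - lo z (c, a) - lo z (c, b)"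
  unfolding sum_three[OF d] by (simp add: dg sign_three[OF d])
 finally have l: "lo z (a, b) + lo z (a, c) - lo z (b, a) + lo z (b, c) - lo z (c, a) - lo z (c, b) = 0" using z(2) by simp
 have e: "lo z (b, a) + lo z (c, a) = 0" "lo z (a, b) + lo z (c, b) = 0" "lo z (a, c) + lo z (b, c) = 0"
  "lo z (a, b) + lo z (a, c) = 0" "lo z (b, a) + lo z (b, c) = 0" "lo z (c, a) + lo z (c, b) = 0"
  using col[of a] col[of b] col[of c] row[of a] row[of b] row[of c] dg by auto
 show ?thesis
 proof (rule poly_mapping_eqI)
  fix w :: "'a \<times> 'a"
  obtain x y where w: "w = (x, y)" by (metis surj_pair)
  show "lo z w = lo 0 w" using l e k[of x y] dg unfolding w by force
 qed
qed

text \<open>A row or column with one nonzero entry has a second one. Following such entries, which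
  avoid the diagonal, forces three vertices into both sets when there are fewer than four.\<close>

lemma small_support:
 assumes z: "z \<in> L_module R S" "z \<noteq> 0" and fin: "finite R" "finite S" and c: "card (R \<union> S) < 4"
 shows "R = S \<and> card R = 3"
proof -
 obtain w where w: "lo z w \<noteq> lo 0 w" using z(2) poly_mapping_eqI[of z 0] by blast
 obtain r s where "w = (r, s)" by (metis surj_pair)
 hence rs: "lo z (r, s) \<noteq> 0" using w by simp
 have k: "\<And>x y. lo z (x, y) \<noteq> 0 ==> x \<in> R \<and> y \<in> S" and dg: "\<And>x. lo z (x, x) = 0"
  and col: "\<And>y. y \<in> S ==> (\<Sum>x\<in>R. lo z (x, y)) = 0" and row: "\<And>x. x \<in> R ==> (\<Sum>y\<in>S. lo z (x, y)) = 0"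
  using z(1) unfolding L_iff by blast+
 have row': "\<exists>y'. y' \<noteq> y \<and> lo z (x, y') \<noteq> 0" if nz: "lo z (x, y) \<noteq> 0" for x y
 proof (rule ccontr)
  assume "\<not> ?thesis"
  hence "(\<Sum>y'\<in>S. lo z (x, y')) = (\<Sum>y'\<in>S. if y' = y then lo z (x, y) else 0)" by (intro sum.cong) auto
  also have "\<dots> = lo z (x, y)" using k[OF nz] fin by simp
  finally show False using row k[OF nz] nz by simp
 qed
 have col': "\<exists>x'. x' \<noteq> x \<and> lo z (x', y) \<noteq> 0" if nz: "lo z (x, y) \<noteq> 0" for x y
 proof (rule ccontr)
  assume "\<not> ?thesis"
  hence "(\<Sum>x'\<in>R. lo z (x', y)) = (\<Sum>x'\<in>R. if x' = x then lo z (x, y) else 0)" by (intro sum.cong) auto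
  also have "\<dots> = lo z (x, y)" using k[OF nz] fin by simp
  finally show False using col k[OF nz] nz by simp
 qed
 obtain t where t: "t \<noteq> s" "lo z (r, t) \<noteq> 0" using row'[OF rs] by blast
 have ne: "r \<noteq> s" "r \<noteq> t" using dg rs t(2) by metis+
 have T: "{r, s, t} \<subseteq> R \<union> S" "card {r, s, t} = 3" using k[OF rs] k[OF t(2)] ne t(1) by auto
 have eq: "R \<union> S = {r, s, t}" by (rule card_subset_eq[symmetric]) (use T c fin card_mono[of "R \<union> S" "{r, s, t}"] in auto)
 have third: "x \<in> {r, s, t}" if "x \<in> R \<or> x \<in> S" for x using that eq by blast
 obtain x1 where x1: "x1 \<noteq> r" "lo z (x1, s) \<noteq> 0" using col'[OF rs] by blast
 have x1t: "x1 = t" using dg x1(2) third[of x1] k[OF x1(2)] x1(1) by blast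
 obtain x2 where x2: "x2 \<noteq> r" "lo z (x2, t) \<noteq> 0" using col'[OF t(2)] by blast
 have x2s: "x2 = s" using dg x2(2) third[of x2] k[OF x2(2)] x2(1) by blast
 obtain x3 where x3: "x3 \<noteq> s" "lo z (t, x3) \<noteq> 0" using row'[of t s] x1(2) x1t by blast
 have x3r: "x3 = r" using dg x3(2) third[of x3] k[OF x3(2)] x3(1) by blast
 have "R = {r, s, t}" "S = {r, s, t}" using k[OF rs] k[OF t(2)] k[OF x1(2)] k[OF x2(2)] k[OF x3(2)] x1t x2s x3r eq by blast+
 thus ?thesis using T(2) by simp
qed

section \<open>The equivalence\<close>

lemma ordering_from_nontrivial:
 assumes t: "twoc V E" and ns: "nosd E V R S" "nosd E V S R" and RS: "R \<subseteq> V" "S \<subseteq> V"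
  and z: "z \<in> L_module R S" "z \<notin> PM E V R S"
 shows "\<exists>ts. is_ordering (R \<union> S) ts \<and> crossing ts R S \<and> crossfree E V ts \<and> 3 \<le> length ts"
proof -
 interpret twoc V E by (rule t)
 have fin: "finite R" "finite S" using RS finV finite_subset by blast+
 have z0: "z \<noteq> 0" using z(2) by auto
 show ?thesis
 proof (cases "4 \<le> card (R \<union> S)")
  case False
  hence RS3: "R = S" "card R = 3" using small_support[OF z(1) z0 fin] by auto
  obtain ts where ts: "set ts = R" "distinct ts" using finite_distinct_list[OF fin(1)] by blast
  have l: "length ts = 3" using distinct_card[OF ts(2)] ts(1) RS3 by simp
  \<comment> \<open>With three positions there is nothing to cross.\<close>
  thus ?thesis unfolding crossfree_def using ts l RS3 unfolding is_ordering_def crossing_def by (intro exI[of _ ts]) auto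
 next
  case True
  obtain y where y: "y \<in> L_module (R \<union> S) (R \<union> S)" "y \<notin> PM E V (R \<union> S) (R \<union> S)" using equalize[OF ns RS True z] by blast
  have RSV: "R \<union> S \<subseteq> V" using RS by blast
  obtain ts where ts: "distinct ts" "set ts = R \<union> S"
   "\<And>i j k l. i < j ==> j < k ==> k < l ==> l < length ts ==> \<not> lk E V (ts ! i) (ts ! k) (ts ! j) (ts ! l)"
   using separation_order[OF RSV True y] by blast
  have cf: "crossfree E V ts" unfolding crossfree_def using ts(3) by blast
  have l: "4 \<le> length ts" using distinct_card[OF ts(1)] ts(2) True by simp
  have tsV: "set ts \<subseteq> V" using ts(2) RSV by simp
  \<comment> \<open>If \<open>R\<close> and \<open>S\<close> did not cross in this order, all
    quadruples from them would be linked, and these generate \<open>L_module R S\<close>.\<close>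
  have "crossing ts R S"
  proof (rule ccontr)
   assume nc: "\<not> crossing ts R S"
   obtain r r' x y where q: "r \<in> R" "r' \<in> R" "x \<in> S" "y \<in> S" "distinct [r, r', x, y]"
    using exists_quad[OF fin True L_trivial[OF z(1) fin z0]] .
   have "L_module R S \<subseteq> PM E V R S"
   proof (rule gen_quads[OF PM_subspace fin q])
    fix a b c d assume h: "a \<in> R" "b \<in> R" "c \<in> S" "d \<in> S" "distinct [a, b, c, d]"
    hence "a \<in> set ts" "b \<in> set ts" "c \<in> set ts" "d \<in> set ts" using ts(2) by auto
    then obtain i j k m where i: "i < length ts" "a = ts ! i" "j < length ts" "b = ts ! j" "k < length ts" "c = ts ! k" "m < length ts" "d = ts ! m" by (metis in_set_conv_nth)
    have "\<not> alt i j k m"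
    proof
     assume "alt i j k m"
     hence "in_cyclic_order ts [a, c, b, d] \<or> in_cyclic_order ts [a, d, b, c]" using alt_crossing[OF i(1,3,5,7)] i by simp
     moreover have "distinct [a, c, b, d]" "distinct [a, d, b, c]" using h(5) by auto
     ultimately show False using nc h(1-4) unfolding crossing_def by blast
    qed
    moreover have "distinct [i, j, k, m]" using h(5) i by auto
    ultimately have "lk E V a b c d" using noncrossing_lk[OF ts(1) tsV cf i(1,3,5,7)] i by simp
    thus "qd a b c d \<in> PM E V R S" by (rule PM_base[OF h(1-4)])
   qed
   thus False using z by blast
  qed
  thus ?thesis using ts cf l unfolding is_ordering_def by (intro exI[of _ ts]) auto
 qed
qed

lemma link_characterizes:
 assumes t: "twoc V E" and RS: "R \<subseteq> V" "S \<subseteq> V" and ts: "is_ordering (R \<union> S) ts" "crossing ts R S" and cf: "crossfree E V ts"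
  and z: "z \<in> L_module R S"
 shows "link z ts = 0 \<longleftrightarrow> z \<in> PM E V R S"
proof
 interpret twoc V E by (rule t)
 have T: "distinct ts" "set ts = R \<union> S" "R \<union> S \<subseteq> V" using ts RS unfolding is_ordering_def by auto
 show "z \<in> PM E V R S ==> link z ts = 0" using PM_link[OF T(1) cf T(2)[symmetric]] .
 assume l: "link z ts = 0"
 from ts(2) show "z \<in> PM E V R S" unfolding crossing_def
 proof
  assume h: "R = S \<and> card R = 3"
  hence "card (set ts) = 3" unfolding T(2) by (metis sup.idem)
  hence "length ts = 3" using distinct_card[OF T(1)] by simp
  then obtain a b c where abc: "ts = [a, b, c]" by (auto simp: numeral_3_eq_3 length_Suc_conv)
  hence "z = 0" using h T(2) hexagon_kernel[of a b c z] T(1) z l abc by simp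
  thus ?thesis by simp
 next
  assume "\<exists>u1\<in>R. \<exists>u2\<in>R. \<exists>v1\<in>S. \<exists>v2\<in>S. distinct [u1, v1, u2, v2] \<and> in_cyclic_order ts [u1, v1, u2, v2]"
  then obtain u1 u2 v1 v2 where u: "u1 \<in> R" "u2 \<in> R" "v1 \<in> S" "v2 \<in> S" "in_cyclic_order ts [u1, v1, u2, v2]" by blast
  obtain p q r s where i: "p < length ts" "q < length ts" "r < length ts" "s < length ts"
   "u1 = ts ! p" "v1 = ts ! q" "u2 = ts ! r" "v2 = ts ! s" "alt p r q s" using crossing_alt[OF u(5)] .
  show ?thesis by (rule link_kernel[OF T cf i(1,3,2,4) _ _ _ _ i(9) z l]) (use u i in simp_all)
 qed
qed

lemma link_nonzero_exists:
 assumes RS: "finite R" "finite S" and ts: "is_ordering (R \<union> S) ts" "crossing ts R S"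
 shows "\<exists>z\<in>L_module R S. link z ts \<noteq> 0"
 using ts(2) unfolding crossing_def
proof
 have T: "distinct ts" "set ts = R \<union> S" using ts unfolding is_ordering_def by auto
 {
  assume h: "R = S \<and> card R = 3"
  hence "card (set ts) = 3" unfolding T(2) by (metis sup.idem)
  hence "length ts = 3" using distinct_card[OF T(1)] by simp
  then obtain a b c where abc: "ts = [a, b, c]" by (auto simp: numeral_3_eq_3 length_Suc_conv)
  hence e: "R = {a, b, c}" "S = {a, b, c}" and d: "distinct [a, b, c]" using h T by auto
  show ?thesis using hexagon[OF d] unfolding e abc by force
 next
  assume "\<exists>u1\<in>R. \<exists>u2\<in>R. \<exists>v1\<in>S. \<exists>v2\<in>S. distinct [u1, v1, u2, v2] \<and> in_cyclic_order ts [u1, v1, u2, v2]"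
  then obtain u1 u2 v1 v2 where u: "u1 \<in> R" "u2 \<in> R" "v1 \<in> S" "v2 \<in> S" "distinct [u1, v1, u2, v2]" "in_cyclic_order ts [u1, v1, u2, v2]" by blast
  obtain p q r s where i: "p < length ts" "q < length ts" "r < length ts" "s < length ts"
   "u1 = ts ! p" "v1 = ts ! q" "u2 = ts ! r" "v2 = ts ! s" "alt p r q s" using crossing_alt[OF u(6)] .
  have "link (qd u1 u2 v1 v2) ts \<noteq> 0" using alt_ne[OF i(9)] link_quad[OF T(1) i(1,3,2,4)] i by simp
  moreover have "qd u1 u2 v1 v2 \<in> L_module R S" by (rule qd_L[OF RS u(1-4)]) (use u(5) in auto)
  ultimately show ?thesis by blast
 }
qed

theorem theorem1p1:
  fixes G :: "'v ugraph" and R S :: "'v set"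
  assumes "fin_graph G" and "R \<subseteq> verts G" and "S \<subseteq> verts G"
    and "RS_connected G R S"
  shows "(L_module R S - P_module G R S \<noteq> {} \<longleftrightarrow>
          (\<exists>ts. is_ordering (R \<union> S) ts \<and> crossing ts R S \<and> nearly_planar G ts))
       \<and> ((\<exists>ts. is_ordering (R \<union> S) ts \<and> crossing ts R S \<and> nearly_planar G ts) \<longleftrightarrow>
          (\<exists>ts. is_ordering (R \<union> S) ts \<and> crossing ts R S \<and>
             (\<forall>z\<in>L_module R S. link z ts = 0 \<longleftrightarrow> z \<in> P_module G R S)))"
proof -
 let ?one = "L_module R S - P_module G R S \<noteq> {}"
  and ?two = "\<exists>ts. is_ordering (R \<union> S) ts \<and> crossing ts R S \<and> nearly_planar G ts"
  and ?three = "\<exists>ts. is_ordering (R \<union> S) ts \<and> crossing ts R S \<and>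
       (\<forall>z\<in>L_module R S. link z ts = 0 \<longleftrightarrow> z \<in> P_module G R S)"
 note RS = assms(2,3)
 have t: "twoc (verts G) (edges G)" using two_connected_twoc assms(1,4) unfolding RS_connected_def by blast
 have ns: "nosd (edges G) (verts G) R S" "nosd (edges G) (verts G) S R"
  using no_sided_nosd[OF assms(1)] assms(4) unfolding RS_connected_def by blast+
 have fin: "finite R" "finite S" using assms finite_subset unfolding fin_graph_def by blast+
 have "?one ==> ?two"
 proof -
  assume ?one
  then obtain z where z: "z \<in> L_module R S" "z \<notin> PM (edges G) (verts G) R S" unfolding P_module_eq by blast
  obtain ts where ts: "is_ordering (R \<union> S) ts" "crossing ts R S" "crossfree (edges G) (verts G) ts" "3 \<le> length ts"
   using ordering_from_nontrivial[OF t ns RS z] by blast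
  have "nearly_planar G ts"
   using ts(1) RS unfolding is_ordering_def using crossfree_nearly_planar[OF assms(1) _ _ ts(4,3)] by blast
  thus ?two using ts by blast
 qed
 moreover have "?two ==> ?three"
 proof -
  assume ?two
  then obtain ts where ts: "is_ordering (R \<union> S) ts" "crossing ts R S" "nearly_planar G ts" by blast
  have cf: "crossfree (edges G) (verts G) ts" by (rule nearly_planar_crossfree[OF assms(1) ts(3)])
  have "\<forall>z\<in>L_module R S. link z ts = 0 \<longleftrightarrow> z \<in> P_module G R S"
   unfolding P_module_eq using link_characterizes[OF t RS ts(1,2) cf] by blast
  thus ?three using ts by blast
 qed
 moreover have "?three ==> ?one"
 proof -
  assume ?three
  then obtain ts where ts: "is_ordering (R \<union> S) ts" "crossing ts R S" "\<forall>z\<in>L_module R S. link z ts = 0 \<longleftrightarrow> z \<in> P_module G R S"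
   by blast
  thus ?one using link_nonzero_exists[OF fin ts(1,2)] by blast
 qed
 ultimately show ?thesis by blast
qed

end
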